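(* Let $1\le p<\infty$ and let $f\in\mathscr H^p$. Then for almost every $\chi\in\mathbb T^\infty$ (with respect to $m_\infty$), $$\|f\|_{\mathscr H^p}^p=|f(+\infty)|^p+\lim_{T\to\infty}\frac{p^2}{2T}\int_{-T}^T\int_0^\infty|f_\chi(\sigma+it)|^{p-2}\,|f_\chi'(\sigma+it)|^2\,\sigma\,\mathrm d\sigma\,\mathrm dt .$$
   Context: For real $\kappa$ let $\mathbb C_\kappa=\{s\in\mathbb C:\operatorname{Re}s>\kappa\}$. For a Dirichlet polynomial $P(s)=\sum_{n=1}^N a_nn^{-s}$ put $M_p(P,\sigma)=\left(\lim_{T\to\infty}\frac1{2T}\int_{-T}^T|P(\sigma+it)|^p\,\mathrm dt\right)^{1/p}$ and $\|P\|_{\mathscr H^p}=\lim_{\sigma\downarrow0}M_p(P,\sigma)$. The space $\mathscr H^p$ is the completion of the space of Dirichlet polynomials in this norm. Its elements are identified with Dirichlet series $f(s)=\sum_{n\ge1}a_nn^{-s}$ (the coefficient $a_n$ being the limit of the $n$-th coefficients of an approximating Cauchy sequence of Dirichlet polynomials); these series converge absolutely in $\mathbb C_{1/2}$. Write $f(+\infty)=a_1$ for the constant term. $\mathbb T$ is the unit circle and $\mathbb T^\infty=\mathbb T\times\mathbb T\times\cdots$ is identified with the set of completely multiplicative functions $\chi:\mathbb Z^+\to\mathbb T$ via $\chi\leftrightarrow(\chi(2),\chi(3),\chi(5),\dots)$ (values at the primes); $m_\infty$ is the normalized Haar measure on $\mathbb T^\infty$, i.e. the infinite product of the normalized arclength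 measure. For $f(s)=\sum a_nn^{-s}$ and $\chi\in\mathbb T^\infty$ put $f_\chi(s)=\sum_{n\ge1}a_n\chi(n)n^{-s}$. It is known that for $f\in\mathscr H^p$ the function $f_\chi$ has an analytic continuation to $\mathbb C_0$ for almost every $\chi$; this continuation is still denoted $f_\chi$. If $f\equiv0$, the integrand $|f_\chi|^{p-2}|f_\chi'|^2$ is interpreted as $0$ (otherwise it is defined off the zeros of $f_\chi$, hence almost everywhere). *)

theory Defs
  imports "HOL-Probability.Probability" "HOL-Complex_Analysis.Complex_Analysis"
begin

text \<open>
  A (formal) Dirichlet series \<open>\<Sum>n\<ge>1. a n * n powr (-s)\<close> is represented by its coefficient
  function \<open>a :: nat \<Rightarrow> complex\<close>, with the convention \<open>a 0 = 0\<close>; the constant term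
  \<open>f(+\<infinity>)\<close> is the coefficient \<open>a 1\<close>.
\<close>

definition dirichlet_polys :: "(nat \<Rightarrow> complex) set" where
  "dirichlet_polys = {a. a 0 = 0 \<and> finite {n. a n \<noteq> 0}}"

definition eval_dpoly :: "(nat \<Rightarrow> complex) \<Rightarrow> complex \<Rightarrow> complex" where
  "eval_dpoly a s = (\<Sum>n | a n \<noteq> 0. a n * of_nat n powr (- s))"

definition dpoly_mean :: "real \<Rightarrow> (nat \<Rightarrow> complex) \<Rightarrow> real \<Rightarrow> real" where
  "dpoly_mean p a \<sigma> =
     (Lim at_top (\<lambda>T::real. 1 / (2 * T) *
        (LINT t:{-T..T}|lborel. norm (eval_dpoly a (Complex \<sigma> t)) powr p))) powr (1 / p)"

definition dpoly_norm :: "real \<Rightarrow> (nat \<Rightarrow> complex) \<Rightarrow> real" where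
  "dpoly_norm p a = Lim (at_right 0) (dpoly_mean p a)"

text \<open>
  The completion \<open>\<H>\<^sup>p\<close> of the Dirichlet polynomials, built from Cauchy sequences \<open>P\<close>, whose
  limit is identified with the series \<open>f\<close> of the limits of coefficients.  This identification
  is injective on the completion, so the norm is determined by \<open>f\<close>
  (it does not depend on the sequence \<open>P\<close>).
\<close>

definition Hp_approx :: "real \<Rightarrow> (nat \<Rightarrow> nat \<Rightarrow> complex) \<Rightarrow> (nat \<Rightarrow> complex) \<Rightarrow> bool" where
  "Hp_approx p P f \<longleftrightarrow>
     (\<forall>k. P k \<in> dirichlet_polys) \<and>
     (\<forall>\<epsilon>>0. \<exists>K. \<forall>j\<ge>K. \<forall>k\<ge>K. dpoly_norm p (\<lambda>n. P j n - P k n) < \<epsilon>) \<and>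
     (\<forall>n. (\<lambda>k. P k n) \<longlonglongrightarrow> f n)"

definition Hp :: "real \<Rightarrow> (nat \<Rightarrow> complex) set" where
  "Hp p = {f. \<exists>P. Hp_approx p P f}"

definition Hp_norm :: "real \<Rightarrow> (nat \<Rightarrow> complex) \<Rightarrow> real" where
  "Hp_norm p f = (THE r. \<exists>P. Hp_approx p P f \<and> (\<lambda>k. dpoly_norm p (P k)) \<longlonglongrightarrow> r)"

definition circle_measure :: "complex measure" where
  "circle_measure =
     distr (uniform_measure lborel {0..2 * pi}) (restrict_space borel (sphere 0 1)) cis"

text \<open>A point of the infinite torus is the family of its coordinates, indexed by the primes.\<close>

definition torus_measure :: "(nat \<Rightarrow> complex) measure" where
  "torus_measure = PiM {q. prime q} (\<lambda>_. circle_measure)"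

text \<open>The completely multiplicative function \<open>\<chi>\<close> with prescribed values \<open>\<xi>\<close> at the primes.\<close>

definition cmult_ext :: "(nat \<Rightarrow> complex) \<Rightarrow> nat \<Rightarrow> complex" where
  "cmult_ext \<xi> n = (\<Prod>q\<in>prime_factors n. \<xi> q ^ multiplicity q n)"

text \<open>
  \<open>F\<close> is the analytic continuation of \<open>f\<^sub>\<chi>\<close>, \<open>\<chi> = cmult_ext \<xi>\<close>, to \<open>Re s > 0\<close>; by the identity theorem its values
  there are unique (those outside are irrelevant).  The \<open>n = 0\<close> term of the series is 0.
\<close>

definition is_twist_continuation ::
    "(nat \<Rightarrow> complex) \<Rightarrow> (nat \<Rightarrow> complex) \<Rightarrow> (complex \<Rightarrow> complex) \<Rightarrow> bool" where
  "is_twist_continuation f \<xi> F \<longleftrightarrow>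
     F holomorphic_on {s. Re s > 0} \<and>
     (\<forall>s. Re s > 1 / 2 \<longrightarrow> (\<lambda>n. f n * cmult_ext \<xi> n * of_nat n powr (- s)) sums F s)"

text \<open>
  The double integral is taken in \<open>[0,\<infinity>]\<close>.  As \<open>0 powr x = 0\<close> for every real \<open>x\<close>, the integrand
  is 0 at the zeros of \<open>F\<close>, a null set unless \<open>F\<close> vanishes identically on \<open>Re s > 0\<close>.
\<close>

definition LP_integral :: "real \<Rightarrow> (complex \<Rightarrow> complex) \<Rightarrow> real \<Rightarrow> ennreal" where
  "LP_integral p F T =
     (\<integral>\<^sup>+t\<in>{-T..T}. (\<integral>\<^sup>+\<sigma>\<in>{0<..}.
        ennreal (norm (F (Complex \<sigma> t)) powr (p - 2) * norm (deriv F (Complex \<sigma> t)) ^ 2 * \<sigma>)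
      \<partial>lborel) \<partial>lborel)"

end

theory Submission
  imports Defs
begin

text \<open>
  Write \<open>F\<^sub>\<xi>\<close> for the twist of \<open>f\<close> by the character with coordinates \<open>\<xi>\<close>, and \<open>E\<close> for expectation
  with respect to Haar measure.  A vertical translation of \<open>F\<^sub>\<xi>\<close> is a rotation of \<open>\<xi>\<close>:
  \<open>F\<^sub>\<xi> (s + \<i>t) = F\<^sub>\<zeta> s\<close>, where \<open>\<zeta> = rot t \<xi>\<close> has the coordinates \<open>\<xi> q * q powr (- \<i>t)\<close>.  The rotations
  preserve Haar measure, so \<open>m \<sigma> = E \<bar>F\<^sub>\<xi> (\<sigma> + \<i>t)\<bar>\<^sup>p\<close> does not depend on \<open>t\<close>.  The Laplacian of
  \<open>\<bar>F\<bar>\<^sup>p\<close> is \<open>p\<^sup>2 \<bar>F\<bar>\<^sup>p\<^sup>-\<^sup>2 \<bar>F'\<bar>\<^sup>2\<close> for holomorphic \<open>F\<close>; in expectation the \<open>t\<close>-derivatives disappear and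
  \<open>m'' = p\<^sup>2 E \<bar>F\<^sub>\<xi>\<bar>\<^sup>p\<^sup>-\<^sup>2 \<bar>F\<^sub>\<xi>'\<bar>\<^sup>2\<close> remains.  Since \<open>\<integral> \<sigma> m'' \<sigma> d\<sigma> = m 0 - m \<infinity>\<close> over \<open>(0, \<infinity>)\<close>, and \<open>m\<close> has
  the limits \<open>\<parallel>f\<parallel>\<^sup>p\<close> at 0 and \<open>\<bar>f(+\<infinity>)\<bar>\<^sup>p\<close> at infinity, the functional
  \<open>energy \<xi> = \<integral> \<bar>F\<^sub>\<xi> \<sigma>\<bar>\<^sup>p\<^sup>-\<^sup>2 \<bar>F\<^sub>\<xi>' \<sigma>\<bar>\<^sup>2 \<sigma> d\<sigma>\<close> satisfies \<open>p\<^sup>2 E energy = \<parallel>f\<parallel>\<^sup>p - \<bar>f(+\<infinity>)\<bar>\<^sup>p\<close>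
  (\<open>norm_formula\<close>, \<open>mean_energy\<close>).  The double integral of the theorem is the integral of \<open>energy\<close> along
  the orbit \<open>t \<mapsto> rot t \<xi>\<close>, so the ergodic theorem for this flow (\<open>torus_ergodic\<close>) finishes the proof.

  The ergodic theorem follows from a maximal inequality and a dense class on which orbit averages
  converge at every point.  That class consists of the trigonometric polynomials: the character
  \<open>\<xi> \<mapsto> \<chi> m * cnj (\<chi> n)\<close> is an eigenfunction of the flow with frequency \<open>ln n - ln m\<close>, which is nonzero
  for \<open>m \<noteq> n\<close>.  As the convergence holds at every point, in particular at \<open>\<xi> = 1\<close>, it also turns the
  time means in the definition of the norm into means over the torus: the norm of a Dirichlet
  polynomial is its \<open>L\<^sup>p\<close> norm on the torus (\<open>dpoly_norm_eq\<close>).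

  For general \<open>f\<close> take approximating Dirichlet polynomials \<open>P k\<close> whose successive differences decay
  geometrically in norm.  Because \<open>m\<close> decreases (\<open>tpoly_contract\<close>), the differences are small in mean on
  every vertical line with \<open>\<sigma> \<ge> 0\<close>, hence on circles in the half-plane, and Cauchy's formula gives
  locally uniform convergence on \<open>Re s > 0\<close> for almost every \<open>\<xi>\<close> (\<open>AE_converges\<close>).  That the limit is the
  sum of the twisted series for \<open>Re s > 1/2\<close> needs a bound for partial sums: a kernel with trapezoidal
  Fourier transform cuts a Dirichlet polynomial off at \<open>N\<close> with \<open>L\<^sup>1\<close> cost \<open>O(log N)\<close>, so almost surely
  the partial sums of the coefficients grow no faster than \<open>N powr (1/2 + \<eta>)\<close>, and Abel summation applies
  (\<open>AE_psum_growth\<close>, \<open>AE_series\<close>).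

  The formula also proves that the norm is well defined: the twisted series alone determines
  \<open>F\<^sub>\<xi>\<close>, hence the right-hand side, so every approximating sequence leads to the same norm
  (\<open>Hp_norm_eq\<close>).
\<close>

section \<open>The torus and its Kronecker flow\<close>

lemma space_circle_measure: "space circle_measure = sphere 0 1"
  and sets_circle_measure: "sets circle_measure = sets (restrict_space borel (sphere (0::complex) 1))"
  by (auto simp: circle_measure_def space_restrict_space)

lemma cis_measurable_circle: "cis \<in> uniform_measure lborel {0..2*pi} \<rightarrow>\<^sub>M restrict_space borel (sphere 0 1)"
proof (rule measurable_restrict_space2)
  have "cis \<in> borel_measurable borel"
    by (intro borel_measurable_continuous_onI continuous_intros)
  then show "cis \<in> uniform_measure lborel {0..2*pi} \<rightarrow>\<^sub>M borel"
    by (simp add: measurable_def)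
qed auto

lemma prob_space_circle_measure: "prob_space circle_measure"
  unfolding circle_measure_def
  by (rule prob_space.prob_space_distr[OF prob_space_uniform_measure cis_measurable_circle]) auto

lemma id_measurable_circle: "(\<lambda>z. z) \<in> borel_measurable circle_measure"
  by (simp cong: measurable_cong_sets add: measurable_cong_sets[OF sets_circle_measure refl] measurable_restrict_space1)

lemma circle_measurable_iff: "f \<in> M \<rightarrow>\<^sub>M circle_measure \<longleftrightarrow> f \<in> borel_measurable M \<and> f \<in> space M \<rightarrow> sphere 0 1"
  by (subst measurable_cong_sets[OF refl sets_circle_measure]) (auto simp: measurable_restrict_space2_iff)

lemma nn_integral_circle_measure:
  assumes "g \<in> borel_measurable circle_measure"
  shows "(\<integral>\<^sup>+z. g z \<partial>circle_measure) = (\<integral>\<^sup>+x. g (cis x) * indicator {0..2*pi} x \<partial>lborel) / ennreal (2*pi)"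
proof -
  have g: "g \<in> borel_measurable (restrict_space borel (sphere 0 1))"
    using assms by (simp add: measurable_cong_sets[OF sets_circle_measure refl])
  have c: "(\<lambda>x. g (cis x)) \<in> borel_measurable (uniform_measure lborel {0..2*pi})"
    by (rule measurable_compose[OF cis_measurable_circle g])
  then have c': "(\<lambda>x. g (cis x)) \<in> borel_measurable lborel"
    by (simp add: measurable_def)
  show ?thesis
    unfolding circle_measure_def
    by (subst nn_integral_distr[OF cis_measurable_circle], simp add: g, subst nn_integral_uniform_measure[OF c'])
       (auto simp: mult.commute)
qed

text \<open>
  The window \<open>[\<theta>, 2\<pi> + \<theta>]\<close> is cut at \<open>2\<pi>\<close> and its second part is moved back by a period.
\<close>

lemma nn_integral_periodic_shift:
  fixes g :: "real \<Rightarrow> ennreal"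
  assumes [measurable]: "g \<in> borel_measurable borel" and per: "\<And>x. g (x + 2*pi) = g x"
    and th: "0 \<le> \<theta>" "\<theta> < 2*pi"
  shows "(\<integral>\<^sup>+x. g (x + \<theta>) * indicator {0..2*pi} x \<partial>lborel) = (\<integral>\<^sup>+x. g x * indicator {0..2*pi} x \<partial>lborel)"
proof -
  have sh: "(\<integral>\<^sup>+x. h (x + c) \<partial>lborel) = (\<integral>\<^sup>+x. h x \<partial>lborel)" if [measurable]: "h \<in> borel_measurable borel"
    for h :: "real \<Rightarrow> ennreal" and c
    using nn_integral_real_affine[of h 1 c] by (simp add: add.commute)
  have "(\<integral>\<^sup>+x. g (x + \<theta>) * indicator {0..2*pi} x \<partial>lborel) = (\<integral>\<^sup>+x. g (x + \<theta>) * indicator {\<theta>..2*pi+\<theta>} (x + \<theta>) \<partial>lborel)"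
    by (intro nn_integral_cong) (auto simp: indicator_def)
  also have "\<dots> = (\<integral>\<^sup>+x. g x * indicator {\<theta>..2*pi+\<theta>} x \<partial>lborel)"
    by (rule sh[of "\<lambda>x. g x * indicator {\<theta>..2*pi+\<theta>} x"]) measurable
  also have "\<dots> = (\<integral>\<^sup>+x. g x * indicator {\<theta>..2*pi} x + g x * indicator {2*pi<..2*pi+\<theta>} x \<partial>lborel)"
    using th by (intro nn_integral_cong) (auto simp: indicator_def)
  also have "\<dots> = (\<integral>\<^sup>+x. g x * indicator {\<theta>..2*pi} x \<partial>lborel) + (\<integral>\<^sup>+x. g x * indicator {2*pi<..2*pi+\<theta>} x \<partial>lborel)"
    by (rule nn_integral_add) measurable
  also have "(\<integral>\<^sup>+x. g x * indicator {2*pi<..2*pi+\<theta>} x \<partial>lborel) =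
      (\<integral>\<^sup>+x. g (x + 2*pi) * indicator {2*pi<..2*pi+\<theta>} (x + 2*pi) \<partial>lborel)"
    by (rule sh[symmetric, of "\<lambda>x. g x * indicator {2*pi<..2*pi+\<theta>} x"]) measurable
  also have "\<dots> = (\<integral>\<^sup>+x. g x * indicator {0<..\<theta>} x \<partial>lborel)"
    by (intro nn_integral_cong) (auto simp: indicator_def per)
  also have "(\<integral>\<^sup>+x. g x * indicator {\<theta>..2*pi} x \<partial>lborel) + \<dots> =
     (\<integral>\<^sup>+x. g x * indicator {\<theta>..2*pi} x + g x * indicator {0<..\<theta>} x \<partial>lborel)"
    by (rule nn_integral_add[symmetric]) measurable
  also have "\<dots> = (\<integral>\<^sup>+x. g x * indicator {0..2*pi} x \<partial>lborel)"
  proof (rule nn_integral_cong_AE)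
    have "AE x in lborel. x \<noteq> \<theta> \<and> x \<noteq> (0::real)"
      by (auto intro!: AE_conjI AE_lborel_singleton)
    then show "AE x in lborel. g x * indicator {\<theta>..2*pi} x + g x * indicator {0<..\<theta>} x = g x * indicator {0..2*pi} x"
      by eventually_elim (use th in \<open>auto simp: indicator_def\<close>)
  qed
  finally show ?thesis .
qed

lemma rotation_measurable_circle:
  assumes "norm w = 1"
  shows "(\<lambda>z. z * w) \<in> circle_measure \<rightarrow>\<^sub>M circle_measure"
  using assms id_measurable_circle by (auto simp: circle_measurable_iff space_circle_measure norm_mult)

lemma distr_circle_measure_rotation:
  assumes w: "norm w = 1"
  shows "distr circle_measure circle_measure (\<lambda>z. z * w) = circle_measure"
proof (rule measure_eqI)
  fix A assume "A \<in> sets (distr circle_measure circle_measure (\<lambda>z. z * w))"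
  then have A[measurable]: "A \<in> sets circle_measure" by simp
  obtain \<theta> where \<theta>: "0 \<le> \<theta>" "\<theta> < 2*pi" "w = cis \<theta>"
  proof -
    have "w = cis (Arg2pi w)"
      using w Arg2pi_eq[of w] by (simp add: cis_conv_exp)
    then show ?thesis using that[of "Arg2pi w"] Arg2pi[of w] by auto
  qed
  let ?g = "\<lambda>x::real. indicator A (cis x) :: ennreal"
  have [measurable]: "cis \<in> borel \<rightarrow>\<^sub>M circle_measure"
    by (auto simp: circle_measurable_iff intro!: borel_measurable_continuous_onI continuous_intros)
  note [measurable] = rotation_measurable_circle[OF w]
  have "emeasure (distr circle_measure circle_measure (\<lambda>z. z * w)) A = (\<integral>\<^sup>+z. indicator A (z * w) \<partial>circle_measure)"
    by (subst emeasure_distr) (auto simp: nn_integral_indicator[symmetric] intro!: nn_integral_cong simp del: nn_integral_indicator split: split_indicator)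
  also have "\<dots> = (\<integral>\<^sup>+x. ?g (x + \<theta>) * indicator {0..2*pi} x \<partial>lborel) / ennreal (2*pi)"
    by (subst nn_integral_circle_measure) (auto simp: \<theta>(3) cis_mult intro!: measurable_compose[OF rotation_measurable_circle])
  also have "\<dots> = (\<integral>\<^sup>+x. ?g x * indicator {0..2*pi} x \<partial>lborel) / ennreal (2*pi)"
    by (subst nn_integral_periodic_shift) (use \<theta> in \<open>auto simp: cis_mult[symmetric]\<close>)
  also have "\<dots> = (\<integral>\<^sup>+z. indicator A z \<partial>circle_measure)"
    by (subst nn_integral_circle_measure) auto
  finally show "emeasure (distr circle_measure circle_measure (\<lambda>z. z * w)) A = emeasure circle_measure A"
    by simp
qed simp

lemma prob_space_torus_measure: "prob_space torus_measure"
  unfolding torus_measure_def by (intro prob_space_PiM prob_space_circle_measure)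

interpretation TM: prob_space torus_measure by (rule prob_space_torus_measure)

lemma torus_Fubini:
  fixes g :: "(nat \<Rightarrow> complex) \<Rightarrow> real \<Rightarrow> ennreal"
  assumes "case_prod g \<in> borel_measurable (torus_measure \<Otimes>\<^sub>M lborel)"
  shows "(\<integral>\<^sup>+x. (\<integral>\<^sup>+\<xi>. g \<xi> x \<partial>torus_measure) \<partial>lborel) = (\<integral>\<^sup>+\<xi>. (\<integral>\<^sup>+x. g \<xi> x \<partial>lborel) \<partial>torus_measure)"
proof -
  interpret pair_sigma_finite torus_measure "lborel :: real measure" ..
  show ?thesis by (rule Fubini'[OF assms])
qed

lemma space_torus_measure: "space torus_measure = (\<Pi>\<^sub>E q\<in>{q. prime q}. sphere 0 1)"
  by (simp add: torus_measure_def space_PiM space_circle_measure)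

lemma torus_coord_measurable_circle:
  "prime q \<Longrightarrow> (\<lambda>\<xi>. \<xi> q) \<in> torus_measure \<rightarrow>\<^sub>M circle_measure"
  unfolding torus_measure_def by (rule measurable_component_singleton) auto

lemma torus_coord_measurable: "prime q \<Longrightarrow> (\<lambda>\<xi>. \<xi> q) \<in> borel_measurable torus_measure"
  by (rule measurable_compose[OF torus_coord_measurable_circle id_measurable_circle])

lemma norm_torus_coord: "\<xi> \<in> space torus_measure \<Longrightarrow> prime q \<Longrightarrow> norm (\<xi> q) = 1"
  by (auto simp: space_torus_measure)

text \<open>
  The Kronecker flow: the coordinate at the prime \<open>q\<close> moves with angular velocity \<open>- ln q\<close>, so that
  it is multiplied by \<open>q powr (- \<i>t)\<close> at time \<open>t\<close>.
\<close>

definition rot :: "real \<Rightarrow> (nat \<Rightarrow> complex) \<Rightarrow> nat \<Rightarrow> complex" where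
  "rot t \<xi> = (\<lambda>q\<in>{q. prime q}. \<xi> q * cis (- t * ln (real q)))"

text \<open>
  A coordinatewise map pulls a finite-dimensional box back to the box of the preimages, and such
  boxes determine the product measure.
\<close>

lemma distr_PiM_map:
  assumes M: "\<And>i. i \<in> I \<Longrightarrow> prob_space (M i)" and f: "\<And>i. i \<in> I \<Longrightarrow> f i \<in> M i \<rightarrow>\<^sub>M M i"
    and d: "\<And>i. i \<in> I \<Longrightarrow> distr (M i) (M i) (f i) = M i"
  shows "distr (PiM I M) (PiM I M) (\<lambda>\<omega>. \<lambda>i\<in>I. f i (\<omega> i)) = PiM I M"
proof (rule measure_eqI_PiM_infinite)
  interpret prob_space "PiM I M" by (intro prob_space_PiM M)
  have m: "(\<lambda>\<omega>. \<lambda>i\<in>I. f i (\<omega> i)) \<in> PiM I M \<rightarrow>\<^sub>M PiM I M"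
    by (rule measurable_restrict, rule measurable_compose[OF measurable_component_singleton], assumption, rule f)
  show "finite_measure (distr (PiM I M) (PiM I M) (\<lambda>\<omega>. \<lambda>i\<in>I. f i (\<omega> i)))"
    using prob_space_distr[OF m] by (simp add: prob_space_def)
  fix A J assume J: "finite J" "J \<subseteq> I" and A: "\<And>i. i \<in> J \<Longrightarrow> A i \<in> sets (M i)"
  let ?B = "\<lambda>i. f i -` A i \<inter> space (M i)"
  have B: "?B i \<in> sets (M i)" "M i (?B i) = M i (A i)" if "i \<in> J" for i
    using that J A f[of i] d[of i] emeasure_distr[of "f i" "M i" "M i" "A i"] by (auto intro: measurable_sets)
  have "distr (PiM I M) (PiM I M) (\<lambda>\<omega>. \<lambda>i\<in>I. f i (\<omega> i)) (prod_emb I M J (Pi\<^sub>E J A)) =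
     PiM I M ((\<lambda>\<omega>. \<lambda>i\<in>I. f i (\<omega> i)) -` prod_emb I M J (Pi\<^sub>E J A) \<inter> space (PiM I M))"
    using J A by (intro emeasure_distr[OF m] sets_PiM_I) auto
  also have "(\<lambda>\<omega>. \<lambda>i\<in>I. f i (\<omega> i)) -` prod_emb I M J (Pi\<^sub>E J A) \<inter> space (PiM I M) = prod_emb I M J (Pi\<^sub>E J ?B)"
  proof (intro set_eqI iffI)
    fix \<omega> assume "\<omega> \<in> (\<lambda>\<omega>. \<lambda>i\<in>I. f i (\<omega> i)) -` prod_emb I M J (Pi\<^sub>E J A) \<inter> space (PiM I M)"
    then show "\<omega> \<in> prod_emb I M J (Pi\<^sub>E J ?B)"
      using J by (auto simp: prod_emb_def space_PiM PiE_iff restrict_def subset_iff extensional_def split: if_splits)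
  next
    fix \<omega> assume "\<omega> \<in> prod_emb I M J (Pi\<^sub>E J ?B)"
    then show "\<omega> \<in> (\<lambda>\<omega>. \<lambda>i\<in>I. f i (\<omega> i)) -` prod_emb I M J (Pi\<^sub>E J A) \<inter> space (PiM I M)"
      using J measurable_space[OF f] by (auto simp: prod_emb_def space_PiM PiE_iff restrict_def subset_iff extensional_def split: if_splits)
  qed
  also have "PiM I M \<dots> = (\<Prod>i\<in>J. M i (?B i))"
    using J B by (intro emeasure_PiM_emb M) auto
  also have "\<dots> = (\<Prod>i\<in>J. M i (A i))" using B by simp
  also have "\<dots> = PiM I M (prod_emb I M J (Pi\<^sub>E J A))"
    using J A by (intro emeasure_PiM_emb[symmetric] M) auto
  finally show "distr (PiM I M) (PiM I M) (\<lambda>\<omega>. \<lambda>i\<in>I. f i (\<omega> i)) (prod_emb I M J (Pi\<^sub>E J A)) = PiM I M (prod_emb I M J (Pi\<^sub>E J A))" .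
qed auto

lemma distr_rot: "distr torus_measure torus_measure (rot t) = torus_measure"
proof -
  have "distr torus_measure torus_measure (\<lambda>\<omega>. \<lambda>i\<in>{q. prime q}. \<omega> i * cis (- t * ln (real i))) = torus_measure"
    unfolding torus_measure_def
    by (rule distr_PiM_map[of _ _ "\<lambda>i z. z * cis (- t * ln (real i))"])
       (auto intro!: prob_space_circle_measure rotation_measurable_circle distr_circle_measure_rotation)
  then show ?thesis unfolding rot_def .
qed

lemma rot_measurable_pair: "(\<lambda>x. rot (fst x) (snd x)) \<in> borel \<Otimes>\<^sub>M torus_measure \<rightarrow>\<^sub>M torus_measure"
  unfolding torus_measure_def rot_def
proof (rule measurable_restrict)
  fix q :: nat assume "q \<in> {q. prime q}"
  then have q: "prime q" by simp
  have [measurable]: "(\<lambda>\<xi>. \<xi> q) \<in> borel_measurable (Pi\<^sub>M {q. prime q} (\<lambda>_. circle_measure))"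
    using torus_coord_measurable[OF q] by (simp add: torus_measure_def)
  have [measurable]: "cis \<in> borel_measurable borel"
    by (auto intro!: borel_measurable_continuous_onI continuous_intros)
  show "(\<lambda>x. snd x q * cis (- fst x * ln (real q))) \<in> borel \<Otimes>\<^sub>M Pi\<^sub>M {q. prime q} (\<lambda>_. circle_measure) \<rightarrow>\<^sub>M circle_measure"
    unfolding circle_measurable_iff
  proof
    show "(\<lambda>x. snd x q * cis (- fst x * ln (real q))) \<in> borel_measurable (borel \<Otimes>\<^sub>M Pi\<^sub>M {q. prime q} (\<lambda>_. circle_measure))"
      by measurable
    show "(\<lambda>x. snd x q * cis (- fst x * ln (real q))) \<in> space (borel \<Otimes>\<^sub>M Pi\<^sub>M {q. prime q} (\<lambda>_. circle_measure)) \<rightarrow> sphere 0 1"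
      using norm_torus_coord[of _ q] q by (auto simp: space_pair_measure norm_mult torus_measure_def)
  qed
qed

lemma rot_measurable_comp:
  assumes "f \<in> borel_measurable M" "g \<in> M \<rightarrow>\<^sub>M torus_measure"
  shows "(\<lambda>x. rot (f x) (g x)) \<in> M \<rightarrow>\<^sub>M torus_measure"
  using measurable_compose[OF measurable_Pair[OF assms] rot_measurable_pair] by simp

lemma rot_measurable: "rot t \<in> torus_measure \<rightarrow>\<^sub>M torus_measure"
  using rot_measurable_comp[of "\<lambda>_. t" torus_measure "\<lambda>x. x"] by (simp add: eta_contract_eq)

lemma rot_in_space: "\<xi> \<in> space torus_measure \<Longrightarrow> rot t \<xi> \<in> space torus_measure"
  using rot_measurable by (rule measurable_space)

lemma rot_add: "rot s (rot t \<xi>) = rot (s + t) \<xi>"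
  by (auto simp: rot_def restrict_def cis_mult algebra_simps)

lemma rot_0: "\<xi> \<in> space torus_measure \<Longrightarrow> rot 0 \<xi> = \<xi>"
  by (auto simp: rot_def space_torus_measure PiE_iff extensional_def restrict_def)

lemma nn_integral_rot:
  assumes "g \<in> borel_measurable torus_measure"
  shows "(\<integral>\<^sup>+\<xi>. g (rot t \<xi>) \<partial>torus_measure) = (\<integral>\<^sup>+\<xi>. g \<xi> \<partial>torus_measure)"
  using nn_integral_distr[OF rot_measurable, of g t] assms by (simp add: distr_rot)

lemma integral_rot:
  fixes g :: "_ \<Rightarrow> complex"
  assumes "g \<in> borel_measurable torus_measure"
  shows "(\<integral>\<xi>. g (rot t \<xi>) \<partial>torus_measure) = (\<integral>\<xi>. g \<xi> \<partial>torus_measure)"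
  using integral_distr[OF rot_measurable assms, of t] by (simp add: distr_rot)

section \<open>Characters and twisted Dirichlet polynomials\<close>

lemma norm_cmult_ext: "\<xi> \<in> space torus_measure \<Longrightarrow> norm (cmult_ext \<xi> n) = 1"
  unfolding cmult_ext_def prod_norm[symmetric]
  by (intro prod.neutral) (auto simp: norm_power norm_torus_coord in_prime_factors_iff)

lemma cmult_ext_measurable [measurable]: "(\<lambda>\<xi>. cmult_ext \<xi> n) \<in> borel_measurable torus_measure"
  unfolding cmult_ext_def
  by (intro borel_measurable_prod borel_measurable_power torus_coord_measurable) (auto simp: in_prime_factors_iff)

lemma cmult_ext_superset:
  assumes "finite S" "prime_factors n \<subseteq> S" "S \<subseteq> {q. prime q}"
  shows "cmult_ext \<xi> n = (\<Prod>q\<in>S. \<xi> q ^ multiplicity q n)"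
  unfolding cmult_ext_def
  by (rule prod.mono_neutral_left) (use assms in \<open>auto simp: in_prime_factors_iff not_dvd_imp_multiplicity_0\<close>)

lemma cmult_ext_mult:
  assumes "m > 0" "n > 0"
  shows "cmult_ext \<xi> (m * n) = cmult_ext \<xi> m * cmult_ext \<xi> n"
proof -
  let ?S = "prime_factors m \<union> prime_factors n"
  have "cmult_ext \<xi> (m * n) = (\<Prod>q\<in>?S. \<xi> q ^ multiplicity q (m * n))"
    using assms by (intro cmult_ext_superset) (auto simp: prime_factors_product in_prime_factors_iff)
  also have "\<dots> = (\<Prod>q\<in>?S. \<xi> q ^ multiplicity q m * \<xi> q ^ multiplicity q n)"
    using assms by (intro prod.cong refl)
      (auto simp: prime_elem_multiplicity_mult_distrib in_prime_factors_iff power_add)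
  also have "\<dots> = cmult_ext \<xi> m * cmult_ext \<xi> n"
    unfolding prod.distrib
    by (subst (1 2) cmult_ext_superset[of ?S]) (auto simp: in_prime_factors_iff)
  finally show ?thesis .
qed

lemma cmult_ext_prime: "prime q \<Longrightarrow> cmult_ext \<xi> q = \<xi> q"
  by (simp add: cmult_ext_def prime_prime_factors)

lemma cmult_ext_1 [simp]: "cmult_ext \<xi> (Suc 0) = 1"
  by (simp add: cmult_ext_def)

lemma cis_sum: "(\<Prod>i\<in>A. cis (f i)) = cis (\<Sum>i\<in>A. f i)"
  by (induction A rule: infinite_finite_induct) (auto simp: cis_mult)

text \<open>
  Every character is an eigenfunction of the flow: the frequencies \<open>ln q\<close> of the coordinates
  add up to \<open>ln n\<close> along the prime factorisation of \<open>n\<close>.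
\<close>

lemma cmult_ext_rot:
  assumes "n > 0"
  shows "cmult_ext (rot t \<xi>) n = cmult_ext \<xi> n * cis (- t * ln (real n))"
proof -
  have "cmult_ext (rot t \<xi>) n = (\<Prod>q\<in>prime_factors n. \<xi> q ^ multiplicity q n * cis (- t * (real (multiplicity q n) * ln (real q))))"
    unfolding cmult_ext_def
    by (intro prod.cong refl) (auto simp: rot_def in_prime_factors_iff power_mult_distrib Complex.DeMoivre algebra_simps)
  also have "\<dots> = cmult_ext \<xi> n * cis (- t * (\<Sum>q\<in>prime_factors n. real (multiplicity q n) * ln (real q)))"
    by (simp add: prod.distrib cis_sum cmult_ext_def sum_distrib_left sum_negf)
  also have "(\<Sum>q\<in>prime_factors n. real (multiplicity q n) * ln (real q)) = ln (real (\<Prod>q\<in>prime_factors n. q ^ multiplicity q n))"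
    by (subst of_nat_prod, subst ln_prod) (auto simp: in_prime_factors_iff ln_realpow prime_gt_0_nat)
  also have "(\<Prod>q\<in>prime_factors n. q ^ multiplicity q n) = n"
    using assms by (simp add: prime_factorization_nat[symmetric])
  finally show ?thesis .
qed

text \<open>
  The value at \<open>s\<close> of the Dirichlet polynomial \<open>a\<close> twisted by the character \<open>\<xi>\<close>.
\<close>

definition tpoly :: "(nat \<Rightarrow> complex) \<Rightarrow> (nat \<Rightarrow> complex) \<Rightarrow> complex \<Rightarrow> complex" where
  "tpoly a \<xi> s = (\<Sum>n | a n \<noteq> 0. a n * cmult_ext \<xi> n * of_nat n powr (- s))"

lemma of_nat_powr_imag_shift:
  assumes "n > 0"
  shows "of_nat n powr (- (s + \<i> * of_real t)) = of_nat n powr (- s) * cis (- t * ln (real n))"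
  using assms
  by (simp add: powr_def mult_exp_exp cis_conv_exp Ln_of_nat algebra_simps)

text \<open>
  Rotating the character translates the argument vertically.  This identity links means over the
  torus with means over vertical lines.
\<close>

lemma tpoly_rot:
  assumes "a 0 = 0"
  shows "tpoly a (rot t \<xi>) s = tpoly a \<xi> (s + \<i> * of_real t)"
  unfolding tpoly_def
proof (rule sum.cong[OF refl])
  fix n assume "n \<in> {n. a n \<noteq> 0}"
  then have "n > 0" using assms by (cases n) auto
  then show "a n * cmult_ext (rot t \<xi>) n * of_nat n powr - s = a n * cmult_ext \<xi> n * of_nat n powr - (s + \<i> * complex_of_real t)"
    by (simp only: cmult_ext_rot of_nat_powr_imag_shift mult_ac)
qed

lemma of_nat_powr_measurable [measurable]: "(\<lambda>s::complex. of_nat n powr (- s)) \<in> borel_measurable borel"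
  by (cases "n = 0") (auto intro!: borel_measurable_continuous_onI continuous_intros simp: powr_def)

lemma tpoly_measurable_pair [measurable]:
  "(\<lambda>x. tpoly a (fst x) (snd x)) \<in> borel_measurable (torus_measure \<Otimes>\<^sub>M borel)"
  unfolding tpoly_def by measurable

section \<open>The maximal ergodic inequality\<close>

text \<open>
  The maximum over \<open>k \<le> n\<close> of the Birkhoff sums \<open>\<Sum>j<k. g ((S ^^ j) x)\<close>, the empty sum included.
  The recursion splits off the first summand; the proof of the maximal inequality rests on this form.
\<close>

primrec orbit_max :: "('a \<Rightarrow> 'a) \<Rightarrow> ('a \<Rightarrow> real) \<Rightarrow> nat \<Rightarrow> 'a \<Rightarrow> real" where
  "orbit_max S g 0 = (\<lambda>_. 0)"
| "orbit_max S g (Suc n) = (\<lambda>x. max 0 (g x + orbit_max S g n (S x)))"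

lemma orbit_max_nonneg: "orbit_max S g n x \<ge> 0"
  by (cases n) auto

lemma orbit_max_mono: "orbit_max S g n x \<le> orbit_max S g (Suc n) x"
proof (induction n arbitrary: x)
  case (Suc n)
  have "max 0 (g x + orbit_max S g n (S x)) \<le> max 0 (g x + orbit_max S g (Suc n) (S x))"
    by (intro max.mono add_left_mono order_refl Suc.IH)
  then show ?case by (simp only: orbit_max.simps)
qed auto

lemma orbit_sum_le_max: "k \<le> n \<Longrightarrow> (\<Sum>j<k. g ((S ^^ j) x)) \<le> orbit_max S g n x"
proof (induction n arbitrary: k x)
  case (Suc n)
  show ?case
  proof (cases k)
    case (Suc m)
    have "(\<Sum>j<k. g ((S ^^ j) x)) = g x + (\<Sum>j<m. g ((S ^^ j) (S x)))"
      by (simp only: Suc sum.lessThan_Suc_shift funpow_Suc_right o_def funpow.simps id_def)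
    also have "\<dots> \<le> g x + orbit_max S g n (S x)"
      using Suc.IH[of m "S x"] Suc.prems Suc by simp
    finally show ?thesis by simp
  qed (use orbit_max_nonneg[of S g "Suc n" x] in \<open>simp del: orbit_max.simps\<close>)
qed auto

context prob_space begin

lemma orbit_max_integrable:
  assumes S: "S \<in> M \<rightarrow>\<^sub>M M" "distr M M S = M" and g: "integrable M g"
  shows "integrable M (orbit_max S g n)"
proof (induction n)
  case (Suc n)
  have "integrable (distr M M S) (orbit_max S g n)" using Suc S by simp
  then have "integrable M (\<lambda>x. orbit_max S g n (S x))"
    by (rule integrable_distr[OF S(1)])
  then show ?case using g by (auto intro!: Bochner_Integration.integrable_max)
qed auto

text \<open>
  Garsia's argument: where the maximum \<open>M n\<close> with \<open>n = m + 1\<close> is positive, the recursion reads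
  \<open>g x = M n x - M m (S x)\<close>, and elsewhere \<open>0 \<ge> M n x - M m (S x)\<close>.  Integrating, \<open>S\<close> disappears because it
  preserves the measure, and \<open>M n \<ge> M m\<close>.
\<close>

lemma maximal_ergodic:
  assumes S: "S \<in> M \<rightarrow>\<^sub>M M" "distr M M S = M" and g: "integrable M g"
  shows "0 \<le> (\<integral>x. g x * indicator {x. orbit_max S g n x > 0} x \<partial>M)"
proof (cases n)
  case (Suc m)
  note I = orbit_max_integrable[OF S g]
  let ?A = "{x. orbit_max S g n x > 0}"
  have IS: "integrable M (\<lambda>x. orbit_max S g m (S x))"
    using integrable_distr[OF S(1), of "orbit_max S g m"] I S by simp
  have meas: "{x \<in> space M. orbit_max S g n x > 0} \<in> sets M"
    using borel_measurable_integrable[OF I[of n]] by measurable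
  have ig: "integrable M (\<lambda>x. g x * indicator ?A x)"
  proof (rule Bochner_Integration.integrable_bound[OF g])
    have "(\<lambda>x. g x * indicator {x \<in> space M. orbit_max S g n x > 0} x) \<in> borel_measurable M"
      using meas g by measurable
    then show "(\<lambda>x. g x * indicator ?A x) \<in> borel_measurable M"
      by (rule measurable_cong[THEN iffD1, rotated]) (auto simp: indicator_def)
  qed (auto simp: indicator_def)
  have "0 = (\<integral>x. orbit_max S g m x \<partial>M) - (\<integral>x. orbit_max S g m (S x) \<partial>M)"
    using integral_distr[OF S(1), of "orbit_max S g m"] I[of m] S by simp
  also have "\<dots> \<le> (\<integral>x. orbit_max S g n x \<partial>M) - (\<integral>x. orbit_max S g m (S x) \<partial>M)"
    using integral_mono[OF I[of m] I[of n]] orbit_max_mono[of S g m] Suc by simp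
  also have "\<dots> = (\<integral>x. orbit_max S g n x - orbit_max S g m (S x) \<partial>M)"
    using I IS by simp
  also have "\<dots> \<le> (\<integral>x. g x * indicator ?A x \<partial>M)"
    by (rule integral_mono[OF Bochner_Integration.integrable_diff[OF I IS] ig])
       (use orbit_max_nonneg[of S g m] in \<open>auto simp: Suc indicator_def\<close>)
  finally show ?thesis .
qed auto

text \<open>
  The maximal inequality for \<open>g - \<kappa>\<close>, whose Birkhoff sums are positive exactly when an average
  of \<open>g\<close> exceeds \<open>\<kappa>\<close>.
\<close>

lemma maximal_ergodic_weak_type:
  assumes S: "S \<in> M \<rightarrow>\<^sub>M M" "distr M M S = M" and g: "integrable M g" "\<And>x. g x \<ge> 0" and l: "\<kappa> > 0"
  shows "\<exists>B\<in>sets M. prob B \<le> (\<integral>x. g x \<partial>M) / \<kappa> \<and>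
     (\<forall>x\<in>space M - B. \<forall>k. (\<Sum>j<k. g ((S ^^ j) x)) \<le> \<kappa> * k)"
proof -
  let ?h = "\<lambda>x. g x - \<kappa>"
  have h: "integrable M ?h" using g by auto
  define A where "A n = {x\<in>space M. orbit_max S ?h n x > 0}" for n
  have [measurable]: "orbit_max S ?h n \<in> borel_measurable M" for n
    using orbit_max_integrable[OF S h] by (rule borel_measurable_integrable)
  have A[measurable]: "A n \<in> sets M" for n unfolding A_def by measurable
  have bd: "prob (A n) \<le> (\<integral>x. g x \<partial>M) / \<kappa>" for n
  proof -
    have "0 \<le> (\<integral>x. ?h x * indicator {x. orbit_max S ?h n x > 0} x \<partial>M)"
      by (rule maximal_ergodic[OF S h])
    also have "\<dots> = (\<integral>x. g x * indicator (A n) x - \<kappa> * indicator (A n) x \<partial>M)"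
      by (rule Bochner_Integration.integral_cong) (auto simp: A_def indicator_def)
    also have "\<dots> = (\<integral>x. g x * indicator (A n) x \<partial>M) - \<kappa> * prob (A n)"
      using g(1) by (subst Bochner_Integration.integral_diff)
        (auto simp: integrable_real_mult_indicator less_top[symmetric])
    also have "(\<integral>x. g x * indicator (A n) x \<partial>M) \<le> (\<integral>x. g x \<partial>M)"
      by (rule integral_mono[OF integrable_real_mult_indicator[OF A g(1)] g(1)])
         (use g(2) in \<open>auto simp: indicator_def\<close>)
    finally show ?thesis using l by (simp add: field_simps)
  qed
  have inc: "incseq A"
    by (rule incseq_SucI) (auto simp: A_def simp del: orbit_max.simps intro: less_le_trans[OF _ orbit_max_mono])
  let ?B = "\<Union>n. A n"
  have "prob ?B \<le> (\<integral>x. g x \<partial>M) / \<kappa>"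
    by (rule LIMSEQ_le_const2[OF finite_Lim_measure_incseq[OF _ inc]]) (use bd in auto)
  moreover have "(\<Sum>j<k. g ((S ^^ j) x)) \<le> \<kappa> * k" if "x \<in> space M - ?B" for x k
  proof -
    have "(\<Sum>j<k. ?h ((S ^^ j) x)) \<le> orbit_max S ?h k x"
      by (rule orbit_sum_le_max) simp
    also have "\<dots> \<le> 0" using that by (auto simp: A_def not_less)
    finally show ?thesis by (simp add: sum_subtractf mult.commute)
  qed
  ultimately show ?thesis by (intro bexI[of _ ?B]) auto
qed

end

section \<open>The ergodic theorem for flows with a dense class of averaging functions\<close>

locale prob_flow = prob_space M for M :: "'a measure" +
  fixes T :: "real \<Rightarrow> 'a \<Rightarrow> 'a"
  assumes T_pair: "(\<lambda>x. T (fst x) (snd x)) \<in> borel \<Otimes>\<^sub>M M \<rightarrow>\<^sub>M M"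
    and T_pres: "distr M M (T t) = M"
    and T_add: "T s (T t x) = T (s + t) x"
    and T_0: "x \<in> space M \<Longrightarrow> T 0 x = x"
begin

sublocale pair_sigma_finite lborel M ..

lemma T_measurable_comp:
  assumes "f \<in> borel_measurable N" "g \<in> N \<rightarrow>\<^sub>M M"
  shows "(\<lambda>x. T (f x) (g x)) \<in> N \<rightarrow>\<^sub>M M"
  using measurable_compose[OF measurable_Pair[OF assms] T_pair] by simp

lemma T_measurable: "T t \<in> M \<rightarrow>\<^sub>M M"
  using T_measurable_comp[of "\<lambda>_. t" M "\<lambda>x. x"] by (simp add: eta_contract_eq)

lemma nn_integral_T:
  assumes "g \<in> borel_measurable M"
  shows "(\<integral>\<^sup>+x. g (T t x) \<partial>M) = (\<integral>\<^sup>+x. g x \<partial>M)"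
  using nn_integral_distr[OF T_measurable, of g t] assms by (simp add: T_pres)

text \<open>
  Fubini together with invariance.  With \<open>g\<close> the indicator of a null set it says that almost every
  orbit meets the null set only for a null set of times.
\<close>

lemma nn_integral_weighted_orbit:
  fixes g :: "'a \<Rightarrow> ennreal"
  assumes [measurable]: "g \<in> borel_measurable M" "w \<in> borel_measurable borel"
  shows "(\<integral>\<^sup>+x. (\<integral>\<^sup>+t. w t * g (T t x) \<partial>lborel) \<partial>M) = (\<integral>\<^sup>+t. w t \<partial>lborel) * (\<integral>\<^sup>+x. g x \<partial>M)"
proof -
  have [measurable]: "(\<lambda>x. T (fst x) (snd x)) \<in> lborel \<Otimes>\<^sub>M M \<rightarrow>\<^sub>M M"
    by (intro T_measurable_comp) auto
  have [measurable]: "T t \<in> M \<rightarrow>\<^sub>M M" for t by (rule T_measurable)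
  have "(\<integral>\<^sup>+x. (\<integral>\<^sup>+t. w t * g (T t x) \<partial>lborel) \<partial>M) = (\<integral>\<^sup>+t. (\<integral>\<^sup>+x. w t * g (T t x) \<partial>M) \<partial>lborel)"
    by (rule Fubini') (auto simp: case_prod_beta)
  also have "\<dots> = (\<integral>\<^sup>+t. w t * (\<integral>\<^sup>+x. g x \<partial>M) \<partial>lborel)"
    by (auto intro!: nn_integral_cong simp: nn_integral_cmult nn_integral_T)
  also have "\<dots> = (\<integral>\<^sup>+t. w t \<partial>lborel) * (\<integral>\<^sup>+x. g x \<partial>M)"
    by (rule nn_integral_multc) auto
  finally show ?thesis .
qed

lemma integrable_orbit_pair:
  fixes g :: "'a \<Rightarrow> real"
  assumes g: "integrable M g"
  shows "integrable (lborel \<Otimes>\<^sub>M M) (\<lambda>(t, x). indicator {0..R} t * g (T t x))"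
proof (rule integrableI_bounded)
  have [measurable]: "(\<lambda>x. T (fst x) (snd x)) \<in> lborel \<Otimes>\<^sub>M M \<rightarrow>\<^sub>M M"
    by (intro T_measurable_comp) auto
  have [measurable]: "T t \<in> M \<rightarrow>\<^sub>M M" for t by (rule T_measurable)
  have [measurable]: "g \<in> borel_measurable M" using g by auto
  show m: "(\<lambda>(t, x). indicator {0..R} t * g (T t x)) \<in> borel_measurable (lborel \<Otimes>\<^sub>M M)"
    unfolding case_prod_beta by measurable
  have "(\<integral>\<^sup>+z. ennreal (norm (case z of (t, x) \<Rightarrow> indicator {0..R} t * g (T t x))) \<partial>(lborel \<Otimes>\<^sub>M M))
     = (\<integral>\<^sup>+x. (\<integral>\<^sup>+t. ennreal (norm (indicator {0..R} t * g (T t x))) \<partial>lborel) \<partial>M)"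
    using nn_integral_snd[of "\<lambda>z. ennreal (norm (case z of (t, x) \<Rightarrow> indicator {0..R} t * g (T t x)))"] m
    by (simp add: case_prod_beta)
  also have "\<dots> = (\<integral>\<^sup>+x. (\<integral>\<^sup>+t. indicator {0..R} t * ennreal \<bar>g (T t x)\<bar> \<partial>lborel) \<partial>M)"
    by (intro nn_integral_cong) (auto simp: indicator_def)
  also have "\<dots> = (\<integral>\<^sup>+t. indicator {0..R} t \<partial>lborel) * (\<integral>\<^sup>+x. ennreal \<bar>g x\<bar> \<partial>M)"
    by (rule nn_integral_weighted_orbit) auto
  also have "\<dots> < \<infinity>"
    using g by (auto simp: ennreal_mult_less_top integrable_iff_bounded emeasure_lborel_Icc_eq)
  finally show "(\<integral>\<^sup>+z. ennreal (norm (case z of (t, x) \<Rightarrow> indicator {0..R} t * g (T t x))) \<partial>(lborel \<Otimes>\<^sub>M M)) < \<infinity>" .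
qed

lemma AE_orbit_integrable:
  fixes g :: "'a \<Rightarrow> real"
  assumes g: "integrable M g"
  shows "AE x in M. \<forall>R. set_integrable lborel {0..R} (\<lambda>t. g (T t x))"
proof -
  have "AE x in M. \<forall>n::nat. integrable lborel (\<lambda>t. indicator {0..real n} t * g (T t x))"
    unfolding AE_all_countable using AE_integrable_snd[OF integrable_orbit_pair[OF g]] by auto
  then show ?thesis
  proof eventually_elim
    case (elim x)
    show ?case
    proof
      fix R :: real
      obtain n :: nat where n: "R \<le> real n" using real_arch_simple by blast
      have "set_integrable lborel {0..real n} (\<lambda>t. g (T t x))"
        using elim by (simp add: set_integrable_def)
      then show "set_integrable lborel {0..R} (\<lambda>t. g (T t x))"
        by (rule set_integrable_subset) (use n in auto)
    qed
  qed
qed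

lemma T_funpow: "x \<in> space M \<Longrightarrow> (T 1 ^^ j) x = T (real j) x"
  by (induction j) (auto simp: T_0 T_add add.commute)

lemma orbit_integral_sum:
  fixes d :: "'a \<Rightarrow> real"
  assumes x: "x \<in> space M" and i: "\<And>R. set_integrable lborel {0..R} (\<lambda>t. d (T t x))"
  shows "(\<Sum>j<k. (LINT t:{0..1}|lborel. d (T t ((T 1 ^^ j) x)))) = (LINT t:{0..real k}|lborel. d (T t x))"
proof (induction k)
  case 0
  have "AE t in lborel. t \<noteq> (0::real)" by (rule AE_lborel_singleton)
  then have "AE t in lborel. indicator {0..0} t *\<^sub>R d (T t x) = 0"
    by eventually_elim auto
  then have "(LINT t:{0..0}|lborel. d (T t x)) = 0"
    unfolding set_lebesgue_integral_def by (rule integral_eq_zero_AE)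
  then show ?case by simp
next
  case (Suc k)
  have "(LINT t:{0..1}|lborel. d (T t ((T 1 ^^ k) x))) = (LINT t:{0..1}|lborel. d (T (t + real k) x))"
    by (simp add: T_funpow[OF x] T_add)
  also have "\<dots> = (LINT t:{real k..real (Suc k)}|lborel. d (T t x))"
    unfolding set_lebesgue_integral_def
    by (subst (2) lborel_integral_real_affine[where c=1 and t="real k"])
       (auto intro!: Bochner_Integration.integral_cong simp: indicator_def add.commute)
  finally have 1: "(LINT t:{0..1}|lborel. d (T t ((T 1 ^^ k) x))) = \<dots>" .
  have "(LINT t:{0..real (Suc k)}|lborel. d (T t x)) = (LINT t:{0..real k} \<union> {real k..real (Suc k)}|lborel. d (T t x))"
    by (intro arg_cong[where f="\<lambda>A. LINT t:A|lborel. d (T t x)"]) auto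
  also have "\<dots> = (LINT t:{0..real k}|lborel. d (T t x)) + (LINT t:{real k..real (Suc k)}|lborel. d (T t x))"
  proof (rule set_integral_Un_AE)
    have "AE t in lborel. t \<noteq> real k" by (rule AE_lborel_singleton)
    then show "AE t in lborel. \<not> (t \<in> {0..real k} \<and> t \<in> {real k..real (Suc k)})"
      by eventually_elim auto
    show "set_integrable lborel {real k..real (Suc k)} (\<lambda>t. d (T t x))"
      by (rule set_integrable_subset[OF i[of "real (Suc k)"]]) auto
  qed (use i in auto)
  finally show ?case using Suc 1 by simp
qed

text \<open>
  The discrete maximal inequality for the time-one map, applied to the integral of \<open>d\<close> over a unit of
  time.  The factor 2 pays for rounding \<open>R\<close> up to an integer.
\<close>

lemma maximal_flow_inequality:
  fixes d :: "'a \<Rightarrow> real"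
  assumes d: "integrable M d" "\<And>x. d x \<ge> 0" and l: "\<kappa> > 0"
  shows "\<exists>B\<in>sets M. prob B \<le> (\<integral>x. d x \<partial>M) / \<kappa> \<and>
     (AE x in M. x \<notin> B \<longrightarrow> (\<forall>R\<ge>1. (LINT t:{0..R}|lborel. d (T t x)) \<le> 2 * \<kappa> * R))"
proof -
  note P = integrable_orbit_pair[OF d(1), of 1]
  let ?D = "\<lambda>x. LINT t:{0..1}|lborel. d (T t x)"
  have D: "integrable M ?D"
    using integrable_snd[OF P] by (simp add: set_lebesgue_integral_def)
  have "(\<integral>x. ?D x \<partial>M) = (\<integral>t. (\<integral>x. indicator {0..1} t * d (T t x) \<partial>M) \<partial>lborel)"
    using Fubini_integral[OF P] by (simp add: set_lebesgue_integral_def)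
  also have "\<dots> = (\<integral>t. indicator {0..1::real} t * (\<integral>x. d x \<partial>M) \<partial>lborel)"
    using integral_distr[OF T_measurable, of d] d(1)
    by (intro Bochner_Integration.integral_cong) (auto simp: T_pres)
  also have "\<dots> = (\<integral>x. d x \<partial>M)" by simp
  finally have ED: "(\<integral>x. ?D x \<partial>M) = (\<integral>x. d x \<partial>M)" .
  have D0: "?D x \<ge> 0" for x
    unfolding set_lebesgue_integral_def using d(2) by (intro integral_nonneg_AE) auto
  from maximal_ergodic_weak_type[OF T_measurable[of 1] T_pres D D0 l]
  obtain B where B: "B \<in> sets M" "prob B \<le> (\<integral>x. d x \<partial>M) / \<kappa>"
    "\<And>x k. x \<in> space M - B \<Longrightarrow> (\<Sum>j<k. ?D ((T 1 ^^ j) x)) \<le> \<kappa> * real k"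
    unfolding ED by metis
  have "AE x in M. x \<notin> B \<longrightarrow> (\<forall>R\<ge>1. (LINT t:{0..R}|lborel. d (T t x)) \<le> 2 * \<kappa> * R)"
    using AE_orbit_integrable[OF d(1)] AE_space
  proof eventually_elim
    case (elim x)
    show ?case
    proof (intro impI allI)
      fix R :: real assume x: "x \<notin> B" and R: "1 \<le> R"
      define k where "k = nat \<lceil>R\<rceil>"
      have k: "R \<le> real k" "real k \<le> 2 * R" using R unfolding k_def by linarith+
      have "(LINT t:{0..R}|lborel. d (T t x)) \<le> (LINT t:{0..real k}|lborel. d (T t x))"
        using elim(1) k d(2) unfolding set_lebesgue_integral_def set_integrable_def
        by (intro integral_mono) (auto simp: indicator_def)
      also have "\<dots> = (\<Sum>j<k. ?D ((T 1 ^^ j) x))"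
        using elim by (intro orbit_integral_sum[symmetric]) auto
      also have "\<dots> \<le> \<kappa> * real k" using B(3) elim x by auto
      also have "\<dots> \<le> 2 * \<kappa> * R" using k l by simp
      finally show "(LINT t:{0..R}|lborel. d (T t x)) \<le> 2 * \<kappa> * R" .
    qed
  qed
  then show ?thesis using B by blast
qed

text \<open>
  A Banach principle.  Approximating \<open>g\<close> to within \<open>2\<^sup>-\<^sup>n / (n + 1)\<close> and applying the maximal inequality
  at level \<open>1 / (n + 1)\<close>, the exceptional sets have summable probability; by Borel--Cantelli almost
  every point lies outside all but finitely many of them, and there the averages of \<open>g\<close> follow those of
  the approximants.
\<close>

lemma ergodic_one_sided_real:
  fixes g :: "'a \<Rightarrow> real"
  assumes g: "integrable M g"
    and dense: "\<And>\<epsilon>. \<epsilon> > 0 \<Longrightarrow> \<exists>q::'a \<Rightarrow> real. integrable M q \<and> (\<integral>x. \<bar>g x - q x\<bar> \<partial>M) < \<epsilon> \<and>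
       (\<forall>x\<in>space M. ((\<lambda>R. (LINT t:{0..R}|lborel. q (T t x)) / R) \<longlongrightarrow> (\<integral>x. q x \<partial>M)) at_top)"
  shows "AE x in M. ((\<lambda>R. (LINT t:{0..R}|lborel. g (T t x)) / R) \<longlongrightarrow> (\<integral>x. g x \<partial>M)) at_top"
proof -
  define c where "c = (\<integral>x. g x \<partial>M)"
  define la :: "nat \<Rightarrow> real" where "la n = 1 / real (Suc n)" for n
  have la: "la n > 0" for n by (simp add: la_def)
  have "\<forall>n. \<exists>q::'a \<Rightarrow> real. integrable M q \<and> (\<integral>x. \<bar>g x - q x\<bar> \<partial>M) < la n * (1/2)^n \<and>
       (\<forall>x\<in>space M. ((\<lambda>R. (LINT t:{0..R}|lborel. q (T t x)) / R) \<longlongrightarrow> (\<integral>x. q x \<partial>M)) at_top)"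
    by (intro allI dense) (simp add: la)
  from choice[OF this] obtain q :: "nat \<Rightarrow> 'a \<Rightarrow> real" where q: "\<And>n. integrable M (q n)"
    "\<And>n. (\<integral>x. \<bar>g x - q n x\<bar> \<partial>M) < la n * (1/2)^n"
    "\<And>n x. x \<in> space M \<Longrightarrow> ((\<lambda>R. (LINT t:{0..R}|lborel. q n (T t x)) / R) \<longlongrightarrow> (\<integral>x. q n x \<partial>M)) at_top"
    by blast
  let ?d = "\<lambda>n x. \<bar>g x - q n x\<bar>"
  have d: "integrable M (?d n)" for n using g q(1) by auto
  have "\<forall>n. \<exists>B\<in>sets M. prob B \<le> (\<integral>x. ?d n x \<partial>M) / la n \<and>
     (AE x in M. x \<notin> B \<longrightarrow> (\<forall>R\<ge>1. (LINT t:{0..R}|lborel. ?d n (T t x)) \<le> 2 * la n * R))"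
    using d la by (intro allI maximal_flow_inequality) auto
  then have "\<forall>n. \<exists>B. B\<in>sets M \<and> prob B \<le> (\<integral>x. ?d n x \<partial>M) / la n \<and>
     (AE x in M. x \<notin> B \<longrightarrow> (\<forall>R\<ge>1. (LINT t:{0..R}|lborel. ?d n (T t x)) \<le> 2 * la n * R))"
    by blast
  from choice[OF this] obtain B where B: "\<And>n. B n \<in> sets M" "\<And>n. prob (B n) \<le> (\<integral>x. ?d n x \<partial>M) / la n"
     "\<And>n. AE x in M. x \<notin> B n \<longrightarrow> (\<forall>R\<ge>1. (LINT t:{0..R}|lborel. ?d n (T t x)) \<le> 2 * la n * R)"
    by blast
  have pB: "prob (B n) \<le> (1/2)^n" for n
  proof -
    have "(\<integral>x. ?d n x \<partial>M) / la n \<le> (1/2)^n"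
      using q(2)[of n] la[of n] by (simp add: divide_le_eq mult.commute)
    then show ?thesis using B(2)[of n] by simp
  qed
  have bc: "AE x in M. eventually (\<lambda>n. x \<in> space M - B n) sequentially"
  proof (rule borel_cantelli_AE1[OF B(1)])
    show "emeasure M (B n) < \<infinity>" for n by (simp add: less_top[symmetric])
    have "summable (\<lambda>n. (1/2::real)^n)" by (rule summable_geometric) simp
    then show "summable (\<lambda>n. prob (B n))"
      by (rule summable_comparison_test[rotated]) (use pB in auto)
  qed
  have "AE x in M. \<forall>n. x \<notin> B n \<longrightarrow> (\<forall>R\<ge>1. (LINT t:{0..R}|lborel. ?d n (T t x)) \<le> 2 * la n * R)"
    unfolding AE_all_countable using B(3) by auto
  moreover have "AE x in M. \<forall>n. \<forall>R. set_integrable lborel {0..R} (\<lambda>t. q n (T t x))"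
    unfolding AE_all_countable using AE_orbit_integrable[OF q(1)] by auto
  ultimately show ?thesis
    using bc AE_orbit_integrable[OF g] AE_space
  proof eventually_elim
    case (elim x)
    show ?case unfolding c_def[symmetric]
    proof (rule tendstoI)
      fix e :: real assume e: "e > 0"
      have "la \<longlonglongrightarrow> 0" unfolding la_def by (rule LIMSEQ_Suc[OF lim_1_over_n])
      then have "eventually (\<lambda>n. la n < e/4) sequentially"
        using e by (intro order_tendstoD) auto
      with elim(3) have "eventually (\<lambda>n. x \<notin> B n \<and> la n < e/4) sequentially"
        by eventually_elim auto
      then obtain n where n: "x \<notin> B n" "la n < e/4" by (auto simp: eventually_sequentially)
      have "eventually (\<lambda>R. dist ((LINT t:{0..R}|lborel. q n (T t x)) / R) (\<integral>x. q n x \<partial>M) < e/4) at_top"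
        by (rule tendstoD[OF q(3)]) (use elim e in auto)
      then show "eventually (\<lambda>R. dist ((LINT t:{0..R}|lborel. g (T t x)) / R) c < e) at_top"
        using eventually_ge_at_top[of 1]
      proof eventually_elim
        case (elim R)
        note ig = \<open>\<forall>R. set_integrable lborel {0..R} (\<lambda>t. g (T t x))\<close>[rule_format, of R]
        note iq = \<open>\<forall>n R. set_integrable lborel {0..R} (\<lambda>t. q n (T t x))\<close>[rule_format, of R n]
        have "\<bar>(LINT t:{0..R}|lborel. g (T t x)) - (LINT t:{0..R}|lborel. q n (T t x))\<bar> \<le> 2 * la n * R"
        proof -
          have "\<bar>(LINT t:{0..R}|lborel. g (T t x)) - (LINT t:{0..R}|lborel. q n (T t x))\<bar> =
            \<bar>LINT t:{0..R}|lborel. g (T t x) - q n (T t x)\<bar>"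
            using ig iq by (subst set_integral_diff(2)) auto
          also have "\<dots> \<le> (LINT t:{0..R}|lborel. ?d n (T t x))"
            using set_integral_norm_bound[of lborel "{0..R}" "\<lambda>t. g (T t x) - q n (T t x)"] ig iq
            by (simp add: set_integral_diff(1))
          also have "\<dots> \<le> 2 * la n * R"
            using \<open>\<forall>n. x \<notin> B n \<longrightarrow> _\<close> n(1) elim by auto
          finally show ?thesis .
        qed
        then have 1: "\<bar>(LINT t:{0..R}|lborel. g (T t x)) / R - (LINT t:{0..R}|lborel. q n (T t x)) / R\<bar> \<le> 2 * la n"
          using elim by (simp add: diff_divide_distrib[symmetric] divide_le_eq)
        have "\<bar>(\<integral>x. q n x \<partial>M) - c\<bar> = \<bar>\<integral>x. g x - q n x \<partial>M\<bar>"
          using g q(1) by (simp add: c_def)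
        also have "\<dots> \<le> (\<integral>x. ?d n x \<partial>M)"
          using integral_norm_bound[of M "\<lambda>x. g x - q n x"] by simp
        also have "\<dots> \<le> la n * (1/2)^n" using q(2)[of n] by simp
        also have "\<dots> \<le> la n * 1"
          using la[of n] by (intro mult_left_mono power_le_one) auto
        finally have 2: "\<bar>(\<integral>x. q n x \<partial>M) - c\<bar> \<le> la n" by simp
        show ?case using 1 2 elim(1) n(2) unfolding dist_real_def by linarith
      qed
    qed
  qed
qed

text \<open>
  An integrable function with values in \<open>[0, \<infinity>]\<close> agrees with a finite one off a null set, which almost
  every orbit meets only for a null set of times.
\<close>

lemma ergodic_one_sided:
  fixes g :: "'a \<Rightarrow> ennreal"
  assumes g[measurable]: "g \<in> borel_measurable M" and fin: "(\<integral>\<^sup>+x. g x \<partial>M) < \<infinity>"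
    and dense: "\<And>(h::'a \<Rightarrow> real) \<epsilon>. integrable M h \<Longrightarrow> \<epsilon> > 0 \<Longrightarrow>
       \<exists>q::'a \<Rightarrow> real. integrable M q \<and> (\<integral>x. \<bar>h x - q x\<bar> \<partial>M) < \<epsilon> \<and>
       (\<forall>x\<in>space M. ((\<lambda>R. (LINT t:{0..R}|lborel. q (T t x)) / R) \<longlongrightarrow> (\<integral>x. q x \<partial>M)) at_top)"
  shows "AE x in M. ((\<lambda>R. ennreal (1/R) * (\<integral>\<^sup>+t\<in>{0..R}. g (T t x) \<partial>lborel)) \<longlongrightarrow> (\<integral>\<^sup>+x. g x \<partial>M)) at_top"
proof -
  define h where "h x = enn2real (g x)" for x
  have [measurable]: "h \<in> borel_measurable M" unfolding h_def by measurable
  have ae: "AE x in M. g x = ennreal (h x)"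
    using nn_integral_PInf_AE[OF g] fin by (auto simp: h_def less_top)
  have eq: "(\<integral>\<^sup>+x. g x \<partial>M) = (\<integral>\<^sup>+x. ennreal (h x) \<partial>M)"
    by (rule nn_integral_cong_AE[OF ae])
  have h: "integrable M h"
    using fin unfolding eq by (intro integrableI_nonneg) (auto simp: h_def)
  have E: "(\<integral>\<^sup>+x. g x \<partial>M) = ennreal (\<integral>x. h x \<partial>M)"
    unfolding eq by (rule nn_integral_eq_integral[OF h]) (auto simp: h_def)
  have [measurable]: "(\<lambda>x. T (fst x) (snd x)) \<in> lborel \<Otimes>\<^sub>M M \<rightarrow>\<^sub>M M"
    by (intro T_measurable_comp) auto
  have [measurable]: "(\<lambda>x. T (snd x) (fst x)) \<in> M \<Otimes>\<^sub>M lborel \<rightarrow>\<^sub>M M"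
    by (intro T_measurable_comp) auto
  have [measurable]: "T t \<in> M \<rightarrow>\<^sub>M M" for t by (rule T_measurable)
  define N where "N = {y\<in>space M. g y \<noteq> ennreal (h y)}"
  have N[measurable]: "N \<in> sets M" unfolding N_def by measurable
  have indN[measurable]: "indicator N \<in> borel_measurable M" by simp
  have "(\<integral>\<^sup>+x. (\<integral>\<^sup>+t. 1 * indicator N (T t x) \<partial>lborel) \<partial>M) = (\<integral>\<^sup>+t. 1 \<partial>(lborel::real measure)) * (\<integral>\<^sup>+x. indicator N x \<partial>M)"
    by (rule nn_integral_weighted_orbit) auto
  also have "(\<integral>\<^sup>+x. indicator N x \<partial>M) = 0"
    using AE_E2[OF ae] by (simp add: N_def)
  finally have N0: "(\<integral>\<^sup>+x. (\<integral>\<^sup>+t. indicator N (T t x) \<partial>lborel) \<partial>M) = 0"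
    by simp
  have Nm: "(\<lambda>z. indicator N (T (snd z) (fst z)) :: ennreal) \<in> borel_measurable (M \<Otimes>\<^sub>M lborel)"
    by (rule measurable_compose[OF _ indN]) (intro T_measurable_comp, auto)
  have "(\<lambda>x. (\<integral>\<^sup>+t. indicator N (T t x) \<partial>lborel)) \<in> borel_measurable M"
    by (rule lborel.borel_measurable_nn_integral) (use Nm in \<open>simp add: case_prod_beta\<close>)
  with N0 have ae0: "AE x in M. (\<integral>\<^sup>+t. indicator N (T t x) \<partial>lborel) = 0"
    by (simp add: nn_integral_0_iff_AE)
  have er: "AE x in M. ((\<lambda>R. (LINT t:{0..R}|lborel. h (T t x)) / R) \<longlongrightarrow> (\<integral>x. h x \<partial>M)) at_top"
    by (rule ergodic_one_sided_real[OF h]) (rule dense[OF h])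
  show ?thesis
    using ae0 AE_orbit_integrable[OF h] er AE_space
  proof eventually_elim
    case (elim x)
    have [measurable]: "(\<lambda>t. T t x) \<in> lborel \<rightarrow>\<^sub>M M"
      using elim by (intro T_measurable_comp) auto
    have "(\<lambda>t. indicator N (T t x) :: ennreal) \<in> borel_measurable lborel"
      by (rule measurable_compose[OF _ indN]) measurable
    with elim(1) have "AE t in lborel. indicator N (T t x) = (0::ennreal)"
      by (simp add: nn_integral_0_iff_AE)
    then have ag: "AE t in lborel. g (T t x) = ennreal (h (T t x))"
      by eventually_elim (use measurable_space[OF T_measurable elim(4)] in \<open>auto simp: N_def indicator_def split: if_splits\<close>)
    have "((\<lambda>R. ennreal ((LINT t:{0..R}|lborel. h (T t x)) / R)) \<longlongrightarrow> (\<integral>\<^sup>+x. g x \<partial>M)) at_top"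
      unfolding E using elim(3) by (rule tendsto_ennrealI)
    moreover have "eventually (\<lambda>R. ennreal ((LINT t:{0..R}|lborel. h (T t x)) / R) =
       ennreal (1/R) * (\<integral>\<^sup>+t\<in>{0..R}. g (T t x) \<partial>lborel)) at_top"
      using eventually_gt_at_top[of 0]
    proof eventually_elim
      case (elim R)
      have i: "integrable lborel (\<lambda>t. indicator {0..R} t * h (T t x))"
        using \<open>\<forall>R. set_integrable lborel {0..R} (\<lambda>t. h (T t x))\<close> by (simp add: set_integrable_def)
      have "(\<integral>\<^sup>+t\<in>{0..R}. g (T t x) \<partial>lborel) = (\<integral>\<^sup>+t. ennreal (indicator {0..R} t * h (T t x)) \<partial>lborel)"
        using ag by (intro nn_integral_cong_AE, eventually_elim) (auto simp: indicator_def)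
      also have "\<dots> = ennreal (LINT t:{0..R}|lborel. h (T t x))"
        unfolding set_lebesgue_integral_def real_scaleR_def
        by (rule nn_integral_eq_integral[OF i]) (auto simp: h_def)
      finally show ?case using elim
        by (simp add: ennreal_mult'[symmetric])
    qed
    ultimately show ?case by (rule Lim_transform_eventually)
  qed
qed

end

text \<open>
  The average over \<open>[-R, R]\<close> is the mean of the averages over \<open>[0, R]\<close> for the flow and for its reversal.
\<close>

lemma (in prob_flow) ergodic_two_sided:
  fixes g :: "'a \<Rightarrow> ennreal"
  assumes g[measurable]: "g \<in> borel_measurable M" and fin: "(\<integral>\<^sup>+x. g x \<partial>M) < \<infinity>"
    and dense: "\<And>(h::'a \<Rightarrow> real) \<epsilon>. integrable M h \<Longrightarrow> \<epsilon> > 0 \<Longrightarrow>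
       \<exists>q::'a \<Rightarrow> real. integrable M q \<and> (\<integral>x. \<bar>h x - q x\<bar> \<partial>M) < \<epsilon> \<and>
       (\<forall>x\<in>space M. ((\<lambda>R. (LINT t:{0..R}|lborel. q (T t x)) / R) \<longlongrightarrow> (\<integral>x. q x \<partial>M)) at_top \<and>
         ((\<lambda>R. (LINT t:{0..R}|lborel. q (T (-t) x)) / R) \<longlongrightarrow> (\<integral>x. q x \<partial>M)) at_top)"
  shows "AE x in M. ((\<lambda>R. ennreal (1/(2*R)) * (\<integral>\<^sup>+t\<in>{-R..R}. g (T t x) \<partial>lborel)) \<longlongrightarrow> (\<integral>\<^sup>+x. g x \<partial>M)) at_top"
proof -
  interpret B: prob_flow M "\<lambda>t. T (-t)"
  proof
    show "(\<lambda>x. T (- fst x) (snd x)) \<in> borel \<Otimes>\<^sub>M M \<rightarrow>\<^sub>M M"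
      by (intro T_measurable_comp) auto
  qed (auto simp: T_pres T_add T_0)
  have 1: "AE x in M. ((\<lambda>R. ennreal (1/R) * (\<integral>\<^sup>+t\<in>{0..R}. g (T t x) \<partial>lborel)) \<longlongrightarrow> (\<integral>\<^sup>+x. g x \<partial>M)) at_top"
    by (rule ergodic_one_sided[OF g fin]) (use dense in meson)
  have 2: "AE x in M. ((\<lambda>R. ennreal (1/R) * (\<integral>\<^sup>+t\<in>{0..R}. g (T (-t) x) \<partial>lborel)) \<longlongrightarrow> (\<integral>\<^sup>+x. g x \<partial>M)) at_top"
    by (rule B.ergodic_one_sided[OF g fin]) (use dense in meson)
  show ?thesis using 1 2 AE_space
  proof eventually_elim
    case (elim x)
    have [measurable]: "(\<lambda>t. T t x) \<in> lborel \<rightarrow>\<^sub>M M" "(\<lambda>t. T t x) \<in> borel \<rightarrow>\<^sub>M M"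
      using elim by (auto intro!: T_measurable_comp)
    let ?I = "\<integral>\<^sup>+x. g x \<partial>M"
    have "((\<lambda>R. ennreal (1/2) * (ennreal (1/R) * (\<integral>\<^sup>+t\<in>{0..R}. g (T t x) \<partial>lborel) +
          ennreal (1/R) * (\<integral>\<^sup>+t\<in>{0..R}. g (T (-t) x) \<partial>lborel))) \<longlongrightarrow> ennreal (1/2) * (?I + ?I)) at_top"
      by (intro ennreal_tendsto_cmult[OF ennreal_less_top] tendsto_add elim)
    also have "ennreal (1/2) * (?I + ?I) = ?I"
    proof -
      obtain r where r: "?I = ennreal r" "r \<ge> 0" using fin by (cases ?I) auto
      have "ennreal (1/2) * (ennreal r + ennreal r) = ennreal (1/2 * (r + r))"
        using r(2) by (simp only: ennreal_mult[of "1/2" "r+r"] ennreal_plus[OF r(2) r(2)])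
      then show ?thesis by (simp add: r)
    qed
    finally show ?case
    proof (rule Lim_transform_eventually)
      show "eventually (\<lambda>R. ennreal (1/2) * (ennreal (1/R) * (\<integral>\<^sup>+t\<in>{0..R}. g (T t x) \<partial>lborel) +
          ennreal (1/R) * (\<integral>\<^sup>+t\<in>{0..R}. g (T (-t) x) \<partial>lborel)) =
          ennreal (1/(2*R)) * (\<integral>\<^sup>+t\<in>{-R..R}. g (T t x) \<partial>lborel)) at_top"
        using eventually_gt_at_top[of 0]
      proof eventually_elim
        case (elim R)
        have "(\<integral>\<^sup>+t\<in>{0..R}. g (T (-t) x) \<partial>lborel) = (\<integral>\<^sup>+t\<in>{-R..0}. g (T t x) \<partial>lborel)"
          by (subst nn_integral_real_affine[where c="-1" and t=0])
             (auto intro!: nn_integral_cong simp: indicator_def)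
        then have "(\<integral>\<^sup>+t\<in>{0..R}. g (T t x) \<partial>lborel) + (\<integral>\<^sup>+t\<in>{0..R}. g (T (-t) x) \<partial>lborel) =
           (\<integral>\<^sup>+t. g (T t x) * indicator {0..R} t + g (T t x) * indicator {-R..0} t \<partial>lborel)"
          by (subst nn_integral_add) auto
        also have "\<dots> = (\<integral>\<^sup>+t\<in>{-R..R}. g (T t x) \<partial>lborel)"
        proof (rule nn_integral_cong_AE)
          have "AE t in lborel. t \<noteq> (0::real)" by (rule AE_lborel_singleton)
          then show "AE t in lborel. g (T t x) * indicator {0..R} t + g (T t x) * indicator {-R..0} t =
              g (T t x) * indicator {-R..R} t"
            by eventually_elim (use elim in \<open>auto simp: indicator_def\<close>)
        qed
        finally have e: "(\<integral>\<^sup>+t\<in>{0..R}. g (T t x) \<partial>lborel) + (\<integral>\<^sup>+t\<in>{0..R}. g (T (-t) x) \<partial>lborel) = \<dots>" .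
        have "ennreal (1/(2*R)) = ennreal (1/2) * ennreal (1/R)"
          by (subst ennreal_mult[symmetric]) (use elim in auto)
        then show ?case unfolding e[symmetric] by (simp add: distrib_left mult.assoc)
      qed
    qed
  qed
qed

section \<open>Trigonometric polynomials on the torus\<close>

text \<open>
  Characters are parametrised by pairs \<open>(m, n)\<close>, standing for the rational number \<open>m / n\<close> which need not
  be in lowest terms: products and conjugates are then given by the obvious operations on pairs.
\<close>

inductive trig_poly :: "((nat \<Rightarrow> complex) \<Rightarrow> complex) \<Rightarrow> bool" where
  trig_char: "m > 0 \<Longrightarrow> n > 0 \<Longrightarrow> trig_poly (\<lambda>\<xi>. c * (cmult_ext \<xi> m * cnj (cmult_ext \<xi> n)))"
| trig_add: "trig_poly f \<Longrightarrow> trig_poly g \<Longrightarrow> trig_poly (\<lambda>\<xi>. f \<xi> + g \<xi>)"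

lemma trig_const: "trig_poly (\<lambda>\<xi>. c)"
  using trig_char[of 1 1 c] by simp

lemma trig_mult:
  assumes "trig_poly f" "trig_poly g"
  shows "trig_poly (\<lambda>\<xi>. f \<xi> * g \<xi>)"
  using assms
proof (induction f)
  case (trig_char m n c)
  from trig_char(3) show ?case
  proof (induction g)
    case (trig_char m' n' c')
    have "trig_poly (\<lambda>\<xi>. (c * c') * (cmult_ext \<xi> (m * m') * cnj (cmult_ext \<xi> (n * n'))))"
      using \<open>m > 0\<close> \<open>n > 0\<close> trig_char by (intro trig_poly.trig_char) auto
    then show ?case
      using \<open>m > 0\<close> \<open>n > 0\<close> trig_char by (simp add: cmult_ext_mult mult_ac)
  next
    case (trig_add f g)
    then show ?case by (simp add: distrib_left trig_poly.trig_add)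
  qed
next
  case (trig_add f g)
  then show ?case by (simp add: distrib_right trig_poly.trig_add)
qed

lemma trig_cnj: "trig_poly f \<Longrightarrow> trig_poly (\<lambda>\<xi>. cnj (f \<xi>))"
proof (induction f rule: trig_poly.induct)
  case (trig_char m n c)
  then show ?case using trig_poly.trig_char[of n m "cnj c"] by (simp add: mult.commute)
qed (auto intro: trig_poly.intros)

lemma trig_sum: "finite I \<Longrightarrow> (\<And>i. i \<in> I \<Longrightarrow> trig_poly (f i)) \<Longrightarrow> trig_poly (\<lambda>\<xi>. \<Sum>i\<in>I. f i \<xi>)"
  by (induction I rule: finite_induct) (auto intro: trig_const trig_add)

lemma trig_ext: "n > 0 \<Longrightarrow> trig_poly (\<lambda>\<xi>. cmult_ext \<xi> n)"
  using trig_char[of n 1 1] by simp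

lemma cnj_measurable [measurable (raw)]: "f \<in> borel_measurable M \<Longrightarrow> (\<lambda>x. cnj (f x)) \<in> borel_measurable M"
  by (rule measurable_compose[OF _ borel_measurable_continuous_onI]) (auto intro: continuous_intros)

lemma trig_measurable: "trig_poly f \<Longrightarrow> f \<in> borel_measurable torus_measure"
proof (induction f rule: trig_poly.induct)
  case (trig_char m n c)
  show ?case by measurable
next
  case (trig_add f g)
  then show ?case by (intro borel_measurable_add)
qed

lemma trig_bounded: "trig_poly f \<Longrightarrow> \<exists>C. \<forall>\<xi>\<in>space torus_measure. norm (f \<xi>) \<le> C"
proof (induction f rule: trig_poly.induct)
  case (trig_char m n c)
  show ?case by (intro exI[of _ "norm c"]) (auto simp: norm_mult norm_cmult_ext)
next
  case (trig_add f g)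
  then obtain C D where "\<forall>\<xi>\<in>space torus_measure. norm (f \<xi>) \<le> C" "\<forall>\<xi>\<in>space torus_measure. norm (g \<xi>) \<le> D" by auto
  then show ?case by (intro exI[of _ "C + D"]) (auto intro!: norm_triangle_mono)
qed

lemma trig_integrable: "trig_poly f \<Longrightarrow> integrable torus_measure f"
proof -
  assume f: "trig_poly f"
  obtain C where "\<forall>\<xi>\<in>space torus_measure. norm (f \<xi>) \<le> C" using trig_bounded[OF f] by auto
  then show ?thesis
    by (intro TM.integrable_const_bound[of _ C] trig_measurable f) auto
qed

lemma rot_curve_measurable:
  "\<xi> \<in> space torus_measure \<Longrightarrow> (\<lambda>t. rot (d * t) \<xi>) \<in> borel \<rightarrow>\<^sub>M torus_measure"
  by (intro rot_measurable_comp) auto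

lemma integral_cis_average:
  fixes w :: real
  assumes w: "w \<noteq> 0"
  shows "((\<lambda>R. (LINT t:{0..R}|lborel. cis (w * t)) / of_real R) \<longlongrightarrow> 0) at_top"
proof -
  have int: "(LINT t:{0..R}|lborel. cis (w * t)) = (cis (w * R) - 1) / (\<i> * w)" if "R \<ge> 0" for R
  proof -
    have "(\<integral>t. indicator {0..R} t *\<^sub>R cis (w * t) \<partial>lborel) = cis (w * R) / (\<i> * w) - cis (w * 0) / (\<i> * w)"
    proof (rule integral_FTC_atLeastAtMost[OF that])
      fix x
      have "((\<lambda>z. exp (\<i> * w * z) / (\<i> * w)) has_field_derivative exp (\<i> * w * of_real x)) (at (of_real x))"
        using w by (auto intro!: derivative_eq_intros)
      from has_vector_derivative_real_field[OF this, of "{0..R}"]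
      show "((\<lambda>x. cis (w * x) / (\<i> * of_real w)) has_vector_derivative cis (w * x)) (at x within {0..R})"
        by (simp add: cis_conv_exp mult.assoc)
    qed (intro continuous_intros)
    then show ?thesis by (simp add: set_lebesgue_integral_def diff_divide_distrib)
  qed
  show ?thesis
  proof (rule Lim_null_comparison)
    show "eventually (\<lambda>R. norm ((LINT t:{0..R}|lborel. cis (w * t)) / of_real R) \<le> (2 / \<bar>w\<bar>) / R) at_top"
      using eventually_gt_at_top[of 0]
    proof eventually_elim
      case (elim R)
      have "norm (cis (w * R) - 1) \<le> 2" using norm_triangle_ineq4[of "cis (w * R)" 1] by simp
      then show ?case using elim w
        by (simp add: int norm_divide norm_mult divide_right_mono)
    qed
    show "((\<lambda>R. (2 / \<bar>w\<bar>) / R) \<longlongrightarrow> 0) at_top"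
      by (rule tendsto_divide_0[OF tendsto_const]) (rule filterlim_at_top_imp_at_infinity[OF filterlim_ident])
  qed
qed

lemma set_integrable_bounded_Icc:
  fixes f :: "real \<Rightarrow> complex"
  assumes "f \<in> borel_measurable borel" "\<And>t. norm (f t) \<le> C"
  shows "set_integrable lborel {a..b} f"
  unfolding set_integrable_def
proof (rule Bochner_Integration.integrable_bound)
  show "integrable lborel (\<lambda>t. indicator {a..b} t *\<^sub>R C)"
    by (intro integrable_scaleR_left integrable_real_indicator) (auto simp: emeasure_lborel_Icc_eq)
  show "AE x in lborel. norm (indicator {a..b} x *\<^sub>R f x) \<le> norm (indicator {a..b} x *\<^sub>R C)"
  proof (rule AE_I2)
    fix x show "norm (indicator {a..b} x *\<^sub>R f x) \<le> norm (indicator {a..b} x *\<^sub>R C)"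
      using assms(2)[of x] by (auto simp: indicator_def)
  qed
qed (use assms in auto)

lemma trig_orbit_integrable:
  assumes "trig_poly f" "\<xi> \<in> space torus_measure"
  shows "set_integrable lborel {a..b} (\<lambda>t. f (rot (d * t) \<xi>))"
proof -
  obtain C where "\<forall>\<xi>\<in>space torus_measure. norm (f \<xi>) \<le> C" using trig_bounded[OF assms(1)] by auto
  then show ?thesis
    by (intro set_integrable_bounded_Icc[where C = C] measurable_compose[OF rot_curve_measurable trig_measurable] assms)
       (auto simp: rot_in_space assms)
qed

text \<open>
  Both directions of time are included, and the limit is required at every point of the torus.
\<close>

definition orbit_mean :: "((nat \<Rightarrow> complex) \<Rightarrow> complex) \<Rightarrow> bool" where
  "orbit_mean f \<longleftrightarrow> (\<forall>\<xi>\<in>space torus_measure. \<forall>d\<in>{-1, 1::real}.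
     ((\<lambda>R. (LINT t:{0..R}|lborel. f (rot (d * t) \<xi>)) / of_real R) \<longlongrightarrow> (\<integral>\<xi>. f \<xi> \<partial>torus_measure)) at_top)"

lemma const_average: "((\<lambda>R. (LINT t:{0..R}|lborel. c) / of_real R) \<longlongrightarrow> (c::complex)) at_top"
proof (rule Lim_transform_eventually[OF tendsto_const])
  show "eventually (\<lambda>R. c = (LINT t:{0..R}|lborel. c) / of_real R) at_top"
    using eventually_gt_at_top[of 0]
    by eventually_elim (simp add: set_lebesgue_integral_def scaleR_conv_of_real)
qed

text \<open>
  For \<open>m \<noteq> n\<close> the character has a frequency \<open>w \<noteq> 0\<close>; the rotation by time \<open>\<pi> / w\<close> preserves the integral
  and multiplies it by \<open>-1\<close>.
\<close>

lemma char_orthogonality: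
  assumes "m > 0" "n > 0"
  shows "(\<integral>\<xi>. cmult_ext \<xi> m * cnj (cmult_ext \<xi> n) \<partial>torus_measure) = (if m = n then 1 else 0)"
proof (cases "m = n")
  case True
  have "(\<integral>\<xi>. cmult_ext \<xi> m * cnj (cmult_ext \<xi> n) \<partial>torus_measure) = (\<integral>\<xi>. 1 \<partial>torus_measure)"
    using True norm_cmult_ext by (intro Bochner_Integration.integral_cong) (auto simp: complex_norm_square[symmetric])
  then show ?thesis using True by (simp add: TM.prob_space)
next
  case False
  define w where "w = ln (real n) - ln (real m)"
  have w: "w \<noteq> 0" using False assms by (simp add: w_def)
  let ?f = "\<lambda>\<xi>. cmult_ext \<xi> m * cnj (cmult_ext \<xi> n)"
  have rotf: "?f (rot t \<xi>) = ?f \<xi> * cis (w * t)" for t \<xi>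
    using assms by (simp add: cmult_ext_rot w_def cis_cnj cis_mult algebra_simps)
  have "(\<integral>\<xi>. ?f \<xi> \<partial>torus_measure) = (\<integral>\<xi>. ?f (rot (pi / w) \<xi>) \<partial>torus_measure)"
    by (rule integral_rot[symmetric]) measurable
  also have "\<dots> = - (\<integral>\<xi>. ?f \<xi> \<partial>torus_measure)" unfolding rotf using w by simp
  finally show ?thesis using False by simp
qed

lemma trig_orbit_mean: "trig_poly f \<Longrightarrow> orbit_mean f"
proof (induction f rule: trig_poly.induct)
  case (trig_char m n c)
  let ?f = "\<lambda>\<xi>. c * (cmult_ext \<xi> m * cnj (cmult_ext \<xi> n))"
  show ?case
  proof (cases "m = n")
    case True
    have 1: "?f \<xi> = c" if "\<xi> \<in> space torus_measure" for \<xi>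
      using norm_cmult_ext[OF that, of n] True by (simp add: complex_norm_square[symmetric])
    have "(\<integral>\<xi>. ?f \<xi> \<partial>torus_measure) = (\<integral>\<xi>. c \<partial>torus_measure)"
      by (intro Bochner_Integration.integral_cong 1 refl)
    then have E: "(\<integral>\<xi>. ?f \<xi> \<partial>torus_measure) = c" by (simp add: TM.prob_space)
    show ?thesis unfolding orbit_mean_def E
    proof (intro ballI)
      fix \<xi> and d :: real assume "\<xi> \<in> space torus_measure"
      then show "((\<lambda>R. (LINT t:{0..R}|lborel. ?f (rot (d * t) \<xi>)) / of_real R) \<longlongrightarrow> c) at_top"
        using const_average[of c] by (simp only: 1[OF rot_in_space])
    qed
  next
    case False
    define w where "w = ln (real n) - ln (real m)"
    have w: "w \<noteq> 0" using False trig_char by (simp add: w_def)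
    have rotf: "?f (rot t \<xi>) = ?f \<xi> * cis (w * t)" for t \<xi>
      using trig_char by (simp add: cmult_ext_rot w_def cis_cnj cis_mult algebra_simps)
    have z: "(\<integral>\<xi>. ?f \<xi> \<partial>torus_measure) = 0"
      using trig_char False by (simp add: char_orthogonality)
    show ?thesis unfolding orbit_mean_def z
    proof (intro ballI)
      fix \<xi> d assume "\<xi> \<in> space torus_measure" and d: "d \<in> {- 1, 1::real}"
      have "((\<lambda>R. ?f \<xi> * ((LINT t:{0..R}|lborel. cis ((w * d) * t)) / of_real R)) \<longlongrightarrow> ?f \<xi> * 0) at_top"
        using w d by (intro tendsto_mult tendsto_const integral_cis_average) auto
      then show "((\<lambda>R. (LINT t:{0..R}|lborel. ?f (rot (d * t) \<xi>)) / of_real R) \<longlongrightarrow> 0) at_top"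
        unfolding rotf by (simp add: mult.assoc)
    qed
  qed
next
  case (trig_add f g)
  show ?case unfolding orbit_mean_def
  proof (intro ballI)
    fix \<xi> d assume x: "\<xi> \<in> space torus_measure" and d: "d \<in> {- 1, 1::real}"
    have "((\<lambda>R. (LINT t:{0..R}|lborel. f (rot (d * t) \<xi>)) / of_real R + (LINT t:{0..R}|lborel. g (rot (d * t) \<xi>)) / of_real R)
       \<longlongrightarrow> (\<integral>\<xi>. f \<xi> \<partial>torus_measure) + (\<integral>\<xi>. g \<xi> \<partial>torus_measure)) at_top"
      using trig_add x d by (intro tendsto_add) (auto simp: orbit_mean_def)
    then show "((\<lambda>R. (LINT t:{0..R}|lborel. f (rot (d * t) \<xi>) + g (rot (d * t) \<xi>)) / of_real R)
       \<longlongrightarrow> (\<integral>\<xi>. f \<xi> + g \<xi> \<partial>torus_measure)) at_top"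
      using trig_add x
      by (simp add: trig_integrable set_integral_add(2) trig_orbit_integrable add_divide_distrib)
  qed
qed

text \<open>
  Uniform limits of trigonometric polynomials.  They include the \<open>p\<close>-th powers of the moduli of
  twisted Dirichlet polynomials, and orbit means still exist at every point.
\<close>

definition uniform_trig :: "((nat \<Rightarrow> complex) \<Rightarrow> complex) \<Rightarrow> bool" where
  "uniform_trig h \<longleftrightarrow> (\<forall>\<epsilon>>0. \<exists>q. trig_poly q \<and> (\<forall>\<xi>\<in>space torus_measure. norm (h \<xi> - q \<xi>) < \<epsilon>))"

lemma uniform_trig_bounded: "uniform_trig h \<Longrightarrow> \<exists>C>0. \<forall>\<xi>\<in>space torus_measure. norm (h \<xi>) \<le> C"
proof -
  assume "uniform_trig h"
  then obtain q where q: "trig_poly q" "\<And>\<xi>. \<xi> \<in> space torus_measure \<Longrightarrow> norm (h \<xi> - q \<xi>) < 1"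
    unfolding uniform_trig_def by (meson zero_less_one)
  obtain C where C: "\<And>\<xi>. \<xi> \<in> space torus_measure \<Longrightarrow> norm (q \<xi>) \<le> C" using trig_bounded[OF q(1)] by auto
  have "norm (h \<xi>) \<le> \<bar>C\<bar> + 1" if "\<xi> \<in> space torus_measure" for \<xi>
    using q(2)[OF that] C[OF that] norm_triangle_sub[of "h \<xi>" "q \<xi>"] by linarith
  then show ?thesis by (intro exI[of _ "\<bar>C\<bar> + 1"]) auto
qed

lemma uniform_trig_mult:
  assumes "uniform_trig f" "uniform_trig g"
  shows "uniform_trig (\<lambda>\<xi>. f \<xi> * g \<xi>)"
  unfolding uniform_trig_def
proof (intro allI impI)
  fix \<epsilon> :: real assume e: "\<epsilon> > 0"
  obtain C where C: "C > 0" "\<And>\<xi>. \<xi> \<in> space torus_measure \<Longrightarrow> norm (g \<xi>) \<le> C"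
    using uniform_trig_bounded[OF assms(2)] by auto
  obtain p where p: "trig_poly p" "\<And>\<xi>. \<xi> \<in> space torus_measure \<Longrightarrow> norm (f \<xi> - p \<xi>) < \<epsilon> / 2 / C"
    using assms(1) e C unfolding uniform_trig_def by (meson divide_pos_pos zero_less_numeral)
  obtain D' where D': "\<And>\<xi>. \<xi> \<in> space torus_measure \<Longrightarrow> norm (p \<xi>) \<le> D'"
    using trig_bounded[OF p(1)] by blast
  define D where "D = \<bar>D'\<bar> + 1"
  have D: "D > 0" "\<And>\<xi>. \<xi> \<in> space torus_measure \<Longrightarrow> norm (p \<xi>) \<le> D"
    using D' by (force simp: D_def)+
  obtain q where q: "trig_poly q" "\<And>\<xi>. \<xi> \<in> space torus_measure \<Longrightarrow> norm (g \<xi> - q \<xi>) < \<epsilon> / 2 / D"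
    using assms(2) e D unfolding uniform_trig_def by (meson divide_pos_pos zero_less_numeral)
  have "norm (f \<xi> * g \<xi> - p \<xi> * q \<xi>) < \<epsilon>" if x: "\<xi> \<in> space torus_measure" for \<xi>
  proof -
    have "norm (f \<xi> * g \<xi> - p \<xi> * q \<xi>) = norm ((f \<xi> - p \<xi>) * g \<xi> + p \<xi> * (g \<xi> - q \<xi>))"
      by (simp add: algebra_simps)
    also have "\<dots> \<le> norm (f \<xi> - p \<xi>) * norm (g \<xi>) + norm (p \<xi>) * norm (g \<xi> - q \<xi>)"
      by (rule norm_triangle_le) (simp add: norm_mult)
    also have "\<dots> \<le> norm (f \<xi> - p \<xi>) * C + D * norm (g \<xi> - q \<xi>)"
      by (intro add_mono mult_left_mono mult_right_mono C D x) auto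
    also have "\<dots> < (\<epsilon> / 2 / C) * C + D * (\<epsilon> / 2 / D)"
      by (intro add_strict_mono mult_strict_right_mono mult_strict_left_mono p q C D x)
    also have "\<dots> = \<epsilon>" using C D by simp
    finally show ?thesis .
  qed
  then show "\<exists>q. trig_poly q \<and> (\<forall>\<xi>\<in>space torus_measure. norm (f \<xi> * g \<xi> - q \<xi>) < \<epsilon>)"
    using trig_mult[OF p(1) q(1)] by blast
qed

lemma trig_imp_uniform: "trig_poly f \<Longrightarrow> uniform_trig f"
  unfolding uniform_trig_def by force

lemma uniform_trig_prod:
  "finite J \<Longrightarrow> (\<And>j. j \<in> J \<Longrightarrow> uniform_trig (f j)) \<Longrightarrow> uniform_trig (\<lambda>\<xi>. \<Prod>j\<in>J. f j \<xi>)"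
  by (induction J rule: finite_induct) (auto intro: uniform_trig_mult trig_imp_uniform trig_const)

lemma trig_real_polynomial:
  fixes g :: "complex \<Rightarrow> real"
  assumes "real_polynomial_function g" "trig_poly f"
  shows "trig_poly (\<lambda>\<xi>. of_real (g (f \<xi>)))"
  using assms(1)
proof (induction g rule: real_polynomial_function.induct)
  case (linear g)
  interpret g: bounded_linear g by fact
  have "g z = Re z * g 1 + Im z * g \<i>" for z
    using g.add[of "Re z *\<^sub>R 1" "Im z *\<^sub>R \<i>"] g.scaleR[of "Re z" 1] g.scaleR[of "Im z" \<i>]
    by (simp add: scaleR_conv_of_real complex_eq[symmetric] mult.commute)
  moreover have "of_real (Re z) = (1/2) * (z + cnj z)" "of_real (Im z) = (- \<i> / 2) * (z + (-1) * cnj z)" for z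
    by (auto simp: complex_eq_iff)
  ultimately have eq: "(\<lambda>\<xi>. of_real (g (f \<xi>))) = (\<lambda>\<xi>. ((1/2) * (f \<xi> + cnj (f \<xi>))) * of_real (g 1) +
      ((- \<i> / 2) * (f \<xi> + (-1) * cnj (f \<xi>))) * of_real (g \<i>))"
    by (metis of_real_add of_real_mult)
  show ?case unfolding eq
    by (intro trig_add trig_mult trig_const trig_cnj assms(2))
next
  case (const c)
  show ?case by (rule trig_const)
qed (auto intro: trig_add trig_mult)

text \<open>
  The values of \<open>f\<close> stay in a compact disc, on which \<open>g\<close> is a uniform limit of real polynomials by the
  Stone--Weierstrass theorem; a polynomial in a trigonometric polynomial and its conjugate is again one.
\<close>

lemma uniform_trig_continuous:
  fixes g :: "complex \<Rightarrow> real"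
  assumes g: "continuous_on UNIV g" and f: "trig_poly f"
  shows "uniform_trig (\<lambda>\<xi>. of_real (g (f \<xi>)))"
  unfolding uniform_trig_def
proof (intro allI impI)
  fix \<epsilon> :: real assume e: "\<epsilon> > 0"
  obtain C where C: "\<And>\<xi>. \<xi> \<in> space torus_measure \<Longrightarrow> norm (f \<xi>) \<le> C" using trig_bounded[OF f] by auto
  obtain h where h: "real_polynomial_function h" "\<And>z. z \<in> cball 0 C \<Longrightarrow> \<bar>g z - h z\<bar> < \<epsilon>"
    using Stone_Weierstrass_real_polynomial_function[OF compact_cball continuous_on_subset[OF g subset_UNIV] e] by blast
  have "norm (of_real (g (f \<xi>)) - of_real (h (f \<xi>)) :: complex) < \<epsilon>" if "\<xi> \<in> space torus_measure" for \<xi>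
    using h(2)[of "f \<xi>"] C[OF that] by (simp flip: of_real_diff)
  then show "\<exists>q. trig_poly q \<and> (\<forall>\<xi>\<in>space torus_measure. norm (of_real (g (f \<xi>)) - q \<xi>) < \<epsilon>)"
    using trig_real_polynomial[OF h(1) f] by blast
qed

text \<open>
  Replacing \<open>h\<close> by a trigonometric polynomial within \<open>\<epsilon>\<close> changes all orbit averages and the integral by at
  most \<open>\<epsilon>\<close>.
\<close>

lemma uniform_trig_orbit_mean:
  assumes h: "uniform_trig h" and m[measurable]: "h \<in> borel_measurable torus_measure"
  shows "orbit_mean h"
  unfolding orbit_mean_def
proof (intro ballI tendstoI)
  fix \<xi> d and \<epsilon> :: real assume x: "\<xi> \<in> space torus_measure" and d: "d \<in> {- 1, 1::real}" and e: "\<epsilon> > 0"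
  obtain q where q: "trig_poly q" "\<And>\<xi>. \<xi> \<in> space torus_measure \<Longrightarrow> norm (h \<xi> - q \<xi>) < \<epsilon>/4"
    using h e unfolding uniform_trig_def by (meson divide_pos_pos zero_less_numeral)
  obtain C where C: "\<And>\<xi>. \<xi> \<in> space torus_measure \<Longrightarrow> norm (h \<xi>) \<le> C"
    using uniform_trig_bounded[OF h] by auto
  have ih: "integrable torus_measure h"
    by (intro TM.integrable_const_bound[of _ C]) (use C in auto)
  have E: "norm ((\<integral>\<xi>. h \<xi> \<partial>torus_measure) - (\<integral>\<xi>. q \<xi> \<partial>torus_measure)) \<le> \<epsilon>/4"
  proof -
    have "norm ((\<integral>\<xi>. h \<xi> \<partial>torus_measure) - (\<integral>\<xi>. q \<xi> \<partial>torus_measure)) = norm (\<integral>\<xi>. h \<xi> - q \<xi> \<partial>torus_measure)"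
      using ih trig_integrable[OF q(1)] by simp
    also have "\<dots> \<le> (\<integral>\<xi>. norm (h \<xi> - q \<xi>) \<partial>torus_measure)" by (rule integral_norm_bound)
    also have "\<dots> \<le> (\<integral>\<xi>. \<epsilon>/4 \<partial>torus_measure)"
      using ih trig_integrable[OF q(1)] q(2) by (intro integral_mono) (auto intro: less_imp_le)
    finally show ?thesis by (simp add: TM.prob_space)
  qed
  have "eventually (\<lambda>R. dist ((LINT t:{0..R}|lborel. q (rot (d * t) \<xi>)) / of_real R) (\<integral>\<xi>. q \<xi> \<partial>torus_measure) < \<epsilon>/4) at_top"
    using trig_orbit_mean[OF q(1)] x d e unfolding orbit_mean_def by (intro tendstoD) auto
  then show "eventually (\<lambda>R. dist ((LINT t:{0..R}|lborel. h (rot (d * t) \<xi>)) / of_real R) (\<integral>\<xi>. h \<xi> \<partial>torus_measure) < \<epsilon>) at_top"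
    using eventually_gt_at_top[of 0]
  proof eventually_elim
    case (elim R)
    have i1: "set_integrable lborel {0..R} (\<lambda>t. h (rot (d * t) \<xi>))"
      by (intro set_integrable_bounded_Icc[where C = C] measurable_compose[OF rot_curve_measurable m] x C rot_in_space)
    note i2 = trig_orbit_integrable[OF q(1) x, of 0 R d]
    have "norm ((LINT t:{0..R}|lborel. h (rot (d * t) \<xi>)) - (LINT t:{0..R}|lborel. q (rot (d * t) \<xi>)))
       = norm (LINT t:{0..R}|lborel. h (rot (d * t) \<xi>) - q (rot (d * t) \<xi>))"
      using i1 i2 by (simp add: set_integral_diff(2))
    also have "\<dots> \<le> (LINT t:{0..R}|lborel. norm (h (rot (d * t) \<xi>) - q (rot (d * t) \<xi>)))"
      by (rule set_integral_norm_bound[OF set_integral_diff(1)[OF i1 i2]])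
    also have "\<dots> \<le> (LINT t:{0..R}|lborel. \<epsilon>/4)"
      using set_integrable_norm[OF set_integral_diff(1)[OF i1 i2]] q(2) x
      by (intro set_integral_mono) (auto intro!: less_imp_le rot_in_space borel_integrable_atLeastAtMost' continuous_intros)
    also have "\<dots> = \<epsilon>/4 * R" using elim by (simp add: set_lebesgue_integral_def)
    finally have "norm ((LINT t:{0..R}|lborel. h (rot (d * t) \<xi>)) / of_real R - (LINT t:{0..R}|lborel. q (rot (d * t) \<xi>)) / of_real R) \<le> \<epsilon>/4"
      using elim by (simp add: norm_divide divide_le_eq flip: diff_divide_distrib)
    then have "dist ((LINT t:{0..R}|lborel. h (rot (d * t) \<xi>)) / of_real R) ((LINT t:{0..R}|lborel. q (rot (d * t) \<xi>)) / of_real R) \<le> \<epsilon>/4"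
      by (simp add: dist_norm)
    moreover have "dist (\<integral>\<xi>. q \<xi> \<partial>torus_measure) (\<integral>\<xi>. h \<xi> \<partial>torus_measure) \<le> \<epsilon>/4"
      using E by (simp add: dist_norm norm_minus_commute)
    ultimately show ?case using elim e
      dist_triangle[of "(LINT t:{0..R}|lborel. h (rot (d * t) \<xi>)) / of_real R" "\<integral>\<xi>. h \<xi> \<partial>torus_measure" "(LINT t:{0..R}|lborel. q (rot (d * t) \<xi>)) / of_real R"]
      dist_triangle[of "(LINT t:{0..R}|lborel. q (rot (d * t) \<xi>)) / of_real R" "\<integral>\<xi>. h \<xi> \<partial>torus_measure" "\<integral>\<xi>. q \<xi> \<partial>torus_measure"]
      by linarith
  qed
qed

section \<open>Density of trigonometric polynomials in \<open>L\<^sup>1\<close>\<close>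

definition L1_trig :: "((nat \<Rightarrow> complex) \<Rightarrow> real) \<Rightarrow> bool" where
  "L1_trig h \<longleftrightarrow> integrable torus_measure h \<and>
     (\<forall>\<epsilon>>0. \<exists>q. trig_poly q \<and> (\<integral>\<xi>. norm (of_real (h \<xi>) - q \<xi>) \<partial>torus_measure) < \<epsilon>)"

lemma uniform_imp_L1_trig:
  assumes h: "uniform_trig (\<lambda>\<xi>. of_real (h \<xi>))" and m[measurable]: "h \<in> borel_measurable torus_measure"
  shows "L1_trig h"
proof -
  obtain C where C: "\<And>\<xi>. \<xi> \<in> space torus_measure \<Longrightarrow> \<bar>h \<xi>\<bar> \<le> C"
    using uniform_trig_bounded[OF h] by auto
  have ih: "integrable torus_measure h"
    by (intro TM.integrable_const_bound[of _ C]) (use C in auto)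
  have "\<exists>q. trig_poly q \<and> (\<integral>\<xi>. norm (of_real (h \<xi>) - q \<xi>) \<partial>torus_measure) < \<epsilon>" if e: "\<epsilon> > 0" for \<epsilon>
  proof -
    obtain q where q: "trig_poly q" "\<And>\<xi>. \<xi> \<in> space torus_measure \<Longrightarrow> norm (of_real (h \<xi>) - q \<xi>) < \<epsilon>/2"
      using h e unfolding uniform_trig_def by (meson divide_pos_pos zero_less_numeral)
    have "(\<integral>\<xi>. norm (of_real (h \<xi>) - q \<xi>) \<partial>torus_measure) \<le> (\<integral>\<xi>. \<epsilon>/2 \<partial>torus_measure)"
      using ih trig_integrable[OF q(1)] q(2) by (intro integral_mono) (auto intro: less_imp_le)
    then show ?thesis using q(1) e by (auto simp: TM.prob_space)
  qed
  then show ?thesis using ih by (simp add: L1_trig_def)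
qed

lemma L1_trig_add:
  assumes "L1_trig f" "L1_trig g"
  shows "L1_trig (\<lambda>\<xi>. f \<xi> + g \<xi>)"
proof -
  have i: "integrable torus_measure f" "integrable torus_measure g" using assms by (auto simp: L1_trig_def)
  have "\<exists>q. trig_poly q \<and> (\<integral>\<xi>. norm (of_real (f \<xi> + g \<xi>) - q \<xi>) \<partial>torus_measure) < \<epsilon>" if e: "\<epsilon> > 0" for \<epsilon>
  proof -
    obtain p q where p: "trig_poly p" "(\<integral>\<xi>. norm (of_real (f \<xi>) - p \<xi>) \<partial>torus_measure) < \<epsilon>/2"
      and q: "trig_poly q" "(\<integral>\<xi>. norm (of_real (g \<xi>) - q \<xi>) \<partial>torus_measure) < \<epsilon>/2"
      using assms e unfolding L1_trig_def by (meson half_gt_zero)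
    note j = i trig_integrable[OF p(1)] trig_integrable[OF q(1)]
    have "(\<integral>\<xi>. norm (of_real (f \<xi> + g \<xi>) - (p \<xi> + q \<xi>)) \<partial>torus_measure)
       \<le> (\<integral>\<xi>. norm (of_real (f \<xi>) - p \<xi>) + norm (of_real (g \<xi>) - q \<xi>) \<partial>torus_measure)"
      using j by (intro integral_mono) (auto intro!: norm_triangle_mono[of "_ - _" _ "_ - _", OF order_refl order_refl, THEN order_trans[rotated]] simp: norm_diff_triangle_ineq)
    also have "\<dots> < \<epsilon>" using j p(2) q(2) by simp
    finally show ?thesis using trig_add[OF p(1) q(1)] by blast
  qed
  then show ?thesis using i by (simp add: L1_trig_def)
qed

lemma L1_trig_cmult:
  assumes f: "L1_trig f"
  shows "L1_trig (\<lambda>\<xi>. c * f \<xi>)"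
proof (cases "c = 0")
  case True
  have "L1_trig (\<lambda>_. 0)" by (rule uniform_imp_L1_trig) (auto intro!: trig_imp_uniform trig_const)
  then show ?thesis using True by simp
next
  case False
  have i: "integrable torus_measure f" using assms by (auto simp: L1_trig_def)
  have "\<exists>q. trig_poly q \<and> (\<integral>\<xi>. norm (of_real (c * f \<xi>) - q \<xi>) \<partial>torus_measure) < \<epsilon>" if e: "\<epsilon> > 0" for \<epsilon>
  proof -
    obtain p where p: "trig_poly p" "(\<integral>\<xi>. norm (of_real (f \<xi>) - p \<xi>) \<partial>torus_measure) < \<epsilon> / \<bar>c\<bar>"
      using assms e False unfolding L1_trig_def by (meson divide_pos_pos zero_less_abs_iff)
    have "(\<integral>\<xi>. norm (of_real (c * f \<xi>) - of_real c * p \<xi>) \<partial>torus_measure) = \<bar>c\<bar> * (\<integral>\<xi>. norm (of_real (f \<xi>) - p \<xi>) \<partial>torus_measure)"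
      by (simp add: norm_mult flip: right_diff_distrib)
    then show ?thesis using p False trig_mult[OF trig_const[of "of_real c"] p(1)]
      by (intro exI[of _ "\<lambda>\<xi>. of_real c * p \<xi>"]) (simp add: pos_less_divide_eq mult.commute)
  qed
  then show ?thesis using i by (simp add: L1_trig_def)
qed

lemma L1_trig_dominated_limit:
  assumes h: "\<And>n. L1_trig (h n)" and w: "integrable torus_measure w"
    and g: "g \<in> borel_measurable torus_measure"
    and lim: "\<And>\<xi>. \<xi> \<in> space torus_measure \<Longrightarrow> (\<lambda>n. h n \<xi>) \<longlonglongrightarrow> g \<xi>"
    and bd: "\<And>n \<xi>. \<xi> \<in> space torus_measure \<Longrightarrow> \<bar>h n \<xi>\<bar> \<le> w \<xi>"
  shows "L1_trig g"
proof -
  have ih: "integrable torus_measure (h n)" for n using h by (auto simp: L1_trig_def)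
  have ig: "integrable torus_measure g"
    by (rule integrable_dominated_convergence[where s = h, OF g borel_measurable_integrable[OF ih] w])
       (use lim bd in auto)
  have "(\<lambda>n. \<integral>\<xi>. \<bar>g \<xi> - h n \<xi>\<bar> \<partial>torus_measure) \<longlonglongrightarrow> (\<integral>\<xi>. 0 \<partial>torus_measure)"
  proof (rule integral_dominated_convergence[where w = "\<lambda>\<xi>. \<bar>g \<xi>\<bar> + w \<xi>"])
    show "AE \<xi> in torus_measure. (\<lambda>n. \<bar>g \<xi> - h n \<xi>\<bar>) \<longlonglongrightarrow> 0"
    proof (rule AE_I2)
      fix \<xi> assume x: "\<xi> \<in> space torus_measure"
      show "(\<lambda>n. \<bar>g \<xi> - h n \<xi>\<bar>) \<longlonglongrightarrow> 0"
        using tendsto_rabs[OF tendsto_diff[OF tendsto_const[of "g \<xi>"] lim[OF x]]] by simp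
    qed
    show "AE \<xi> in torus_measure. norm \<bar>g \<xi> - h n \<xi>\<bar> \<le> \<bar>g \<xi>\<bar> + w \<xi>" for n
    proof (rule AE_I2)
      fix \<xi> assume x: "\<xi> \<in> space torus_measure"
      show "norm \<bar>g \<xi> - h n \<xi>\<bar> \<le> \<bar>g \<xi>\<bar> + w \<xi>" using bd[OF x, of n] by simp
    qed
  qed (use ig ih w in auto)
  then have l0: "(\<lambda>n. \<integral>\<xi>. \<bar>g \<xi> - h n \<xi>\<bar> \<partial>torus_measure) \<longlonglongrightarrow> 0" by simp
  have "\<exists>q. trig_poly q \<and> (\<integral>\<xi>. norm (of_real (g \<xi>) - q \<xi>) \<partial>torus_measure) < \<epsilon>" if e: "\<epsilon> > 0" for \<epsilon>
  proof -
    have "eventually (\<lambda>n. (\<integral>\<xi>. \<bar>g \<xi> - h n \<xi>\<bar> \<partial>torus_measure) < \<epsilon>/2) sequentially"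
      using e by (intro order_tendstoD(2)[OF l0]) auto
    then obtain n where n: "(\<integral>\<xi>. \<bar>g \<xi> - h n \<xi>\<bar> \<partial>torus_measure) < \<epsilon>/2" by (auto simp: eventually_sequentially)
    obtain q where q: "trig_poly q" "(\<integral>\<xi>. norm (of_real (h n \<xi>) - q \<xi>) \<partial>torus_measure) < \<epsilon>/2"
      using h[of n] e unfolding L1_trig_def by (meson half_gt_zero)
    note j = ig ih[of n] trig_integrable[OF q(1)]
    have "(\<integral>\<xi>. norm (of_real (g \<xi>) - q \<xi>) \<partial>torus_measure)
       \<le> (\<integral>\<xi>. \<bar>g \<xi> - h n \<xi>\<bar> + norm (of_real (h n \<xi>) - q \<xi>) \<partial>torus_measure)"
    proof (rule integral_mono)
      fix \<xi>
      have "norm (of_real (g \<xi>) - q \<xi>) = norm (of_real (g \<xi> - h n \<xi>) + (of_real (h n \<xi>) - q \<xi>))" by simp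
      also have "\<dots> \<le> \<bar>g \<xi> - h n \<xi>\<bar> + norm (of_real (h n \<xi>) - q \<xi>)"
        by (rule norm_triangle_le) (simp del: of_real_diff)
      finally show "norm (of_real (g \<xi>) - q \<xi>) \<le> \<bar>g \<xi> - h n \<xi>\<bar> + norm (of_real (h n \<xi>) - q \<xi>)" .
    qed (use j in auto)
    also have "\<dots> < \<epsilon>" using j n q(2) by simp
    finally show ?thesis using q(1) by blast
  qed
  then show ?thesis using ig by (simp add: L1_trig_def)
qed

lemma closed_indicator_limit:
  fixes C :: "complex set"
  assumes "closed C"
  shows "\<exists>g :: nat \<Rightarrow> complex \<Rightarrow> real. (\<forall>n. continuous_on UNIV (g n)) \<and> (\<forall>n z. 0 \<le> g n z \<and> g n z \<le> 1) \<and>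
     (\<forall>z. (\<lambda>n. g n z) \<longlonglongrightarrow> indicator C z)"
proof (cases "C = {}")
  case True
  then show ?thesis by (intro exI[of _ "\<lambda>_ _. 0"]) auto
next
  case False
  let ?g = "\<lambda>n z. max 0 (1 - real n * infdist z C)"
  have "(\<lambda>n. ?g n z) \<longlonglongrightarrow> indicator C z" for z
  proof (cases "z \<in> C")
    case False
    then have d: "infdist z C > 0"
      using in_closed_iff_infdist_zero[OF assms \<open>C \<noteq> {}\<close>, of z] infdist_nonneg[of z C] by linarith
    obtain N where N: "1 < real N * infdist z C" using reals_Archimedean3[OF d] by blast
    have "eventually (\<lambda>n. ?g n z = 0) sequentially"
      using eventually_ge_at_top[of N]
    proof eventually_elim
      case (elim n)
      then have "real N * infdist z C \<le> real n * infdist z C" using d by (intro mult_right_mono) auto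
      then show ?case using N by simp
    qed
    then show ?thesis using False by (simp add: tendsto_eventually)
  qed (use assms in simp)
  moreover have "continuous_on UNIV (?g n)" for n by (intro continuous_intros)
  moreover have "0 \<le> ?g n z \<and> ?g n z \<le> 1" for n z by (simp add: infdist_nonneg)
  ultimately show ?thesis by (intro exI[of _ ?g]) blast
qed

text \<open>
  An intersection-stable generator of the sigma-algebra.  Closed sets are convenient because their
  indicators are pointwise limits of continuous functions.
\<close>

definition closed_cylinders :: "(nat \<Rightarrow> complex) set set" where
  "closed_cylinders = {E. \<exists>J C. finite J \<and> J \<subseteq> {q. prime q} \<and> (\<forall>q\<in>J. closed (C q)) \<and>
     E = {\<xi>\<in>space torus_measure. \<forall>q\<in>J. \<xi> q \<in> C q}}"

text \<open>
  The indicator is a bounded pointwise limit of finite products of continuous functions of single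
  coordinates, and coordinates are characters.
\<close>

lemma closed_cylinder_L1_trig:
  assumes "E \<in> closed_cylinders"
  shows "L1_trig (indicator E)" "E \<in> sets torus_measure"
proof -
  obtain J C where J: "finite J" "J \<subseteq> {q. prime q}" "\<And>q. q \<in> J \<Longrightarrow> closed (C q)"
    "E = {\<xi>\<in>space torus_measure. \<forall>q\<in>J. \<xi> q \<in> C q}"
    using assms by (auto simp: closed_cylinders_def)
  have "\<forall>q\<in>J. \<exists>g :: nat \<Rightarrow> complex \<Rightarrow> real. (\<forall>n. continuous_on UNIV (g n)) \<and> (\<forall>n z. 0 \<le> g n z \<and> g n z \<le> 1) \<and>
     (\<forall>z. (\<lambda>n. g n z) \<longlonglongrightarrow> indicator (C q) z)"
    using closed_indicator_limit J by blast
  from bchoice[OF this] obtain g where g: "\<And>q n. q \<in> J \<Longrightarrow> continuous_on UNIV (g q n :: complex \<Rightarrow> real)"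
     "\<And>q n z. q \<in> J \<Longrightarrow> 0 \<le> g q n z" "\<And>q n z. q \<in> J \<Longrightarrow> g q n z \<le> 1"
     "\<And>q z. q \<in> J \<Longrightarrow> (\<lambda>n. g q n z) \<longlonglongrightarrow> indicator (C q) z" by blast
  have coord: "(\<lambda>\<xi>. \<xi> q) \<in> borel_measurable torus_measure" if "q \<in> J" for q
    using that J by (intro torus_coord_measurable) auto
  show E: "E \<in> sets torus_measure"
  proof -
    have "{\<xi>\<in>space torus_measure. \<xi> q \<in> C q} \<in> sets torus_measure" if "q \<in> J" for q
    proof -
      have "(\<lambda>\<xi>. \<xi> q) -` C q \<inter> space torus_measure \<in> sets torus_measure"
        by (rule measurable_sets[OF coord[OF that]]) (use J(3)[OF that] in auto)
      then show ?thesis by (simp add: vimage_def Int_def conj_commute)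
    qed
    then show ?thesis unfolding J(4) by (rule sets.sets_Collect_finite_All[OF _ J(1)]) 
  qed
  show "L1_trig (indicator E)"
  proof (rule L1_trig_dominated_limit[where h = "\<lambda>n \<xi>. \<Prod>q\<in>J. g q n (\<xi> q)" and w = "\<lambda>_. 1"])
    fix n
    show "L1_trig (\<lambda>\<xi>. \<Prod>q\<in>J. g q n (\<xi> q))"
    proof (rule uniform_imp_L1_trig)
      have "trig_poly (\<lambda>\<xi>. \<xi> q)" if "q \<in> J" for q
        using trig_ext[of q] that J(2) by (auto simp: cmult_ext_prime prime_gt_0_nat subset_iff)
      then show "uniform_trig (\<lambda>\<xi>. of_real (\<Prod>q\<in>J. g q n (\<xi> q)))"
        unfolding of_real_prod by (intro uniform_trig_prod J uniform_trig_continuous g)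
      show "(\<lambda>\<xi>. \<Prod>q\<in>J. g q n (\<xi> q)) \<in> borel_measurable torus_measure"
        by (intro borel_measurable_prod measurable_compose[OF coord borel_measurable_continuous_onI] g)
    qed
  next
    fix \<xi> assume x: "\<xi> \<in> space torus_measure"
    have "(\<lambda>n. \<Prod>q\<in>J. g q n (\<xi> q)) \<longlonglongrightarrow> (\<Prod>q\<in>J. indicator (C q) (\<xi> q))"
      by (intro tendsto_prod g)
    also have "(\<Prod>q\<in>J. indicator (C q) (\<xi> q)) = (indicator E \<xi> :: real)"
      using x J(1) by (auto simp: J(4) indicator_def prod_zero_iff)
    finally show "(\<lambda>n. \<Prod>q\<in>J. g q n (\<xi> q)) \<longlonglongrightarrow> indicator E \<xi>" .
    show "\<bar>\<Prod>q\<in>J. g q n (\<xi> q)\<bar> \<le> 1" for n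
      using g by (auto simp: abs_prod intro!: prod_le_1)
  qed (use E in \<open>auto simp: TM.emeasure_space_1\<close>)
qed

lemma sets_torus_closed_cylinders: "sets torus_measure = sigma_sets (space torus_measure) closed_cylinders"
proof
  let ?N = "sigma (space torus_measure) closed_cylinders"
  have sub: "closed_cylinders \<subseteq> Pow (space torus_measure)" by (auto simp: closed_cylinders_def)
  have sN: "sets ?N = sigma_sets (space torus_measure) closed_cylinders" using sub by (rule sets_measure_of)
  have spN: "space ?N = space torus_measure" using sub by (rule space_measure_of)
  have "(\<lambda>\<xi>. \<lambda>q\<in>{q. prime q}. \<xi> q) \<in> ?N \<rightarrow>\<^sub>M torus_measure"
    unfolding torus_measure_def
  proof (rule measurable_restrict)
    fix q :: nat assume "q \<in> {q. prime q}"
    then have q: "prime q" by simp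
    have "(\<lambda>\<xi>. \<xi> q) \<in> borel_measurable ?N"
    proof (rule borel_measurableI)
      fix S :: "complex set" assume S: "open S"
      have "(\<lambda>\<xi>. \<xi> q) -` S \<inter> space ?N = space ?N - {\<xi>\<in>space torus_measure. \<forall>q'\<in>{q}. \<xi> q' \<in> - S}"
        by (auto simp: spN)
      moreover have "{\<xi>\<in>space torus_measure. \<forall>q'\<in>{q}. \<xi> q' \<in> - S} \<in> closed_cylinders"
        unfolding closed_cylinders_def using q S
        by (intro CollectI exI[of _ "{q}"] exI[of _ "\<lambda>_. - S"]) auto
      ultimately show "(\<lambda>\<xi>. \<xi> q) -` S \<inter> space ?N \<in> sets ?N"
        by (auto simp: sN intro!: sets.compl_sets[of _ ?N, unfolded sN])
    qed
    then show "(\<lambda>\<xi>. \<xi> q) \<in> sigma (space (Pi\<^sub>M {q. prime q} (\<lambda>_. circle_measure))) closed_cylinders \<rightarrow>\<^sub>M circle_measure"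
      using norm_torus_coord[OF _ q] by (auto simp: circle_measurable_iff spN simp flip: torus_measure_def)
  qed
  moreover have "(\<lambda>q\<in>{q. prime q}. \<xi> q) = \<xi>" if "\<xi> \<in> space ?N" for \<xi>
    using that unfolding spN by (auto simp: space_torus_measure PiE_iff extensional_def restrict_def)
  ultimately have id: "(\<lambda>\<xi>. \<xi>) \<in> ?N \<rightarrow>\<^sub>M torus_measure"
    by (subst measurable_cong[of ?N _ "\<lambda>\<xi>. \<lambda>q\<in>{q. prime q}. \<xi> q"]) auto
  show "sets torus_measure \<subseteq> sigma_sets (space torus_measure) closed_cylinders"
  proof
    fix A assume A: "A \<in> sets torus_measure"
    then have "A \<subseteq> space torus_measure" by (rule sets.sets_into_space)
    then show "A \<in> sigma_sets (space torus_measure) closed_cylinders"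
      using measurable_sets[OF id A] by (simp add: spN sN Int_absorb2)
  qed
  show "sigma_sets (space torus_measure) closed_cylinders \<subseteq> sets torus_measure"
    by (rule sets.sigma_sets_subset) (use closed_cylinder_L1_trig(2) in auto)
qed

lemma Int_stable_closed_cylinders: "Int_stable closed_cylinders"
proof (rule Int_stableI)
  fix a b assume "a \<in> closed_cylinders" "b \<in> closed_cylinders"
  then obtain J C J' C' where J: "finite J" "J \<subseteq> {q. prime q}" "\<forall>q\<in>J. closed (C q)"
    "a = {\<xi>\<in>space torus_measure. \<forall>q\<in>J. \<xi> q \<in> C q}"
    and J': "finite J'" "J' \<subseteq> {q. prime q}" "\<forall>q\<in>J'. closed (C' q)"
    "b = {\<xi>\<in>space torus_measure. \<forall>q\<in>J'. \<xi> q \<in> C' q}"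
    unfolding closed_cylinders_def by blast
  show "a \<inter> b \<in> closed_cylinders"
    unfolding closed_cylinders_def
    by (intro CollectI exI[of _ "J \<union> J'"] exI[of _ "\<lambda>q. (if q \<in> J then C q else UNIV) \<inter> (if q \<in> J' then C' q else UNIV)"])
       (use J J' in \<open>auto split: if_splits\<close>)
qed

text \<open>
  Dynkin's lemma: the sets whose indicators can be approximated contain the closed cylinders and
  are stable under complements and countable disjoint unions.
\<close>

lemma indicator_L1_trig:
  assumes "A \<in> sets torus_measure"
  shows "L1_trig (indicator A)"
proof -
  have sub: "closed_cylinders \<subseteq> Pow (space torus_measure)" by (auto simp: closed_cylinders_def)
  have A: "A \<in> sigma_sets (space torus_measure) closed_cylinders"
    using assms by (simp add: sets_torus_closed_cylinders)
  show ?thesis using Int_stable_closed_cylinders sub A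
  proof (induction rule: sigma_sets_induct_disjoint)
    case (basic A)
    then show ?case by (rule closed_cylinder_L1_trig)
  next
    case empty
    show ?case by (rule uniform_imp_L1_trig) (auto intro!: trig_imp_uniform trig_const)
  next
    case (compl A)
    have 1: "L1_trig (\<lambda>_. 1)" by (rule uniform_imp_L1_trig) (auto intro!: trig_imp_uniform trig_const)
    have "L1_trig (\<lambda>\<xi>. 1 + (-1) * indicator A \<xi>)"
      by (intro L1_trig_add L1_trig_cmult 1 compl)
    then show ?case
    proof (rule L1_trig_dominated_limit[where w = "\<lambda>_. 1" and h = "\<lambda>_ \<xi>. 1 + (-1) * indicator A \<xi>"])
      show "indicator (space torus_measure - A) \<in> borel_measurable torus_measure"
        using compl(1) by (auto simp flip: sets_torus_closed_cylinders)
    qed (auto simp: indicator_def TM.emeasure_space_1)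
  next
    case (union A)
    have m: "A i \<in> sets torus_measure" for i using union(2) by (auto simp: sets_torus_closed_cylinders)
    show ?case
    proof (rule L1_trig_dominated_limit[where w = "\<lambda>_. 1" and h = "\<lambda>n \<xi>. \<Sum>i<n. indicator (A i) \<xi>"])
      show "L1_trig (\<lambda>\<xi>. \<Sum>i<n. indicator (A i) \<xi>)" for n
      proof (induction n)
        case 0
        show ?case by (rule uniform_imp_L1_trig) (auto intro!: trig_imp_uniform trig_const)
      qed (auto intro: L1_trig_add union)
      show "indicator (\<Union> (range A)) \<in> borel_measurable torus_measure" using m by auto
      fix \<xi>
      have "(\<lambda>i. indicator (A i) \<xi> :: real) sums indicator (\<Union> (range A)) \<xi>"
        by (rule indicator_sums) (use union(1) in \<open>auto simp: disjoint_family_on_def\<close>)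
      then show "(\<lambda>n. \<Sum>i<n. indicator (A i) \<xi>) \<longlonglongrightarrow> (indicator (\<Union> (range A)) \<xi> :: real)"
        by (simp add: sums_def)
      show "\<bar>\<Sum>i<n. indicator (A i) \<xi>\<bar> \<le> (1::real)" for n
      proof -
        have "(\<Sum>i<n. indicator (A i) \<xi>) = (indicator (\<Union>i<n. A i) \<xi> :: real)"
          by (rule indicator_UN_disjoint[symmetric]) (use union(1) in \<open>auto simp: disjoint_family_on_def\<close>)
        then show ?thesis by simp
      qed
    qed auto
  qed
qed

lemma integrable_L1_trig:
  assumes "integrable torus_measure (h :: _ \<Rightarrow> real)"
  shows "L1_trig h"
  using assms
proof (induction rule: integrable_induct)
  case (base A c)
  then show ?case using L1_trig_cmult[OF indicator_L1_trig[OF base(1)], of c] by (simp add: mult.commute)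
next
  case (add f g)
  then show ?case by (intro L1_trig_add)
next
  case (lim f s)
  show ?case
    by (rule L1_trig_dominated_limit[where h = s and w = "\<lambda>\<xi>. 2 * \<bar>f \<xi>\<bar>"]) (use lim in auto)
qed

interpretation TF: prob_flow torus_measure rot
  by unfold_locales (auto simp: rot_measurable_pair distr_rot rot_add rot_0)

lemma torus_ergodic:
  fixes g :: "(nat \<Rightarrow> complex) \<Rightarrow> ennreal"
  assumes g: "g \<in> borel_measurable torus_measure" and fin: "(\<integral>\<^sup>+\<xi>. g \<xi> \<partial>torus_measure) < \<infinity>"
  shows "AE \<xi> in torus_measure. ((\<lambda>R. ennreal (1/(2*R)) * (\<integral>\<^sup>+t\<in>{-R..R}. g (rot t \<xi>) \<partial>lborel))
     \<longlongrightarrow> (\<integral>\<^sup>+\<xi>. g \<xi> \<partial>torus_measure)) at_top"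
proof (rule TF.ergodic_two_sided[OF g fin])
  fix h :: "_ \<Rightarrow> real" and \<epsilon> :: real assume h: "integrable torus_measure h" and e: "\<epsilon> > 0"
  obtain q where q: "trig_poly q" "(\<integral>\<xi>. norm (of_real (h \<xi>) - q \<xi>) \<partial>torus_measure) < \<epsilon>"
    using integrable_L1_trig[OF h] e unfolding L1_trig_def by meson
  let ?r = "\<lambda>\<xi>. Re (q \<xi>)"
  note iq = trig_integrable[OF q(1)]
  have "(\<integral>\<xi>. \<bar>h \<xi> - ?r \<xi>\<bar> \<partial>torus_measure) \<le> (\<integral>\<xi>. norm (of_real (h \<xi>) - q \<xi>) \<partial>torus_measure)"
  proof (rule integral_mono)
    fix \<xi> show "\<bar>h \<xi> - ?r \<xi>\<bar> \<le> norm (of_real (h \<xi>) - q \<xi>)"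
      using abs_Re_le_cmod[of "of_real (h \<xi>) - q \<xi>"] by simp
  qed (use h iq in auto)
  also note q(2)
  finally have 1: "(\<integral>\<xi>. \<bar>h \<xi> - ?r \<xi>\<bar> \<partial>torus_measure) < \<epsilon>" .
  have 2: "((\<lambda>R. (LINT t:{0..R}|lborel. ?r (rot (d * t) \<xi>)) / R) \<longlongrightarrow> (\<integral>\<xi>. ?r \<xi> \<partial>torus_measure)) at_top"
    if x: "\<xi> \<in> space torus_measure" and d: "d \<in> {-1, 1}" for \<xi> d
  proof -
    have "((\<lambda>R. (LINT t:{0..R}|lborel. q (rot (d * t) \<xi>)) / of_real R) \<longlongrightarrow> (\<integral>\<xi>. q \<xi> \<partial>torus_measure)) at_top"
      using trig_orbit_mean[OF q(1)] x d unfolding orbit_mean_def by blast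
    from tendsto_Re[OF this]
    have "((\<lambda>R. Re ((LINT t:{0..R}|lborel. q (rot (d * t) \<xi>)) / of_real R)) \<longlongrightarrow> (\<integral>\<xi>. ?r \<xi> \<partial>torus_measure)) at_top"
      using iq by simp
    also have "(\<lambda>R. Re ((LINT t:{0..R}|lborel. q (rot (d * t) \<xi>)) / of_real R)) = (\<lambda>R. (LINT t:{0..R}|lborel. ?r (rot (d * t) \<xi>)) / R)"
      using trig_orbit_integrable[OF q(1) x, of 0 _ d]
      by (simp add: set_lebesgue_integral_def set_integrable_def flip: integral_Re)
    finally show ?thesis .
  qed
  show "\<exists>q::_ \<Rightarrow> real. integrable torus_measure q \<and> (\<integral>\<xi>. \<bar>h \<xi> - q \<xi>\<bar> \<partial>torus_measure) < \<epsilon> \<and>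
       (\<forall>\<xi>\<in>space torus_measure. ((\<lambda>R. (LINT t:{0..R}|lborel. q (rot t \<xi>)) / R) \<longlongrightarrow> (\<integral>\<xi>. q \<xi> \<partial>torus_measure)) at_top \<and>
         ((\<lambda>R. (LINT t:{0..R}|lborel. q (rot (-t) \<xi>)) / R) \<longlongrightarrow> (\<integral>\<xi>. q \<xi> \<partial>torus_measure)) at_top)"
    using 1 2[of _ 1] 2[of _ "-1"] iq by (intro exI[of _ ?r]) auto
qed

section \<open>Green's identity for powers of a holomorphic function\<close>

text \<open>
  Two integrations by parts.  The parabola vanishes at both end points, so the boundary terms contain
  values of \<open>u\<close> but none of its derivative; this is what makes the limit \<open>e \<rightarrow> 0\<close> and the passage to
  expectations possible below.
\<close>

lemma integral_second_derivative_parabola: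
  fixes u u1 u2 :: "real \<Rightarrow> real"
  assumes ac: "a \<le> c"
    and u1: "\<And>x. x \<in> {a..c} \<Longrightarrow> (u has_vector_derivative u1 x) (at x within {a..c})"
    and u2: "\<And>x. x \<in> {a..c} \<Longrightarrow> (u1 has_vector_derivative u2 x) (at x within {a..c})"
    and c2: "continuous_on {a..c} u2"
  shows "(LINT x:{a..c}|lborel. u2 x * ((x - a) * (c - x))) =
     (c - a) * (u a + u c) - 2 * (LINT x:{a..c}|lborel. u x)"
proof -
  have cu: "continuous_on {a..c} u"
    by (rule continuous_on_vector_derivative[OF u1])
  let ?W = "\<lambda>x. u1 x * ((x - a) * (c - x)) - u x * (a + c - 2 * x)"
  have "(\<integral>x. indicator {a..c} x *\<^sub>R (u2 x * ((x - a) * (c - x)) + 2 * u x) \<partial>lborel) = ?W c - ?W a"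
  proof (rule integral_FTC_atLeastAtMost[OF ac])
    fix x assume x: "a \<le> x" "x \<le> c"
    have 1: "(u has_real_derivative u1 x) (at x within {a..c})" "(u1 has_real_derivative u2 x) (at x within {a..c})"
      using u1[of x] u2[of x] x by (auto simp: has_real_derivative_iff_has_vector_derivative)
    have "(?W has_real_derivative (u2 x * ((x - a) * (c - x)) + 2 * u x)) (at x within {a..c})"
      by (auto intro!: derivative_eq_intros 1 simp: algebra_simps)
    then show "(?W has_vector_derivative (u2 x * ((x - a) * (c - x)) + 2 * u x)) (at x within {a..c})"
      by (simp add: has_real_derivative_iff_has_vector_derivative)
  next
    show "continuous_on {a..c} (\<lambda>x. u2 x * ((x - a) * (c - x)) + 2 * u x)"
      by (intro continuous_intros c2 cu)
  qed
  moreover have "(\<integral>x. indicator {a..c} x *\<^sub>R (u2 x * ((x - a) * (c - x)) + 2 * u x) \<partial>lborel) =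
    (LINT x:{a..c}|lborel. u2 x * ((x - a) * (c - x))) + 2 * (LINT x:{a..c}|lborel. u x)"
  proof -
    have "set_integrable lborel {a..c} (\<lambda>x. u2 x * ((x - a) * (c - x)))"
      by (intro borel_integrable_atLeastAtMost' continuous_intros c2)
    moreover have "set_integrable lborel {a..c} (\<lambda>x. 2 * u x)"
      by (intro borel_integrable_atLeastAtMost' continuous_intros cu)
    ultimately show ?thesis
      by (simp add: set_integral_add(2)[symmetric] set_lebesgue_integral_def[of _ _ "\<lambda>x. u2 x * ((x - a) * (c - x)) + 2 * u x"]
         flip: set_integral_mult_right)
  qed
  ultimately show ?thesis by (simp add: algebra_simps)
qed

text \<open>
  The function \<open>\<bar>F\<bar>\<^sup>p\<close> need not be smooth at zeros of \<open>F\<close>; it is replaced by \<open>(\<bar>F\<bar>\<^sup>2 + e) powr q\<close> with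
  \<open>q = p / 2\<close> and \<open>e > 0\<close>.  In the derivatives along a curve, \<open>z\<close>, \<open>z1\<close> and \<open>z2\<close> are its position,
  velocity and acceleration.
\<close>

definition rpow :: "real \<Rightarrow> real \<Rightarrow> complex \<Rightarrow> real" where
  "rpow q e z = ((norm z)\<^sup>2 + e) powr q"

definition rpow1 :: "real \<Rightarrow> real \<Rightarrow> complex \<Rightarrow> complex \<Rightarrow> real" where
  "rpow1 q e z z1 = 2 * q * ((norm z)\<^sup>2 + e) powr (q - 1) * (z \<bullet> z1)"

definition rpow2 :: "real \<Rightarrow> real \<Rightarrow> complex \<Rightarrow> complex \<Rightarrow> complex \<Rightarrow> real" where
  "rpow2 q e z z1 z2 = 4 * q * (q - 1) * ((norm z)\<^sup>2 + e) powr (q - 2) * (z \<bullet> z1)\<^sup>2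
     + 2 * q * ((norm z)\<^sup>2 + e) powr (q - 1) * ((norm z1)\<^sup>2 + z \<bullet> z2)"

lemma inner_has_real_derivative:
  fixes f g :: "real \<Rightarrow> complex"
  assumes "(f has_vector_derivative f') (at x within S)" "(g has_vector_derivative g') (at x within S)"
  shows "((\<lambda>x. f x \<bullet> g x) has_real_derivative (f x \<bullet> g' + f' \<bullet> g x)) (at x within S)"
  using bounded_bilinear.has_vector_derivative[OF bounded_bilinear_inner assms]
  by (simp add: has_real_derivative_iff_has_vector_derivative)

lemma rpow_has_derivative:
  assumes e: "e > 0" and f: "(f has_vector_derivative f1) (at x within S)"
  shows "((\<lambda>x. rpow q e (f x)) has_real_derivative rpow1 q e (f x) f1) (at x within S)"
proof -
  have "((\<lambda>x. (f x \<bullet> f x + e) powr q) has_real_derivative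
     q * (f x \<bullet> f x + e) powr (q - 1) * ((f x \<bullet> f1 + f1 \<bullet> f x) + 0)) (at x within S)"
    by (intro DERIV_chain2[OF has_real_derivative_powr] DERIV_add inner_has_real_derivative f DERIV_const
        add_nonneg_pos inner_ge_zero e)
  then show ?thesis
    unfolding rpow_def rpow1_def power2_norm_eq_inner
    by (simp add: inner_commute[of f1] mult_ac)
qed

lemma rpow1_has_derivative:
  assumes e: "e > 0" and f: "(f has_vector_derivative f1 x) (at x within S)"
    and f1: "(f1 has_vector_derivative f2) (at x within S)"
  shows "((\<lambda>x. rpow1 q e (f x) (f1 x)) has_real_derivative rpow2 q e (f x) (f1 x) f2) (at x within S)"
proof -
  have 1: "((\<lambda>x. rpow (q - 1) e (f x)) has_real_derivative rpow1 (q - 1) e (f x) (f1 x)) (at x within S)"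
    by (rule rpow_has_derivative[OF e f])
  have "((\<lambda>x. (2 * q * rpow (q - 1) e (f x)) * (f x \<bullet> f1 x)) has_real_derivative
    (2 * q * rpow1 (q - 1) e (f x) (f1 x)) * (f x \<bullet> f1 x) + (f x \<bullet> f2 + f1 x \<bullet> f1 x) * (2 * q * rpow (q - 1) e (f x))) (at x within S)"
    by (intro DERIV_mult DERIV_cmult 1 inner_has_real_derivative f f1)
  then show ?thesis
    by (simp add: rpow1_def rpow2_def rpow_def dot_square_norm power2_eq_square[of "_ \<bullet> _"] algebra_simps)
qed

text \<open>
  The Laplacian of \<open>(\<bar>F\<bar>\<^sup>2 + e) powr q\<close> at a point where \<open>F\<close> has the value \<open>z\<close> and the derivative \<open>z1\<close>.
\<close>

definition lap :: "real \<Rightarrow> real \<Rightarrow> complex \<Rightarrow> complex \<Rightarrow> real" where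
  "lap q e z z1 = ((norm z)\<^sup>2 + e) powr (q - 2) * (4 * q\<^sup>2 * (norm z)\<^sup>2 + 4 * q * e) * (norm z1)\<^sup>2"

text \<open>
  Along horizontal and vertical lines the velocity of \<open>F\<close> is \<open>F'\<close> and \<open>\<i>F'\<close>, its acceleration \<open>F''\<close> and
  \<open>- F''\<close>; so the second derivative of \<open>F\<close> cancels from the sum.
\<close>

lemma rpow2_laplace:
  assumes e: "e > 0"
  shows "rpow2 q e z z1 z2 + rpow2 q e z (\<i> * z1) (- z2) = lap q e z z1"
proof -
  have pos: "(norm z)\<^sup>2 + e > 0" using e by (simp add: add_nonneg_pos)
  have p: "((norm z)\<^sup>2 + e) powr (q - 1) = ((norm z)\<^sup>2 + e) powr (q - 2) * ((norm z)\<^sup>2 + e)"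
  proof -
    have "((norm z)\<^sup>2 + e) powr (q - 1) = ((norm z)\<^sup>2 + e) powr (q - 2) * ((norm z)\<^sup>2 + e) powr 1"
      unfolding powr_add[symmetric] by simp
    then show ?thesis using pos by simp
  qed
  have i: "(z \<bullet> z1)\<^sup>2 + (z \<bullet> (\<i> * z1))\<^sup>2 = (norm z)\<^sup>2 * (norm z1)\<^sup>2"
    unfolding cmod_power2 inner_complex_def by (simp add: power2_eq_square algebra_simps)
  have "rpow2 q e z z1 z2 + rpow2 q e z (\<i> * z1) (- z2) =
     4 * q * (q - 1) * ((norm z)\<^sup>2 + e) powr (q - 2) * ((z \<bullet> z1)\<^sup>2 + (z \<bullet> (\<i> * z1))\<^sup>2)
     + 4 * q * ((norm z)\<^sup>2 + e) powr (q - 1) * (norm z1)\<^sup>2"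
    by (simp add: rpow2_def norm_mult algebra_simps)
  also have "\<dots> = lap q e z z1"
    unfolding i p lap_def by (simp add: algebra_simps power2_eq_square)
  finally show ?thesis .
qed

lemma continuous_on_rpow [continuous_intros]:
  assumes "e > 0" "continuous_on S f"
  shows "continuous_on S (\<lambda>x. rpow q e (f x))"
  unfolding rpow_def
  by (intro continuous_intros assms) (use assms(1) in \<open>auto simp: add_nonneg_pos less_imp_neq[symmetric] intro!: less_imp_neq[symmetric] add_nonneg_pos\<close>)

lemma continuous_on_rpow2 [continuous_intros]:
  assumes "e > 0" "continuous_on S f" "continuous_on S f1" "continuous_on S f2"
  shows "continuous_on S (\<lambda>x. rpow2 q e (f x) (f1 x) (f2 x))"
  unfolding rpow2_def
  by (intro continuous_intros assms) (use assms(1) in \<open>auto intro!: less_imp_neq[symmetric] add_nonneg_pos\<close>)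

lemma continuous_on_lap [continuous_intros]:
  assumes "e > 0" "continuous_on S f" "continuous_on S f1"
  shows "continuous_on S (\<lambda>x. lap q e (f x) (f1 x))"
  unfolding lap_def
  by (intro continuous_intros assms) (use assms(1) in \<open>auto intro!: less_imp_neq[symmetric] add_nonneg_pos\<close>)

lemma deriv_halfplane:
  assumes F: "F holomorphic_on {s. Re s > c}" and s: "Re s > c"
  shows "(F has_field_derivative deriv F s) (at s)"
  by (rule holomorphic_derivI[OF F]) (auto simp: open_halfspace_Re_gt s)

lemma Complex_vector_derivatives:
  assumes F: "F holomorphic_on {s. Re s > c}" and s: "\<sigma> > c"
  shows "((\<lambda>x. F (Complex x t)) has_vector_derivative deriv F (Complex \<sigma> t)) (at \<sigma> within S)"
    and "((\<lambda>x. F (Complex \<sigma> x)) has_vector_derivative \<i> * deriv F (Complex \<sigma> t)) (at t within S)"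
proof -
  have 1: "((\<lambda>x. Complex x t) has_vector_derivative 1) (at \<sigma>)"
    unfolding Complex_eq by (auto intro!: derivative_eq_intros)
  have 2: "((\<lambda>x. Complex \<sigma> x) has_vector_derivative \<i>) (at t)"
    unfolding Complex_eq by (auto intro!: derivative_eq_intros)
  note D = deriv_halfplane[OF F, of "Complex \<sigma> t"]
  show "((\<lambda>x. F (Complex x t)) has_vector_derivative deriv F (Complex \<sigma> t)) (at \<sigma> within S)"
    using field_vector_diff_chain_at[OF 1 D] s by (auto simp: o_def intro: has_vector_derivative_at_within)
  show "((\<lambda>x. F (Complex \<sigma> x)) has_vector_derivative \<i> * deriv F (Complex \<sigma> t)) (at t within S)"
    using field_vector_diff_chain_at[OF 2 D] s by (auto simp: o_def intro: has_vector_derivative_at_within)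
qed

lemma integrable_box:
  fixes f :: "real \<times> real \<Rightarrow> real"
  assumes "continuous_on ({a..b} \<times> {c..d}) f"
  shows "integrable (lborel \<Otimes>\<^sub>M lborel) (\<lambda>x. indicator ({a..b} \<times> {c..d}) x * f x)"
  using borel_integrable_compact[of "{a..b} \<times> {c..d}" f] assms
  by (simp add: lborel_prod compact_Times)

text \<open>
  Green's identity on the rectangle \<open>[al, ga] \<times> [0, 1]\<close> with the product of two parabolas as weight,
  obtained from \<open>integral_second_derivative_parabola\<close> in each of the two variables.
\<close>

lemma green_regularised:
  fixes q e c al ga :: real
  assumes F: "F holomorphic_on {s. Re s > c}" and al: "c < al" "al \<le> ga" and e: "e > 0"
  defines "Q \<equiv> {al..ga} \<times> {0..1::real}"
    and "M2 \<equiv> lborel \<Otimes>\<^sub>M lborel :: (real \<times> real) measure"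
    and "A \<equiv> \<lambda>\<sigma>. (\<sigma> - al) * (ga - \<sigma>)" and "B \<equiv> \<lambda>t::real. t * (1 - t)"
    and "u \<equiv> \<lambda>\<sigma> t. rpow q e (F (Complex \<sigma> t))"
  shows "(\<integral>x. indicator Q x * (A (fst x) * B (snd x) * lap q e (F (Complex (fst x) (snd x))) (deriv F (Complex (fst x) (snd x)))) \<partial>M2)
     = (LINT t:{0..1}|lborel. B t * ((ga - al) * (u al t + u ga t)))
       + (LINT \<sigma>:{al..ga}|lborel. A \<sigma> * (u \<sigma> 0 + u \<sigma> 1))
       - 2 * (\<integral>x. indicator Q x * ((A (fst x) + B (snd x)) * u (fst x) (snd x)) \<partial>M2)"
proof -
  have F1: "deriv F holomorphic_on {s. Re s > c}"
    by (rule holomorphic_deriv[OF F open_halfspace_Re_gt])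
  have F2: "deriv (deriv F) holomorphic_on {s. Re s > c}"
    by (rule holomorphic_deriv[OF F1 open_halfspace_Re_gt])
  let ?z = "\<lambda>x::real\<times>real. Complex (fst x) (snd x)"
  have cz: "continuous_on Q ?z" unfolding Complex_eq by (intro continuous_intros)
  have cF: "continuous_on Q (\<lambda>x. G (?z x))" if "G holomorphic_on {s. Re s > c}" for G
    by (rule continuous_on_compose2[OF holomorphic_on_imp_continuous_on[OF that] cz])
       (use al in \<open>auto simp: Q_def\<close>)
  define us where "us x = rpow2 q e (F (?z x)) (deriv F (?z x)) (deriv (deriv F) (?z x))" for x
  define ut where "ut x = rpow2 q e (F (?z x)) (\<i> * deriv F (?z x)) (- deriv (deriv F) (?z x))" for x
  have cus: "continuous_on Q us" and cut: "continuous_on Q ut"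
    unfolding us_def ut_def by (intro continuous_intros cF F F1 F2 e)+
  have cu: "continuous_on Q (\<lambda>x. u (fst x) (snd x))"
    unfolding u_def by (intro continuous_intros cF F e)
  have cA: "continuous_on Q (\<lambda>x. A (fst x))" and cB: "continuous_on Q (\<lambda>x. B (snd x))"
    unfolding A_def B_def by (intro continuous_intros)+
  have int: "integrable M2 (\<lambda>x. indicator Q x * f x)" if "continuous_on Q f" for f :: "_ \<Rightarrow> real"
    using integrable_box[of al ga 0 1 f] that by (simp add: Q_def M2_def)
  have slice_s: "continuous_on {al..ga} (\<lambda>\<sigma>. f (\<sigma>, t))" if "continuous_on Q f" "t \<in> {0..1}" for f :: "_ \<Rightarrow> real" and t
    by (rule continuous_on_compose2[OF that(1)]) (use that(2) in \<open>auto simp: Q_def intro!: continuous_intros\<close>)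
  have slice_t: "continuous_on {0..1} (\<lambda>t. f (\<sigma>, t))" if "continuous_on Q f" "\<sigma> \<in> {al..ga}" for f :: "_ \<Rightarrow> real" and \<sigma>
    by (rule continuous_on_compose2[OF that(1)]) (use that(2) in \<open>auto simp: Q_def intro!: continuous_intros\<close>)
  have ind: "indicator Q (\<sigma>, t) = (indicator {al..ga} \<sigma> * indicator {0..1} t :: real)" for \<sigma> t
    by (auto simp: Q_def indicator_def)

  have by_parts_s: "(LINT \<sigma>:{al..ga}|lborel. us (\<sigma>, t) * A \<sigma>) =
      (ga - al) * (u al t + u ga t) - 2 * (LINT \<sigma>:{al..ga}|lborel. u \<sigma> t)" if t: "t \<in> {0..1}" for t
    unfolding A_def
  proof (rule integral_second_derivative_parabola[OF al(2)])
    fix x assume x: "x \<in> {al..ga}"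
    show "((\<lambda>\<sigma>. u \<sigma> t) has_vector_derivative rpow1 q e (F (Complex x t)) (deriv F (Complex x t))) (at x within {al..ga})"
      unfolding u_def has_real_derivative_iff_has_vector_derivative[symmetric]
      using x al by (intro rpow_has_derivative e Complex_vector_derivatives[OF F]) auto
    show "((\<lambda>x. rpow1 q e (F (Complex x t)) (deriv F (Complex x t))) has_vector_derivative us (x, t)) (at x within {al..ga})"
      unfolding us_def has_real_derivative_iff_has_vector_derivative[symmetric] fst_conv snd_conv
      using x al by (intro rpow1_has_derivative e Complex_vector_derivatives[OF F] Complex_vector_derivatives[OF F1]) auto
  qed (rule slice_s[OF cus t])
  have by_parts_t: "(LINT t:{0..1}|lborel. ut (\<sigma>, t) * B t) =
      (u \<sigma> 0 + u \<sigma> 1) - 2 * (LINT t:{0..1}|lborel. u \<sigma> t)" if s: "\<sigma> \<in> {al..ga}" for \<sigma>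
  proof -
    have "(LINT t:{0..1}|lborel. ut (\<sigma>, t) * ((t - 0) * (1 - t))) =
      (1 - 0) * (u \<sigma> 0 + u \<sigma> 1) - 2 * (LINT t:{0..1}|lborel. u \<sigma> t)"
    proof (rule integral_second_derivative_parabola)
      fix x :: real assume x: "x \<in> {0..1}"
      show "((\<lambda>t. u \<sigma> t) has_vector_derivative rpow1 q e (F (Complex \<sigma> x)) (\<i> * deriv F (Complex \<sigma> x))) (at x within {0..1})"
        unfolding u_def has_real_derivative_iff_has_vector_derivative[symmetric]
        using s al by (intro rpow_has_derivative e Complex_vector_derivatives[OF F]) auto
      have "((\<lambda>t. \<i> * deriv F (Complex \<sigma> t)) has_vector_derivative - deriv (deriv F) (Complex \<sigma> x)) (at x within {0..1})"
        using has_vector_derivative_mult_right[OF Complex_vector_derivatives(2)[OF F1, of \<sigma> x "{0..1}"], of \<i>] s al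
        by (simp add: mult.assoc[symmetric])
      then show "((\<lambda>x. rpow1 q e (F (Complex \<sigma> x)) (\<i> * deriv F (Complex \<sigma> x))) has_vector_derivative ut (\<sigma>, x)) (at x within {0..1})"
        unfolding ut_def has_real_derivative_iff_has_vector_derivative[symmetric] fst_conv snd_conv
        using s al by (intro rpow1_has_derivative e Complex_vector_derivatives[OF F]) auto
    qed (use slice_t[OF cut s] in auto)
    then show ?thesis by (simp add: B_def)
  qed

  have fub_t: "(\<integral>x. indicator Q x * (g (snd x) * f x) \<partial>M2) = (LINT t:{0..1}|lborel. g t * (LINT \<sigma>:{al..ga}|lborel. f (\<sigma>, t)))"
    if "continuous_on Q f" "continuous_on Q (\<lambda>x. g (snd x))" for f and g :: "real \<Rightarrow> real"
  proof -
    have "integrable M2 (\<lambda>x. indicator Q x * (g (snd x) * f x))"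
      by (intro int continuous_intros that)
    then have "(\<integral>x. indicator Q x * (g (snd x) * f x) \<partial>M2) = (\<integral>t. (\<integral>\<sigma>. indicator Q (\<sigma>, t) * (g t * f (\<sigma>, t)) \<partial>lborel) \<partial>lborel)"
      unfolding M2_def using lborel_pair.integral_snd[of "\<lambda>\<sigma> t. indicator Q (\<sigma>, t) * (g t * f (\<sigma>, t))"]
      by (simp add: case_prod_beta')
    also have "\<dots> = (LINT t:{0..1}|lborel. g t * (LINT \<sigma>:{al..ga}|lborel. f (\<sigma>, t)))"
      unfolding set_lebesgue_integral_def real_scaleR_def ind
      by (intro Bochner_Integration.integral_cong refl)
         (auto simp: mult_ac simp flip: integral_mult_right_zero)
    finally show ?thesis .
  qed
  have fub_s: "(\<integral>x. indicator Q x * (g (fst x) * f x) \<partial>M2) = (LINT \<sigma>:{al..ga}|lborel. g \<sigma> * (LINT t:{0..1}|lborel. f (\<sigma>, t)))"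
    if "continuous_on Q f" "continuous_on Q (\<lambda>x. g (fst x))" for f and g :: "real \<Rightarrow> real"
  proof -
    have "integrable M2 (\<lambda>x. indicator Q x * (g (fst x) * f x))"
      by (intro int continuous_intros that)
    then have "(\<integral>x. indicator Q x * (g (fst x) * f x) \<partial>M2) = (\<integral>\<sigma>. (\<integral>t. indicator Q (\<sigma>, t) * (g \<sigma> * f (\<sigma>, t)) \<partial>lborel) \<partial>lborel)"
      unfolding M2_def using lborel_pair.integral_fst'[of "\<lambda>x. indicator Q x * (g (fst x) * f x)"]
      by simp
    also have "\<dots> = (LINT \<sigma>:{al..ga}|lborel. g \<sigma> * (LINT t:{0..1}|lborel. f (\<sigma>, t)))"
      unfolding set_lebesgue_integral_def real_scaleR_def ind
      by (intro Bochner_Integration.integral_cong refl)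
         (auto simp: mult_ac simp flip: integral_mult_right_zero)
    finally show ?thesis .
  qed
  have cA': "continuous_on {al..ga} A" and cB': "continuous_on {0..1} B"
    unfolding A_def B_def by (intro continuous_intros)+
  have u0: "continuous_on {0..1} (\<lambda>t. u \<sigma> t)" if "\<sigma> \<in> {al..ga}" for \<sigma>
    using slice_t[OF cu that] by simp
  have u0': "continuous_on {al..ga} (\<lambda>\<sigma>. u \<sigma> t)" if "t \<in> {0..1}" for t
    using slice_s[OF cu that] by simp
  note siI = borel_integrable_atLeastAtMost'
  have int_s: "set_integrable lborel {0..1} (\<lambda>t. B t * (LINT \<sigma>:{al..ga}|lborel. u \<sigma> t))"
  proof -
    have "integrable M2 (\<lambda>x. indicator Q x * (B (snd x) * u (fst x) (snd x)))"
      by (intro int continuous_intros cu cB)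
    then have "integrable lborel (\<lambda>t. \<integral>\<sigma>. indicator Q (\<sigma>, t) * (B t * u \<sigma> t) \<partial>lborel)"
      unfolding M2_def using lborel_pair.integrable_snd[of "\<lambda>\<sigma> t. indicator Q (\<sigma>, t) * (B t * u \<sigma> t)"]
      by (simp add: case_prod_beta')
    then show ?thesis
      unfolding set_integrable_def set_lebesgue_integral_def real_scaleR_def ind
      by (rule Bochner_Integration.integrable_cong[THEN iffD1, rotated 2])
         (auto simp: mult_ac simp flip: integral_mult_right_zero)
  qed
  have int_t: "set_integrable lborel {al..ga} (\<lambda>\<sigma>. A \<sigma> * (LINT t:{0..1}|lborel. u \<sigma> t))"
  proof -
    have "integrable M2 (\<lambda>x. indicator Q x * (A (fst x) * u (fst x) (snd x)))"
      by (intro int continuous_intros cu cA)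
    from lborel_pair.integrable_fst'[OF this[unfolded M2_def]]
    have "integrable lborel (\<lambda>\<sigma>. \<integral>t. indicator Q (\<sigma>, t) * (A \<sigma> * u \<sigma> t) \<partial>lborel)" by simp
    then show ?thesis
      unfolding set_integrable_def set_lebesgue_integral_def real_scaleR_def ind
      by (rule Bochner_Integration.integrable_cong[THEN iffD1, rotated 2])
         (auto simp: mult_ac simp flip: integral_mult_right_zero)
  qed
  have S: "(\<integral>x. indicator Q x * (B (snd x) * (us x * A (fst x))) \<partial>M2) =
     (LINT t:{0..1}|lborel. B t * ((ga - al) * (u al t + u ga t))) - 2 * (LINT t:{0..1}|lborel. B t * (LINT \<sigma>:{al..ga}|lborel. u \<sigma> t))"
  proof -
    have "(\<integral>x. indicator Q x * (B (snd x) * (us x * A (fst x))) \<partial>M2) =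
       (LINT t:{0..1}|lborel. B t * (LINT \<sigma>:{al..ga}|lborel. us (\<sigma>, t) * A \<sigma>))"
      by (subst fub_t) (auto intro!: continuous_intros cus cA cB)
    also have "\<dots> = (LINT t:{0..1}|lborel. B t * ((ga - al) * (u al t + u ga t)) - 2 * (B t * (LINT \<sigma>:{al..ga}|lborel. u \<sigma> t)))"
      by (intro set_lebesgue_integral_cong) (auto simp: by_parts_s right_diff_distrib)
    also have "\<dots> = (LINT t:{0..1}|lborel. B t * ((ga - al) * (u al t + u ga t))) - (LINT t:{0..1}|lborel. 2 * (B t * (LINT \<sigma>:{al..ga}|lborel. u \<sigma> t)))"
      by (intro set_integral_diff(2) set_integrable_mult_right int_s, intro siI continuous_intros cB' u0)
         (use al in auto)
    finally show ?thesis by simp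
  qed
  have T: "(\<integral>x. indicator Q x * (A (fst x) * (ut x * B (snd x))) \<partial>M2) =
     (LINT \<sigma>:{al..ga}|lborel. A \<sigma> * (u \<sigma> 0 + u \<sigma> 1)) - 2 * (LINT \<sigma>:{al..ga}|lborel. A \<sigma> * (LINT t:{0..1}|lborel. u \<sigma> t))"
  proof -
    have "(\<integral>x. indicator Q x * (A (fst x) * (ut x * B (snd x))) \<partial>M2) =
       (LINT \<sigma>:{al..ga}|lborel. A \<sigma> * (LINT t:{0..1}|lborel. ut (\<sigma>, t) * B t))"
      by (subst fub_s) (auto intro!: continuous_intros cut cA cB)
    also have "\<dots> = (LINT \<sigma>:{al..ga}|lborel. A \<sigma> * (u \<sigma> 0 + u \<sigma> 1) - 2 * (A \<sigma> * (LINT t:{0..1}|lborel. u \<sigma> t)))"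
      by (intro set_lebesgue_integral_cong) (auto simp: by_parts_t right_diff_distrib)
    also have "\<dots> = (LINT \<sigma>:{al..ga}|lborel. A \<sigma> * (u \<sigma> 0 + u \<sigma> 1)) - (LINT \<sigma>:{al..ga}|lborel. 2 * (A \<sigma> * (LINT t:{0..1}|lborel. u \<sigma> t)))"
      by (intro set_integral_diff(2) set_integrable_mult_right int_t, intro siI continuous_intros cA' u0')
         auto
    finally show ?thesis by simp
  qed
  have U: "(\<integral>x. indicator Q x * ((A (fst x) + B (snd x)) * u (fst x) (snd x)) \<partial>M2) =
     (LINT t:{0..1}|lborel. B t * (LINT \<sigma>:{al..ga}|lborel. u \<sigma> t)) + (LINT \<sigma>:{al..ga}|lborel. A \<sigma> * (LINT t:{0..1}|lborel. u \<sigma> t))"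
  proof -
    have "(\<integral>x. indicator Q x * ((A (fst x) + B (snd x)) * u (fst x) (snd x)) \<partial>M2) =
       (\<integral>x. indicator Q x * (A (fst x) * u (fst x) (snd x)) + indicator Q x * (B (snd x) * u (fst x) (snd x)) \<partial>M2)"
      by (simp add: algebra_simps)
    also have "\<dots> = (\<integral>x. indicator Q x * (A (fst x) * u (fst x) (snd x)) \<partial>M2) + (\<integral>x. indicator Q x * (B (snd x) * u (fst x) (snd x)) \<partial>M2)"
      by (intro Bochner_Integration.integral_add int continuous_intros cu cA cB)
    finally show ?thesis
      using fub_s[OF cu cA] fub_t[OF cu cB] by simp
  qed
  have lapx: "lap q e (F (?z x)) (deriv F (?z x)) = us x + ut x" for x
    unfolding us_def ut_def by (rule rpow2_laplace[OF e, symmetric])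
  have "(\<integral>x. indicator Q x * (A (fst x) * B (snd x) * lap q e (F (?z x)) (deriv F (?z x))) \<partial>M2) =
     (\<integral>x. indicator Q x * (B (snd x) * (us x * A (fst x))) + indicator Q x * (A (fst x) * (ut x * B (snd x))) \<partial>M2)"
    by (intro Bochner_Integration.integral_cong refl) (simp only: lapx, simp add: algebra_simps)
  also have "\<dots> = (\<integral>x. indicator Q x * (B (snd x) * (us x * A (fst x))) \<partial>M2) + (\<integral>x. indicator Q x * (A (fst x) * (ut x * B (snd x))) \<partial>M2)"
    by (intro Bochner_Integration.integral_add int continuous_intros cus cut cA cB)
  finally show ?thesis unfolding S T U by simp
qed

lemma bounded_dct:
  fixes f :: "nat \<Rightarrow> 'a \<Rightarrow> real"
  assumes S: "S \<in> sets M" "emeasure M S < \<infinity>"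
    and m: "\<And>j. (\<lambda>x. indicator S x * f j x) \<in> borel_measurable M" "(\<lambda>x. indicator S x * g x) \<in> borel_measurable M"
    and lim: "AE x in M. x \<in> S \<longrightarrow> (\<lambda>j. f j x) \<longlonglongrightarrow> g x"
    and bd: "\<And>j x. x \<in> S \<Longrightarrow> \<bar>f j x\<bar> \<le> C"
  shows "(\<lambda>j. \<integral>x. indicator S x * f j x \<partial>M) \<longlonglongrightarrow> (\<integral>x. indicator S x * g x \<partial>M)"
    and "integrable M (\<lambda>x. indicator S x * g x)"
proof -
  have w: "integrable M (\<lambda>x. indicator S x * C :: real)" using S by simp
  have l: "AE x in M. (\<lambda>j. indicator S x * f j x) \<longlonglongrightarrow> indicator S x * g x"
    using lim by eventually_elim (auto simp: indicator_def)
  have b: "AE x in M. norm (indicator S x * f j x) \<le> indicator S x * C" for j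
    using bd by (auto simp: indicator_def)
  show "(\<lambda>j. \<integral>x. indicator S x * f j x \<partial>M) \<longlonglongrightarrow> (\<integral>x. indicator S x * g x \<partial>M)"
    by (rule integral_dominated_convergence[OF m(2) m(1) w l b])
  show "integrable M (\<lambda>x. indicator S x * g x)"
    by (rule integrable_dominated_convergence[OF m(2) m(1) w l b])
qed

lemma square_powr: "x \<ge> 0 \<Longrightarrow> (x\<^sup>2) powr q = (x::real) powr (2 * q)"
proof -
  assume "x \<ge> 0"
  then have "x\<^sup>2 = x powr 2" by (rule powr_numeral[symmetric])
  then show ?thesis by (simp only: powr_powr)
qed

lemma rpow_0: "rpow (p / 2) 0 z = norm z powr p"
  by (simp add: rpow_def square_powr)

lemma rpow_tendsto:
  assumes "q > 0" "e \<longlonglongrightarrow> 0" "\<And>j. e j > 0"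
  shows "(\<lambda>j. rpow q (e j) z) \<longlonglongrightarrow> rpow q 0 z"
  unfolding rpow_def
  by (rule tendsto_powr') (use assms in \<open>auto intro!: tendsto_eq_intros always_eventually simp: less_imp_le\<close>)

lemma lap_tendsto:
  assumes "e \<longlonglongrightarrow> 0" "z \<noteq> 0 \<or> z1 = 0"
  shows "(\<lambda>j. lap (p / 2) (e j) z z1) \<longlonglongrightarrow> p\<^sup>2 * (norm z powr (p - 2) * (norm z1)\<^sup>2)"
proof (cases "z1 = 0")
  case False
  then have z: "z \<noteq> 0" using assms by auto
  have "(\<lambda>j. lap (p / 2) (e j) z z1) \<longlonglongrightarrow>
     ((norm z)\<^sup>2 + 0) powr (p / 2 - 2) * (4 * (p / 2)\<^sup>2 * (norm z)\<^sup>2 + 4 * (p / 2) * 0) * (norm z1)\<^sup>2"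
    unfolding lap_def using z by (intro tendsto_intros assms(1)) auto
  also have "((norm z)\<^sup>2 + 0) powr (p / 2 - 2) = norm z powr (p - 4)"
    by (simp add: square_powr)
  also have "norm z powr (p - 4) * (4 * (p / 2)\<^sup>2 * (norm z)\<^sup>2 + 4 * (p / 2) * 0) = p\<^sup>2 * (norm z powr (p - 4) * norm z powr 2)"
    using z by (simp add: power2_eq_square)
  also have "norm z powr (p - 4) * norm z powr 2 = norm z powr (p - 2)"
    unfolding powr_add[symmetric] by simp
  finally show ?thesis by (simp add: mult_ac)
qed (auto simp: lap_def)

lemma lap_nonneg: "q \<ge> 0 \<Longrightarrow> e \<ge> 0 \<Longrightarrow> lap q e z z1 \<ge> 0"
  by (auto simp: lap_def intro!: mult_nonneg_nonneg add_nonneg_nonneg)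

text \<open>
  For \<open>p < 2\<close> the limit density can be unbounded near zeros of \<open>F\<close>, but a constant multiple of it dominates
  all regularised densities.
\<close>

lemma lap_le_small_exponent:
  assumes p: "0 < p" "p < 2" and e: "e > 0" and z: "z \<noteq> 0 \<or> z1 = 0"
  shows "lap (p / 2) e z z1 \<le> (2 / p) * (p\<^sup>2 * (norm z powr (p - 2) * (norm z1)\<^sup>2))"
proof (cases "z1 = 0")
  case False
  then have "z \<noteq> 0" using z by auto
  then have v: "(norm z)\<^sup>2 > 0" by simp
  let ?v = "(norm z)\<^sup>2"
  have "(?v + e) powr (p / 2 - 2) * (4 * (p / 2)\<^sup>2 * ?v + 4 * (p / 2) * e) \<le> (?v + e) powr (p / 2 - 2) * (2 * p * (?v + e))"
  proof (intro mult_left_mono)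
    have "p * p * ?v \<le> p * 2 * ?v" using p v by (intro mult_right_mono mult_left_mono) auto
    then show "4 * (p / 2)\<^sup>2 * ?v + 4 * (p / 2) * e \<le> 2 * p * (?v + e)"
      by (simp add: power2_eq_square algebra_simps)
  qed auto
  also have "\<dots> = 2 * p * ((?v + e) powr (p / 2 - 2) * (?v + e) powr 1)"
    using v e by simp
  also have "\<dots> = 2 * p * (?v + e) powr (p / 2 - 1)"
    unfolding powr_add[symmetric] by simp
  also have "\<dots> \<le> 2 * p * ?v powr (p / 2 - 1)"
    using p v e by (intro mult_left_mono powr_mono2') auto
  also have "?v powr (p / 2 - 1) = norm z powr (p - 2)"
    by (simp add: square_powr)
  finally have "lap (p / 2) e z z1 \<le> (2 * p * norm z powr (p - 2)) * (norm z1)\<^sup>2"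
    unfolding lap_def by (intro mult_right_mono) auto
  then show ?thesis using p by (simp add: power2_eq_square)
qed (auto simp: lap_def)

lemma lap_le_large_exponent:
  assumes p: "2 \<le> p" and e: "0 < e" "e \<le> 1" and z: "norm z \<le> C" "norm z1 \<le> C"
  shows "lap (p / 2) e z z1 \<le> p\<^sup>2 * (C\<^sup>2 + 1) powr (p / 2 - 1) * C\<^sup>2"
proof -
  let ?v = "(norm z)\<^sup>2"
  have pos: "?v + e > 0" using e by (simp add: add_nonneg_pos)
  have "(?v + e) powr (p / 2 - 2) * (4 * (p / 2)\<^sup>2 * ?v + 4 * (p / 2) * e) \<le> (?v + e) powr (p / 2 - 2) * (p\<^sup>2 * (?v + e))"
  proof (intro mult_left_mono)
    have "2 * p * e \<le> p * p * e" using p e by (intro mult_right_mono) auto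
    then show "4 * (p / 2)\<^sup>2 * ?v + 4 * (p / 2) * e \<le> p\<^sup>2 * (?v + e)"
      by (simp add: power2_eq_square algebra_simps)
  qed auto
  also have "\<dots> = p\<^sup>2 * ((?v + e) powr (p / 2 - 2) * (?v + e) powr 1)"
    using pos by simp
  also have "\<dots> = p\<^sup>2 * (?v + e) powr (p / 2 - 1)"
    unfolding powr_add[symmetric] by simp
  also have "\<dots> \<le> p\<^sup>2 * (C\<^sup>2 + 1) powr (p / 2 - 1)"
    using p e z pos by (intro mult_left_mono powr_mono2 add_mono power_mono) auto
  finally have "lap (p / 2) e z z1 \<le> (p\<^sup>2 * (C\<^sup>2 + 1) powr (p / 2 - 1)) * (norm z1)\<^sup>2"
    unfolding lap_def by (intro mult_right_mono) auto
  also have "\<dots> \<le> (p\<^sup>2 * (C\<^sup>2 + 1) powr (p / 2 - 1)) * C\<^sup>2"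
    using z by (intro mult_left_mono power_mono) auto
  finally show ?thesis .
qed

lemma fsigma_halfplane: "fsigma {s::complex. Re s > c}"
proof -
  have "{s. Re s > c} = (\<Union>n. {s. Re s \<ge> c + 1 / real (Suc n)})"
  proof (intro set_eqI iffI)
    fix s assume "s \<in> {s. Re s > c}"
    then obtain n where "1 / real (Suc n) < Re s - c"
      using reals_Archimedean[of "Re s - c"] by (auto simp: inverse_eq_divide)
    then show "s \<in> (\<Union>n. {s. Re s \<ge> c + 1 / real (Suc n)})"
      by (auto intro!: exI[of _ n])
  next
    fix s assume "s \<in> (\<Union>n. {s. Re s \<ge> c + 1 / real (Suc n)})"
    then obtain n where "Re s \<ge> c + 1 / real (Suc n)" by auto
    moreover have "1 / real (Suc n) > 0" by simp
    ultimately show "s \<in> {s. Re s > c}" by (simp only: mem_Collect_eq)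
  qed
  then show ?thesis by (auto intro!: fsigma.intros closed_halfspace_Re_ge)
qed

text \<open>
  The zeros of a nonconstant holomorphic function are countable, and a constant has derivative 0.
  The exceptional set is thus null even when \<open>F\<close> vanishes identically.
\<close>

lemma AE_zero_imp_deriv_zero:
  assumes F: "F holomorphic_on {s. Re s > c}"
  shows "AE x in (lborel \<Otimes>\<^sub>M lborel :: (real \<times> real) measure). fst x > c \<longrightarrow>
     F (Complex (fst x) (snd x)) \<noteq> 0 \<or> deriv F (Complex (fst x) (snd x)) = 0"
proof (cases "F constant_on {s. Re s > c}")
  case True
  then obtain w where w: "\<And>s. Re s > c \<Longrightarrow> F s = w" by (auto simp: constant_on_def)
  have "deriv F s = 0" if "Re s > c" for s
  proof -
    have "eventually (\<lambda>s. Re s > c) (nhds s)"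
      using eventually_nhds_in_open[OF open_halfspace_Re_gt[of c], of s] that by simp
    then have "deriv F s = deriv (\<lambda>_. w) s"
      by (intro deriv_cong_ev refl, eventually_elim) (use w in auto)
    then show ?thesis by simp
  qed
  then show ?thesis by auto
next
  case False
  have S: "countable {z\<in>{s. Re s > c}. F z = 0}"
    by (rule holomorphic_countable_zeros[OF F _ _ _ False])
       (auto simp: open_halfspace_Re_gt convex_connected convex_halfspace_Re_gt fsigma_halfplane)
  let ?N = "(\<lambda>z. (Re z, Im z)) ` {z\<in>{s. Re s > c}. F z = 0}"
  have "?N \<in> null_sets lborel"
    by (intro countable_imp_null_set_lborel countable_image S)
  then have "AE x in (lborel \<Otimes>\<^sub>M lborel). x \<notin> ?N"
    by (simp add: lborel_prod AE_not_in)
  then show ?thesis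
  proof eventually_elim
    case (elim x)
    show ?case
    proof (intro impI)
      assume "c < fst x"
      have "(Re (Complex (fst x) (snd x)), Im (Complex (fst x) (snd x))) = x" by simp
      then show "F (Complex (fst x) (snd x)) \<noteq> 0 \<or> deriv F (Complex (fst x) (snd x)) = 0"
        using elim \<open>c < fst x\<close> by (metis (mono_tags, lifting) complex.sel(1) imageI mem_Collect_eq)
    qed
  qed
qed

text \<open>
  The limit \<open>e \<rightarrow> 0\<close> in \<open>green_regularised\<close>.  For \<open>p \<ge> 2\<close> the Laplacians are bounded on the rectangle.
  For \<open>p < 2\<close> Fatou's lemma first shows that the limit density is integrable, after which a multiple of it
  serves as the dominating function.  The terms are arranged so that no subtraction occurs in
  \<open>[0, \<infinity>]\<close>.
\<close>

lemma green_power: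
  fixes p c al ga :: real
  assumes F: "F holomorphic_on {s. Re s > c}" and al: "c < al" "al \<le> ga" and p: "1 \<le> p"
  defines "Q \<equiv> {al..ga} \<times> {0..1::real}"
    and "M2 \<equiv> lborel \<Otimes>\<^sub>M lborel :: (real \<times> real) measure"
    and "A \<equiv> \<lambda>\<sigma>. (\<sigma> - al) * (ga - \<sigma>)" and "B \<equiv> \<lambda>t::real. t * (1 - t)"
    and "m \<equiv> \<lambda>\<sigma> t. norm (F (Complex \<sigma> t)) powr p"
    and "k \<equiv> \<lambda>s. p\<^sup>2 * (norm (F s) powr (p - 2) * (norm (deriv F s))\<^sup>2)"
  shows "(\<integral>\<^sup>+x. ennreal (indicator Q x * (A (fst x) * B (snd x) * k (Complex (fst x) (snd x)))) \<partial>M2)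
        + 2 * (\<integral>\<^sup>+x. ennreal (indicator Q x * ((A (fst x) + B (snd x)) * m (fst x) (snd x))) \<partial>M2)
     = (\<integral>\<^sup>+t. ennreal (indicator {0..1} t * (B t * ((ga - al) * (m al t + m ga t)))) \<partial>lborel)
       + (\<integral>\<^sup>+\<sigma>. ennreal (indicator {al..ga} \<sigma> * (A \<sigma> * (m \<sigma> 0 + m \<sigma> 1))) \<partial>lborel)"
proof -
  let ?z = "\<lambda>x::real\<times>real. Complex (fst x) (snd x)"
  have F1: "deriv F holomorphic_on {s. Re s > c}"
    by (rule holomorphic_deriv[OF F open_halfspace_Re_gt])
  have cz: "continuous_on Q ?z" unfolding Complex_eq by (intro continuous_intros)
  have cF: "continuous_on Q (\<lambda>x. G (?z x))" if "G holomorphic_on {s. Re s > c}" for G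
    by (rule continuous_on_compose2[OF holomorphic_on_imp_continuous_on[OF that] cz])
       (use al in \<open>auto simp: Q_def\<close>)
  have compQ: "compact Q" by (simp add: Q_def compact_Times)
  have bnd: "\<exists>C. \<forall>x\<in>Q. norm (G (?z x)) \<le> C" if "G holomorphic_on {s. Re s > c}" for G
    using compact_imp_bounded[OF compact_continuous_image[OF cF[OF that] compQ]]
    by (auto simp: bounded_iff)
  obtain C where C: "\<And>x. x \<in> Q \<Longrightarrow> norm (F (?z x)) \<le> C" "\<And>x. x \<in> Q \<Longrightarrow> norm (deriv F (?z x)) \<le> C"
    using bnd[OF F] bnd[OF F1] by (metis max.coboundedI1 max.coboundedI2)
  define e where "e j = 1 / real (Suc j)" for j
  have e: "e j > 0" "e j \<le> 1" for j by (auto simp: e_def)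
  have e0: "e \<longlonglongrightarrow> 0" unfolding e_def by (rule LIMSEQ_Suc[OF lim_1_over_n])
  define u where "u j \<sigma> t = rpow (p/2) (e j) (F (Complex \<sigma> t))" for j \<sigma> t
  define A0 where "A0 = (ga - al)\<^sup>2"
  have Ab: "0 \<le> A \<sigma>" "A \<sigma> \<le> A0" if "\<sigma> \<in> {al..ga}" for \<sigma>
  proof -
    show "0 \<le> A \<sigma>" using that by (auto simp: A_def)
    show "A \<sigma> \<le> A0" using that unfolding A_def A0_def power2_eq_square by (intro mult_mono) auto
  qed
  have Bb: "0 \<le> B t" "B t \<le> 1" if "t \<in> {0..1}" for t
  proof -
    show "0 \<le> B t" using that by (auto simp: B_def)
    show "B t \<le> 1" using that mult_mono[of t 1 "1 - t" 1] by (auto simp: B_def)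
  qed
  have QD: "x \<in> Q \<longleftrightarrow> fst x \<in> {al..ga} \<and> snd x \<in> {0..1}" for x by (cases x) (auto simp: Q_def)
  have ulim: "(\<lambda>j. u j \<sigma> t) \<longlonglongrightarrow> m \<sigma> t" for \<sigma> t
    unfolding u_def m_def rpow_0[symmetric] by (rule rpow_tendsto) (use p e0 e in auto)
  define C1 where "C1 = (C\<^sup>2 + 1) powr (p/2)"
  have ub: "0 \<le> u j \<sigma> t" "u j \<sigma> t \<le> C1" if "(\<sigma>, t) \<in> Q" for j \<sigma> t
  proof -
    show "0 \<le> u j \<sigma> t" by (simp add: u_def rpow_def)
    show "u j \<sigma> t \<le> C1"
      unfolding u_def rpow_def C1_def
      using C(1)[OF that] e[of j] p by (intro powr_mono2 add_mono power_mono add_nonneg_nonneg) auto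
  qed
  have C1_0: "0 \<le> C1" by (simp add: C1_def)
  have cu: "continuous_on Q (\<lambda>x. u j (fst x) (snd x))" for j
    unfolding u_def by (intro continuous_intros cF F e)
  have cm: "continuous_on Q (\<lambda>x. m (fst x) (snd x))"
    unfolding m_def using p by (intro continuous_on_powr' continuous_intros cF F) auto
  have cA: "continuous_on Q (\<lambda>x. A (fst x))" and cB: "continuous_on Q (\<lambda>x. B (snd x))"
    unfolding A_def B_def by (intro continuous_intros)+
  have cA': "continuous_on S A" and cB': "continuous_on S B" for S
    unfolding A_def B_def by (intro continuous_intros)+
  have slice: "continuous_on {al..ga} (\<lambda>\<sigma>. f (\<sigma>, t))" if "continuous_on Q f" "t \<in> {0..1}" for f :: "_ \<Rightarrow> real" and t
    by (rule continuous_on_compose2[OF that(1)]) (use that(2) in \<open>auto simp: Q_def intro!: continuous_intros\<close>)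
  have slice': "continuous_on {0..1} (\<lambda>t. f (\<sigma>, t))" if "continuous_on Q f" "\<sigma> \<in> {al..ga}" for f :: "_ \<Rightarrow> real" and \<sigma>
    by (rule continuous_on_compose2[OF that(1)]) (use that(2) in \<open>auto simp: Q_def intro!: continuous_intros\<close>)
  note sl = slice[OF cu, simplified] slice'[OF cu, simplified] slice[OF cm, simplified] slice'[OF cm, simplified]
  have setQ: "Q \<in> sets M2" "emeasure M2 Q < \<infinity>"
    using compQ emeasure_bounded_finite[OF compact_imp_bounded[OF compQ]]
    by (auto simp: M2_def lborel_prod compact_imp_closed)
  have mQ: "(\<lambda>x. indicator Q x * f x) \<in> borel_measurable M2" if "continuous_on Q f" for f :: "_ \<Rightarrow> real"
    using integrable_box[of al ga 0 1 f] that by (auto simp: Q_def M2_def)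
  have mI: "(\<lambda>x. indicator {a..b} x * f x) \<in> borel_measurable borel" if "continuous_on {a..b} f" for f :: "real \<Rightarrow> real" and a b
    using borel_integrable_atLeastAtMost'[OF that] by (auto simp: set_integrable_def)
  have alga: "al \<in> {al..ga}" "ga \<in> {al..ga}" using al by auto

  have iI: "integrable lborel (\<lambda>x. indicator {a..b} x * f x)" if "continuous_on {a..b} f" for f :: "real \<Rightarrow> real" and a b
    using borel_integrable_atLeastAtMost'[OF that] by (auto simp: set_integrable_def)
  have iQ: "integrable M2 (\<lambda>x. indicator Q x * f x)" if "continuous_on Q f" for f :: "_ \<Rightarrow> real"
    using integrable_box[of al ga 0 1 f] that by (simp add: Q_def M2_def)
  have I1: "integrable lborel (\<lambda>t. indicator {0..1} t * (B t * ((ga - al) * (m al t + m ga t))))"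
    by (intro iI continuous_intros cB' sl al) (use al in auto)
  have I2: "integrable lborel (\<lambda>\<sigma>. indicator {al..ga} \<sigma> * (A \<sigma> * (m \<sigma> 0 + m \<sigma> 1)))"
    by (intro iI continuous_intros cA' sl al) auto
  have I3: "integrable M2 (\<lambda>x. indicator Q x * ((A (fst x) + B (snd x)) * m (fst x) (snd x)))"
    by (intro iQ continuous_intros cA cB cm)
  have L1: "(\<lambda>j. \<integral>t. indicator {0..1} t * (B t * ((ga - al) * (u j al t + u j ga t))) \<partial>lborel)
      \<longlonglongrightarrow> (\<integral>t. indicator {0..1} t * (B t * ((ga - al) * (m al t + m ga t))) \<partial>lborel)"
  proof (rule bounded_dct(1)[where C = "1 * ((ga - al) * (C1 + C1))"])
    fix j x assume x: "x \<in> {0..1::real}"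
    have "B x * ((ga - al) * (u j al x + u j ga x)) \<le> 1 * ((ga - al) * (C1 + C1))"
      using Bb[OF x] al x ub[of _ x j] C1_0 by (intro mult_mono mult_left_mono add_mono) (auto simp: Q_def)
    moreover have "0 \<le> B x * ((ga - al) * (u j al x + u j ga x))"
      using Bb[OF x] al x ub[of _ x j] by (auto simp: Q_def intro!: mult_nonneg_nonneg)
    ultimately show "\<bar>B x * ((ga - al) * (u j al x + u j ga x))\<bar> \<le> 1 * ((ga - al) * (C1 + C1))" by simp
  qed (auto intro!: mI continuous_intros cB' sl al tendsto_intros ulim)
  have L2: "(\<lambda>j. \<integral>\<sigma>. indicator {al..ga} \<sigma> * (A \<sigma> * (u j \<sigma> 0 + u j \<sigma> 1)) \<partial>lborel)
      \<longlonglongrightarrow> (\<integral>\<sigma>. indicator {al..ga} \<sigma> * (A \<sigma> * (m \<sigma> 0 + m \<sigma> 1)) \<partial>lborel)"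
  proof (rule bounded_dct(1)[where C = "A0 * (C1 + C1)"])
    fix j x assume x: "x \<in> {al..ga}"
    have "A x * (u j x 0 + u j x 1) \<le> A0 * (C1 + C1)"
      using Ab[OF x] x ub[of x _ j] C1_0 by (intro mult_mono mult_left_mono add_mono) (auto simp: Q_def A0_def)
    moreover have "0 \<le> A x * (u j x 0 + u j x 1)"
      using Ab[OF x] x ub[of x _ j] by (auto simp: Q_def intro!: mult_nonneg_nonneg)
    ultimately show "\<bar>A x * (u j x 0 + u j x 1)\<bar> \<le> A0 * (C1 + C1)" by simp
  qed (auto intro!: mI continuous_intros cA' sl al tendsto_intros ulim simp: emeasure_compact_finite[simplified])
  have L3: "(\<lambda>j. \<integral>x. indicator Q x * ((A (fst x) + B (snd x)) * u j (fst x) (snd x)) \<partial>M2)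
      \<longlonglongrightarrow> (\<integral>x. indicator Q x * ((A (fst x) + B (snd x)) * m (fst x) (snd x)) \<partial>M2)"
  proof (rule bounded_dct(1)[where C = "(A0 + 1) * C1"])
    fix j x assume x: "x \<in> Q"
    have "(A (fst x) + B (snd x)) * u j (fst x) (snd x) \<le> (A0 + 1) * C1"
      using Ab[of "fst x"] Bb[of "snd x"] x ub[of "fst x" "snd x" j] C1_0 unfolding QD
      by (intro mult_mono add_mono) (auto simp: QD A0_def)
    moreover have "0 \<le> (A (fst x) + B (snd x)) * u j (fst x) (snd x)"
      using Ab[of "fst x"] Bb[of "snd x"] x ub[of "fst x" "snd x" j] unfolding QD
      by (auto simp: QD intro!: mult_nonneg_nonneg)
    ultimately show "\<bar>(A (fst x) + B (snd x)) * u j (fst x) (snd x)\<bar> \<le> (A0 + 1) * C1" by simp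
  qed (auto intro!: setQ(1) mQ continuous_intros cA cB cu cm tendsto_intros ulim simp: setQ(2)[simplified])

  define l where "l j x = A (fst x) * B (snd x) * lap (p/2) (e j) (F (?z x)) (deriv F (?z x))" for j x
  define l0 where "l0 x = A (fst x) * B (snd x) * k (?z x)" for x
  let ?R = "(\<integral>t. indicator {0..1} t * (B t * ((ga - al) * (m al t + m ga t))) \<partial>lborel)
    + (\<integral>\<sigma>. indicator {al..ga} \<sigma> * (A \<sigma> * (m \<sigma> 0 + m \<sigma> 1)) \<partial>lborel)
    - 2 * (\<integral>x. indicator Q x * ((A (fst x) + B (snd x)) * m (fst x) (snd x)) \<partial>M2)"
  have "(\<lambda>j. (\<integral>t. indicator {0..1} t * (B t * ((ga - al) * (u j al t + u j ga t))) \<partial>lborel)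
    + (\<integral>\<sigma>. indicator {al..ga} \<sigma> * (A \<sigma> * (u j \<sigma> 0 + u j \<sigma> 1)) \<partial>lborel)
    - 2 * (\<integral>x. indicator Q x * ((A (fst x) + B (snd x)) * u j (fst x) (snd x)) \<partial>M2)) \<longlonglongrightarrow> ?R"
    by (intro tendsto_intros L1 L2 L3)
  moreover have "(\<integral>x. indicator Q x * l j x \<partial>M2) = (\<integral>t. indicator {0..1} t * (B t * ((ga - al) * (u j al t + u j ga t))) \<partial>lborel)
    + (\<integral>\<sigma>. indicator {al..ga} \<sigma> * (A \<sigma> * (u j \<sigma> 0 + u j \<sigma> 1)) \<partial>lborel)
    - 2 * (\<integral>x. indicator Q x * ((A (fst x) + B (snd x)) * u j (fst x) (snd x)) \<partial>M2)" for j
    using green_regularised[OF F al e(1)[of j], of "p/2"]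
    unfolding l_def u_def A_def B_def Q_def M2_def set_lebesgue_integral_def real_scaleR_def .
  ultimately have LR: "(\<lambda>j. \<integral>x. indicator Q x * l j x \<partial>M2) \<longlonglongrightarrow> ?R" by simp
  have cl: "continuous_on Q (l j)" for j
    unfolding l_def by (intro continuous_intros cA cB cF F F1 e)
  have il: "integrable M2 (\<lambda>x. indicator Q x * l j x)" for j
    using integrable_box[of al ga 0 1 "l j"] cl by (simp add: Q_def M2_def)
  have l0n: "0 \<le> l j x" if "x \<in> Q" for j x
    unfolding l_def using that Ab[of "fst x"] Bb[of "snd x"] p e[of j]
    by (intro mult_nonneg_nonneg lap_nonneg) (auto simp: QD)
  have l00: "0 \<le> l0 x" if "x \<in> Q" for x
    unfolding l0_def k_def using that Ab[of "fst x"] Bb[of "snd x"]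
    by (intro mult_nonneg_nonneg) (auto simp: QD)
  have ae: "AE x in M2. x \<in> Q \<longrightarrow> F (?z x) \<noteq> 0 \<or> deriv F (?z x) = 0"
    using AE_zero_imp_deriv_zero[OF F] unfolding M2_def by eventually_elim (use al in \<open>auto simp: QD\<close>)
  have llim: "AE x in M2. (\<lambda>j. indicator Q x * l j x) \<longlonglongrightarrow> indicator Q x * l0 x"
    using ae
  proof eventually_elim
    case (elim x)
    show ?case
    proof (cases "x \<in> Q")
      case True
      then show ?thesis using elim unfolding l_def l0_def k_def
        by (intro tendsto_mult tendsto_const lap_tendsto e0) auto
    qed auto
  qed
  have ml0: "(\<lambda>x. indicator Q x * l0 x) \<in> borel_measurable M2"
  proof -
    have 1: "(\<lambda>x. indicator Q x *\<^sub>R G (?z x)) \<in> borel_measurable M2" if "G holomorphic_on {s. Re s > c}" for G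
      unfolding M2_def lborel_prod
      using borel_measurable_continuous_on_indicator[OF _ cF[OF that]] compact_imp_closed[OF compQ]
      by (auto)
    have "(\<lambda>x. (indicator Q x * A (fst x)) * (indicator Q x * B (snd x)) *
       (p\<^sup>2 * (norm (indicator Q x *\<^sub>R F (?z x)) powr (p - 2) * (norm (indicator Q x *\<^sub>R deriv F (?z x)))\<^sup>2))) \<in> borel_measurable M2"
      using 1[OF F, measurable] 1[OF F1, measurable] mQ[OF cA, measurable] mQ[OF cB, measurable] by measurable
    then show ?thesis
      by (rule measurable_cong[THEN iffD1, rotated]) (auto simp: l0_def k_def indicator_def)
  qed
  have "integrable M2 (\<lambda>x. indicator Q x * l0 x) \<and> (\<lambda>j. \<integral>x. indicator Q x * l j x \<partial>M2) \<longlonglongrightarrow> (\<integral>x. indicator Q x * l0 x \<partial>M2)"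
  proof (cases "p < 2")
    case False
    have "\<bar>l j x\<bar> \<le> A0 * 1 * (p\<^sup>2 * (C\<^sup>2 + 1) powr (p / 2 - 1) * C\<^sup>2)" if x: "x \<in> Q" for j x
    proof -
      have "l j x \<le> A0 * 1 * (p\<^sup>2 * (C\<^sup>2 + 1) powr (p / 2 - 1) * C\<^sup>2)"
        unfolding l_def using Ab[of "fst x"] Bb[of "snd x"] x C[OF x] False e[of j]
        by (intro mult_mono lap_le_large_exponent mult_nonneg_nonneg lap_nonneg) (auto simp: QD A0_def)
      then show ?thesis using l0n[OF x, of j] by simp
    qed
    moreover have "AE x in M2. x \<in> Q \<longrightarrow> (\<lambda>j. l j x) \<longlonglongrightarrow> l0 x"
      using llim by eventually_elim auto
    ultimately show ?thesis
      by (intro conjI bounded_dct[OF setQ mQ[OF cl] ml0])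
  next
    case True
    have nl: "(\<integral>\<^sup>+x. ennreal (indicator Q x * l j x) \<partial>M2) = ennreal (\<integral>x. indicator Q x * l j x \<partial>M2)" for j
      by (rule nn_integral_eq_integral[OF il]) (use l0n in \<open>auto simp: indicator_def\<close>)
    have "(\<integral>\<^sup>+x. ennreal (indicator Q x * l0 x) \<partial>M2) = (\<integral>\<^sup>+x. liminf (\<lambda>j. ennreal (indicator Q x * l j x)) \<partial>M2)"
      using llim
      by (intro nn_integral_cong_AE, eventually_elim)
         (auto intro!: lim_imp_Liminf[symmetric] tendsto_ennrealI)
    also have "\<dots> \<le> liminf (\<lambda>j. \<integral>\<^sup>+x. ennreal (indicator Q x * l j x) \<partial>M2)"
      by (rule nn_integral_liminf) (use mQ[OF cl] in simp)
    also have "\<dots> = ennreal ?R"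
      unfolding nl by (intro lim_imp_Liminf tendsto_ennrealI LR) auto
    finally have "(\<integral>\<^sup>+x. ennreal (indicator Q x * l0 x) \<partial>M2) < \<infinity>" by (simp add: le_less_trans)
    then have il0: "integrable M2 (\<lambda>x. indicator Q x * l0 x)"
      by (intro integrableI_nonneg ml0) (use l00 in \<open>auto simp: indicator_def\<close>)
    have dom: "AE x in M2. norm (indicator Q x * l j x) \<le> (2 / p) * (indicator Q x * l0 x)" for j
      using ae
    proof eventually_elim
      case (elim x)
      show ?case
      proof (cases "x \<in> Q")
        case x: True
        have "l j x \<le> A (fst x) * B (snd x) * ((2 / p) * k (?z x))"
          unfolding l_def k_def using Ab[of "fst x"] Bb[of "snd x"] x elim True p e[of j]
          by (intro mult_left_mono lap_le_small_exponent mult_nonneg_nonneg) (auto simp: QD)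
        then show ?thesis using x l0n[OF x, of j] by (simp add: l0_def mult_ac)
      qed auto
    qed
    have "integrable M2 (\<lambda>x. (2 / p) * (indicator Q x * l0 x))" using il0 by simp
    from integral_dominated_convergence[OF ml0 mQ[OF cl] this llim dom]
    show ?thesis using il0 by blast
  qed
  then have I0: "integrable M2 (\<lambda>x. indicator Q x * l0 x)" and E: "(\<integral>x. indicator Q x * l0 x \<partial>M2) = ?R"
    using LIMSEQ_unique[OF LR] by auto
  have m0: "0 \<le> m \<sigma> t" for \<sigma> t by (simp add: m_def)
  let ?I1 = "\<integral>t. indicator {0..1} t * (B t * ((ga - al) * (m al t + m ga t))) \<partial>lborel"
  let ?I2 = "\<integral>\<sigma>. indicator {al..ga} \<sigma> * (A \<sigma> * (m \<sigma> 0 + m \<sigma> 1)) \<partial>lborel"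
  let ?I3 = "\<integral>x. indicator Q x * ((A (fst x) + B (snd x)) * m (fst x) (snd x)) \<partial>M2"
  let ?I0 = "\<integral>x. indicator Q x * l0 x \<partial>M2"
  have n1: "0 \<le> indicator {0..1} t * (B t * ((ga - al) * (m al t + m ga t)))" for t
    using Bb[of t] al m0[of al t] m0[of ga t] by (auto simp: indicator_def intro!: mult_nonneg_nonneg)
  have n2: "0 \<le> indicator {al..ga} \<sigma> * (A \<sigma> * (m \<sigma> 0 + m \<sigma> 1))" for \<sigma>
    using Ab[of \<sigma>] m0[of \<sigma> 0] m0[of \<sigma> 1] by (auto simp: indicator_def intro!: mult_nonneg_nonneg)
  have n3: "0 \<le> indicator Q x * ((A (fst x) + B (snd x)) * m (fst x) (snd x))" for x
    using Ab[of "fst x"] Bb[of "snd x"] m0 by (auto simp: indicator_def QD intro!: mult_nonneg_nonneg)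
  have n0: "0 \<le> indicator Q x * l0 x" for x using l00[of x] by (auto simp: indicator_def)
  have "ennreal ?I0 + 2 * ennreal ?I3 = ennreal (?I0 + 2 * ?I3)"
  proof -
    have "0 \<le> ?I0" "0 \<le> ?I3"
      by (intro integral_nonneg_AE AE_I2 n0 n3)+
    then show ?thesis by (simp add: ennreal_mult'')
  qed
  also have "\<dots> = ennreal (?I1 + ?I2)" using E by simp
  also have "\<dots> = ennreal ?I1 + ennreal ?I2"
    by (intro ennreal_plus integral_nonneg_AE AE_I2 n1 n2)
  finally show ?thesis
    unfolding nn_integral_eq_integral[OF I1 AE_I2[OF n1]] nn_integral_eq_integral[OF I2 AE_I2[OF n2]]
      nn_integral_eq_integral[OF I3 AE_I2[OF n3]] nn_integral_eq_integral[OF I0 AE_I2[OF n0], unfolded l0_def]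
      l0_def .
qed

section \<open>Littlewood--Paley formula for rotation-equivariant random holomorphic functions\<close>

lemma nn_integral_parabola: "(\<integral>\<^sup>+t. ennreal (indicator {0..1} t * (t * (1 - t))) \<partial>lborel) = ennreal (1/6)"
proof -
  have "(\<integral>t. indicator {0..1::real} t *\<^sub>R (t * (1 - t)) \<partial>lborel) = (1^2/2 - 1^3/3) - (0^2/2 - 0^3/3)"
    by (rule integral_FTC_atLeastAtMost)
       (auto intro!: derivative_eq_intros continuous_intros simp: power2_eq_square algebra_simps
          simp flip: has_real_derivative_iff_has_vector_derivative)
  moreover have "(\<integral>\<^sup>+t. ennreal (indicator {0..1} t * (t * (1 - t))) \<partial>lborel) = ennreal (\<integral>t. indicator {0..1::real} t * (t * (1 - t)) \<partial>lborel)"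
  proof (intro nn_integral_eq_integral)
    have "set_integrable lborel {0..1} (\<lambda>t::real. t * (1 - t))"
      by (intro borel_integrable_atLeastAtMost' continuous_intros)
    then show "integrable lborel (\<lambda>t. indicator {0..1::real} t * (t * (1 - t)))"
      by (simp add: set_integrable_def)
  qed (auto simp: indicator_def)
  ultimately show ?thesis by simp
qed

text \<open>
  A random holomorphic function on \<open>Re s > c\<close> for which rotation of the sample point is vertical
  translation.  Equivariance is demanded at every point and not only almost everywhere, so that it may be
  used at all times simultaneously; holomorphy is only almost sure, and therefore \<open>X'\<close> is a separate
  jointly measurable version of the derivative.
\<close>

locale equivariant_family =
  fixes X X' :: "(nat \<Rightarrow> complex) \<Rightarrow> complex \<Rightarrow> complex" and c p :: real
  assumes p: "1 \<le> p"
    and X_measurable: "(\<lambda>z. X (fst z) (snd z)) \<in> borel_measurable (torus_measure \<Otimes>\<^sub>M borel)"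
    and X'_measurable: "(\<lambda>z. X' (fst z) (snd z)) \<in> borel_measurable (torus_measure \<Otimes>\<^sub>M borel)"
    and X_rot: "X (rot t \<xi>) s = X \<xi> (s + \<i> * of_real t)"
    and X'_rot: "X' (rot t \<xi>) s = X' \<xi> (s + \<i> * of_real t)"
    and X_holomorphic: "AE \<xi> in torus_measure. X \<xi> holomorphic_on {s. Re s > c} \<and> (\<forall>s. Re s > c \<longrightarrow> deriv (X \<xi>) s = X' \<xi> s)"
begin

definition pmean :: "real \<Rightarrow> ennreal" where
  "pmean \<sigma> = (\<integral>\<^sup>+\<xi>. ennreal (norm (X \<xi> (of_real \<sigma>)) powr p) \<partial>torus_measure)"

definition lp_density :: "(nat \<Rightarrow> complex) \<Rightarrow> complex \<Rightarrow> real" where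
  "lp_density \<xi> s = p\<^sup>2 * (norm (X \<xi> s) powr (p - 2) * (norm (X' \<xi> s))\<^sup>2)"

definition mean_density :: "real \<Rightarrow> ennreal" where
  "mean_density \<sigma> = (\<integral>\<^sup>+\<xi>. ennreal (lp_density \<xi> (of_real \<sigma>)) \<partial>torus_measure)"

lemma X_meas_comp:
  assumes "f \<in> N \<rightarrow>\<^sub>M torus_measure" "g \<in> borel_measurable N"
  shows "(\<lambda>x. X (f x) (g x)) \<in> borel_measurable N" "(\<lambda>x. X' (f x) (g x)) \<in> borel_measurable N"
  using measurable_compose[OF measurable_Pair[OF assms] X_measurable]
    measurable_compose[OF measurable_Pair[OF assms] X'_measurable] by auto

lemma lp_density_meas_comp:
  assumes "f \<in> N \<rightarrow>\<^sub>M torus_measure" "g \<in> borel_measurable N"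
  shows "(\<lambda>x. lp_density (f x) (g x)) \<in> borel_measurable N"
  using X_meas_comp[OF assms, measurable] unfolding lp_density_def by measurable

lemma Complex_measurable:
  assumes "f \<in> borel_measurable N" "g \<in> borel_measurable N"
  shows "(\<lambda>x. Complex (f x) (g x)) \<in> borel_measurable N"
  using assms unfolding Complex_eq by measurable

lemma Complex_shift: "of_real \<sigma> + \<i> * of_real t = Complex \<sigma> t"
  by (simp add: complex_eq_iff)

lemma pmean_shift: "(\<integral>\<^sup>+\<xi>. ennreal (norm (X \<xi> (Complex \<sigma> t)) powr p) \<partial>torus_measure) = pmean \<sigma>"
proof -
  note [measurable] = X_meas_comp[of "\<lambda>x. x" torus_measure "\<lambda>_. of_real \<sigma>", simplified]
  show ?thesis
    using nn_integral_rot[of "\<lambda>\<xi>. ennreal (norm (X \<xi> (of_real \<sigma>)) powr p)" t]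
    by (simp add: pmean_def X_rot Complex_shift)
qed

lemma mean_density_shift: "(\<integral>\<^sup>+\<xi>. ennreal (lp_density \<xi> (Complex \<sigma> t)) \<partial>torus_measure) = mean_density \<sigma>"
proof -
  note [measurable] = lp_density_meas_comp[of "\<lambda>x. x" torus_measure "\<lambda>_. of_real \<sigma>", simplified]
  have "lp_density (rot t \<xi>) (of_real \<sigma>) = lp_density \<xi> (Complex \<sigma> t)" for \<xi>
    by (simp add: lp_density_def X_rot X'_rot Complex_shift)
  then show ?thesis
    using nn_integral_rot[of "\<lambda>\<xi>. ennreal (lp_density \<xi> (of_real \<sigma>))" t] by (simp add: mean_density_def)
qed

lemma lp_density_nonneg: "0 \<le> lp_density \<xi> s" by (simp add: lp_density_def)

lemma pmean_measurable [measurable]: "pmean \<in> borel_measurable borel"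
  unfolding pmean_def
  by (rule TM.borel_measurable_nn_integral)
     (use X_meas_comp[of snd "borel \<Otimes>\<^sub>M torus_measure" "\<lambda>x. of_real (fst x)", measurable] in \<open>simp add: case_prod_beta'\<close>)

lemma mean_density_measurable [measurable]: "mean_density \<in> borel_measurable borel"
  unfolding mean_density_def
  by (rule TM.borel_measurable_nn_integral)
     (use lp_density_meas_comp[of snd "borel \<Otimes>\<^sub>M torus_measure" "\<lambda>x. of_real (fst x)", measurable] in \<open>simp add: case_prod_beta'\<close>)

sublocale PB: pair_sigma_finite torus_measure "lborel \<Otimes>\<^sub>M lborel :: (real \<times> real) measure" ..

lemma expectation_weighted_box:
  assumes [measurable]: "w \<in> borel_measurable (lborel \<Otimes>\<^sub>M lborel)" and w: "\<And>x. 0 \<le> (w x :: real)"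
  shows "(\<integral>\<^sup>+\<xi>. (\<integral>\<^sup>+x. ennreal (w x * norm (X \<xi> (Complex (fst x) (snd x))) powr p) \<partial>(lborel \<Otimes>\<^sub>M lborel)) \<partial>torus_measure)
      = (\<integral>\<^sup>+\<sigma>. (\<integral>\<^sup>+t. ennreal (w (\<sigma>, t)) \<partial>lborel) * pmean \<sigma> \<partial>lborel)"
    and "(\<integral>\<^sup>+\<xi>. (\<integral>\<^sup>+x. ennreal (w x * lp_density \<xi> (Complex (fst x) (snd x))) \<partial>(lborel \<Otimes>\<^sub>M lborel)) \<partial>torus_measure)
      = (\<integral>\<^sup>+\<sigma>. (\<integral>\<^sup>+t. ennreal (w (\<sigma>, t)) \<partial>lborel) * mean_density \<sigma> \<partial>lborel)"
proof -
  note [measurable] = Complex_measurable[of fst "lborel \<Otimes>\<^sub>M lborel" snd, simplified]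
  have C: "(\<lambda>x. Complex (fst (snd x)) (snd (snd x))) \<in> borel_measurable (torus_measure \<Otimes>\<^sub>M (lborel \<Otimes>\<^sub>M lborel))"
    by (intro Complex_measurable) auto
  note [measurable] = X_meas_comp[of fst, OF _ C, simplified] lp_density_meas_comp[of fst, OF _ C, simplified]
  note [measurable] = X_meas_comp[of "\<lambda>x. x" torus_measure "\<lambda>_. s" for s, simplified] lp_density_meas_comp[of "\<lambda>x. x" torus_measure "\<lambda>_. s" for s, simplified]
  have gen: "(\<integral>\<^sup>+\<xi>. (\<integral>\<^sup>+x. ennreal (w x * f \<xi> (Complex (fst x) (snd x))) \<partial>(lborel \<Otimes>\<^sub>M lborel)) \<partial>torus_measure)
      = (\<integral>\<^sup>+\<sigma>. (\<integral>\<^sup>+t. ennreal (w (\<sigma>, t)) \<partial>lborel) * g \<sigma> \<partial>lborel)"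
    if fm[measurable]: "(\<lambda>x. f (fst x) (Complex (fst (snd x)) (snd (snd x)))) \<in> borel_measurable (torus_measure \<Otimes>\<^sub>M (lborel \<Otimes>\<^sub>M lborel))"
      and f1[measurable]: "\<And>s. (\<lambda>\<xi>. f \<xi> s) \<in> borel_measurable torus_measure"
      and f0: "\<And>\<xi> s. 0 \<le> (f \<xi> s :: real)" and g: "\<And>\<sigma> t. (\<integral>\<^sup>+\<xi>. ennreal (f \<xi> (Complex \<sigma> t)) \<partial>torus_measure) = g \<sigma>"
      and gm[measurable]: "g \<in> borel_measurable borel"
    for f g
  proof -
    have "(\<integral>\<^sup>+\<xi>. (\<integral>\<^sup>+x. ennreal (w x * f \<xi> (Complex (fst x) (snd x))) \<partial>(lborel \<Otimes>\<^sub>M lborel)) \<partial>torus_measure)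
      = (\<integral>\<^sup>+x. (\<integral>\<^sup>+\<xi>. ennreal (w x * f \<xi> (Complex (fst x) (snd x))) \<partial>torus_measure) \<partial>(lborel \<Otimes>\<^sub>M lborel))"
      by (rule PB.Fubini'[symmetric]) (simp add: case_prod_beta')
    also have "\<dots> = (\<integral>\<^sup>+x. ennreal (w x) * g (fst x) \<partial>(lborel \<Otimes>\<^sub>M lborel))"
      using w f0 by (intro nn_integral_cong) (simp add: ennreal_mult nn_integral_cmult g)
    also have "\<dots> = (\<integral>\<^sup>+\<sigma>. (\<integral>\<^sup>+t. ennreal (w (\<sigma>, t)) * g \<sigma> \<partial>lborel) \<partial>lborel)"
      by (subst lborel.nn_integral_fst[symmetric]) auto
    also have "\<dots> = (\<integral>\<^sup>+\<sigma>. (\<integral>\<^sup>+t. ennreal (w (\<sigma>, t)) \<partial>lborel) * g \<sigma> \<partial>lborel)"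
      by (intro nn_integral_cong nn_integral_multc) measurable
    finally show ?thesis .
  qed
  show "(\<integral>\<^sup>+\<xi>. (\<integral>\<^sup>+x. ennreal (w x * norm (X \<xi> (Complex (fst x) (snd x))) powr p) \<partial>(lborel \<Otimes>\<^sub>M lborel)) \<partial>torus_measure)
      = (\<integral>\<^sup>+\<sigma>. (\<integral>\<^sup>+t. ennreal (w (\<sigma>, t)) \<partial>lborel) * pmean \<sigma> \<partial>lborel)"
    by (rule gen[of "\<lambda>\<xi> s. norm (X \<xi> s) powr p"]) (auto simp: pmean_shift)
  show "(\<integral>\<^sup>+\<xi>. (\<integral>\<^sup>+x. ennreal (w x * lp_density \<xi> (Complex (fst x) (snd x))) \<partial>(lborel \<Otimes>\<^sub>M lborel)) \<partial>torus_measure)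
      = (\<integral>\<^sup>+\<sigma>. (\<integral>\<^sup>+t. ennreal (w (\<sigma>, t)) \<partial>lborel) * mean_density \<sigma> \<partial>lborel)"
    by (rule gen[of lp_density]) (auto simp: mean_density_shift lp_density_nonneg)
qed

lemma expectation_weighted_line:
  fixes w a b :: "real \<Rightarrow> real"
  assumes [measurable]: "w \<in> borel_measurable borel" "a \<in> borel_measurable borel" "b \<in> borel_measurable borel"
    and w: "\<And>x. 0 \<le> w x"
  shows "(\<integral>\<^sup>+\<xi>. (\<integral>\<^sup>+x. ennreal (w x * norm (X \<xi> (Complex (a x) (b x))) powr p) \<partial>lborel) \<partial>torus_measure)
      = (\<integral>\<^sup>+x. ennreal (w x) * pmean (a x) \<partial>lborel)"
proof -
  have C: "(\<lambda>x. Complex (a (snd x)) (b (snd x))) \<in> borel_measurable (torus_measure \<Otimes>\<^sub>M lborel)"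
    by (intro Complex_measurable) auto
  note [measurable] = X_meas_comp(1)[of fst, OF _ C, simplified]
  note [measurable] = X_meas_comp(1)[of "\<lambda>x. x" torus_measure "\<lambda>_. s" for s, simplified]
  have "(\<integral>\<^sup>+\<xi>. (\<integral>\<^sup>+x. ennreal (w x * norm (X \<xi> (Complex (a x) (b x))) powr p) \<partial>lborel) \<partial>torus_measure)
      = (\<integral>\<^sup>+x. (\<integral>\<^sup>+\<xi>. ennreal (w x * norm (X \<xi> (Complex (a x) (b x))) powr p) \<partial>torus_measure) \<partial>lborel)"
    using torus_Fubini[of "\<lambda>\<xi> x. ennreal (w x * norm (X \<xi> (Complex (a x) (b x))) powr p)"]
    by (simp add: case_prod_beta')
  also have "\<dots> = (\<integral>\<^sup>+x. ennreal (w x) * pmean (a x) \<partial>lborel)"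
    using w by (intro nn_integral_cong) (simp add: ennreal_mult nn_integral_cmult pmean_shift)
  finally show ?thesis .
qed

text \<open>
  The expectation of Green's identity.  By stationarity each integral factors into a weight in \<open>t\<close> and a
  mean depending on \<open>\<sigma>\<close> alone.  The boundary terms at \<open>t = 0\<close> and \<open>t = 1\<close> give twice the \<open>\<sigma>\<close>-integral of \<open>pmean\<close> against
  the parabola in \<open>\<sigma>\<close>, and the same quantity occurs on the other side: it cancels, and \<open>1/6\<close>, the
  integral of the parabola in \<open>t\<close>, is a common factor of what remains.
\<close>

lemma mean_green:
  assumes al: "c < al" "al \<le> ga" and bd: "\<And>\<sigma>. \<sigma> > c \<Longrightarrow> pmean \<sigma> \<le> ennreal C"
  shows "(\<integral>\<^sup>+\<sigma>. ennreal (indicator {al..ga} \<sigma> * ((\<sigma> - al) * (ga - \<sigma>))) * mean_density \<sigma> \<partial>lborel)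
     + 2 * (\<integral>\<^sup>+\<sigma>. indicator {al..ga} \<sigma> * pmean \<sigma> \<partial>lborel) = ennreal (ga - al) * (pmean al + pmean ga)"
proof -
  define Q where "Q = {al..ga} \<times> {0..1::real}"
  define A where "A = (\<lambda>\<sigma>. (\<sigma> - al) * (ga - \<sigma>))"
  define B where "B = (\<lambda>t::real. t * (1 - t))"
  let ?M2 = "lborel \<Otimes>\<^sub>M lborel :: (real \<times> real) measure"
  have sf2: "sigma_finite_measure ?M2" unfolding lborel_prod by (rule lborel.sigma_finite_measure_axioms)
  have [measurable]: "A \<in> borel_measurable borel" "B \<in> borel_measurable borel" unfolding A_def B_def by measurable
  have [measurable]: "Q \<in> sets ?M2" by (simp add: Q_def)
  have Q: "indicator Q (\<sigma>, t) = (indicator {al..ga} \<sigma> * indicator {0..1} t :: real)" for \<sigma> t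
    by (auto simp: Q_def indicator_def)
  have Ann: "0 \<le> indicator {al..ga} \<sigma> * A \<sigma>" for \<sigma> by (auto simp: A_def indicator_def)
  have Bnn: "0 \<le> indicator {0..1} t * B t" for t by (auto simp: B_def indicator_def)
  have IB: "(\<integral>\<^sup>+t. ennreal (indicator {0..1} t * B t) \<partial>lborel) = ennreal (1/6)"
    unfolding B_def by (rule nn_integral_parabola)
  define h where "h = (\<integral>\<^sup>+\<sigma>. ennreal (indicator {al..ga} \<sigma> * A \<sigma>) * mean_density \<sigma> \<partial>lborel)"
  define mA where "mA = (\<integral>\<^sup>+\<sigma>. ennreal (indicator {al..ga} \<sigma> * A \<sigma>) * pmean \<sigma> \<partial>lborel)"
  define m1 where "m1 = (\<integral>\<^sup>+\<sigma>. indicator {al..ga} \<sigma> * pmean \<sigma> \<partial>lborel)"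
  let ?m = "\<lambda>\<xi> \<sigma> t. norm (X \<xi> (Complex \<sigma> t)) powr p"
  define E0 where "E0 \<xi> = (\<integral>\<^sup>+x. ennreal ((indicator Q x * (A (fst x) * B (snd x))) * lp_density \<xi> (Complex (fst x) (snd x))) \<partial>?M2)" for \<xi>
  define E1 where "E1 \<xi> = (\<integral>\<^sup>+x. ennreal ((indicator Q x * (A (fst x) + B (snd x))) * ?m \<xi> (fst x) (snd x)) \<partial>?M2)" for \<xi>
  define E2 where "E2 s \<xi> = (\<integral>\<^sup>+t. ennreal ((indicator {0..1} t * B t * (ga - al)) * ?m \<xi> s t) \<partial>lborel)" for \<xi> s
  define E3 where "E3 t \<xi> = (\<integral>\<^sup>+\<sigma>. ennreal ((indicator {al..ga} \<sigma> * A \<sigma>) * ?m \<xi> \<sigma> t) \<partial>lborel)" for \<xi> t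
  have C2: "(\<lambda>x. Complex (fst (snd x)) (snd (snd x))) \<in> borel_measurable (torus_measure \<Otimes>\<^sub>M (lborel \<Otimes>\<^sub>M lborel))"
    by (intro Complex_measurable) auto
  note [measurable] = X_meas_comp(1)[of fst, OF _ C2, simplified] lp_density_meas_comp[of fst, OF _ C2, simplified]
  have C3: "(\<lambda>x. Complex a (snd x)) \<in> borel_measurable (torus_measure \<Otimes>\<^sub>M lborel)"
      "(\<lambda>x. Complex (snd x) a) \<in> borel_measurable (torus_measure \<Otimes>\<^sub>M lborel)" for a
    by (intro Complex_measurable; auto)+
  note [measurable] = X_meas_comp(1)[of fst, OF _ C3(1), simplified] X_meas_comp(1)[of fst, OF _ C3(2), simplified]
  have mE[measurable]: "E0 \<in> borel_measurable torus_measure" "E1 \<in> borel_measurable torus_measure"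
     "E2 s \<in> borel_measurable torus_measure" "E3 s \<in> borel_measurable torus_measure" for s
    unfolding E0_def E1_def E2_def E3_def
    by (intro sigma_finite_measure.borel_measurable_nn_integral[OF sf2] lborel.borel_measurable_nn_integral; simp add: case_prod_beta')+
  have pathwise: "AE \<xi> in torus_measure. E0 \<xi> + 2 * E1 \<xi> = (E2 al \<xi> + E2 ga \<xi>) + (E3 0 \<xi> + E3 1 \<xi>)"
    using X_holomorphic AE_space
  proof eventually_elim
    case (elim \<xi>)
    have [measurable]: "(\<lambda>t. X \<xi> (Complex s t)) \<in> borel_measurable lborel" "(\<lambda>t. X \<xi> (Complex t s)) \<in> borel_measurable lborel" for s
      using elim by (auto intro!: X_meas_comp Complex_measurable)
    have eE2: "(\<integral>\<^sup>+t. ennreal (indicator {0..1} t * (B t * ((ga - al) * (?m \<xi> al t + ?m \<xi> ga t)))) \<partial>lborel) = E2 al \<xi> + E2 ga \<xi>"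
    proof -
      have "ennreal (indicator {0..1} t * (B t * ((ga - al) * (?m \<xi> al t + ?m \<xi> ga t)))) =
         ennreal ((indicator {0..1} t * B t * (ga - al)) * ?m \<xi> al t) + ennreal ((indicator {0..1} t * B t * (ga - al)) * ?m \<xi> ga t)" for t
      proof -
        have n: "0 \<le> indicator {0..1} t * B t * (ga - al)" using Bnn[of t] al by simp
        have "ennreal ((indicator {0..1} t * B t * (ga - al)) * ?m \<xi> al t) + ennreal ((indicator {0..1} t * B t * (ga - al)) * ?m \<xi> ga t)
          = ennreal ((indicator {0..1} t * B t * (ga - al)) * ?m \<xi> al t + (indicator {0..1} t * B t * (ga - al)) * ?m \<xi> ga t)"
          by (rule ennreal_plus[symmetric]) (intro mult_nonneg_nonneg[OF n] powr_ge_zero)+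
        then show ?thesis by (simp only: distrib_left mult.assoc)
      qed
      then show ?thesis unfolding E2_def by (subst nn_integral_add[symmetric]) auto
    qed
    have eE3: "(\<integral>\<^sup>+\<sigma>. ennreal (indicator {al..ga} \<sigma> * (A \<sigma> * (?m \<xi> \<sigma> 0 + ?m \<xi> \<sigma> 1))) \<partial>lborel) = E3 0 \<xi> + E3 1 \<xi>"
    proof -
      have "ennreal (indicator {al..ga} \<sigma> * (A \<sigma> * (?m \<xi> \<sigma> 0 + ?m \<xi> \<sigma> 1))) =
         ennreal ((indicator {al..ga} \<sigma> * A \<sigma>) * ?m \<xi> \<sigma> 0) + ennreal ((indicator {al..ga} \<sigma> * A \<sigma>) * ?m \<xi> \<sigma> 1)" for \<sigma>
      proof -
        have "ennreal ((indicator {al..ga} \<sigma> * A \<sigma>) * ?m \<xi> \<sigma> 0) + ennreal ((indicator {al..ga} \<sigma> * A \<sigma>) * ?m \<xi> \<sigma> 1)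
          = ennreal ((indicator {al..ga} \<sigma> * A \<sigma>) * ?m \<xi> \<sigma> 0 + (indicator {al..ga} \<sigma> * A \<sigma>) * ?m \<xi> \<sigma> 1)"
          by (rule ennreal_plus[symmetric]) (intro mult_nonneg_nonneg[OF Ann] powr_ge_zero)+
        then show ?thesis by (simp only: distrib_left mult.assoc)
      qed
      then show ?thesis unfolding E3_def by (subst nn_integral_add[symmetric]) auto
    qed
    have e0: "E0 \<xi> = (\<integral>\<^sup>+x. ennreal (indicator Q x * (A (fst x) * B (snd x) * (p\<^sup>2 * (norm (X \<xi> (Complex (fst x) (snd x))) powr (p - 2)
         * (norm (deriv (X \<xi>) (Complex (fst x) (snd x))))\<^sup>2)))) \<partial>?M2)"
      unfolding E0_def
      by (intro nn_integral_cong) (use elim(1) al in \<open>auto simp: Q_def indicator_def lp_density_def mult_ac\<close>)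
    have e1: "E1 \<xi> = (\<integral>\<^sup>+x. ennreal (indicator Q x * ((A (fst x) + B (snd x)) * ?m \<xi> (fst x) (snd x))) \<partial>?M2)"
      unfolding E1_def by (simp add: mult.assoc)
    show ?case
      using green_power[of "X \<xi>" c al ga p] elim al p
      unfolding eE2[symmetric] eE3[symmetric] e0 e1 Q_def A_def B_def by simp
  qed
  have "(\<integral>\<^sup>+\<xi>. E0 \<xi> + 2 * E1 \<xi> \<partial>torus_measure) = (\<integral>\<^sup>+\<xi>. (E2 al \<xi> + E2 ga \<xi>) + (E3 0 \<xi> + E3 1 \<xi>) \<partial>torus_measure)"
    by (rule nn_integral_cong_AE[OF pathwise])
  then have main: "(\<integral>\<^sup>+\<xi>. E0 \<xi> \<partial>torus_measure) + 2 * (\<integral>\<^sup>+\<xi>. E1 \<xi> \<partial>torus_measure) =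
     ((\<integral>\<^sup>+\<xi>. E2 al \<xi> \<partial>torus_measure) + (\<integral>\<^sup>+\<xi>. E2 ga \<xi> \<partial>torus_measure)) + ((\<integral>\<^sup>+\<xi>. E3 0 \<xi> \<partial>torus_measure) + (\<integral>\<^sup>+\<xi>. E3 1 \<xi> \<partial>torus_measure))"
    by (simp add: nn_integral_add nn_integral_cmult)
  have I0: "(\<integral>\<^sup>+\<xi>. E0 \<xi> \<partial>torus_measure) = ennreal (1/6) * h"
  proof -
    have "(\<integral>\<^sup>+\<xi>. E0 \<xi> \<partial>torus_measure) = (\<integral>\<^sup>+\<sigma>. (\<integral>\<^sup>+t. ennreal (indicator Q (\<sigma>, t) * (A (fst (\<sigma>, t)) * B (snd (\<sigma>, t)))) \<partial>lborel) * mean_density \<sigma> \<partial>lborel)"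
      unfolding E0_def
      by (rule expectation_weighted_box) (measurable, auto simp: Q_def A_def B_def indicator_def)
    also have "\<dots> = (\<integral>\<^sup>+\<sigma>. ennreal (1/6) * (ennreal (indicator {al..ga} \<sigma> * A \<sigma>) * mean_density \<sigma>) \<partial>lborel)"
    proof (intro nn_integral_cong)
      fix \<sigma>
      have "(\<integral>\<^sup>+t. ennreal (indicator Q (\<sigma>, t) * (A (fst (\<sigma>, t)) * B (snd (\<sigma>, t)))) \<partial>lborel) =
         (\<integral>\<^sup>+t. ennreal (indicator {al..ga} \<sigma> * A \<sigma>) * ennreal (indicator {0..1} t * B t) \<partial>lborel)"
      proof (intro nn_integral_cong)
        fix t
        show "ennreal (indicator Q (\<sigma>, t) * (A (fst (\<sigma>, t)) * B (snd (\<sigma>, t)))) = ennreal (indicator {al..ga} \<sigma> * A \<sigma>) * ennreal (indicator {0..1} t * B t)"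
          unfolding ennreal_mult[OF Ann Bnn, symmetric] Q by (simp add: mult_ac)
      qed
      also have "\<dots> = ennreal (indicator {al..ga} \<sigma> * A \<sigma>) * ennreal (1/6)"
        by (subst nn_integral_cmult) (auto simp: IB)
      finally show "(\<integral>\<^sup>+t. ennreal (indicator Q (\<sigma>, t) * (A (fst (\<sigma>, t)) * B (snd (\<sigma>, t)))) \<partial>lborel) * mean_density \<sigma> =
         ennreal (1/6) * (ennreal (indicator {al..ga} \<sigma> * A \<sigma>) * mean_density \<sigma>)" by (simp add: mult_ac)
    qed
    also have "\<dots> = ennreal (1/6) * h" unfolding h_def by (rule nn_integral_cmult) measurable
    finally show ?thesis .
  qed
  have I1: "(\<integral>\<^sup>+\<xi>. E1 \<xi> \<partial>torus_measure) = mA + ennreal (1/6) * m1"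
  proof -
    have "(\<integral>\<^sup>+\<xi>. E1 \<xi> \<partial>torus_measure) = (\<integral>\<^sup>+\<sigma>. (\<integral>\<^sup>+t. ennreal (indicator Q (\<sigma>, t) * (A (fst (\<sigma>, t)) + B (snd (\<sigma>, t)))) \<partial>lborel) * pmean \<sigma> \<partial>lborel)"
      unfolding E1_def
      by (rule expectation_weighted_box) (measurable, auto simp: Q_def A_def B_def indicator_def)
    also have "\<dots> = (\<integral>\<^sup>+\<sigma>. ennreal (indicator {al..ga} \<sigma> * A \<sigma>) * pmean \<sigma> + ennreal (1/6) * (indicator {al..ga} \<sigma> * pmean \<sigma>) \<partial>lborel)"
    proof (intro nn_integral_cong)
      fix \<sigma>
      have "(\<integral>\<^sup>+t. ennreal (indicator Q (\<sigma>, t) * (A (fst (\<sigma>, t)) + B (snd (\<sigma>, t)))) \<partial>lborel) =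
         (\<integral>\<^sup>+t. ennreal (indicator {al..ga} \<sigma> * A \<sigma>) * indicator {0..1} t + indicator {al..ga} \<sigma> * ennreal (indicator {0..1} t * B t) \<partial>lborel)"
        unfolding Q by (intro nn_integral_cong) (auto simp: indicator_def A_def B_def)
      also have "\<dots> = ennreal (indicator {al..ga} \<sigma> * A \<sigma>) + indicator {al..ga} \<sigma> * ennreal (1/6)"
        by (subst nn_integral_add) (auto simp: nn_integral_cmult IB)
      finally show "(\<integral>\<^sup>+t. ennreal (indicator Q (\<sigma>, t) * (A (fst (\<sigma>, t)) + B (snd (\<sigma>, t)))) \<partial>lborel) * pmean \<sigma> =
         ennreal (indicator {al..ga} \<sigma> * A \<sigma>) * pmean \<sigma> + ennreal (1/6) * (indicator {al..ga} \<sigma> * pmean \<sigma>)"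
        by (simp add: mult_ac distrib_left)
    qed
    also have "\<dots> = mA + ennreal (1/6) * m1" unfolding mA_def m1_def
      by (subst nn_integral_add) (auto simp: nn_integral_cmult)
    finally show ?thesis .
  qed
  have I2: "(\<integral>\<^sup>+\<xi>. E2 s \<xi> \<partial>torus_measure) = ennreal (1/6) * (ennreal (ga - al) * pmean s)" for s
  proof -
    have "(\<integral>\<^sup>+\<xi>. E2 s \<xi> \<partial>torus_measure) = (\<integral>\<^sup>+t. ennreal (indicator {0..1} t * B t * (ga - al)) * pmean s \<partial>lborel)"
      unfolding E2_def by (rule expectation_weighted_line[of _ "\<lambda>_. s" "\<lambda>t. t"]) (use al in \<open>auto simp: B_def indicator_def\<close>)
    also have "\<dots> = (\<integral>\<^sup>+t. ennreal (indicator {0..1} t * B t) * (ennreal (ga - al) * pmean s) \<partial>lborel)"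
    proof (intro nn_integral_cong)
      fix t
      have "ennreal (indicator {0..1} t * B t * (ga - al)) = ennreal (indicator {0..1} t * B t) * ennreal (ga - al)"
        by (rule ennreal_mult[OF Bnn]) (use al in simp)
      then show "ennreal (indicator {0..1} t * B t * (ga - al)) * pmean s = ennreal (indicator {0..1} t * B t) * (ennreal (ga - al) * pmean s)"
        by (simp only: mult.assoc)
    qed
    also have "\<dots> = ennreal (1/6) * (ennreal (ga - al) * pmean s)"
      by (subst nn_integral_multc) (auto simp: IB)
    finally show ?thesis .
  qed
  have I3: "(\<integral>\<^sup>+\<xi>. E3 t \<xi> \<partial>torus_measure) = mA" for t
    unfolding E3_def mA_def by (rule expectation_weighted_line[of _ "\<lambda>s. s" "\<lambda>_. t"]) (auto simp: A_def indicator_def)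
  have fin_mA: "mA < \<top>"
  proof -
    have "mA \<le> (\<integral>\<^sup>+\<sigma>. ennreal ((ga - al)\<^sup>2 * C) * indicator {al..ga} \<sigma> \<partial>lborel)"
      unfolding mA_def
    proof (intro nn_integral_mono)
      fix \<sigma>
      show "ennreal (indicator {al..ga} \<sigma> * A \<sigma>) * pmean \<sigma> \<le> ennreal ((ga - al)\<^sup>2 * C) * indicator {al..ga} \<sigma>"
      proof (cases "\<sigma> \<in> {al..ga}")
        case True
        have "ennreal (A \<sigma>) * pmean \<sigma> \<le> ennreal ((ga - al)\<^sup>2) * ennreal C"
          using True al by (intro mult_mono bd ennreal_leI) (auto simp: A_def power2_eq_square intro!: mult_mono)
        then show ?thesis using True by (simp add: ennreal_mult')
      qed auto
    qed
    also have "\<dots> < \<top>" by (simp add: nn_integral_cmult emeasure_lborel_Icc_eq ennreal_mult_less_top)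
    finally show ?thesis .
  qed
  have "ennreal (1/6) * h + 2 * (mA + ennreal (1/6) * m1) =
     (ennreal (1/6) * (ennreal (ga - al) * pmean al) + ennreal (1/6) * (ennreal (ga - al) * pmean ga)) + (mA + mA)"
    using main unfolding I0 I1 I2 I3 .
  then have "2 * mA + ennreal (1/6) * (h + 2 * m1) = 2 * mA + ennreal (1/6) * (ennreal (ga - al) * (pmean al + pmean ga))"
    by (simp add: distrib_left distrib_right mult_2 mult_2_right add_ac mult_ac)
  moreover have "2 * mA < \<top>" using fin_mA by (simp add: ennreal_mult_less_top)
  ultimately have e: "ennreal (1/6) * (h + 2 * m1) = ennreal (1/6) * (ennreal (ga - al) * (pmean al + pmean ga))"
    by (auto simp: ennreal_add_left_cancel)
  have six: "ennreal 6 * (ennreal (1/6) * x) = x" for x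
  proof -
    have "ennreal 6 * ennreal (1/6) = 1" by (subst ennreal_mult[symmetric]) auto
    then show ?thesis by (simp add: mult.assoc[symmetric] del: ennreal_numeral)
  qed
  have "h + 2 * m1 = ennreal (ga - al) * (pmean al + pmean ga)"
    using arg_cong[OF e, of "\<lambda>x. ennreal 6 * x"] unfolding six .
  then show ?thesis by (simp add: h_def m1_def A_def)
qed

text \<open>
  This is \<open>m al = m \<infinity> + \<integral> (\<sigma> - al)\<^sup>+ m'' \<sigma> d\<sigma>\<close>.  In \<open>mean_green\<close>, divide by \<open>ga - al\<close> and let \<open>ga\<close> tend to
  infinity: the weight \<open>(\<sigma> - al) (ga - \<sigma>) / (ga - al)\<close> increases to \<open>(\<sigma> - al)\<^sup>+\<close>, and the average of
  \<open>pmean\<close> over \<open>[al, ga]\<close> tends to its limit at infinity.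
\<close>

lemma mean_formula:
  assumes al: "c < al" and bd: "\<And>\<sigma>. \<sigma> > c \<Longrightarrow> pmean \<sigma> \<le> ennreal C"
    and lim: "(pmean \<longlongrightarrow> L) at_top"
  shows "(\<integral>\<^sup>+\<sigma>. ennreal (max 0 (\<sigma> - al)) * mean_density \<sigma> \<partial>lborel) + L = pmean al"
proof -
  \<comment> \<open>The weight \<open>(\<sigma> - al) (ga - \<sigma>) / (ga - al)\<close> for \<open>ga = al + n + 1\<close>, cut off to be 0 outside \<open>[al, ga]\<close>.\<close>
  define w where "w n \<sigma> = max 0 (\<sigma> - al) * max 0 (1 - (\<sigma> - al) / real (Suc n))" for n \<sigma>
  have w_eq: "indicator {al..al + real (Suc n)} \<sigma> * ((\<sigma> - al) * (al + real (Suc n) - \<sigma>)) = real (Suc n) * w n \<sigma>" for n \<sigma>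
  proof (cases "\<sigma> \<in> {al..al + real (Suc n)}")
    case True
    then have "w n \<sigma> = (\<sigma> - al) * (1 - (\<sigma> - al) / real (Suc n))" by (simp add: w_def)
    then show ?thesis using True by (simp add: field_simps)
  next
    case False
    then have "w n \<sigma> = 0" by (auto simp: w_def)
    then show ?thesis using False by (simp del: of_nat_Suc)
  qed
  have w0: "0 \<le> w n \<sigma>" for n \<sigma> by (simp add: w_def)
  have Lfin: "L \<le> ennreal C"
    by (rule tendsto_upperbound[OF lim]) (use bd in \<open>auto intro: eventually_mono[OF eventually_gt_at_top[of c]]\<close>)
  have id: "(\<integral>\<^sup>+\<sigma>. ennreal (w n \<sigma>) * mean_density \<sigma> \<partial>lborel) +
     2 * (\<integral>\<^sup>+y. indicator {0..1} y * pmean (al + real (Suc n) * y) \<partial>lborel) = pmean al + pmean (al + real (Suc n))" for n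
  proof -
    let ?k = "real (Suc n)"
    have "(\<integral>\<^sup>+\<sigma>. ennreal (indicator {al..al + ?k} \<sigma> * ((\<sigma> - al) * (al + ?k - \<sigma>))) * mean_density \<sigma> \<partial>lborel)
     + 2 * (\<integral>\<^sup>+\<sigma>. indicator {al..al + ?k} \<sigma> * pmean \<sigma> \<partial>lborel) = ennreal (al + ?k - al) * (pmean al + pmean (al + ?k))"
      by (rule mean_green[OF al _ bd]) auto
    also have "(\<integral>\<^sup>+\<sigma>. ennreal (indicator {al..al + ?k} \<sigma> * ((\<sigma> - al) * (al + ?k - \<sigma>))) * mean_density \<sigma> \<partial>lborel)
       = ennreal ?k * (\<integral>\<^sup>+\<sigma>. ennreal (w n \<sigma>) * mean_density \<sigma> \<partial>lborel)"
      unfolding w_eq by (subst nn_integral_cmult[symmetric]) (auto simp: ennreal_mult w0 mult.assoc w_def)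
    also have "(\<integral>\<^sup>+\<sigma>. indicator {al..al + ?k} \<sigma> * pmean \<sigma> \<partial>lborel) =
       ennreal ?k * (\<integral>\<^sup>+y. indicator {0..1} y * pmean (al + ?k * y) \<partial>lborel)"
    proof -
      have ind: "indicator {al..al + k} (al + k * y) = (indicator {0..1} y :: ennreal)" if "k > 0" for k y
        using that mult_le_cancel_left_pos[of k y 1] by (auto simp: indicator_def zero_le_mult_iff)
      have "?k > 0" by simp
      have "(\<integral>\<^sup>+\<sigma>. indicator {al..al + ?k} \<sigma> * pmean \<sigma> \<partial>lborel) =
         ennreal \<bar>?k\<bar> * (\<integral>\<^sup>+y. indicator {al..al + ?k} (al + ?k * y) * pmean (al + ?k * y) \<partial>lborel)"
        by (rule nn_integral_real_affine) auto
      then show ?thesis unfolding ind[OF \<open>?k > 0\<close>] by simp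
    qed
    finally have e: "ennreal ?k * ((\<integral>\<^sup>+\<sigma>. ennreal (w n \<sigma>) * mean_density \<sigma> \<partial>lborel) +
       2 * (\<integral>\<^sup>+y. indicator {0..1} y * pmean (al + ?k * y) \<partial>lborel)) = ennreal ?k * (pmean al + pmean (al + ?k))"
      by (simp add: distrib_left mult_ac)
    have inv: "ennreal (1 / ?k) * (ennreal ?k * x) = x" for x
    proof -
      have "ennreal (1 / ?k) * ennreal ?k = 1" by (subst ennreal_mult[symmetric]) auto
      then show ?thesis by (simp only: mult.assoc[symmetric] mult_1)
    qed
    show ?thesis using arg_cong[OF e, of "\<lambda>x. ennreal (1 / ?k) * x"] unfolding inv .
  qed
  have k_top: "filterlim (\<lambda>n. real (Suc n)) at_top sequentially"
    by (rule filterlim_compose[OF filterlim_real_sequentially filterlim_Suc])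
  have A: "(\<lambda>n. \<integral>\<^sup>+\<sigma>. ennreal (w n \<sigma>) * mean_density \<sigma> \<partial>lborel) \<longlonglongrightarrow> (\<integral>\<^sup>+\<sigma>. ennreal (max 0 (\<sigma> - al)) * mean_density \<sigma> \<partial>lborel)"
  proof (rule nn_integral_LIMSEQ)
    show "incseq (\<lambda>n \<sigma>. ennreal (w n \<sigma>) * mean_density \<sigma>)"
    proof (intro incseq_SucI le_funI mult_right_mono ennreal_leI)
      fix n \<sigma>
      show "w n \<sigma> \<le> w (Suc n) \<sigma>"
      proof (cases "\<sigma> \<ge> al")
        case True
        then have "(\<sigma> - al) / real (Suc (Suc n)) \<le> (\<sigma> - al) / real (Suc n)"
          by (intro divide_left_mono) auto
        then show ?thesis unfolding w_def by (intro mult_left_mono max.mono) auto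
      qed (simp add: w_def)
    qed auto
    show "(\<lambda>n. ennreal (w n \<sigma>) * mean_density \<sigma>) \<longlonglongrightarrow> ennreal (max 0 (\<sigma> - al)) * mean_density \<sigma>" for \<sigma>
    proof -
      have "(\<lambda>n. (\<sigma> - al) / real (Suc n)) \<longlonglongrightarrow> 0"
        by (rule tendsto_divide_0[OF tendsto_const filterlim_at_top_imp_at_infinity[OF k_top]])
      then have "(\<lambda>n. w n \<sigma>) \<longlonglongrightarrow> max 0 (\<sigma> - al) * max 0 (1 - 0)"
        unfolding w_def by (intro tendsto_intros)
      from tendsto_ennrealI[OF this]
      have l: "(\<lambda>n. ennreal (w n \<sigma>)) \<longlonglongrightarrow> ennreal (max 0 (\<sigma> - al))" by simp
      show ?thesis
      proof (cases "\<sigma> > al")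
        case True
        then show ?thesis by (intro tendsto_mult_ennreal l tendsto_const) auto
      next
        case False
        then show ?thesis by (simp add: w_def)
      qed
    qed
  qed (auto simp: w_def)
  have "(\<lambda>n. \<integral>\<^sup>+y. indicator {0..1} y * pmean (al + real (Suc n) * y) \<partial>lborel) \<longlonglongrightarrow> (\<integral>\<^sup>+y. indicator {0..1::real} y * L \<partial>lborel)"
  proof (rule nn_integral_dominated_convergence[where w = "\<lambda>y. indicator {0..1} y * ennreal C"])
    show "(\<integral>\<^sup>+y. indicator {0..1::real} y * ennreal C \<partial>lborel) < \<infinity>"
      by (simp add: nn_integral_multc emeasure_lborel_Icc_eq ennreal_mult_less_top)
    show "AE y in lborel. indicator {0..1} y * pmean (al + real (Suc n) * y) \<le> indicator {0..1} y * ennreal C" for n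
    proof (rule AE_I2)
      fix y
      have "al + real (Suc n) * y > c" if "y \<ge> 0"
        using that al mult_nonneg_nonneg[of "real (Suc n)" y] by linarith
      then show "indicator {0..1} y * pmean (al + real (Suc n) * y) \<le> indicator {0..1} y * ennreal C"
        using bd by (auto simp: indicator_def simp del: of_nat_Suc)
    qed
    have "AE y in lborel. y \<noteq> (0::real)" by (rule AE_lborel_singleton)
    then show "AE y in lborel. (\<lambda>n. indicator {0..1} y * pmean (al + real (Suc n) * y)) \<longlonglongrightarrow> indicator {0..1} y * L"
    proof eventually_elim
      case (elim y)
      show ?case
      proof (cases "y \<in> {0..1}")
        case True
        then have y: "y > 0" using elim by auto
        have "filterlim (\<lambda>n. al + real (Suc n) * y) at_top sequentially"
          by (intro filterlim_tendsto_add_at_top[OF tendsto_const] filterlim_at_top_mult_tendsto_pos[OF tendsto_const y k_top])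
        then have "(\<lambda>n. pmean (al + real (Suc n) * y)) \<longlonglongrightarrow> L" by (rule filterlim_compose[OF lim])
        then show ?thesis using True by simp
      qed simp
    qed
  qed auto
  also have "(\<integral>\<^sup>+y. indicator {0..1::real} y * L \<partial>lborel) = L"
    by (simp add: nn_integral_multc emeasure_lborel_Icc_eq)
  finally have B: "(\<lambda>n. \<integral>\<^sup>+y. indicator {0..1} y * pmean (al + real (Suc n) * y) \<partial>lborel) \<longlonglongrightarrow> L" .
  have D: "(\<lambda>n. pmean (al + real (Suc n))) \<longlonglongrightarrow> L"
    by (rule filterlim_compose[OF lim]) (intro filterlim_tendsto_add_at_top[OF tendsto_const] k_top)
  have "(\<lambda>n. pmean al + pmean (al + real (Suc n))) \<longlonglongrightarrow> pmean al + L"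
    by (intro tendsto_add tendsto_const D)
  moreover have "(\<lambda>n. pmean al + pmean (al + real (Suc n))) \<longlonglongrightarrow> (\<integral>\<^sup>+\<sigma>. ennreal (max 0 (\<sigma> - al)) * mean_density \<sigma> \<partial>lborel) + 2 * L"
    unfolding id[symmetric] by (intro tendsto_add A ennreal_tendsto_cmult B) auto
  ultimately have "(\<integral>\<^sup>+\<sigma>. ennreal (max 0 (\<sigma> - al)) * mean_density \<sigma> \<partial>lborel) + 2 * L = pmean al + L"
    by (rule LIMSEQ_unique[THEN sym])
  then have "L + ((\<integral>\<^sup>+\<sigma>. ennreal (max 0 (\<sigma> - al)) * mean_density \<sigma> \<partial>lborel) + L) = L + pmean al"
    by (simp add: mult_2 add_ac)
  then show ?thesis
    using Lfin by (subst (asm) ennreal_add_left_cancel) (auto simp: top_unique)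
qed

lemma mean_formula_boundary:
  assumes c: "c = 0" and bd: "\<And>\<sigma>. \<sigma> > 0 \<Longrightarrow> pmean \<sigma> \<le> ennreal C"
    and lim: "(pmean \<longlongrightarrow> L) at_top" and lim0: "(pmean \<longlongrightarrow> N) (at_right 0)"
  shows "(\<integral>\<^sup>+\<sigma>. indicator {0<..} \<sigma> * (ennreal \<sigma> * mean_density \<sigma>) \<partial>lborel) + L = N"
proof -
  define al where "al n = 1 / real (Suc n)" for n
  have al: "al n > 0" for n by (simp add: al_def)
  have al0: "al \<longlonglongrightarrow> 0" unfolding al_def by (rule LIMSEQ_Suc[OF lim_1_over_n])
  have id: "(\<integral>\<^sup>+\<sigma>. ennreal (max 0 (\<sigma> - al n)) * mean_density \<sigma> \<partial>lborel) + L = pmean (al n)" for n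
    by (rule mean_formula[OF _ _ lim, of _ C]) (use al c bd in auto)
  have "(\<lambda>n. \<integral>\<^sup>+\<sigma>. ennreal (max 0 (\<sigma> - al n)) * mean_density \<sigma> \<partial>lborel) \<longlonglongrightarrow> (\<integral>\<^sup>+\<sigma>. indicator {0<..} \<sigma> * (ennreal \<sigma> * mean_density \<sigma>) \<partial>lborel)"
  proof (rule nn_integral_LIMSEQ)
    show "incseq (\<lambda>n \<sigma>. ennreal (max 0 (\<sigma> - al n)) * mean_density \<sigma>)"
      by (intro incseq_SucI le_funI mult_right_mono ennreal_leI max.mono diff_left_mono)
         (auto simp: al_def field_simps)
    show "(\<lambda>n. ennreal (max 0 (\<sigma> - al n)) * mean_density \<sigma>) \<longlonglongrightarrow> indicator {0<..} \<sigma> * (ennreal \<sigma> * mean_density \<sigma>)" for \<sigma>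
    proof (cases "\<sigma> > 0")
      case True
      have "(\<lambda>n. ennreal (max 0 (\<sigma> - al n))) \<longlonglongrightarrow> ennreal (max 0 (\<sigma> - 0))"
        by (intro tendsto_ennrealI tendsto_intros al0)
      then have "(\<lambda>n. ennreal (max 0 (\<sigma> - al n)) * mean_density \<sigma>) \<longlonglongrightarrow> ennreal (max 0 (\<sigma> - 0)) * mean_density \<sigma>"
        using True by (intro tendsto_mult_ennreal tendsto_const) auto
      then show ?thesis using True by (simp add: max_def)
    next
      case False
      then have "max 0 (\<sigma> - al n) = 0" for n using al[of n] by simp
      then show ?thesis using False by simp
    qed
  qed auto
  then have "(\<lambda>n. (\<integral>\<^sup>+\<sigma>. ennreal (max 0 (\<sigma> - al n)) * mean_density \<sigma> \<partial>lborel) + L) \<longlonglongrightarrow>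
     (\<integral>\<^sup>+\<sigma>. indicator {0<..} \<sigma> * (ennreal \<sigma> * mean_density \<sigma>) \<partial>lborel) + L"
    by (intro tendsto_add tendsto_const)
  moreover have "(\<lambda>n. pmean (al n)) \<longlonglongrightarrow> N"
    by (rule filterlim_compose[OF lim0]) (use al al0 in \<open>auto simp: filterlim_at less_imp_neq[OF al, THEN not_sym] intro!: always_eventually\<close>)
  ultimately show ?thesis unfolding id by (rule LIMSEQ_unique)
qed

end

section \<open>The norm of a Dirichlet polynomial on the torus\<close>

lemma dirichlet_polysD:
  assumes "a \<in> dirichlet_polys"
  shows "a 0 = 0" "finite {n. a n \<noteq> 0}" "a n \<noteq> 0 \<Longrightarrow> n > 0"
  using assms by (auto simp: dirichlet_polys_def intro: gr0I)

lemma dirichlet_polys_diff: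
  assumes "a \<in> dirichlet_polys" "b \<in> dirichlet_polys"
  shows "(\<lambda>n. a n - b n) \<in> dirichlet_polys"
proof -
  have "{n. a n - b n \<noteq> 0} \<subseteq> {n. a n \<noteq> 0} \<union> {n. b n \<noteq> 0}" by auto
  then show ?thesis using assms finite_subset unfolding dirichlet_polys_def by fastforce
qed

lemma tpoly_superset:
  assumes "finite S" "{n. a n \<noteq> 0} \<subseteq> S"
  shows "tpoly a \<xi> s = (\<Sum>n\<in>S. a n * cmult_ext \<xi> n * of_nat n powr (- s))"
  unfolding tpoly_def by (rule sum.mono_neutral_left) (use assms in auto)

lemma tpoly_diff:
  assumes "a \<in> dirichlet_polys" "b \<in> dirichlet_polys"
  shows "tpoly (\<lambda>n. a n - b n) \<xi> s = tpoly a \<xi> s - tpoly b \<xi> s"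
proof -
  let ?S = "{n. a n \<noteq> 0} \<union> {n. b n \<noteq> 0}"
  have S: "finite ?S" using assms by (auto simp: dirichlet_polys_def)
  show ?thesis
    unfolding tpoly_superset[of ?S "\<lambda>n. a n - b n", OF S] 
    by (subst (1 2 3) tpoly_superset[OF S]) (auto simp: sum_subtractf algebra_simps)
qed

lemma trig_tpoly:
  assumes "a \<in> dirichlet_polys"
  shows "trig_poly (\<lambda>\<xi>. tpoly a \<xi> s)"
proof -
  have "trig_poly (\<lambda>\<xi>. \<Sum>n | a n \<noteq> 0. (a n * of_nat n powr (- s)) * cmult_ext \<xi> n)"
    by (intro trig_sum trig_mult trig_const trig_ext) (use dirichlet_polysD[OF assms] in auto)
  then show ?thesis by (simp add: tpoly_def mult_ac)
qed

lemma tpoly_measurable [measurable]: "(\<lambda>\<xi>. tpoly a \<xi> s) \<in> borel_measurable torus_measure"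
  unfolding tpoly_def by measurable

lemma norm_of_nat_powr: "n > 0 \<Longrightarrow> norm (of_nat n powr (- s) :: complex) = real n powr (- Re s)"
  by (subst norm_powr_real_powr) auto

lemma tpoly_bound:
  assumes "a \<in> dirichlet_polys" "\<xi> \<in> space torus_measure" "Re s \<ge> - k"
  shows "norm (tpoly a \<xi> s) \<le> (\<Sum>n | a n \<noteq> 0. norm (a n) * real n powr k)"
  unfolding tpoly_def
proof (rule sum_norm_le)
  fix n assume n: "n \<in> {n. a n \<noteq> 0}"
  then have "n > 0" using dirichlet_polysD[OF assms(1)] by auto
  have "norm (a n * cmult_ext \<xi> n * of_nat n powr - s) = norm (a n) * real n powr (- Re s)"
    using \<open>n > 0\<close> assms by (simp add: norm_mult norm_cmult_ext norm_of_nat_powr)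
  also have "\<dots> \<le> norm (a n) * real n powr k"
    using \<open>n > 0\<close> assms by (intro mult_left_mono powr_mono) auto
  finally show "norm (a n * cmult_ext \<xi> n * of_nat n powr - s) \<le> norm (a n) * real n powr k" .
qed

lemma integrable_bounded_torus:
  assumes "f \<in> borel_measurable torus_measure" "\<And>\<xi>. \<xi> \<in> space torus_measure \<Longrightarrow> norm (f \<xi>) \<le> (C::real)"
  shows "integrable torus_measure (f :: _ \<Rightarrow> real)"
  by (rule TM.integrable_const_bound[of _ C]) (use assms in auto)

lemma tpoly_powr_integrable:
  assumes "a \<in> dirichlet_polys" "p \<ge> 0"
  shows "integrable torus_measure (\<lambda>\<xi>. norm (tpoly a \<xi> s) powr p)"
proof (rule integrable_bounded_torus)
  fix \<xi> assume x: "\<xi> \<in> space torus_measure"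
  have "norm (tpoly a \<xi> s) powr p \<le> (\<Sum>n | a n \<noteq> 0. norm (a n) * real n powr (- Re s)) powr p"
    using tpoly_bound[OF assms(1) x, of "- Re s" s] assms by (intro powr_mono2) auto
  then show "norm (norm (tpoly a \<xi> s) powr p) \<le> (\<Sum>n | a n \<noteq> 0. norm (a n) * real n powr (- Re s)) powr p" by simp
qed measurable

text \<open>
  Orbit means in the symmetric form in which they enter the definition of \<open>dpoly_mean\<close>.
\<close>

lemma two_sided_orbit_mean:
  fixes h :: "_ \<Rightarrow> real"
  assumes h: "uniform_trig (\<lambda>\<xi>. of_real (h \<xi>))" and m[measurable]: "h \<in> borel_measurable torus_measure"
    and x: "\<xi> \<in> space torus_measure"
  shows "((\<lambda>T. 1 / (2 * T) * (LINT t:{-T..T}|lborel. h (rot t \<xi>))) \<longlongrightarrow> (\<integral>\<xi>. h \<xi> \<partial>torus_measure)) at_top"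
proof -
  have om: "orbit_mean (\<lambda>\<xi>. of_real (h \<xi>))" by (rule uniform_trig_orbit_mean[OF h]) measurable
  have 1: "((\<lambda>R. (LINT t:{0..R}|lborel. h (rot (d * t) \<xi>)) / R) \<longlongrightarrow> (\<integral>\<xi>. h \<xi> \<partial>torus_measure)) at_top"
    if "d \<in> {-1, 1}" for d
  proof -
    have "((\<lambda>R. (LINT t:{0..R}|lborel. complex_of_real (h (rot (d * t) \<xi>))) / of_real R) \<longlongrightarrow> (\<integral>\<xi>. complex_of_real (h \<xi>) \<partial>torus_measure)) at_top"
      using om x that unfolding orbit_mean_def by blast
    then have "((\<lambda>R. complex_of_real ((LINT t:{0..R}|lborel. h (rot (d * t) \<xi>)) / R)) \<longlongrightarrow> of_real (\<integral>\<xi>. h \<xi> \<partial>torus_measure)) at_top"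
      by (simp add: set_integral_complex_of_real)
    then show ?thesis by (simp only: tendsto_of_real_iff)
  qed
  obtain C where C: "\<And>\<xi>. \<xi> \<in> space torus_measure \<Longrightarrow> norm (h \<xi>) \<le> C"
    using uniform_trig_bounded[OF h] by auto
  have [measurable]: "(\<lambda>t. rot t \<xi>) \<in> borel \<rightarrow>\<^sub>M torus_measure" using rot_curve_measurable[OF x, of 1] by simp
  have int: "set_integrable lborel {a..b} (\<lambda>t. h (rot t \<xi>))" for a b
    unfolding set_integrable_def
  proof (rule Bochner_Integration.integrable_bound)
    show "integrable lborel (\<lambda>t. indicator {a..b} t *\<^sub>R C)"
      by (intro integrable_scaleR_left integrable_real_indicator) (auto simp: emeasure_lborel_Icc_eq)
    show "AE t in lborel. norm (indicator {a..b} t *\<^sub>R h (rot t \<xi>)) \<le> norm (indicator {a..b} t *\<^sub>R C)"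
    proof (rule AE_I2)
      fix t show "norm (indicator {a..b} t *\<^sub>R h (rot t \<xi>)) \<le> norm (indicator {a..b} t *\<^sub>R C)"
        using C[OF rot_in_space[OF x], of t] by (auto simp: indicator_def)
    qed
  qed measurable
  have "((\<lambda>R. (1/2) * ((LINT t:{0..R}|lborel. h (rot (1 * t) \<xi>)) / R + (LINT t:{0..R}|lborel. h (rot ((-1) * t) \<xi>)) / R))
     \<longlongrightarrow> (1/2) * ((\<integral>\<xi>. h \<xi> \<partial>torus_measure) + (\<integral>\<xi>. h \<xi> \<partial>torus_measure))) at_top"
    by (intro tendsto_intros 1) auto
  then have "((\<lambda>R. (1/2) * ((LINT t:{0..R}|lborel. h (rot (1 * t) \<xi>)) / R + (LINT t:{0..R}|lborel. h (rot ((-1) * t) \<xi>)) / R))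
     \<longlongrightarrow> (\<integral>\<xi>. h \<xi> \<partial>torus_measure)) at_top" by simp
  then show ?thesis
  proof (rule Lim_transform_eventually)
    show "eventually (\<lambda>R. (1/2) * ((LINT t:{0..R}|lborel. h (rot (1 * t) \<xi>)) / R + (LINT t:{0..R}|lborel. h (rot ((-1) * t) \<xi>)) / R)
       = 1 / (2 * R) * (LINT t:{-R..R}|lborel. h (rot t \<xi>))) at_top"
      using eventually_gt_at_top[of 0]
    proof eventually_elim
      case (elim R)
      have "(LINT t:{0..R}|lborel. h (rot ((-1) * t) \<xi>)) = (LINT t:{-R..0}|lborel. h (rot t \<xi>))"
        unfolding set_lebesgue_integral_def
        by (subst (2) lborel_integral_real_affine[where c = "-1" and t = 0])
           (auto intro!: Bochner_Integration.integral_cong simp: indicator_def)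
      moreover have "(LINT t:{-R..R}|lborel. h (rot t \<xi>)) = (LINT t:{-R..0} \<union> {0..R}|lborel. h (rot t \<xi>))"
        using elim by (intro arg_cong[where f = "\<lambda>A. LINT t:A|lborel. h (rot t \<xi>)"]) auto
      moreover have "\<dots> = (LINT t:{-R..0}|lborel. h (rot t \<xi>)) + (LINT t:{0..R}|lborel. h (rot t \<xi>))"
      proof (rule set_integral_Un_AE)
        have "AE t in lborel. t \<noteq> (0::real)" by (rule AE_lborel_singleton)
        then show "AE t in lborel. \<not> (t \<in> {-R..0} \<and> t \<in> {0..R})" by eventually_elim auto
      qed (use int in auto)
      ultimately show ?case using elim by (simp add: field_simps)
    qed
  qed
qed

text \<open>
  The trivial character; along its orbit a twisted polynomial takes the values of the untwisted one on a
  vertical line.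
\<close>

definition torus_one :: "nat \<Rightarrow> complex" where "torus_one = (\<lambda>q\<in>{q. prime q}. 1)"

lemma torus_one_space: "torus_one \<in> space torus_measure"
  by (auto simp: torus_one_def space_torus_measure)

lemma eval_dpoly_torus_one: "eval_dpoly a s = tpoly a torus_one s"
  unfolding eval_dpoly_def tpoly_def
  by (intro sum.cong refl) (auto simp: cmult_ext_def torus_one_def in_prime_factors_iff intro!: prod.neutral)

lemma uniform_trig_tpoly_powr:
  assumes "a \<in> dirichlet_polys" "p > 0"
  shows "uniform_trig (\<lambda>\<xi>. of_real (norm (tpoly a \<xi> s) powr p))"
  by (rule uniform_trig_continuous[OF _ trig_tpoly[OF assms(1)], of "\<lambda>z. norm z powr p"])
     (intro continuous_on_powr' continuous_intros ballI, use assms in auto)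

text \<open>
  The time mean is an orbit mean at the single point \<open>torus_one\<close>.  An almost everywhere ergodic theorem
  would not suffice here; \<open>\<bar>P\<bar>\<^sup>p\<close> being a uniform limit of trigonometric polynomials does.
\<close>

lemma dpoly_mean_eq:
  assumes a: "a \<in> dirichlet_polys" and p: "p > 0"
  shows "dpoly_mean p a \<sigma> = (\<integral>\<xi>. norm (tpoly a \<xi> (of_real \<sigma>)) powr p \<partial>torus_measure) powr (1 / p)"
proof -
  have "((\<lambda>T. 1 / (2 * T) * (LINT t:{-T..T}|lborel. norm (tpoly a (rot t torus_one) (of_real \<sigma>)) powr p))
     \<longlongrightarrow> (\<integral>\<xi>. norm (tpoly a \<xi> (of_real \<sigma>)) powr p \<partial>torus_measure)) at_top"
    by (rule two_sided_orbit_mean[OF uniform_trig_tpoly_powr[OF a p] _ torus_one_space]) measurable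
  moreover have "tpoly a (rot t torus_one) (of_real \<sigma>) = eval_dpoly a (Complex \<sigma> t)" for t
    using dirichlet_polysD(1)[OF a] by (simp add: tpoly_rot eval_dpoly_torus_one Complex_eq)
  ultimately show ?thesis
    unfolding dpoly_mean_def by (subst tendsto_Lim) auto
qed

lemma tpoly_continuous:
  assumes "a \<in> dirichlet_polys" shows "continuous_on UNIV (tpoly a \<xi>)"
  unfolding tpoly_def
  by (intro continuous_intros) (use dirichlet_polysD[OF assms] in auto)

lemma tpoly_powr_mean_tendsto:
  fixes S :: "nat \<Rightarrow> real"
  assumes a: "a \<in> dirichlet_polys" and p: "p > 0" and S: "\<And>n. S n \<ge> 0"
    and lim: "\<And>\<xi>. \<xi> \<in> space torus_measure \<Longrightarrow> (\<lambda>n. tpoly a \<xi> (of_real (S n))) \<longlonglongrightarrow> g \<xi>"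
    and g[measurable]: "g \<in> borel_measurable torus_measure"
  shows "(\<lambda>n. \<integral>\<xi>. norm (tpoly a \<xi> (of_real (S n))) powr p \<partial>torus_measure) \<longlonglongrightarrow> (\<integral>\<xi>. norm (g \<xi>) powr p \<partial>torus_measure)"
proof (rule integral_dominated_convergence[where w = "\<lambda>_. (\<Sum>n | a n \<noteq> 0. norm (a n) * real n powr 0) powr p"])
  show "AE \<xi> in torus_measure. (\<lambda>n. norm (tpoly a \<xi> (of_real (S n))) powr p) \<longlonglongrightarrow> norm (g \<xi>) powr p"
    by (rule AE_I2, intro tendsto_powr' tendsto_norm lim tendsto_const) (use p in auto)
  show "AE \<xi> in torus_measure. norm (norm (tpoly a \<xi> (of_real (S n))) powr p) \<le> (\<Sum>n | a n \<noteq> 0. norm (a n) * real n powr 0) powr p" for n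
  proof (rule AE_I2)
    fix \<xi> assume "\<xi> \<in> space torus_measure"
    then have "norm (tpoly a \<xi> (of_real (S n))) powr p \<le> (\<Sum>n | a n \<noteq> 0. norm (a n) * real n powr 0) powr p"
      using S[of n] p by (intro powr_mono2 tpoly_bound[OF a]) auto
    then show "norm (norm (tpoly a \<xi> (of_real (S n))) powr p) \<le> (\<Sum>n | a n \<noteq> 0. norm (a n) * real n powr 0) powr p" by simp
  qed
qed (auto simp: TM.emeasure_space_1)

definition pnorm :: "real \<Rightarrow> ((nat \<Rightarrow> complex) \<Rightarrow> complex) \<Rightarrow> real" where
  "pnorm p Y = (\<integral>\<xi>. norm (Y \<xi>) powr p \<partial>torus_measure) powr (1 / p)"

lemma tpoly_powr_mean_at_right_0:
  assumes a: "a \<in> dirichlet_polys" and p: "p > 0"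
  shows "((\<lambda>\<sigma>. \<integral>\<xi>. norm (tpoly a \<xi> (of_real \<sigma>)) powr p \<partial>torus_measure) \<longlongrightarrow> (\<integral>\<xi>. norm (tpoly a \<xi> 0) powr p \<partial>torus_measure)) (at_right 0)"
proof (rule tendsto_at_right_sequentially[of 0 1])
  fix S :: "nat \<Rightarrow> real" assume S: "\<And>n. 0 < S n" "S \<longlonglongrightarrow> 0"
  show "(\<lambda>n. \<integral>\<xi>. norm (tpoly a \<xi> (of_real (S n))) powr p \<partial>torus_measure) \<longlonglongrightarrow> (\<integral>\<xi>. norm (tpoly a \<xi> 0) powr p \<partial>torus_measure)"
  proof (rule tpoly_powr_mean_tendsto[OF a p])
    fix \<xi>
    have "isCont (tpoly a \<xi>) 0" using tpoly_continuous[OF a] by (simp add: continuous_on_eq_continuous_at)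
    moreover have "(\<lambda>n. complex_of_real (S n)) \<longlonglongrightarrow> 0" using tendsto_of_real[OF S(2)] by simp
    ultimately show "(\<lambda>n. tpoly a \<xi> (of_real (S n))) \<longlonglongrightarrow> tpoly a \<xi> 0" by (rule isCont_tendsto_compose)
  qed (use S in \<open>auto intro: less_imp_le\<close>)
qed auto

lemma tpoly_powr_mean_at_top:
  assumes a: "a \<in> dirichlet_polys" and p: "p > 0"
  shows "((\<lambda>\<sigma>. \<integral>\<xi>. norm (tpoly a \<xi> (of_real \<sigma>)) powr p \<partial>torus_measure) \<longlongrightarrow> norm (a 1) powr p) at_top"
proof (rule tendsto_at_topI_sequentially)
  fix S :: "nat \<Rightarrow> real" assume S: "filterlim S at_top sequentially"
  let ?S = "\<lambda>n. max 0 (S n)"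
  have S': "filterlim ?S at_top sequentially"
    by (rule filterlim_at_top_mono[OF S]) auto
  have "(\<lambda>n. \<integral>\<xi>. norm (tpoly a \<xi> (of_real (?S n))) powr p \<partial>torus_measure) \<longlonglongrightarrow> (\<integral>\<xi>. norm (a 1) powr p \<partial>torus_measure)"
  proof (rule tpoly_powr_mean_tendsto[OF a p])
    fix \<xi>
    have t: "(\<lambda>n. of_nat m powr (- of_real (?S n)) :: complex) \<longlonglongrightarrow> (if m = 1 then 1 else 0)" if m: "m > 0" for m :: nat
    proof (cases "m = 1")
      case False
      then have "1 < real m" using m by auto
      have "(\<lambda>n. real m powr (- ?S n)) \<longlonglongrightarrow> 0"
        unfolding powr_def using \<open>1 < real m\<close> m
        by (auto intro!: filterlim_compose[OF exp_at_bot] filterlim_tendsto_pos_mult_at_top[OF tendsto_const _ S'] simp: mult.commute[of _ "ln _"] filterlim_uminus_at_bot)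
      then have "(\<lambda>n. norm (of_nat m powr (- of_real (?S n)) :: complex)) \<longlonglongrightarrow> 0"
        using m by (simp add: norm_of_nat_powr)
      then show ?thesis using False by (simp add: tendsto_norm_zero_iff)
    qed simp
    have "(\<lambda>n. tpoly a \<xi> (of_real (?S n))) \<longlonglongrightarrow> (\<Sum>m | a m \<noteq> 0. a m * cmult_ext \<xi> m * (if m = 1 then 1 else 0))"
      unfolding tpoly_def by (intro tendsto_sum tendsto_mult tendsto_const t) (use dirichlet_polysD[OF a] in auto)
    also have "(\<Sum>m | a m \<noteq> 0. a m * cmult_ext \<xi> m * (if m = 1 then 1 else 0)) = (\<Sum>m | a m \<noteq> 0. if m = 1 then a m * cmult_ext \<xi> m else 0)"
      by (intro sum.cong) auto
    also have "\<dots> = a 1"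
      using dirichlet_polysD(2)[OF a] by (subst sum.delta) auto
    finally show "(\<lambda>n. tpoly a \<xi> (of_real (?S n))) \<longlonglongrightarrow> a 1" .
  qed auto
  then have "(\<lambda>n. \<integral>\<xi>. norm (tpoly a \<xi> (of_real (?S n))) powr p \<partial>torus_measure) \<longlonglongrightarrow> norm (a 1) powr p"
    by (simp add: TM.prob_space)
  then show "(\<lambda>n. \<integral>\<xi>. norm (tpoly a \<xi> (of_real (S n))) powr p \<partial>torus_measure) \<longlonglongrightarrow> norm (a 1) powr p"
  proof (rule Lim_transform_eventually)
    have "eventually (\<lambda>n. S n \<ge> 0) sequentially" using S by (simp add: filterlim_at_top)
    then show "eventually (\<lambda>n. (\<integral>\<xi>. norm (tpoly a \<xi> (of_real (?S n))) powr p \<partial>torus_measure) = (\<integral>\<xi>. norm (tpoly a \<xi> (of_real (S n))) powr p \<partial>torus_measure)) sequentially"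
      by eventually_elim (simp add: max_def)
  qed
qed

lemma dpoly_norm_eq:
  assumes a: "a \<in> dirichlet_polys" and p: "p > 0"
  shows "dpoly_norm p a = pnorm p (\<lambda>\<xi>. tpoly a \<xi> 0)"
proof -
  have "((\<lambda>\<sigma>. (\<integral>\<xi>. norm (tpoly a \<xi> (of_real \<sigma>)) powr p \<partial>torus_measure) powr (1 / p)) \<longlongrightarrow> pnorm p (\<lambda>\<xi>. tpoly a \<xi> 0)) (at_right 0)"
    unfolding pnorm_def
    by (rule tendsto_powr'[OF tpoly_powr_mean_at_right_0[OF a p] tendsto_const]) (use p in auto)
  then show ?thesis
    unfolding dpoly_norm_def dpoly_mean_eq[OF a p, abs_def] by (intro tendsto_Lim) auto
qed

lemma pnorm_nonneg: "pnorm p Y \<ge> 0" by (simp add: pnorm_def)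

lemma pnorm_powr:
  assumes "p > 0" shows "pnorm p Y powr p = (\<integral>\<xi>. norm (Y \<xi>) powr p \<partial>torus_measure)"
  using assms by (simp add: pnorm_def powr_powr integral_nonneg_AE)

section \<open>Minkowski's inequality\<close>

lemma powr_convex_nonneg:
  fixes x y :: real
  assumes p: "p \<ge> 1" and x: "x \<ge> 0" "y \<ge> 0" and u: "u \<ge> 0" "v \<ge> 0" "u + v = 1"
  shows "(u * x + v * y) powr p \<le> u * x powr p + v * y powr p"
proof -
  have le: "(w * z) powr p \<le> w * z powr p" if "0 \<le> w" "w \<le> 1" "z \<ge> 0" for w z :: real
  proof -
    have "w powr p \<le> w powr 1"
      using that p by (intro powr_mono') auto
    then show ?thesis using that by (simp add: powr_mult mult_right_mono)
  qed
  consider "x = 0" | "y = 0" | "x > 0" "y > 0" using x by linarith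
  then show ?thesis
  proof cases
    case 3
    have "convex_on {0<..} (\<lambda>x. x powr p)" by (rule powr_convex[OF p])
    then have "\<forall>x\<in>{0<..}. \<forall>y\<in>{0<..}. \<forall>u\<ge>0. \<forall>v\<ge>0. u + v = 1 \<longrightarrow> (u *\<^sub>R x + v *\<^sub>R y) powr p \<le> u * x powr p + v * y powr p"
      by (simp add: convex_on_def)
    then show ?thesis using 3 u by auto
  qed (use le[of u x] le[of v y] x u p in auto)
qed

lemma powr_add_bound:
  fixes x y A B p :: real
  assumes p: "p \<ge> 1" and A: "A > 0" "B > 0" and x: "x \<ge> 0" "y \<ge> 0"
  shows "(x + y) powr p \<le> (A + B) powr p * (A / (A + B) * (x powr p / A powr p) + B / (A + B) * (y powr p / B powr p))"
proof -
  have "(x + y) powr p = ((A + B) * (A / (A + B) * (x / A) + B / (A + B) * (y / B))) powr p"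
  proof -
    have "A + B \<noteq> 0" using A by linarith
    then have "(A + B) * (A / (A + B) * (x / A) + B / (A + B) * (y / B)) = x + y"
      using A by (simp add: distrib_left)
    then show ?thesis by simp
  qed
  also have "\<dots> = (A + B) powr p * (A / (A + B) * (x / A) + B / (A + B) * (y / B)) powr p"
    using A x by (intro powr_mult)
  also have "\<dots> \<le> (A + B) powr p * (A / (A + B) * (x / A) powr p + B / (A + B) * (y / B) powr p)"
    using A x p by (intro mult_left_mono powr_convex_nonneg) (auto simp: add_divide_distrib[symmetric])
  also have "(x / A) powr p = x powr p / A powr p" using A x by (simp add: powr_divide)
  also have "(y / B) powr p = y powr p / B powr p" using A x by (simp add: powr_divide)
  finally show ?thesis .
qed

text \<open>
  Convexity of \<open>x powr p\<close> applied to \<open>Y / A\<close> and \<open>Z / B\<close> with weights proportional to \<open>A\<close> and \<open>B\<close>, where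
  \<open>A\<close> and \<open>B\<close> exceed the norms of \<open>Y\<close> and \<open>Z\<close> by \<open>e / 2\<close>; the excess makes them positive also when a norm is 0.
\<close>

lemma Minkowski:
  assumes p: "p \<ge> 1" and m[measurable]: "Y \<in> borel_measurable torus_measure" "Z \<in> borel_measurable torus_measure"
    and i: "integrable torus_measure (\<lambda>\<xi>. norm (Y \<xi>) powr p)" "integrable torus_measure (\<lambda>\<xi>. norm (Z \<xi>) powr p)"
  shows "integrable torus_measure (\<lambda>\<xi>. norm (Y \<xi> + Z \<xi>) powr p)"
    and "pnorm p (\<lambda>\<xi>. Y \<xi> + Z \<xi>) \<le> pnorm p Y + pnorm p Z"
proof -
  let ?b = "\<lambda>A B \<xi>. (A + B) powr p * (A / (A + B) * (norm (Y \<xi>) powr p / A powr p) + B / (A + B) * (norm (Z \<xi>) powr p / B powr p))"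
  have b: "norm (Y \<xi> + Z \<xi>) powr p \<le> ?b A B \<xi>" if "A > 0" "B > 0" for A B \<xi>
  proof -
    have "norm (Y \<xi> + Z \<xi>) powr p \<le> (norm (Y \<xi>) + norm (Z \<xi>)) powr p"
      using p by (intro powr_mono2 norm_triangle_ineq) auto
    also have "\<dots> \<le> ?b A B \<xi>" using that p by (intro powr_add_bound) auto
    finally show ?thesis .
  qed
  have ib: "integrable torus_measure (?b A B)" for A B
    by (intro integrable_mult_right Bochner_Integration.integrable_add integrable_divide i)
  show I: "integrable torus_measure (\<lambda>\<xi>. norm (Y \<xi> + Z \<xi>) powr p)"
    by (rule Bochner_Integration.integrable_bound[OF ib[of 1 1]]) (use b[of 1 1] in \<open>auto intro: order_trans[OF _ abs_ge_self]\<close>)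
  show "pnorm p (\<lambda>\<xi>. Y \<xi> + Z \<xi>) \<le> pnorm p Y + pnorm p Z"
  proof (rule field_le_epsilon)
    fix e :: real assume e: "e > 0"
    define A where "A = pnorm p Y + e/2"
    define B where "B = pnorm p Z + e/2"
    have AB: "A > 0" "B > 0" using e pnorm_nonneg[of p] by (auto simp: A_def B_def add_nonneg_pos)
    have le: "(\<integral>\<xi>. norm (Y \<xi>) powr p \<partial>torus_measure) \<le> A powr p" "(\<integral>\<xi>. norm (Z \<xi>) powr p \<partial>torus_measure) \<le> B powr p"
      using p e by (auto simp: pnorm_powr[symmetric] A_def B_def pnorm_nonneg intro!: powr_mono2)
    have "(\<integral>\<xi>. norm (Y \<xi> + Z \<xi>) powr p \<partial>torus_measure) \<le> (\<integral>\<xi>. ?b A B \<xi> \<partial>torus_measure)"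
      by (rule integral_mono[OF I ib]) (use b AB in auto)
    also have "\<dots> = (A + B) powr p * (A / (A + B) * ((\<integral>\<xi>. norm (Y \<xi>) powr p \<partial>torus_measure) / A powr p) + B / (A + B) * ((\<integral>\<xi>. norm (Z \<xi>) powr p \<partial>torus_measure) / B powr p))"
      by (simp add: i)
    also have "\<dots> \<le> (A + B) powr p * (A / (A + B) * 1 + B / (A + B) * 1)"
      using le AB by (intro mult_left_mono add_mono) (auto simp: divide_le_eq)
    also have "\<dots> = (A + B) powr p" using AB by (simp add: add_divide_distrib[symmetric])
    finally have "(\<integral>\<xi>. norm (Y \<xi> + Z \<xi>) powr p \<partial>torus_measure) powr (1 / p) \<le> ((A + B) powr p) powr (1 / p)"
      using p by (intro powr_mono2) (auto simp: integral_nonneg_AE)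
    also have "\<dots> = A + B" using p AB by (simp add: powr_powr)
    finally show "pnorm p (\<lambda>\<xi>. Y \<xi> + Z \<xi>) \<le> pnorm p Y + pnorm p Z + e"
      by (simp add: pnorm_def[of p "\<lambda>\<xi>. Y \<xi> + Z \<xi>"] A_def B_def)
  qed
qed

lemma pnorm_uminus: "pnorm p (\<lambda>\<xi>. - Y \<xi>) = pnorm p Y"
  by (simp add: pnorm_def)

lemma pnorm_diff_le:
  assumes p: "p \<ge> 1" and m: "Y \<in> borel_measurable torus_measure" "Z \<in> borel_measurable torus_measure"
    and i: "integrable torus_measure (\<lambda>\<xi>. norm (Y \<xi>) powr p)" "integrable torus_measure (\<lambda>\<xi>. norm (Z \<xi>) powr p)"
  shows "\<bar>pnorm p Y - pnorm p Z\<bar> \<le> pnorm p (\<lambda>\<xi>. Y \<xi> - Z \<xi>)"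
proof -
  have iD: "integrable torus_measure (\<lambda>\<xi>. norm (Y \<xi> - Z \<xi>) powr p)" 
    using Minkowski(1)[OF p m(1), of "\<lambda>\<xi>. - Z \<xi>"] m i by simp
  have "pnorm p Y \<le> pnorm p (\<lambda>\<xi>. Y \<xi> - Z \<xi>) + pnorm p Z"
    using Minkowski(2)[OF p _ m(2) iD i(2)] m by simp
  moreover have "pnorm p Z \<le> pnorm p Y + pnorm p (\<lambda>\<xi>. - (Y \<xi> - Z \<xi>))"
    using Minkowski(2)[OF p m(1), of "\<lambda>\<xi>. - (Y \<xi> - Z \<xi>)"] m i iD by (simp add: norm_minus_commute)
  ultimately show ?thesis unfolding pnorm_uminus by linarith
qed

section \<open>Horizontal translation contracts the norm\<close>

lemma tpoly_has_field_derivative: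
  assumes "a \<in> dirichlet_polys"
  shows "(tpoly a \<xi> has_field_derivative tpoly (\<lambda>n. - of_real (ln (real n)) * a n) \<xi> s) (at s)"
proof -
  have "(tpoly a \<xi> has_field_derivative (\<Sum>n | a n \<noteq> 0. a n * cmult_ext \<xi> n * (- (of_nat n powr (- s) * Ln (of_nat n))))) (at s)"
    unfolding tpoly_def
  proof (intro DERIV_sum DERIV_cmult)
    fix n assume "n \<in> {n. a n \<noteq> 0}"
    then have n: "(of_nat n :: complex) \<noteq> 0" using dirichlet_polysD[OF assms] by auto
    show "((\<lambda>s. of_nat n powr - s) has_field_derivative - (of_nat n powr - s * Ln (of_nat n))) (at s)"
      using DERIV_chain2[OF has_field_derivative_powr_right[OF n] DERIV_minus[OF DERIV_ident], of s]
      by (simp add: mult.commute)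
  qed
  also have "(\<Sum>n | a n \<noteq> 0. a n * cmult_ext \<xi> n * (- (of_nat n powr (- s) * Ln (of_nat n)))) = tpoly (\<lambda>n. - of_real (ln (real n)) * a n) \<xi> s"
    by (subst tpoly_superset[of "{n. a n \<noteq> 0}"])
       (use dirichlet_polysD[OF assms] in \<open>auto intro!: sum.cong simp: Ln_of_nat\<close>)
  finally show ?thesis .
qed

lemma tpoly_equivariant_family:
  assumes a: "a \<in> dirichlet_polys" and p: "p \<ge> 1"
  shows "equivariant_family (tpoly a) (tpoly (\<lambda>n. - of_real (ln (real n)) * a n)) c p"
proof
  have "(tpoly a \<xi>) holomorphic_on {s. c < Re s}" for \<xi>
    by (rule holomorphic_on_subset[of _ UNIV])
       (use tpoly_has_field_derivative[OF a] in \<open>auto intro!: derivative_intros simp: holomorphic_on_open\<close>)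
  moreover have "deriv (tpoly a \<xi>) s = tpoly (\<lambda>n. - of_real (ln (real n)) * a n) \<xi> s" for \<xi> s
    by (rule DERIV_imp_deriv[OF tpoly_has_field_derivative[OF a]])
  ultimately show "AE \<xi> in torus_measure. tpoly a \<xi> holomorphic_on {s. c < Re s} \<and>
     (\<forall>s. c < Re s \<longrightarrow> deriv (tpoly a \<xi>) s = tpoly (\<lambda>n. - of_real (ln (real n)) * a n) \<xi> s)" by auto
qed (use dirichlet_polysD[OF a] in \<open>auto simp: tpoly_rot p\<close>)

text \<open>
  In \<open>mean_formula\<close> the weight \<open>(\<sigma> - al)\<^sup>+\<close> decreases as \<open>al\<close> grows.
\<close>

lemma tpoly_contract:
  assumes a: "a \<in> dirichlet_polys" and p: "p \<ge> 1" and s: "Re s \<ge> 0"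
  shows "(\<integral>\<^sup>+\<xi>. ennreal (norm (tpoly a \<xi> s) powr p) \<partial>torus_measure) \<le> ennreal (dpoly_norm p a powr p)"
proof -
  \<comment> \<open>A Dirichlet polynomial is entire, so the half-plane may be taken to contain the line \<open>Re s = 0\<close>.\<close>
  interpret E: equivariant_family "tpoly a" "tpoly (\<lambda>n. - of_real (ln (real n)) * a n)" "-1" p
    by (rule tpoly_equivariant_family[OF a p])
  have pm: "E.pmean \<sigma> = ennreal (\<integral>\<xi>. norm (tpoly a \<xi> (of_real \<sigma>)) powr p \<partial>torus_measure)" for \<sigma>
    unfolding E.pmean_def using p by (intro nn_integral_eq_integral tpoly_powr_integrable a) auto
  have lim: "(E.pmean \<longlongrightarrow> ennreal (norm (a 1) powr p)) at_top"
    unfolding pm[abs_def] by (intro tendsto_ennrealI tpoly_powr_mean_at_top a) (use p in auto)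
  define C where "C = (\<Sum>n | a n \<noteq> 0. norm (a n) * real n powr 1) powr p"
  have bd: "E.pmean \<sigma> \<le> ennreal C" if "\<sigma> > -1" for \<sigma>
  proof -
    have "E.pmean \<sigma> \<le> (\<integral>\<^sup>+\<xi>. ennreal C \<partial>torus_measure)"
      unfolding E.pmean_def C_def
      by (intro nn_integral_mono ennreal_leI powr_mono2 tpoly_bound[OF a]) (use that p in auto)
    then show ?thesis by (simp add: TM.emeasure_space_1)
  qed
  have "E.pmean (Re s) = (\<integral>\<^sup>+\<sigma>. ennreal (max 0 (\<sigma> - Re s)) * E.mean_density \<sigma> \<partial>lborel) + ennreal (norm (a 1) powr p)"
    by (rule E.mean_formula[OF _ bd lim, symmetric]) (use s in auto)
  also have "\<dots> \<le> (\<integral>\<^sup>+\<sigma>. ennreal (max 0 (\<sigma> - 0)) * E.mean_density \<sigma> \<partial>lborel) + ennreal (norm (a 1) powr p)"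
    using s by (intro add_mono nn_integral_mono mult_right_mono ennreal_leI) auto
  also have "\<dots> = E.pmean 0"
    by (rule E.mean_formula[OF _ bd lim]) auto
  also have "E.pmean 0 = ennreal (dpoly_norm p a powr p)"
    using p by (simp add: pm dpoly_norm_eq[OF a] pnorm_powr)
  also have "E.pmean (Re s) = (\<integral>\<^sup>+\<xi>. ennreal (norm (tpoly a \<xi> s) powr p) \<partial>torus_measure)"
    using E.pmean_shift[of "Re s" "Im s"] by simp
  finally show ?thesis .
qed

section \<open>A summation kernel with trapezoidal Fourier transform\<close>

lemma nn_integral_even:
  fixes h :: "real \<Rightarrow> ennreal"
  assumes [measurable]: "h \<in> borel_measurable borel" and even: "\<And>t. h (- t) = h t"
  shows "(\<integral>\<^sup>+t. h t \<partial>lborel) = 2 * (\<integral>\<^sup>+t. h t * indicator {0<..} t \<partial>lborel)"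
proof -
  have "(\<integral>\<^sup>+t. h t \<partial>lborel) = (\<integral>\<^sup>+t. h t * indicator {0<..} t + h t * indicator {..<0} t \<partial>lborel)"
  proof (rule nn_integral_cong_AE)
    have "AE t in lborel. t \<noteq> (0::real)" by (rule AE_lborel_singleton)
    then show "AE t in lborel. h t = h t * indicator {0<..} t + h t * indicator {..<0} t"
      by eventually_elim (auto simp: indicator_def)
  qed
  also have "\<dots> = (\<integral>\<^sup>+t. h t * indicator {0<..} t \<partial>lborel) + (\<integral>\<^sup>+t. h t * indicator {..<0} t \<partial>lborel)"
    by (rule nn_integral_add) measurable
  also have "(\<integral>\<^sup>+t. h t * indicator {..<0} t \<partial>lborel) = (\<integral>\<^sup>+t. h t * indicator {0<..} t \<partial>lborel)"
    by (subst nn_integral_real_affine[where c = "-1" and t = 0])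
       (auto intro!: nn_integral_cong simp: even indicator_def)
  finally show ?thesis by (simp add: mult_2)
qed

lemma one_minus_cos_over_at_0: "((\<lambda>t::real. (1 - cos t) / t) \<longlongrightarrow> 0) (at 0)"
proof -
  have "((\<lambda>h. (cos (0 + h) - cos 0) / h) \<longlongrightarrow> - sin (0::real)) (at 0)"
    using DERIV_cos[of "0::real"] by (simp add: DERIV_def)
  from tendsto_minus[OF this] show ?thesis by (simp add: minus_divide_left)
qed

text \<open>
  Integration by parts reduces the integral to that of \<open>sin t / t\<close>.
\<close>

lemma nn_integral_one_minus_cos_half:
  "(\<integral>\<^sup>+t. ennreal ((1 - cos t) / t\<^sup>2) * indicator {0<..} t \<partial>lborel) = ennreal (pi / 2)"
proof -
  define F where "F t = Si t - (1 - cos t) / t" for t :: real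
  define a where "a n = 1 / real (Suc n)" for n
  have a: "a n > 0" for n by (simp add: a_def)
  have a0: "a \<longlonglongrightarrow> 0" unfolding a_def by (rule LIMSEQ_Suc[OF lim_1_over_n])
  have F: "DERIV F x :> (1 - cos x) / x\<^sup>2" if "x > 0" for x
  proof -
    have "DERIV F x :> sinc x - (sin x * x - (1 - cos x)) / (x * x)"
      unfolding F_def using that by (auto intro!: derivative_eq_intros DERIV_Si)
    moreover have "sinc x - (sin x * x - (1 - cos x)) / (x * x) = (1 - cos x) / x\<^sup>2"
      using that by (simp add: diff_divide_distrib power2_eq_square)
    ultimately show ?thesis by simp
  qed
  have Ftop: "(F \<longlongrightarrow> pi / 2 - 0) at_top"
    unfolding F_def
  proof (intro tendsto_diff Si_at_top)
    show "((\<lambda>x::real. (1 - cos x) / x) \<longlongrightarrow> 0) at_top"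
    proof (rule Lim_null_comparison)
      show "eventually (\<lambda>x. norm ((1 - cos x) / x) \<le> 2 / x) at_top"
        using eventually_gt_at_top[of 0]
      proof eventually_elim
        case (elim x)
        have "0 \<le> 1 - cos x" "1 - cos x \<le> 2" using cos_ge_minus_one[of x] by auto
        then show ?case using elim by (simp add: divide_right_mono)
      qed
      show "((\<lambda>x::real. 2 / x) \<longlongrightarrow> 0) at_top"
        by (rule tendsto_divide_0[OF tendsto_const]) (rule filterlim_at_top_imp_at_infinity[OF filterlim_ident])
    qed
  qed
  have F0: "(\<lambda>n. F (a n)) \<longlonglongrightarrow> Si 0 - 0"
    unfolding F_def
  proof (rule tendsto_diff)
    show "(\<lambda>n. Si (a n)) \<longlonglongrightarrow> Si 0" by (rule isCont_tendsto_compose[OF isCont_Si a0])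
    show "(\<lambda>n. (1 - cos (a n)) / a n) \<longlonglongrightarrow> 0"
      by (rule filterlim_compose[OF one_minus_cos_over_at_0])
         (use a0 less_imp_neq[OF a, THEN not_sym] in \<open>auto simp: filterlim_at\<close>)
  qed
  have "Si 0 = 0" by (simp add: Si_def zero_ereal_def)
  with F0 have F0: "(\<lambda>n. F (a n)) \<longlonglongrightarrow> 0" by simp
  have step: "(\<integral>\<^sup>+t. ennreal ((1 - cos t) / t\<^sup>2) * indicator {a n..} t \<partial>lborel) = ennreal (pi / 2 - F (a n))" for n
    using nn_integral_FTC_atLeast[of "\<lambda>t. (1 - cos t) / t\<^sup>2" "a n" F "pi / 2"] F Ftop a[of n] by auto
  have "(\<lambda>n. \<integral>\<^sup>+t. ennreal ((1 - cos t) / t\<^sup>2) * indicator {a n..} t \<partial>lborel) \<longlonglongrightarrow> (\<integral>\<^sup>+t. ennreal ((1 - cos t) / t\<^sup>2) * indicator {0<..} t \<partial>lborel)"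
  proof (rule nn_integral_LIMSEQ)
    show "incseq (\<lambda>n t. ennreal ((1 - cos t) / t\<^sup>2) * indicator {a n..} t)"
    proof (intro incseq_SucI le_funI mult_left_mono)
      fix n and t :: real
      have "a (Suc n) \<le> a n" unfolding a_def by (simp add: field_simps)
      then show "indicator {a n..} t \<le> (indicator {a (Suc n)..} t :: ennreal)" by (auto simp: indicator_def)
    qed auto
    fix t :: real
    show "(\<lambda>n. ennreal ((1 - cos t) / t\<^sup>2) * indicator {a n..} t) \<longlonglongrightarrow> ennreal ((1 - cos t) / t\<^sup>2) * indicator {0<..} t"
    proof (cases "t > 0")
      case True
      have "eventually (\<lambda>n. a n < t) sequentially" using order_tendstoD(2)[OF a0 True] .
      then have "eventually (\<lambda>n. ennreal ((1 - cos t) / t\<^sup>2) * indicator {a n..} t = ennreal ((1 - cos t) / t\<^sup>2) * indicator {0<..} t) sequentially"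
        by eventually_elim (use True in auto)
      then show ?thesis by (rule tendsto_eventually)
    next
      case False
      then have "indicator {a n..} t = (0::ennreal)" for n using a[of n] by (auto simp: indicator_def)
      then show ?thesis using False by simp
    qed
  qed auto
  moreover have "(\<lambda>n. ennreal (pi / 2 - F (a n))) \<longlonglongrightarrow> ennreal (pi / 2 - 0)"
    by (intro tendsto_ennrealI tendsto_diff tendsto_const F0)
  ultimately show ?thesis unfolding step using LIMSEQ_unique by fastforce
qed

lemma has_bochner_integral_one_minus_cos:
  "has_bochner_integral lborel (\<lambda>t::real. (1 - cos (c * t)) / t\<^sup>2) (pi * \<bar>c\<bar>)"
proof (cases "c = 0")
  case False
  have "(\<integral>\<^sup>+t. ennreal ((1 - cos t) / t\<^sup>2) \<partial>lborel) = ennreal pi"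
    by (subst nn_integral_even) (auto simp: nn_integral_one_minus_cos_half ennreal_mult''[symmetric] simp flip: ennreal_numeral)
  then have "ennreal pi = ennreal \<bar>c\<bar> * (\<integral>\<^sup>+t. ennreal ((1 - cos (c * t)) / (c * t)\<^sup>2) \<partial>lborel)"
    using nn_integral_real_affine[of "\<lambda>t. ennreal ((1 - cos t) / t\<^sup>2)" c 0] False by simp
  also have "\<dots> = (\<integral>\<^sup>+t. ennreal \<bar>c\<bar> * ennreal ((1 - cos (c * t)) / (c * t)\<^sup>2) \<partial>lborel)"
    by (rule nn_integral_cmult[symmetric]) measurable
  finally have 1: "ennreal pi = (\<integral>\<^sup>+t. ennreal (\<bar>c\<bar> * ((1 - cos (c * t)) / (c * t)\<^sup>2)) \<partial>lborel)"
    by (simp add: ennreal_mult' del: times_divide_eq_right)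
  have "ennreal \<bar>c\<bar> * ennreal pi = (\<integral>\<^sup>+t. ennreal \<bar>c\<bar> * ennreal (\<bar>c\<bar> * ((1 - cos (c * t)) / (c * t)\<^sup>2)) \<partial>lborel)"
    unfolding 1 by (rule nn_integral_cmult[symmetric]) measurable
  also have "\<dots> = (\<integral>\<^sup>+t. ennreal ((1 - cos (c * t)) / t\<^sup>2) \<partial>lborel)"
  proof (intro nn_integral_cong)
    fix t
    have "\<bar>c\<bar> * (\<bar>c\<bar> * ((1 - cos (c * t)) / (c * t)\<^sup>2)) = (1 - cos (c * t)) / t\<^sup>2"
    proof -
      have "\<bar>c\<bar> * (\<bar>c\<bar> * ((1 - cos (c * t)) / (c * t)\<^sup>2)) = (\<bar>c\<bar> * \<bar>c\<bar>) * ((1 - cos (c * t)) / (c * t)\<^sup>2)"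
        by (simp only: mult.assoc)
      also have "\<dots> = (c * c) * ((1 - cos (c * t)) / (c * t)\<^sup>2)" by (simp only: abs_mult_self_eq)
      also have "\<dots> = (1 - cos (c * t)) / t\<^sup>2" using False by (simp add: power2_eq_square)
      finally show ?thesis .
    qed
    then show "ennreal \<bar>c\<bar> * ennreal (\<bar>c\<bar> * ((1 - cos (c * t)) / (c * t)\<^sup>2)) = ennreal ((1 - cos (c * t)) / t\<^sup>2)"
      by (subst ennreal_mult'[symmetric]) auto
  qed
  finally have "(\<integral>\<^sup>+t. ennreal ((1 - cos (c * t)) / t\<^sup>2) \<partial>lborel) = ennreal (pi * \<bar>c\<bar>)"
    by (simp add: ennreal_mult'[symmetric] mult.commute)
  then show ?thesis
    by (intro has_bochner_integral_nn_integral) auto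
qed (simp add: has_bochner_integral_zero)

text \<open>
  The kernel whose Fourier transform is the trapezoid equal to 1 on \<open>[-a, a]\<close>, to 0 outside \<open>[-b, b]\<close>, and
  linear in between.
\<close>

definition trap_kernel :: "real \<Rightarrow> real \<Rightarrow> real \<Rightarrow> real" where
  "trap_kernel a b t = (cos (a * t) - cos (b * t)) / (pi * (b - a) * t\<^sup>2)"

lemma trap_kernel_measurable [measurable]: "trap_kernel a b \<in> borel_measurable borel"
  unfolding trap_kernel_def by measurable

lemma trap_kernel_even: "trap_kernel a b (- t) = trap_kernel a b t"
  by (simp add: trap_kernel_def)

text \<open>
  The product formula for cosines writes the integrand as a combination of four functions
  \<open>(1 - cos (c t)) / t\<^sup>2\<close>, each with integral \<open>\<pi> \<bar>c\<bar>\<close>.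
\<close>

lemma has_bochner_integral_trap_kernel_cos:
  assumes "a < b"
  shows "has_bochner_integral lborel (\<lambda>t. trap_kernel a b t * cos (l * t))
     ((\<bar>b + l\<bar> + \<bar>b - l\<bar> - \<bar>a + l\<bar> - \<bar>a - l\<bar>) / (2 * (b - a)))"
proof -
  let ?h = "\<lambda>c t. (1 - cos (c * t)) / t\<^sup>2 :: real"
  have "has_bochner_integral lborel (\<lambda>t. (1 / (2 * pi * (b - a))) * (?h (b + l) t + ?h (b - l) t - ?h (a + l) t - ?h (a - l) t))
     ((1 / (2 * pi * (b - a))) * (pi * \<bar>b + l\<bar> + pi * \<bar>b - l\<bar> - pi * \<bar>a + l\<bar> - pi * \<bar>a - l\<bar>))"
    by (intro has_bochner_integral_mult_right has_bochner_integral_add has_bochner_integral_diff has_bochner_integral_one_minus_cos)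
  moreover have "(1 / (2 * pi * (b - a))) * (?h (b + l) t + ?h (b - l) t - ?h (a + l) t - ?h (a - l) t) = trap_kernel a b t * cos (l * t)" for t
  proof -
    have c: "cos ((x + l) * t) + cos ((x - l) * t) = 2 * (cos (x * t) * cos (l * t))" for x
      by (simp add: distrib_right left_diff_distrib cos_add cos_diff)
    have "?h (b + l) t + ?h (b - l) t - ?h (a + l) t - ?h (a - l) t =
       ((cos ((a + l) * t) + cos ((a - l) * t)) - (cos ((b + l) * t) + cos ((b - l) * t))) / t\<^sup>2"
      by (simp add: diff_divide_distrib add_divide_distrib)
    also have "\<dots> = 2 * ((cos (a * t) - cos (b * t)) * cos (l * t)) / t\<^sup>2"
      unfolding c by (simp add: algebra_simps)
    finally have e: "?h (b + l) t + ?h (b - l) t - ?h (a + l) t - ?h (a - l) t = \<dots>" .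
    show ?thesis unfolding e trap_kernel_def by simp
  qed
  moreover have "(1 / (2 * pi * (b - a))) * (pi * \<bar>b + l\<bar> + pi * \<bar>b - l\<bar> - pi * \<bar>a + l\<bar> - pi * \<bar>a - l\<bar>) =
     (\<bar>b + l\<bar> + \<bar>b - l\<bar> - \<bar>a + l\<bar> - \<bar>a - l\<bar>) / (2 * (b - a))"
  proof -
    have "pi * \<bar>b + l\<bar> + pi * \<bar>b - l\<bar> - pi * \<bar>a + l\<bar> - pi * \<bar>a - l\<bar> = pi * (\<bar>b + l\<bar> + \<bar>b - l\<bar> - \<bar>a + l\<bar> - \<bar>a - l\<bar>)"
      by (simp add: algebra_simps)
    then show ?thesis using assms by simp
  qed
  ultimately show ?thesis by simp
qed

lemma trap_kernel_cos_plateau: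
  assumes "0 \<le> a" "a < b" "0 \<le> l" "l \<le> a"
  shows "has_bochner_integral lborel (\<lambda>t. trap_kernel a b t * cos (l * t)) 1"
proof -
  have "(\<bar>b + l\<bar> + \<bar>b - l\<bar> - \<bar>a + l\<bar> - \<bar>a - l\<bar>) / (2 * (b - a)) = 1" using assms by (simp add: abs_if)
  then show ?thesis using has_bochner_integral_trap_kernel_cos[OF assms(2), of l] by (simp only:)
qed

lemma trap_kernel_cos_zero:
  assumes "0 \<le> a" "a < b" "b \<le> l"
  shows "has_bochner_integral lborel (\<lambda>t. trap_kernel a b t * cos (l * t)) 0"
proof -
  have "(\<bar>b + l\<bar> + \<bar>b - l\<bar> - \<bar>a + l\<bar> - \<bar>a - l\<bar>) / (2 * (b - a)) = 0" using assms by (simp add: abs_if)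
  then show ?thesis using has_bochner_integral_trap_kernel_cos[OF assms(2), of l] by (simp only:)
qed

lemma abs_cos_diff_le:
  fixes x y :: real
  shows "\<bar>cos x - cos y\<bar> \<le> \<bar>x\<^sup>2 - y\<^sup>2\<bar> / 2" "\<bar>cos x - cos y\<bar> \<le> \<bar>y - x\<bar>" "\<bar>cos x - cos y\<bar> \<le> 2"
proof -
  have e: "\<bar>cos x - cos y\<bar> = 2 * (\<bar>sin ((x + y) / 2)\<bar> * \<bar>sin ((y - x) / 2)\<bar>)"
    by (simp add: cos_diff_cos abs_mult)
  have "\<bar>sin ((x + y) / 2)\<bar> * \<bar>sin ((y - x) / 2)\<bar> \<le> \<bar>(x + y) / 2\<bar> * \<bar>(y - x) / 2\<bar>"
    by (intro mult_mono abs_sin_x_le_abs_x) auto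
  also have "\<dots> = \<bar>x\<^sup>2 - y\<^sup>2\<bar> / 4"
    by (simp add: abs_mult[symmetric] power2_eq_square algebra_simps abs_minus_commute)
  finally show "\<bar>cos x - cos y\<bar> \<le> \<bar>x\<^sup>2 - y\<^sup>2\<bar> / 2" unfolding e by simp
  have "\<bar>sin ((x + y) / 2)\<bar> * \<bar>sin ((y - x) / 2)\<bar> \<le> 1 * \<bar>(y - x) / 2\<bar>"
    by (intro mult_mono abs_sin_x_le_abs_x) auto
  then show "\<bar>cos x - cos y\<bar> \<le> \<bar>y - x\<bar>" unfolding e by simp
  have "\<bar>sin ((x + y) / 2)\<bar> * \<bar>sin ((y - x) / 2)\<bar> \<le> 1 * 1"
    by (intro mult_mono) auto
  then show "\<bar>cos x - cos y\<bar> \<le> 2" unfolding e by simp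
qed

text \<open>
  The kernel is at most \<open>(a + b) / 2\<close>, at most \<open>1 / t\<close>, and at most \<open>2 / ((b - a) t\<^sup>2)\<close> in absolute value;
  these bounds are used on \<open>[0, 1]\<close>, \<open>[1, R]\<close> and \<open>[R, \<infinity>)\<close>.
\<close>

lemma trap_kernel_L1:
  assumes ab: "0 \<le> a" "a < b" and R: "R \<ge> 1"
  shows "(\<integral>\<^sup>+t. ennreal \<bar>trap_kernel a b t\<bar> \<partial>lborel) \<le> ennreal (a + b + 2 * ln R + 4 / ((b - a) * R))"
proof -
  let ?d = "b - a"
  have d: "?d > 0" using ab by simp
  define k where "k = 2 / ?d"
  have k0: "k \<ge> 0" using d by (simp add: k_def)
  have pi1: "1 \<le> pi" using pi_ge_two by simp
  have div_pi: "x / pi \<le> x" if "x \<ge> 0" for x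
    using that pi1 by (simp add: divide_le_eq mult_le_cancel_left1)
  have kt: "\<bar>trap_kernel a b t\<bar> = \<bar>cos (a * t) - cos (b * t)\<bar> / (?d * t\<^sup>2) / pi" for t
    using d by (simp add: trap_kernel_def abs_mult mult_ac)
  have k': "\<bar>trap_kernel a b t\<bar> \<le> \<bar>cos (a * t) - cos (b * t)\<bar> / (?d * t\<^sup>2)" for t
    unfolding kt using d by (intro div_pi) auto
  have b1: "\<bar>trap_kernel a b t\<bar> \<le> (a + b) / 2" if t: "t > 0" for t
  proof -
    have "\<bar>trap_kernel a b t\<bar> \<le> (\<bar>(a * t)\<^sup>2 - (b * t)\<^sup>2\<bar> / 2) / (?d * t\<^sup>2)"
      using d by (intro order_trans[OF k'] divide_right_mono abs_cos_diff_le) auto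
    also have "\<bar>(a * t)\<^sup>2 - (b * t)\<^sup>2\<bar> = (?d * t\<^sup>2) * (a + b)"
    proof -
      have "(a * t)\<^sup>2 - (b * t)\<^sup>2 = - ((?d * t\<^sup>2) * (a + b))" by (simp add: power2_eq_square algebra_simps)
      then show ?thesis using d ab by (simp add: abs_mult)
    qed
    finally show ?thesis using d t by simp
  qed
  have b2: "\<bar>trap_kernel a b t\<bar> \<le> 1 / t" if t: "t > 0" for t
  proof -
    have "\<bar>trap_kernel a b t\<bar> \<le> \<bar>b * t - a * t\<bar> / (?d * t\<^sup>2)"
      using d by (intro order_trans[OF k'] divide_right_mono abs_cos_diff_le) auto
    also have "\<bar>b * t - a * t\<bar> = ?d * t" using d t by (simp add: left_diff_distrib[symmetric] abs_mult)
    finally show ?thesis using d t by (simp add: power2_eq_square)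
  qed
  have b3: "\<bar>trap_kernel a b t\<bar> \<le> k * (1 / t\<^sup>2)" if t: "t > 0" for t
  proof -
    have "\<bar>trap_kernel a b t\<bar> \<le> 2 / (?d * t\<^sup>2)"
      using d by (intro order_trans[OF k'] divide_right_mono abs_cos_diff_le) auto
    then show ?thesis by (simp add: k_def)
  qed
  have I1: "(\<integral>\<^sup>+t. ennreal ((a + b) / 2) * indicator {0..1::real} t \<partial>lborel) = ennreal ((a + b) / 2)"
    by (simp add: nn_integral_cmult emeasure_lborel_Icc_eq)
  have I2: "(\<integral>\<^sup>+t. ennreal (1 / t) * indicator {1..R} t \<partial>lborel) = ennreal (ln R - ln 1)"
    by (rule nn_integral_FTC_Icc) (use R in \<open>auto intro!: derivative_eq_intros simp: has_real_derivative_iff_has_vector_derivative[symmetric] divide_inverse\<close>)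
  have I3: "(\<integral>\<^sup>+t. ennreal (k * (1 / t\<^sup>2)) * indicator {R..} t \<partial>lborel) = ennreal (0 - (- (k * (1 / R))))"
  proof (rule nn_integral_FTC_atLeast)
    show "DERIV (\<lambda>t. - (k * (1 / t))) x :> k * (1 / x\<^sup>2)" if "R \<le> x" for x
    proof -
      show ?thesis
        using that R by (auto intro!: derivative_eq_intros simp: power2_eq_square)
    qed
    have "((\<lambda>t::real. - (k * (1 / t))) \<longlongrightarrow> - (k * 0)) at_top"
      by (intro tendsto_intros tendsto_divide_0[OF tendsto_const] filterlim_at_top_imp_at_infinity[OF filterlim_ident])
    then show "((\<lambda>t::real. - (k * (1 / t))) \<longlongrightarrow> 0) at_top" by simp
  qed (use k0 in auto)
  have "(\<integral>\<^sup>+t. ennreal \<bar>trap_kernel a b t\<bar> * indicator {0<..} t \<partial>lborel) \<le>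
     (\<integral>\<^sup>+t. ennreal ((a + b) / 2) * indicator {0..1::real} t + (ennreal (1 / t) * indicator {1..R} t
       + ennreal (k * (1 / t\<^sup>2)) * indicator {R..} t) \<partial>lborel)"
  proof (intro nn_integral_mono)
    fix t :: real
    consider "t \<le> 0" | "0 < t" "t \<le> 1" | "1 < t" "t \<le> R" | "R < t" by linarith
    then show "ennreal \<bar>trap_kernel a b t\<bar> * indicator {0<..} t \<le> ennreal ((a + b) / 2) * indicator {0..1::real} t + (ennreal (1 / t) * indicator {1..R} t
       + ennreal (k * (1 / t\<^sup>2)) * indicator {R..} t)"
    proof cases
      case 2
      then show ?thesis using b1[of t] by (auto simp: ennreal_leI intro!: add_increasing2)
    next
      case 3
      then show ?thesis using b2[of t] by (auto simp: ennreal_leI intro!: add_increasing2)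
    next
      case 4
      then have "t > 0" using R by simp
      then show ?thesis using b3[of t] 4 R by (auto simp: ennreal_leI)
    qed (auto simp: indicator_def)
  qed
  also have "\<dots> = ennreal ((a + b) / 2) + (ennreal (ln R) + ennreal (k * (1 / R)))"
    by (simp add: nn_integral_add I1 I2 I3 del: times_divide_eq_right)
  also have "\<dots> = ennreal ((a + b) / 2 + (ln R + k * (1 / R)))"
  proof -
    have "0 \<le> (a + b) / 2" "0 \<le> ln R" "0 \<le> k * (1 / R)" using ab k0 R by auto
    then show ?thesis by (simp only: ennreal_plus add_nonneg_nonneg)
  qed
  finally have "2 * (\<integral>\<^sup>+t. ennreal \<bar>trap_kernel a b t\<bar> * indicator {0<..} t \<partial>lborel) \<le> 2 * ennreal ((a + b) / 2 + (ln R + k * (1 / R)))"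
    by (rule mult_left_mono) simp
  also have "\<dots> = ennreal (2 * ((a + b) / 2 + (ln R + k * (1 / R))))"
    by (subst ennreal_mult') auto
  also have "2 * ((a + b) / 2 + (ln R + k * (1 / R))) = a + b + 2 * ln R + 4 / (?d * R)"
    by (simp add: k_def)
  also have "2 * (\<integral>\<^sup>+t. ennreal \<bar>trap_kernel a b t\<bar> * indicator {0<..} t \<partial>lborel) = (\<integral>\<^sup>+t. ennreal \<bar>trap_kernel a b t\<bar> \<partial>lborel)"
    by (rule nn_integral_even[symmetric]) (auto simp: trap_kernel_even)
  finally show ?thesis .
qed

text \<open>
  The gap between \<open>ln N\<close> and \<open>ln (N + 1)\<close> is at least \<open>1 / (N + 1)\<close>; taking \<open>R = N + 1\<close> balances the last two
  terms of the bound.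
\<close>

lemma trap_kernel_log_L1:
  assumes N: "N \<ge> (1::nat)"
  shows "(\<integral>\<^sup>+t. ennreal \<bar>trap_kernel (ln (real N)) (ln (real (Suc N))) t\<bar> \<partial>lborel) \<le> ennreal (4 * ln (real N + 1) + 4)"
proof -
  let ?a = "ln (real N)" and ?b = "ln (real (Suc N))" and ?R = "real N + 1"
  have ab: "0 \<le> ?a" "?a < ?b" using N by auto
  have d: "?b - ?a \<ge> 1 / ?R"
  proof -
    have "ln (real N / (real N + 1)) \<le> real N / (real N + 1) - 1"
      using N by (intro ln_le_minus_one) auto
    also have "real N / (real N + 1) - 1 = - (1 / ?R)" by (simp add: field_simps)
    also have "ln (real N / (real N + 1)) = ?a - ?b" using N by (simp add: ln_div add.commute)
    finally show ?thesis by simp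
  qed
  then have d1: "(?b - ?a) * ?R \<ge> 1" by (simp add: divide_le_eq)
  have "(\<integral>\<^sup>+t. ennreal \<bar>trap_kernel ?a ?b t\<bar> \<partial>lborel) \<le> ennreal (?a + ?b + 2 * ln ?R + 4 / ((?b - ?a) * ?R))"
    by (rule trap_kernel_L1[OF ab]) simp
  also have "\<dots> \<le> ennreal (4 * ln (real N + 1) + 4)"
  proof (rule ennreal_leI)
    have "4 / ((?b - ?a) * ?R) \<le> 4" using d1 by (simp add: divide_le_eq)
    moreover have "?b = ln ?R" by (simp add: add.commute)
    ultimately show "?a + ?b + 2 * ln ?R + 4 / ((?b - ?a) * ?R) \<le> 4 * ln (real N + 1) + 4" using ab by linarith
  qed
  finally show ?thesis .
qed

section \<open>Abel summation for Dirichlet series\<close>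

lemma abel_summation:
  fixes c b :: "nat \<Rightarrow> 'a::comm_ring_1"
  shows "(\<Sum>n\<le>N. c n * b n) = (\<Sum>n\<le>N. c n) * b (Suc N) + (\<Sum>n\<le>N. (\<Sum>k\<le>n. c k) * (b n - b (Suc n)))"
  by (induction N) (auto simp: algebra_simps)

lemma norm_nat_powr_diff_le:
  assumes n: "n > 0" and s: "Re s > 0"
  shows "norm ((of_nat n :: complex) powr (- s) - of_nat (Suc n) powr (- s)) \<le> norm s * real n powr (- Re s - 1)"
proof -
  let ?S = "closed_segment (of_nat n :: complex) (of_nat (Suc n))"
  have S: "\<exists>x\<ge>real n. z = of_real x" if zS: "z \<in> ?S" for z
  proof -
    obtain u where u: "0 \<le> u" "u \<le> 1" "z = (1 - u) *\<^sub>R of_nat n + u *\<^sub>R of_nat (Suc n)"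
      using zS unfolding closed_segment_def by blast
    then have "z = of_real (real n + u)" by (simp add: scaleR_conv_of_real algebra_simps)
    then show ?thesis using u by (intro exI[of _ "real n + u"]) auto
  qed
  have "norm ((of_nat n :: complex) powr (- s) - of_nat (Suc n) powr (- s))
     \<le> (norm s * real n powr (- Re s - 1)) * norm (of_nat n - of_nat (Suc n) :: complex)"
  proof (rule field_differentiable_bound[where f = "\<lambda>z. z powr (- s)" and S = ?S and f' = "\<lambda>z. - s * z powr (- s - 1)"])
    fix z assume "z \<in> ?S"
    then obtain x where x: "real n \<le> x" "z = of_real x" using S by blast
    then have x0: "x > 0" using n by (auto intro: less_le_trans[of 0 "real n"])
    show "((\<lambda>z. z powr (- s)) has_field_derivative - s * z powr (- s - 1)) (at z within ?S)"
      unfolding x(2) using x0 by (auto intro!: derivative_eq_intros)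
    have "norm (- s * z powr (- s - 1)) = norm s * x powr (- Re s - 1)"
      using x0 x by (simp add: norm_mult norm_powr_real_powr)
    also have "\<dots> \<le> norm s * real n powr (- Re s - 1)"
      using x n s by (intro mult_left_mono powr_mono2') auto
    finally show "norm (- s * z powr (- s - 1)) \<le> norm s * real n powr (- Re s - 1)" .
  qed auto
  then show ?thesis by simp
qed

text \<open>
  Summation by parts replaces the series by \<open>\<Sum>n. S n * (n powr (- s) - (n + 1) powr (- s))\<close>, whose terms are
  \<open>O(n powr (\<kappa> - Re s - 1))\<close> locally uniformly in \<open>s\<close>.
\<close>

lemma dirichlet_series_holomorphic_sum:
  fixes c :: "nat \<Rightarrow> complex"
  assumes c0: "c 0 = 0" and \<kappa>: "\<kappa> > 0" and C: "\<And>n. n > 0 \<Longrightarrow> norm (\<Sum>k\<le>n. c k) \<le> C * real n powr \<kappa>"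
  shows "\<exists>g. g holomorphic_on {s. Re s > \<kappa>} \<and> (\<forall>s. Re s > \<kappa> \<longrightarrow> (\<lambda>n. c n * of_nat n powr (- s)) sums g s)"
proof -
  define S where "S n = (\<Sum>k\<le>n. c k)" for n
  let ?b = "\<lambda>s n. of_nat n powr (- s) :: complex"
  let ?t = "\<lambda>n s. S n * (?b s n - ?b s (Suc n))"
  have S0: "S 0 = 0" by (simp add: S_def c0)
  have C0: "C \<ge> 0" using C[of 1] norm_ge_zero[of "\<Sum>k\<le>1. c k"] by (simp del: norm_ge_zero)
  have tb: "norm (?t n s) \<le> C * M * real n powr (\<kappa> - r - 1)" if s: "Re s \<ge> r" "norm s \<le> M" "r > 0" for n s r M
  proof (cases "n = 0")
    case False
    then have n: "n > 0" by simp
    have "norm (?t n s) = norm (S n) * norm (?b s n - ?b s (Suc n))" by (rule norm_mult)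
    also have "\<dots> \<le> (C * real n powr \<kappa>) * (norm s * real n powr (- Re s - 1))"
      unfolding S_def by (intro mult_mono C n norm_nat_powr_diff_le) (use s C0 in auto)
    also have "\<dots> \<le> (C * real n powr \<kappa>) * (M * real n powr (- r - 1))"
      using s n C0 order_trans[OF norm_ge_zero s(2)] by (intro mult_left_mono mult_mono powr_mono) auto
    also have "\<dots> = C * M * (real n powr \<kappa> * real n powr (- r - 1))" by simp
    also have "\<dots> = C * M * real n powr (\<kappa> - r - 1)" unfolding powr_add[symmetric] by (simp add: algebra_simps)
    finally show ?thesis .
  qed (simp add: S0)
  define g where "g s = (\<Sum>n. ?t n s)" for s
  have sm: "summable (\<lambda>n. C * M * real n powr (\<kappa> - r - 1))" if "r > \<kappa>" for r M
    using that by (intro summable_mult) (simp add: summable_real_powr_iff)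
  have hol: "g holomorphic_on {s. Re s > \<kappa>}"
  proof (rule holomorphic_uniform_sequence[where f = "\<lambda>N s. \<Sum>n<N. ?t n s"])
    show "open {s. Re s > \<kappa>}" by (rule open_halfspace_Re_gt)
    have bh: "(\<lambda>s. ?b s n) holomorphic_on A" if "n > 0" for n A
      using that by (intro holomorphic_intros) auto
    have "(\<lambda>s. ?t n s) holomorphic_on A" for n A
    proof (cases "n = 0")
      case False
      then show ?thesis by (intro holomorphic_intros bh) auto
    qed (simp add: S0)
    then show "(\<lambda>s. \<Sum>n<N. ?t n s) holomorphic_on {s. Re s > \<kappa>}" for N by (intro holomorphic_on_sum)
    fix x :: complex assume x: "x \<in> {s. Re s > \<kappa>}"
    define d where "d = (Re x - \<kappa>) / 2"
    have d: "d > 0" using x by (simp add: d_def)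
    have near: "Re y \<ge> \<kappa> + d" "norm y \<le> norm x + d" if "y \<in> cball x d" for y
    proof -
      have "norm (x - y) \<le> d" using that by (simp add: dist_norm)
      moreover have "\<bar>Re (x - y)\<bar> \<le> norm (x - y)" by (rule abs_Re_le_cmod)
      moreover have "norm y \<le> norm x + norm (x - y)" using norm_triangle_sub[of y x] by (simp add: norm_minus_commute)
      moreover have "2 * d = Re x - \<kappa>" by (simp add: d_def)
      ultimately show "Re y \<ge> \<kappa> + d" "norm y \<le> norm x + d" by auto
    qed
    have "uniform_limit (cball x d) (\<lambda>N s. \<Sum>n<N. ?t n s) g sequentially"
      unfolding g_def
      by (rule Weierstrass_m_test[OF tb sm[of "\<kappa> + d" "norm x + d"]]) (use near d \<kappa> in auto)
    moreover have "cball x d \<subseteq> {s. Re s > \<kappa>}" using near(1) d by fastforce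
    ultimately show "\<exists>d>0. cball x d \<subseteq> {s. Re s > \<kappa>} \<and> uniform_limit (cball x d) (\<lambda>N s. \<Sum>n<N. ?t n s) g sequentially"
      using d by blast
  qed
  have sums: "(\<lambda>n. c n * ?b s n) sums g s" if s: "Re s > \<kappa>" for s
  proof -
    have "summable (\<lambda>n. ?t n s)"
      by (rule summable_comparison_test'[OF sm[OF s, of "norm s"], of 0]) (use tb[of "Re s" s "norm s"] s \<kappa> in auto)
    then have 1: "(\<lambda>N. \<Sum>n\<le>N. ?t n s) \<longlonglongrightarrow> g s"
      unfolding g_def by (rule summable_LIMSEQ')
    have "(\<lambda>N. S N * ?b s (Suc N)) \<longlonglongrightarrow> 0"
    proof (rule Lim_null_comparison)
      show "eventually (\<lambda>N. norm (S N * ?b s (Suc N)) \<le> C * real N powr (\<kappa> - Re s)) sequentially"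
        using eventually_gt_at_top[of 0]
      proof eventually_elim
        case (elim N)
        have "norm (S N * ?b s (Suc N)) = norm (S N) * real (Suc N) powr (- Re s)"
          by (simp add: norm_mult norm_powr_real_powr del: of_nat_Suc)
        also have "\<dots> \<le> (C * real N powr \<kappa>) * real N powr (- Re s)"
          using elim s \<kappa> C0 unfolding S_def by (intro mult_mono C powr_mono2') auto
        also have "\<dots> = C * real N powr (\<kappa> - Re s)" by (simp add: mult.assoc flip: powr_add)
        finally show ?case .
      qed
      have "(\<lambda>N. real N powr (\<kappa> - Re s)) \<longlonglongrightarrow> 0"
        using s by (intro tendsto_neg_powr filterlim_real_sequentially) auto
      then show "(\<lambda>N. C * real N powr (\<kappa> - Re s)) \<longlonglongrightarrow> 0" using tendsto_mult_right_zero by blast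
    qed
    from tendsto_add[OF this 1] have "(\<lambda>N. S N * ?b s (Suc N) + (\<Sum>n\<le>N. ?t n s)) \<longlonglongrightarrow> g s" by simp
    also have "(\<lambda>N. S N * ?b s (Suc N) + (\<Sum>n\<le>N. ?t n s)) = (\<lambda>N. \<Sum>n\<le>N. c n * ?b s n)"
      unfolding S_def by (rule ext) (rule abel_summation[symmetric])
    finally have "(\<lambda>N. \<Sum>n\<le>N. c n * ?b s n) \<longlonglongrightarrow> g s" .
    then show ?thesis by (simp add: sums_def_le)
  qed
  show ?thesis using hol sums by blast
qed

section \<open>The random analytic continuation\<close>

text \<open>
  Cauchy's integral formula on a circle of radius \<open>\<rho>\<close>; points at distance at most \<open>\<rho> / 2\<close> from the centre keep
  distance at least \<open>\<rho> / 2\<close> from the circle.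
\<close>

lemma circle_mean_bound:
  assumes g: "g holomorphic_on UNIV" and \<rho>: "\<rho> > 0" and w: "w \<in> cball c (\<rho> / 2)"
  shows "norm (g w) \<le> 2 * (LINT x:{0..1}|lborel. norm (g (c + of_real \<rho> * exp (2 * of_real pi * \<i> * of_real x))))"
proof -
  let ?\<gamma> = "\<lambda>x::real. c + of_real \<rho> * exp (2 * of_real pi * \<i> * of_real x)"
  have cg: "continuous_on A (\<lambda>x. g (?\<gamma> x))" for A
    by (rule continuous_on_compose2[OF holomorphic_on_imp_continuous_on[OF g]]) (auto intro!: continuous_intros)
  have dist: "norm (?\<gamma> x - w) \<ge> \<rho> / 2" for x
  proof -
    have "norm (?\<gamma> x - c) = \<rho>" using \<rho> by (simp add: norm_mult norm_exp_eq_Re)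
    moreover have "norm (w - c) \<le> \<rho> / 2" using w by (simp add: dist_norm norm_minus_commute)
    moreover have "norm (?\<gamma> x - c) - norm (w - c) \<le> norm (?\<gamma> x - w)"
      using norm_triangle_ineq2[of "?\<gamma> x - c" "w - c"] by (simp only: diff_diff_eq2 diff_add_cancel)
    ultimately show ?thesis by linarith
  qed
  have "((\<lambda>u. g u / (u - w)) has_contour_integral (2 * of_real pi * \<i> * g w)) (circlepath c \<rho>)"
    by (rule Cauchy_integral_circlepath_simple)
       (use holomorphic_on_subset[OF g] w \<rho> in \<open>auto simp: dist_norm norm_minus_commute\<close>)
  then have hi: "((\<lambda>x. g (?\<gamma> x) / (?\<gamma> x - w) * (2 * of_real pi * \<i> * of_real \<rho> * exp (2 * of_real pi * \<i> * of_real x))) has_integral (2 * of_real pi * \<i> * g w)) {0..1}"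
    unfolding has_contour_integral_def
  proof (rule has_integral_eq[rotated])
    fix x :: real assume "x \<in> {0..1}"
    then show "g (circlepath c \<rho> x) / (circlepath c \<rho> x - w) * vector_derivative (circlepath c \<rho>) (at x within {0..1}) =
      g (?\<gamma> x) / (?\<gamma> x - w) * (2 * of_real pi * \<i> * of_real \<rho> * exp (2 * of_real pi * \<i> * of_real x))"
      by (subst vector_derivative_circlepath01) (auto simp: circlepath)
  qed
  have ni: "(\<lambda>x. 4 * pi * norm (g (?\<gamma> x))) integrable_on {0..1}"
    by (intro integrable_continuous_interval continuous_intros cg)
  have "norm (integral {0..1} (\<lambda>x. g (?\<gamma> x) / (?\<gamma> x - w) * (2 * of_real pi * \<i> * of_real \<rho> * exp (2 * of_real pi * \<i> * of_real x))))
     \<le> integral {0..1} (\<lambda>x. 4 * pi * norm (g (?\<gamma> x)))"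
  proof (rule integral_norm_bound_integral[OF has_integral_integrable[OF hi] ni])
    fix x :: real
    have "norm (g (?\<gamma> x) / (?\<gamma> x - w) * (2 * of_real pi * \<i> * of_real \<rho> * exp (2 * of_real pi * \<i> * of_real x)))
      = norm (g (?\<gamma> x)) / norm (?\<gamma> x - w) * (2 * pi * \<rho>)"
      using \<rho> by (simp add: norm_mult norm_divide norm_exp_eq_Re)
    also have "\<dots> \<le> norm (g (?\<gamma> x)) / (\<rho> / 2) * (2 * pi * \<rho>)"
      using dist[of x] \<rho> by (intro mult_right_mono divide_left_mono mult_pos_pos) auto
    also have "\<dots> = 4 * pi * norm (g (?\<gamma> x))" using \<rho> by simp
    finally show "norm (g (?\<gamma> x) / (?\<gamma> x - w) * (2 * of_real pi * \<i> * of_real \<rho> * exp (2 * of_real pi * \<i> * of_real x))) \<le> 4 * pi * norm (g (?\<gamma> x))" .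
  qed
  then have "norm (2 * of_real pi * \<i> * g w) \<le> integral {0..1} (\<lambda>x. 4 * pi * norm (g (?\<gamma> x)))"
    by (simp only: integral_unique[OF hi])
  also have "\<dots> = 4 * pi * integral {0..1} (\<lambda>x. norm (g (?\<gamma> x)))" by simp
  also have "integral {0..1} (\<lambda>x. norm (g (?\<gamma> x))) = (LINT x:{0..1}|lborel. norm (g (?\<gamma> x)))"
    by (rule set_borel_integral_eq_integral(2)[symmetric], rule borel_integrable_atLeastAtMost')
       (intro continuous_intros cg)
  finally show ?thesis by (simp add: norm_mult)
qed

lemma le_one_plus_powr:
  fixes x p :: real
  assumes "x \<ge> 0" "p \<ge> 1" shows "x \<le> 1 + x powr p"
proof (cases "x \<le> 1")
  case False
  then have "x powr 1 \<le> x powr p" using assms by (intro powr_mono) auto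
  then show ?thesis using False by simp
qed (simp add: add_increasing2)

lemma holomorphic_tpoly: "a \<in> dirichlet_polys \<Longrightarrow> tpoly a \<xi> holomorphic_on S"
  using tpoly_has_field_derivative by (meson field_differentiable_at_within field_differentiable_def holomorphic_on_def)

text \<open>
  An approximating sequence with geometrically small steps, so that the convergence in norm
  improves to almost sure convergence.
\<close>

locale fast_approx =
  fixes p :: real and P :: "nat \<Rightarrow> nat \<Rightarrow> complex" and f :: "nat \<Rightarrow> complex"
  assumes p: "1 \<le> p" and approx: "Hp_approx p P f"
    and fast: "\<And>k. dpoly_norm p (\<lambda>n. P (Suc k) n - P k n) \<le> (1/4) ^ k"
begin

abbreviation D where "D k \<equiv> (\<lambda>n. P (Suc k) n - P k n)"

text \<open>
  The operator \<open>lim\<close> is total.  Both limits are therefore defined at every \<open>\<xi>\<close> and \<open>s\<close> and inherit exact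
  equivariance under \<open>rot\<close> from the polynomials, whether or not the sequences converge.
\<close>

definition X where "X \<xi> s = lim (\<lambda>k. tpoly (P k) \<xi> s)"
definition X' where "X' \<xi> s = lim (\<lambda>k. tpoly (\<lambda>n. - of_real (ln (real n)) * P k n) \<xi> s)"

lemma P_poly: "P k \<in> dirichlet_polys"
  using approx by (simp add: Hp_approx_def)

lemma D_poly: "D k \<in> dirichlet_polys"
  by (intro dirichlet_polys_diff P_poly)

lemma Cauchy: "\<epsilon> > 0 \<Longrightarrow> \<exists>K. \<forall>j\<ge>K. \<forall>k\<ge>K. dpoly_norm p (\<lambda>n. P j n - P k n) < \<epsilon>"
  using approx by (simp add: Hp_approx_def)

lemma coeff_tendsto: "(\<lambda>k. P k n) \<longlonglongrightarrow> f n"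
  using approx by (simp add: Hp_approx_def)

lemma dpoly_norm_nonneg: "dpoly_norm p a \<ge> 0" if "a \<in> dirichlet_polys"
  using p that by (simp add: dpoly_norm_eq pnorm_nonneg)

text \<open>
  With \<open>\<lambda> = 2\<^sup>k\<close> the inequality \<open>x \<le> (1 + (\<lambda> x) powr p) / \<lambda>\<close> turns the \<open>p\<close>-th mean, at most \<open>4\<^sup>-\<^sup>k\<^sup>p\<close>, into
  a bound for the first mean.
\<close>

lemma D_mean:
  assumes s: "Re s \<ge> 0"
  shows "(\<integral>\<^sup>+\<xi>. ennreal (norm (tpoly (D k) \<xi> s)) \<partial>torus_measure) \<le> ennreal (2 * (1/2)^k)"
proof -
  have "(\<integral>\<^sup>+\<xi>. ennreal (norm (tpoly (D k) \<xi> s)) \<partial>torus_measure) \<le>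
     (\<integral>\<^sup>+\<xi>. ennreal ((1/2)^k) * (1 + ennreal ((2^k) powr p) * ennreal (norm (tpoly (D k) \<xi> s) powr p)) \<partial>torus_measure)"
  proof (intro nn_integral_mono)
    fix \<xi>
    let ?x = "norm (tpoly (D k) \<xi> s)"
    have "?x = (1/2)^k * (2^k * ?x)" by (simp add: power_one_over)
    also have "\<dots> \<le> (1/2)^k * (1 + (2^k * ?x) powr p)"
      by (intro mult_left_mono le_one_plus_powr p) auto
    finally have "ennreal ?x \<le> ennreal ((1/2)^k * (1 + (2^k) powr p * ?x powr p))"
      by (intro ennreal_leI) (simp add: powr_mult)
    also have "\<dots> = ennreal ((1/2)^k) * (1 + ennreal ((2^k) powr p) * ennreal (?x powr p))"
      by (simp add: ennreal_mult')
    finally show "ennreal ?x \<le> ennreal ((1/2)^k) * (1 + ennreal ((2^k) powr p) * ennreal (?x powr p))" .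
  qed
  also have "\<dots> = ennreal ((1/2)^k) * (1 + ennreal ((2^k) powr p) * (\<integral>\<^sup>+\<xi>. ennreal (norm (tpoly (D k) \<xi> s) powr p) \<partial>torus_measure))"
    by (simp add: nn_integral_cmult nn_integral_add TM.emeasure_space_1)
  also have "\<dots> \<le> ennreal ((1/2)^k) * (1 + ennreal ((2^k) powr p) * ennreal (((1/4)^k) powr p))"
    using p fast[of k] dpoly_norm_nonneg[OF D_poly[of k]]
    by (intro mult_left_mono add_left_mono order_trans[OF tpoly_contract[OF D_poly p s]] ennreal_leI powr_mono2) auto
  also have "ennreal ((2^k) powr p) * ennreal (((1/4)^k) powr p) = ennreal (((1/2)^k) powr p)"
    by (simp add: ennreal_mult'[symmetric] powr_mult[symmetric] power_mult_distrib[symmetric])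
  also have "ennreal (((1/2)^k) powr p) \<le> 1"
    using p powr_le1[of p "(1/2)^k"] by (simp add: power_le_one)
  also have "ennreal ((1/2)^k) * (1 + 1) = ennreal (2 * (1/2)^k)"
    by (simp add: ennreal_mult' mult.commute)
  finally show ?thesis by (simp add: mult_left_mono add_left_mono)
qed

text \<open>
  The circle about \<open>c\<close> of radius \<open>Re c / 2\<close>, parametrised by \<open>[0, 1]\<close>; it stays in the half-plane.
\<close>

definition circ :: "complex \<Rightarrow> real \<Rightarrow> complex" where
  "circ c x = c + of_real (Re c / 2) * exp (2 * of_real pi * \<i> * of_real x)"

lemma circ_Re: "Re c > 0 \<Longrightarrow> Re (circ c x) \<ge> 0"
proof -
  assume c: "Re c > 0"
  let ?e = "of_real (Re c / 2) * exp (2 * of_real pi * \<i> * of_real x)"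
  have "\<bar>Re ?e\<bar> \<le> norm ?e" by (rule abs_Re_le_cmod)
  also have "norm ?e = Re c / 2" using c by (simp add: norm_mult norm_exp_eq_Re)
  finally show ?thesis using c unfolding circ_def plus_complex.sel by linarith
qed

lemma circ_continuous: "continuous_on S (circ c)"
  unfolding circ_def by (intro continuous_intros)

text \<open>
  By Tonelli the expectation of the sum is at most \<open>\<Sum>k. 2 * 2\<^sup>-\<^sup>k\<close>.
\<close>

lemma AE_circle_sum_finite:
  assumes c: "Re c > 0"
  shows "AE \<xi> in torus_measure. (\<Sum>k. \<integral>\<^sup>+x\<in>{0..1}. ennreal (norm (tpoly (D k) \<xi> (circ c x))) \<partial>lborel) < \<infinity>"
proof -
  have [measurable]: "circ c \<in> borel_measurable borel" by (intro borel_measurable_continuous_onI circ_continuous)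
  have m2[measurable]: "(\<lambda>x. tpoly (D k) (fst x) (circ c (snd x))) \<in> borel_measurable (torus_measure \<Otimes>\<^sub>M lborel)" for k
    using measurable_compose[OF _ tpoly_measurable_pair[of "D k"], of "\<lambda>x. (fst x, circ c (snd x))" "torus_measure \<Otimes>\<^sub>M lborel"] by simp
  have "(\<integral>\<^sup>+\<xi>. (\<Sum>k. \<integral>\<^sup>+x\<in>{0..1}. ennreal (norm (tpoly (D k) \<xi> (circ c x))) \<partial>lborel) \<partial>torus_measure)
    = (\<Sum>k. \<integral>\<^sup>+\<xi>. (\<integral>\<^sup>+x\<in>{0..1}. ennreal (norm (tpoly (D k) \<xi> (circ c x))) \<partial>lborel) \<partial>torus_measure)"
    by (intro nn_integral_suminf lborel.borel_measurable_nn_integral) (simp add: case_prod_beta')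
  also have "\<dots> \<le> (\<Sum>k. ennreal (2 * (1/2)^k))"
  proof (intro suminf_le allI)
    fix k
    have "(\<integral>\<^sup>+\<xi>. (\<integral>\<^sup>+x\<in>{0..1}. ennreal (norm (tpoly (D k) \<xi> (circ c x))) \<partial>lborel) \<partial>torus_measure)
       = (\<integral>\<^sup>+x. (\<integral>\<^sup>+\<xi>. ennreal (norm (tpoly (D k) \<xi> (circ c x))) * indicator {0..1} x \<partial>torus_measure) \<partial>lborel)"
      using torus_Fubini[of "\<lambda>\<xi> x. ennreal (norm (tpoly (D k) \<xi> (circ c x))) * indicator {0..1} x"]
      by (simp add: case_prod_beta')
    also have "\<dots> \<le> (\<integral>\<^sup>+x. ennreal (2 * (1/2)^k) * indicator {0..1::real} x \<partial>lborel)"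
    proof (intro nn_integral_mono)
      fix x
      have "(\<integral>\<^sup>+\<xi>. ennreal (norm (tpoly (D k) \<xi> (circ c x))) * indicator {0..1} x \<partial>torus_measure)
        = (\<integral>\<^sup>+\<xi>. ennreal (norm (tpoly (D k) \<xi> (circ c x))) \<partial>torus_measure) * indicator {0..1} x"
        by (rule nn_integral_multc) measurable
      also have "\<dots> \<le> ennreal (2 * (1/2)^k) * indicator {0..1} x"
        by (intro mult_right_mono D_mean circ_Re c) auto
      finally show "(\<integral>\<^sup>+\<xi>. ennreal (norm (tpoly (D k) \<xi> (circ c x))) * indicator {0..1} x \<partial>torus_measure) \<le> \<dots>" .
    qed
    also have "\<dots> = ennreal (2 * (1/2)^k)" by (simp add: nn_integral_cmult emeasure_lborel_Icc_eq)
    finally show "(\<integral>\<^sup>+\<xi>. (\<integral>\<^sup>+x\<in>{0..1}. ennreal (norm (tpoly (D k) \<xi> (circ c x))) \<partial>lborel) \<partial>torus_measure) \<le> ennreal (2 * (1/2)^k)" .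
  qed auto
  also have "\<dots> = ennreal (\<Sum>k. 2 * (1/2)^k)"
    by (intro suminf_ennreal2 summable_mult summable_geometric) auto
  also have "\<dots> < \<infinity>" by simp
  finally have "(\<integral>\<^sup>+\<xi>. (\<Sum>k. \<integral>\<^sup>+x\<in>{0..1}. ennreal (norm (tpoly (D k) \<xi> (circ c x))) \<partial>lborel) \<partial>torus_measure) < \<infinity>" .
  then have "AE \<xi> in torus_measure. (\<Sum>k. \<integral>\<^sup>+x\<in>{0..1}. ennreal (norm (tpoly (D k) \<xi> (circ c x))) \<partial>lborel) \<noteq> \<infinity>"
    by (intro nn_integral_PInf_AE borel_measurable_suminf_order lborel.borel_measurable_nn_integral)
       (auto simp: case_prod_beta')
  then show ?thesis by (simp add: less_top)
qed

text \<open>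
  The circle means are summable and bound the differences on the concentric disc of half the radius;
  the partial sums of the differences telescope.
\<close>

lemma uniform_limit_disc:
  assumes c: "Re c > 0" and fin: "(\<Sum>k. \<integral>\<^sup>+x\<in>{0..1}. ennreal (norm (tpoly (D k) \<xi> (circ c x))) \<partial>lborel) < \<infinity>"
  shows "uniform_limit (cball c (Re c / 4)) (\<lambda>k. tpoly (P k) \<xi>) (X \<xi>) sequentially"
proof -
  define a where "a k = (LINT x:{0..1}|lborel. norm (tpoly (D k) \<xi> (circ c x)))" for k
  have ct: "continuous_on A (\<lambda>x. tpoly (D k) \<xi> (circ c x))" for A k
    by (rule continuous_on_compose2[OF tpoly_continuous[OF D_poly] circ_continuous]) auto
  have ia: "integrable lborel (\<lambda>x. indicator {0..1} x * norm (tpoly (D k) \<xi> (circ c x)))" for k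
    using borel_integrable_atLeastAtMost'[OF continuous_on_norm[OF ct], of 0 1 k]
    by (simp add: set_integrable_def)
  have a0: "a k \<ge> 0" for k
    unfolding a_def set_lebesgue_integral_def by (intro integral_nonneg_AE) auto
  have an: "(\<integral>\<^sup>+x\<in>{0..1}. ennreal (norm (tpoly (D k) \<xi> (circ c x))) \<partial>lborel) = ennreal (a k)" for k
  proof -
    have "(\<integral>\<^sup>+x\<in>{0..1}. ennreal (norm (tpoly (D k) \<xi> (circ c x))) \<partial>lborel)
       = (\<integral>\<^sup>+x. ennreal (indicator {0..1} x * norm (tpoly (D k) \<xi> (circ c x))) \<partial>lborel)"
      by (intro nn_integral_cong) (auto simp: indicator_def)
    also have "\<dots> = ennreal (a k)"
      unfolding a_def set_lebesgue_integral_def real_scaleR_def by (rule nn_integral_eq_integral[OF ia]) auto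
    finally show ?thesis .
  qed
  have "summable a"
    using fin unfolding an by (intro summable_suminf_not_top a0) (simp add: less_top)
  then have sm: "summable (\<lambda>k. 2 * a k)" by (rule summable_mult)
  have "uniform_limit (cball c (Re c / 4)) (\<lambda>n w. \<Sum>k<n. tpoly (D k) \<xi> w) (\<lambda>w. suminf (\<lambda>k. tpoly (D k) \<xi> w)) sequentially"
  proof (rule Weierstrass_m_test[OF _ sm])
    fix k w assume w: "w \<in> cball c (Re c / 4)"
    show "norm (tpoly (D k) \<xi> w) \<le> 2 * a k"
      unfolding a_def circ_def
      by (rule circle_mean_bound[OF holomorphic_tpoly[OF D_poly]]) (use w c in auto)
  qed
  then have "uniform_limit (cball c (Re c / 4)) (\<lambda>n w. tpoly (P 0) \<xi> w + (\<Sum>k<n. tpoly (D k) \<xi> w))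
     (\<lambda>w. tpoly (P 0) \<xi> w + suminf (\<lambda>k. tpoly (D k) \<xi> w)) sequentially"
    by (intro uniform_limit_add uniform_limit_const)
  also have "(\<lambda>n w. tpoly (P 0) \<xi> w + (\<Sum>k<n. tpoly (D k) \<xi> w)) = (\<lambda>n. tpoly (P n) \<xi>)"
  proof (intro ext)
    fix n w show "tpoly (P 0) \<xi> w + (\<Sum>k<n. tpoly (D k) \<xi> w) = tpoly (P n) \<xi> w"
      using sum_lessThan_telescope[of "\<lambda>k. tpoly (P k) \<xi> w" n] by (simp add: tpoly_diff[OF P_poly P_poly])
  qed
  finally have u: "uniform_limit (cball c (Re c / 4)) (\<lambda>n. tpoly (P n) \<xi>)
     (\<lambda>w. tpoly (P 0) \<xi> w + suminf (\<lambda>k. tpoly (D k) \<xi> w)) sequentially" .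
  moreover have "X \<xi> w = tpoly (P 0) \<xi> w + suminf (\<lambda>k. tpoly (D k) \<xi> w)" if "w \<in> cball c (Re c / 4)" for w
    unfolding X_def by (rule limI[OF tendsto_uniform_limitI[OF u that]])
  ultimately show ?thesis
    by (subst uniform_limit_cong'[where g = "\<lambda>n. tpoly (P n) \<xi>" and i = "\<lambda>w. tpoly (P 0) \<xi> w + suminf (\<lambda>k. tpoly (D k) \<xi> w)"]) auto
qed

definition converges_at :: "(nat \<Rightarrow> complex) \<Rightarrow> bool" where
  "converges_at \<xi> \<longleftrightarrow> (\<forall>s. Re s > 0 \<longrightarrow> (\<lambda>k. tpoly (P k) \<xi> s) \<longlonglongrightarrow> X \<xi> s) \<and> X \<xi> holomorphic_on {s. Re s > 0} \<and>
     (\<forall>s. Re s > 0 \<longrightarrow> deriv (X \<xi>) s = X' \<xi> s)"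

text \<open>
  Countably many discs cover the half-plane, which leaves one null set.  Locally uniform convergence carries
  over to the derivatives.
\<close>

lemma AE_converges: "AE \<xi> in torus_measure. converges_at \<xi>"
proof -
  obtain Z :: "complex set" where Z: "countable Z" "\<And>U. open U \<Longrightarrow> U \<noteq> {} \<Longrightarrow> \<exists>d\<in>Z. d \<in> U"
    using countable_dense_setE by blast
  have "AE \<xi> in torus_measure. \<forall>c\<in>Z. Re c > 0 \<longrightarrow> (\<Sum>k. \<integral>\<^sup>+x\<in>{0..1}. ennreal (norm (tpoly (D k) \<xi> (circ c x))) \<partial>lborel) < \<infinity>"
  proof (subst AE_ball_countable[OF Z(1)], rule ballI)
    fix c assume "c \<in> Z"
    show "AE \<xi> in torus_measure. Re c > 0 \<longrightarrow> (\<Sum>k. \<integral>\<^sup>+x\<in>{0..1}. ennreal (norm (tpoly (D k) \<xi> (circ c x))) \<partial>lborel) < \<infinity>"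
      by (cases "Re c > 0") (use AE_circle_sum_finite[of c] in auto)
  qed
  then show ?thesis
  proof eventually_elim
    case (elim \<xi>)
    let ?H = "{s. Re s > 0}"
    have op: "open ?H" by (rule open_halfspace_Re_gt)
    have loc: "\<exists>d>0. cball x d \<subseteq> ?H \<and> uniform_limit (cball x d) (\<lambda>k. tpoly (P k) \<xi>) (X \<xi>) sequentially"
      if x: "x \<in> ?H" for x
    proof -
      \<comment> \<open>Small enough for the disc of radius \<open>d\<close> about \<open>x\<close> to lie in the disc about any centre \<open>c\<close>
        within distance \<open>d\<close> of \<open>x\<close>, whose radius \<open>Re c / 4\<close> exceeds \<open>15 d / 4\<close>.\<close>
      define d where "d = Re x / 16"
      have d: "d > 0" using x by (simp add: d_def)
      obtain c where c: "c \<in> Z" "c \<in> ball x d" using Z(2)[of "ball x d"] d by auto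
      have "\<bar>Re (x - c)\<bar> \<le> norm (x - c)" by (rule abs_Re_le_cmod)
      with c have Re_c: "Re c > 15 * d" by (simp add: dist_norm d_def)
      then have "Re c > 0" using d by linarith
      have sub: "cball x d \<subseteq> cball c (Re c / 4)"
      proof
        fix y assume "y \<in> cball x d"
        then have "dist c y \<le> 2 * d" using dist_triangle[of c y x] c by (simp add: dist_commute)
        then show "y \<in> cball c (Re c / 4)" using Re_c d by simp
      qed
      have "uniform_limit (cball x d) (\<lambda>k. tpoly (P k) \<xi>) (X \<xi>) sequentially"
        by (rule uniform_limit_on_subset[OF uniform_limit_disc sub]) (use \<open>Re c > 0\<close> elim c in auto)
      moreover have "cball x d \<subseteq> ?H"
      proof
        fix y assume "y \<in> cball x d"
        then have "\<bar>Re (x - y)\<bar> \<le> d" using abs_Re_le_cmod[of "x - y"] by (simp add: dist_norm)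
        moreover have "Re x = 16 * d" by (simp add: d_def)
        ultimately show "y \<in> ?H" using d by (simp only: minus_complex.sel mem_Collect_eq)
      qed
      ultimately show ?thesis using d by blast
    qed
    have hol: "X \<xi> holomorphic_on ?H"
      by (rule holomorphic_uniform_sequence[OF op holomorphic_tpoly[OF P_poly] loc])
    have conv: "(\<lambda>k. tpoly (P k) \<xi> s) \<longlonglongrightarrow> X \<xi> s" if "Re s > 0" for s
    proof -
      obtain d where "d > 0" "uniform_limit (cball s d) (\<lambda>k. tpoly (P k) \<xi>) (X \<xi>) sequentially"
        using loc[of s] \<open>Re s > 0\<close> by auto
      then show ?thesis by (elim tendsto_uniform_limitI) auto
    qed
    obtain g' where g': "\<And>s. s \<in> ?H \<Longrightarrow> (X \<xi> has_field_derivative g' s) (at s)"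
       "\<And>s. s \<in> ?H \<Longrightarrow> (\<lambda>k. tpoly (\<lambda>n. - of_real (ln (real n)) * P k n) \<xi> s) \<longlonglongrightarrow> g' s"
      using has_complex_derivative_uniform_sequence[OF op tpoly_has_field_derivative[OF P_poly] loc] by blast
    have "deriv (X \<xi>) s = X' \<xi> s" if "Re s > 0" for s
      unfolding X'_def using DERIV_imp_deriv[OF g'(1)[of s]] limI[OF g'(2)[of s]] that by simp
    then show ?case using hol conv by (simp add: converges_at_def)
  qed
qed

sublocale EF: equivariant_family X X' 0 p
proof
  show "(\<lambda>z. X (fst z) (snd z)) \<in> borel_measurable (torus_measure \<Otimes>\<^sub>M borel)"
    unfolding X_def by (intro borel_measurable_lim_metric tpoly_measurable_pair)
  show "(\<lambda>z. X' (fst z) (snd z)) \<in> borel_measurable (torus_measure \<Otimes>\<^sub>M borel)"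
    unfolding X'_def by (intro borel_measurable_lim_metric tpoly_measurable_pair)
  show "X (rot t \<xi>) s = X \<xi> (s + \<i> * of_real t)" for t \<xi> s
    unfolding X_def using dirichlet_polysD(1)[OF P_poly] by (simp add: tpoly_rot)
  show "X' (rot t \<xi>) s = X' \<xi> (s + \<i> * of_real t)" for t \<xi> s
    unfolding X'_def using dirichlet_polysD(1)[OF P_poly] by (simp add: tpoly_rot)
  show "AE \<xi> in torus_measure. X \<xi> holomorphic_on {s. 0 < Re s} \<and> (\<forall>s. 0 < Re s \<longrightarrow> deriv (X \<xi>) s = X' \<xi> s)"
    using AE_converges by eventually_elim (auto simp: converges_at_def)
qed (rule p)

lemma X_measurable1 [measurable]: "(\<lambda>\<xi>. X \<xi> s) \<in> borel_measurable torus_measure"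
  unfolding X_def by (intro borel_measurable_lim_metric tpoly_measurable)

text \<open>
  Fatou's lemma along \<open>j\<close>, with the contractivity of horizontal translations for \<open>P j - P k\<close>.  The bound
  does not depend on \<open>\<sigma>\<close>.
\<close>

lemma X_minus_P:
  assumes \<sigma>: "\<sigma> > 0" and e: "\<epsilon> > 0" and K: "\<And>j. j \<ge> K \<Longrightarrow> dpoly_norm p (\<lambda>n. P j n - P k n) < \<epsilon>"
  shows "integrable torus_measure (\<lambda>\<xi>. norm (X \<xi> (of_real \<sigma>) - tpoly (P k) \<xi> (of_real \<sigma>)) powr p)"
    and "pnorm p (\<lambda>\<xi>. X \<xi> (of_real \<sigma>) - tpoly (P k) \<xi> (of_real \<sigma>)) \<le> \<epsilon>"
proof -
  let ?s = "complex_of_real \<sigma>"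
  have "(\<integral>\<^sup>+\<xi>. ennreal (norm (X \<xi> ?s - tpoly (P k) \<xi> ?s) powr p) \<partial>torus_measure)
     = (\<integral>\<^sup>+\<xi>. liminf (\<lambda>j. ennreal (norm (tpoly (P j) \<xi> ?s - tpoly (P k) \<xi> ?s) powr p)) \<partial>torus_measure)"
  proof (rule nn_integral_cong_AE)
    show "AE \<xi> in torus_measure. ennreal (norm (X \<xi> ?s - tpoly (P k) \<xi> ?s) powr p)
      = liminf (\<lambda>j. ennreal (norm (tpoly (P j) \<xi> ?s - tpoly (P k) \<xi> ?s) powr p))"
      using AE_converges
    proof eventually_elim
      case (elim \<xi>)
      then have "(\<lambda>j. tpoly (P j) \<xi> ?s) \<longlonglongrightarrow> X \<xi> ?s" using \<sigma> by (simp add: converges_at_def)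
      then have "(\<lambda>j. norm (tpoly (P j) \<xi> ?s - tpoly (P k) \<xi> ?s) powr p) \<longlonglongrightarrow> norm (X \<xi> ?s - tpoly (P k) \<xi> ?s) powr p"
        using p by (intro tendsto_powr' tendsto_norm tendsto_diff tendsto_const) auto
      then show ?case by (intro lim_imp_Liminf[symmetric] tendsto_ennrealI) auto
    qed
  qed
  also have "\<dots> \<le> liminf (\<lambda>j. \<integral>\<^sup>+\<xi>. ennreal (norm (tpoly (P j) \<xi> ?s - tpoly (P k) \<xi> ?s) powr p) \<partial>torus_measure)"
    by (rule nn_integral_liminf) measurable
  also have "\<dots> \<le> liminf (\<lambda>j. ennreal (\<epsilon> powr p))"
  proof (rule Liminf_mono)
    show "eventually (\<lambda>j. (\<integral>\<^sup>+\<xi>. ennreal (norm (tpoly (P j) \<xi> ?s - tpoly (P k) \<xi> ?s) powr p) \<partial>torus_measure) \<le> ennreal (\<epsilon> powr p)) sequentially"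
      using eventually_ge_at_top[of K]
    proof eventually_elim
      case (elim j)
      have d: "(\<lambda>n. P j n - P k n) \<in> dirichlet_polys" by (intro dirichlet_polys_diff P_poly)
      have "(\<integral>\<^sup>+\<xi>. ennreal (norm (tpoly (P j) \<xi> ?s - tpoly (P k) \<xi> ?s) powr p) \<partial>torus_measure)
        \<le> ennreal (dpoly_norm p (\<lambda>n. P j n - P k n) powr p)"
        using tpoly_contract[OF d p, of ?s] \<sigma> by (simp add: tpoly_diff P_poly)
      also have "\<dots> \<le> ennreal (\<epsilon> powr p)"
        using K[OF elim] p dpoly_norm_nonneg[OF d] by (intro ennreal_leI powr_mono2) auto
      finally show ?case .
    qed
  qed
  also have "\<dots> = ennreal (\<epsilon> powr p)" by (simp add: Liminf_const)
  finally have le: "(\<integral>\<^sup>+\<xi>. ennreal (norm (X \<xi> ?s - tpoly (P k) \<xi> ?s) powr p) \<partial>torus_measure) \<le> ennreal (\<epsilon> powr p)" .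
  show i: "integrable torus_measure (\<lambda>\<xi>. norm (X \<xi> ?s - tpoly (P k) \<xi> ?s) powr p)"
    by (rule integrableI_bounded) (use le in \<open>auto simp: less_top[symmetric] top_unique\<close>)
  have "ennreal (\<integral>\<xi>. norm (X \<xi> ?s - tpoly (P k) \<xi> ?s) powr p \<partial>torus_measure) \<le> ennreal (\<epsilon> powr p)"
    using le by (subst nn_integral_eq_integral[symmetric, OF i]) auto
  then have "(\<integral>\<xi>. norm (X \<xi> ?s - tpoly (P k) \<xi> ?s) powr p \<partial>torus_measure) \<le> \<epsilon> powr p" by simp
  then have "pnorm p (\<lambda>\<xi>. X \<xi> ?s - tpoly (P k) \<xi> ?s) \<le> (\<epsilon> powr p) powr (1 / p)"
    unfolding pnorm_def using p by (intro powr_mono2) (auto simp: integral_nonneg_AE)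
  also have "\<dots> = \<epsilon>" using p e by (simp add: powr_powr)
  finally show "pnorm p (\<lambda>\<xi>. X \<xi> ?s - tpoly (P k) \<xi> ?s) \<le> \<epsilon>" .
qed

lemma X_integrable: "\<sigma> > 0 \<Longrightarrow> integrable torus_measure (\<lambda>\<xi>. norm (X \<xi> (of_real \<sigma>)) powr p)"
proof -
  assume \<sigma>: "\<sigma> > 0"
  obtain K where K: "\<And>j k. j \<ge> K \<Longrightarrow> k \<ge> K \<Longrightarrow> dpoly_norm p (\<lambda>n. P j n - P k n) < 1"
    using Cauchy[of 1] by auto
  have "integrable torus_measure (\<lambda>\<xi>. norm ((X \<xi> (of_real \<sigma>) - tpoly (P K) \<xi> (of_real \<sigma>)) + tpoly (P K) \<xi> (of_real \<sigma>)) powr p)"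
    using p by (intro Minkowski(1) X_minus_P(1)[OF \<sigma> _ K] tpoly_powr_integrable P_poly) auto
  then show ?thesis by simp
qed

lemma pnorm_uniform_limit:
  "uniform_limit {0<..} (\<lambda>k \<sigma>. pnorm p (\<lambda>\<xi>. tpoly (P k) \<xi> (of_real \<sigma>))) (\<lambda>\<sigma>. pnorm p (\<lambda>\<xi>. X \<xi> (of_real \<sigma>))) sequentially"
proof (rule uniform_limitI)
  fix e :: real assume e: "e > 0"
  obtain K where K: "\<And>j k. j \<ge> K \<Longrightarrow> k \<ge> K \<Longrightarrow> dpoly_norm p (\<lambda>n. P j n - P k n) < e / 2"
    using Cauchy[of "e/2"] e by auto
  show "eventually (\<lambda>k. \<forall>\<sigma>\<in>{0<..}. dist (pnorm p (\<lambda>\<xi>. tpoly (P k) \<xi> (of_real \<sigma>))) (pnorm p (\<lambda>\<xi>. X \<xi> (of_real \<sigma>))) < e) sequentially"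
    using eventually_ge_at_top[of K]
  proof eventually_elim
    case (elim k)
    show ?case
    proof
      fix \<sigma> :: real assume "\<sigma> \<in> {0<..}"
      then have \<sigma>: "\<sigma> > 0" by simp
      have "\<bar>pnorm p (\<lambda>\<xi>. X \<xi> (of_real \<sigma>)) - pnorm p (\<lambda>\<xi>. tpoly (P k) \<xi> (of_real \<sigma>))\<bar> \<le> pnorm p (\<lambda>\<xi>. X \<xi> (of_real \<sigma>) - tpoly (P k) \<xi> (of_real \<sigma>))"
        using p by (intro pnorm_diff_le X_integrable \<sigma> tpoly_powr_integrable P_poly) auto
      also have "\<dots> \<le> e / 2" by (rule X_minus_P(2)[OF \<sigma> _ K]) (use e elim in auto)
      finally show "dist (pnorm p (\<lambda>\<xi>. tpoly (P k) \<xi> (of_real \<sigma>))) (pnorm p (\<lambda>\<xi>. X \<xi> (of_real \<sigma>))) < e"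
        using e by (simp add: dist_real_def abs_minus_commute)
    qed
  qed
qed

lemma pmean_eq: "\<sigma> > 0 \<Longrightarrow> EF.pmean \<sigma> = ennreal (pnorm p (\<lambda>\<xi>. X \<xi> (of_real \<sigma>)) powr p)"
  unfolding EF.pmean_def using p
  by (subst nn_integral_eq_integral[OF X_integrable]) (auto simp: pnorm_powr)

text \<open>
  By uniformity in \<open>\<sigma>\<close> the limits \<open>\<sigma> \<rightarrow> 0\<close> and \<open>\<sigma> \<rightarrow> \<infinity>\<close> may be interchanged with \<open>k \<rightarrow> \<infinity>\<close>, which identifies the
  boundary values of \<open>pmean\<close>.
\<close>

lemma norm_formula:
  assumes N: "(\<lambda>k. dpoly_norm p (P k)) \<longlonglongrightarrow> N"
  shows "(\<integral>\<^sup>+\<sigma>. indicator {0<..} \<sigma> * (ennreal \<sigma> * EF.mean_density \<sigma>) \<partial>lborel) + ennreal (norm (f 1) powr p) = ennreal (N powr p)"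
proof -
  have p0: "p > 0" using p by simp
  have root: "((\<lambda>\<sigma>. pnorm p (\<lambda>\<xi>. tpoly (P k) \<xi> (of_real \<sigma>))) \<longlongrightarrow> L powr (1 / p)) F"
    if "((\<lambda>\<sigma>. \<integral>\<xi>. norm (tpoly (P k) \<xi> (of_real \<sigma>)) powr p \<partial>torus_measure) \<longlongrightarrow> L) F" for k L F
    unfolding pnorm_def by (rule tendsto_powr'[OF that tendsto_const]) (use p in \<open>auto simp: integral_nonneg_AE\<close>)
  have z: "((\<lambda>\<sigma>. pnorm p (\<lambda>\<xi>. X \<xi> (of_real \<sigma>))) \<longlongrightarrow> N) (at_right 0)"
  proof (rule swap_uniform_limit'[OF _ N pnorm_uniform_limit])
    show "eventually (\<lambda>k. ((\<lambda>\<sigma>. pnorm p (\<lambda>\<xi>. tpoly (P k) \<xi> (of_real \<sigma>))) \<longlongrightarrow> dpoly_norm p (P k)) (at_right 0)) sequentially"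
      using root[OF tpoly_powr_mean_at_right_0[OF P_poly p0]] by (intro always_eventually) (simp add: dpoly_norm_eq[OF P_poly p0] pnorm_def)
    show "eventually (\<lambda>\<sigma>. \<sigma> \<in> {0<..}) (at_right (0::real))"
      by (simp add: eventually_at_right_less)
  qed auto
  have t: "((\<lambda>\<sigma>. pnorm p (\<lambda>\<xi>. X \<xi> (of_real \<sigma>))) \<longlongrightarrow> norm (f 1)) at_top"
  proof (rule swap_uniform_limit'[OF _ tendsto_norm[OF coeff_tendsto] pnorm_uniform_limit])
    show "eventually (\<lambda>k. ((\<lambda>\<sigma>. pnorm p (\<lambda>\<xi>. tpoly (P k) \<xi> (of_real \<sigma>))) \<longlongrightarrow> norm (P k 1)) at_top) sequentially"
      using root[OF tpoly_powr_mean_at_top[OF P_poly p0]] p by (intro always_eventually) (simp add: powr_powr)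
    show "eventually (\<lambda>\<sigma>. \<sigma> \<in> {0<..}) (at_top :: real filter)"
      by (simp add: eventually_gt_at_top)
  qed auto
  have pw: "(EF.pmean \<longlongrightarrow> ennreal (L powr p)) F"
    if "((\<lambda>\<sigma>. pnorm p (\<lambda>\<xi>. X \<xi> (of_real \<sigma>))) \<longlongrightarrow> L) F" "eventually (\<lambda>\<sigma>. \<sigma> > 0) F" for L F
  proof (rule Lim_transform_eventually)
    show "((\<lambda>\<sigma>. ennreal (pnorm p (\<lambda>\<xi>. X \<xi> (of_real \<sigma>)) powr p)) \<longlongrightarrow> ennreal (L powr p)) F"
      using p0 by (intro tendsto_ennrealI tendsto_powr' that tendsto_const) (auto simp: pnorm_nonneg)
    show "eventually (\<lambda>\<sigma>. ennreal (pnorm p (\<lambda>\<xi>. X \<xi> (of_real \<sigma>)) powr p) = EF.pmean \<sigma>) F"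
      using that(2) by eventually_elim (simp add: pmean_eq)
  qed
  obtain K where K: "\<And>j k. j \<ge> K \<Longrightarrow> k \<ge> K \<Longrightarrow> dpoly_norm p (\<lambda>n. P j n - P k n) < 1"
    using Cauchy[of 1] by auto
  have bd: "EF.pmean \<sigma> \<le> ennreal ((1 + dpoly_norm p (P K)) powr p)" if \<sigma>: "\<sigma> > 0" for \<sigma>
  proof -
    have "(\<integral>\<^sup>+\<xi>. ennreal (norm (tpoly (P K) \<xi> (of_real \<sigma>)) powr p) \<partial>torus_measure) \<le> ennreal (dpoly_norm p (P K) powr p)"
      using \<sigma> by (intro tpoly_contract P_poly p) auto
    then have "(\<integral>\<xi>. norm (tpoly (P K) \<xi> (of_real \<sigma>)) powr p \<partial>torus_measure) \<le> dpoly_norm p (P K) powr p"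
      using p by (subst (asm) nn_integral_eq_integral[OF tpoly_powr_integrable[OF P_poly]]) auto
    then have "pnorm p (\<lambda>\<xi>. tpoly (P K) \<xi> (of_real \<sigma>)) \<le> (dpoly_norm p (P K) powr p) powr (1 / p)"
      unfolding pnorm_def using p by (intro powr_mono2) (auto simp: integral_nonneg_AE)
    also have "\<dots> = dpoly_norm p (P K)" using p dpoly_norm_nonneg[OF P_poly] by (simp add: powr_powr)
    finally have "pnorm p (\<lambda>\<xi>. tpoly (P K) \<xi> (of_real \<sigma>)) \<le> dpoly_norm p (P K)" .
    moreover have "\<bar>pnorm p (\<lambda>\<xi>. X \<xi> (of_real \<sigma>)) - pnorm p (\<lambda>\<xi>. tpoly (P K) \<xi> (of_real \<sigma>))\<bar> \<le> pnorm p (\<lambda>\<xi>. X \<xi> (of_real \<sigma>) - tpoly (P K) \<xi> (of_real \<sigma>))"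
      using p by (intro pnorm_diff_le X_integrable \<sigma> tpoly_powr_integrable P_poly) auto
    moreover have "\<dots> \<le> 1" by (rule X_minus_P(2)[OF \<sigma> _ K]) auto
    ultimately have "pnorm p (\<lambda>\<xi>. X \<xi> (of_real \<sigma>)) \<le> 1 + dpoly_norm p (P K)" by linarith
    then show ?thesis unfolding pmean_eq[OF \<sigma>] using p by (intro ennreal_leI powr_mono2) (auto simp: pnorm_nonneg)
  qed
  show ?thesis
    by (rule EF.mean_formula_boundary[OF refl bd pw[OF t] pw[OF z]])
       (auto simp: eventually_at_right_less eventually_gt_at_top)
qed

end

section \<open>Almost sure convergence of the twisted series\<close>

lemma coefficient_bound:
  assumes a: "a \<in> dirichlet_polys" and n: "n > 0"
  shows "ennreal (norm (a n)) \<le> (\<integral>\<^sup>+\<xi>. ennreal (norm (tpoly a \<xi> 0)) \<partial>torus_measure)"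
proof -
  have i: "integrable torus_measure (\<lambda>\<xi>. tpoly a \<xi> 0 * cnj (cmult_ext \<xi> n))"
    by (intro trig_integrable trig_mult trig_tpoly a trig_cnj trig_ext n)
  have "(\<integral>\<xi>. tpoly a \<xi> 0 * cnj (cmult_ext \<xi> n) \<partial>torus_measure) =
     (\<integral>\<xi>. (\<Sum>m | a m \<noteq> 0. a m * (cmult_ext \<xi> m * cnj (cmult_ext \<xi> n))) \<partial>torus_measure)"
    unfolding tpoly_def sum_distrib_right
    by (intro Bochner_Integration.integral_cong sum.cong refl) (use dirichlet_polysD(3)[OF a] in auto)
  also have "\<dots> = (\<Sum>m | a m \<noteq> 0. \<integral>\<xi>. a m * (cmult_ext \<xi> m * cnj (cmult_ext \<xi> n)) \<partial>torus_measure)"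
    by (intro Bochner_Integration.integral_sum trig_integrable trig_char) (use dirichlet_polysD(3)[OF a] n in auto)
  also have "\<dots> = (\<Sum>m | a m \<noteq> 0. if m = n then a m else 0)"
    using dirichlet_polysD(3)[OF a] n by (intro sum.cong refl) (auto simp: char_orthogonality)
  also have "\<dots> = a n" using dirichlet_polysD(2)[OF a] by (subst sum.delta) auto
  finally have "ennreal (norm (a n)) \<le> (\<integral>\<^sup>+\<xi>. norm (tpoly a \<xi> 0 * cnj (cmult_ext \<xi> n)) \<partial>torus_measure)"
    using integral_norm_bound_ennreal[OF i] by simp
  also have "\<dots> = (\<integral>\<^sup>+\<xi>. ennreal (norm (tpoly a \<xi> 0)) \<partial>torus_measure)"
    by (intro nn_integral_cong) (simp add: norm_mult norm_cmult_ext)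
  finally show ?thesis .
qed

text \<open>
  Averaging \<open>tpoly a (rot t \<xi>) 0\<close> over \<open>t\<close> against the kernel multiplies the \<open>n\<close>-th term by the Fourier
  transform of the kernel at \<open>ln n\<close>, which is 1 for \<open>n \<le> N\<close> and 0 for \<open>n \<ge> N + 1\<close>.  Rotations preserve
  the mean, so the cost is the \<open>L\<^sup>1\<close> norm of the kernel.
\<close>

lemma partial_sum_L1:
  assumes a: "a \<in> dirichlet_polys" and N: "N \<ge> 1"
  shows "(\<integral>\<^sup>+\<xi>. ennreal (norm (\<Sum>n\<le>N. a n * cmult_ext \<xi> n)) \<partial>torus_measure) \<le>
     ennreal (4 * ln (real N + 1) + 4) * (\<integral>\<^sup>+\<xi>. ennreal (norm (tpoly a \<xi> 0)) \<partial>torus_measure)"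
proof -
  define K where "K = trap_kernel (ln (real N)) (ln (real (Suc N)))"
  have [measurable]: "K \<in> borel_measurable borel" by (simp add: K_def)
  have a0: "a 0 = 0" using dirichlet_polysD[OF a] by simp
  have Kcos: "has_bochner_integral lborel (\<lambda>t. K t * cos (ln (real n) * t)) (if n \<le> N then 1 else 0)" if n: "n > 0" for n
  proof (cases "n \<le> N")
    case True
    then show ?thesis using n N trap_kernel_cos_plateau[of "ln (real N)" "ln (real (Suc N))" "ln (real n)"]
      by (simp add: K_def)
  next
    case False
    then show ?thesis using n N trap_kernel_cos_zero[of "ln (real N)" "ln (real (Suc N))" "ln (real n)"]
      by (simp add: K_def)
  qed
  have avg: "(1/2) * (tpoly a (rot t \<xi>) 0 + tpoly a (rot (-t) \<xi>) 0) = (\<Sum>n | a n \<noteq> 0. a n * cmult_ext \<xi> n * of_real (cos (ln (real n) * t)))" for t \<xi>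
    unfolding tpoly_def sum.distrib[symmetric] sum_distrib_left
  proof (intro sum.cong refl)
    fix n assume "n \<in> {n. a n \<noteq> 0}"
    then have n: "n > 0" using dirichlet_polysD[OF a] by auto
    have c: "cis (t * ln (real n)) + cis (- (t * ln (real n))) = 2 * of_real (cos (ln (real n) * t))"
      by (simp add: complex_eq_iff mult.commute)
    have "(1/2) * (a n * cmult_ext (rot t \<xi>) n * of_nat n powr - 0 + a n * cmult_ext (rot (- t) \<xi>) n * of_nat n powr - 0)
      = (1/2) * (a n * cmult_ext \<xi> n * (cis (t * ln (real n)) + cis (- (t * ln (real n)))))"
      using n by (simp add: cmult_ext_rot algebra_simps)
    then show "(1/2) * (a n * cmult_ext (rot t \<xi>) n * of_nat n powr - 0 + a n * cmult_ext (rot (- t) \<xi>) n * of_nat n powr - 0)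
      = a n * cmult_ext \<xi> n * of_real (cos (ln (real n) * t))" unfolding c by simp
  qed
  have rep: "ennreal (norm (\<Sum>n\<le>N. a n * cmult_ext \<xi> n)) \<le>
     (\<integral>\<^sup>+t. ennreal \<bar>K t\<bar> * (ennreal (1/2) * (ennreal (norm (tpoly a (rot t \<xi>) 0)) + ennreal (norm (tpoly a (rot (-t) \<xi>) 0)))) \<partial>lborel)" for \<xi>
  proof -
    have "has_bochner_integral lborel (\<lambda>t. \<Sum>n | a n \<noteq> 0. (a n * cmult_ext \<xi> n) * of_real (K t * cos (ln (real n) * t)))
       (\<Sum>n | a n \<noteq> 0. (a n * cmult_ext \<xi> n) * of_real (if n \<le> N then 1 else 0))"
      by (intro has_bochner_integral_sum has_bochner_integral_mult_right has_bochner_integral_of_real Kcos)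
         (use dirichlet_polysD[OF a] in auto)
    moreover have "(\<Sum>n | a n \<noteq> 0. (a n * cmult_ext \<xi> n) * of_real (if n \<le> N then 1 else 0)) = (\<Sum>n\<le>N. a n * cmult_ext \<xi> n)"
    proof -
      have "(\<Sum>n | a n \<noteq> 0. (a n * cmult_ext \<xi> n) * of_real (if n \<le> N then 1 else 0)) = (\<Sum>n\<in>{n. a n \<noteq> 0} \<inter> {..N}. a n * cmult_ext \<xi> n)"
        using dirichlet_polysD(2)[OF a] by (subst sum.inter_restrict) (auto intro!: sum.cong)
      also have "\<dots> = (\<Sum>n\<le>N. a n * cmult_ext \<xi> n)"
        by (rule sum.mono_neutral_left) auto
      finally show ?thesis .
    qed
    moreover have "(\<Sum>n | a n \<noteq> 0. (a n * cmult_ext \<xi> n) * of_real (K t * cos (ln (real n) * t))) =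
       of_real (K t) * ((1/2) * (tpoly a (rot t \<xi>) 0 + tpoly a (rot (-t) \<xi>) 0))" for t
      unfolding avg sum_distrib_left by (simp add: mult_ac)
    ultimately have hb: "has_bochner_integral lborel (\<lambda>t. of_real (K t) * ((1/2) * (tpoly a (rot t \<xi>) 0 + tpoly a (rot (-t) \<xi>) 0))) (\<Sum>n\<le>N. a n * cmult_ext \<xi> n)"
      by (simp only:)
    have "ennreal (norm (\<Sum>n\<le>N. a n * cmult_ext \<xi> n)) \<le>
      (\<integral>\<^sup>+t. norm (of_real (K t) * ((1/2) * (tpoly a (rot t \<xi>) 0 + tpoly a (rot (-t) \<xi>) 0))) \<partial>lborel)"
      using integral_norm_bound_ennreal[OF integrable.intros[OF hb]] has_bochner_integral_integral_eq[OF hb] by simp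
    also have "\<dots> \<le> (\<integral>\<^sup>+t. ennreal \<bar>K t\<bar> * (ennreal (1/2) * (ennreal (norm (tpoly a (rot t \<xi>) 0)) + ennreal (norm (tpoly a (rot (-t) \<xi>) 0)))) \<partial>lborel)"
    proof (intro nn_integral_mono)
      fix t
      let ?x = "tpoly a (rot t \<xi>) 0" and ?y = "tpoly a (rot (-t) \<xi>) 0"
      have "norm (of_real (K t) * ((1/2) * (?x + ?y))) \<le> \<bar>K t\<bar> * ((1/2) * (norm ?x + norm ?y))"
        unfolding norm_mult by (intro mult_mono) (auto intro: norm_triangle_ineq)
      then have "ennreal (norm (of_real (K t) * ((1/2) * (?x + ?y)))) \<le> ennreal (\<bar>K t\<bar> * ((1/2) * (norm ?x + norm ?y)))"
        by (rule ennreal_leI)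
      also have "\<dots> = ennreal \<bar>K t\<bar> * (ennreal (1/2) * (ennreal (norm ?x) + ennreal (norm ?y)))"
        by (simp only: ennreal_mult'[OF abs_ge_zero] ennreal_mult'[of "1/2"] ennreal_plus[OF norm_ge_zero norm_ge_zero] zero_le_divide_1_iff zero_le_numeral)
      finally show "ennreal (norm (of_real (K t) * ((1/2) * (?x + ?y)))) \<le> ennreal \<bar>K t\<bar> * (ennreal (1/2) * (ennreal (norm ?x) + ennreal (norm ?y)))" .
    qed
    finally show ?thesis .
  qed
  have ms: "(\<lambda>\<xi>. tpoly a (rot t \<xi>) 0) \<in> borel_measurable torus_measure" for t
    by (rule measurable_compose[OF rot_measurable tpoly_measurable])
  have mp: "(\<lambda>x. tpoly a (rot (d * snd x) (fst x)) 0) \<in> borel_measurable (torus_measure \<Otimes>\<^sub>M lborel)" for d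
    by (rule measurable_compose[OF rot_measurable_comp tpoly_measurable]) auto
  note [measurable] = ms mp[of 1, simplified] mp[of "-1", simplified]
  let ?E = "\<integral>\<^sup>+\<xi>. ennreal (norm (tpoly a \<xi> 0)) \<partial>torus_measure"
  have E: "(\<integral>\<^sup>+\<xi>. ennreal (norm (tpoly a (rot t \<xi>) 0)) \<partial>torus_measure) = ?E" for t
    by (rule nn_integral_rot) measurable
  have half: "ennreal (1/2) * (?E + ?E) = ?E"
  proof -
    have "ennreal (1/2) * (?E + ?E) = (ennreal (1/2) * 2) * ?E" by (simp only: mult.assoc mult_2[symmetric])
    also have "ennreal (1/2) * 2 = 1" using ennreal_mult'[of "1/2" 2] by simp
    finally show ?thesis by simp
  qed
  have "(\<integral>\<^sup>+\<xi>. ennreal (norm (\<Sum>n\<le>N. a n * cmult_ext \<xi> n)) \<partial>torus_measure) \<le>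
     (\<integral>\<^sup>+\<xi>. (\<integral>\<^sup>+t. ennreal \<bar>K t\<bar> * (ennreal (1/2) * (ennreal (norm (tpoly a (rot t \<xi>) 0)) + ennreal (norm (tpoly a (rot (-t) \<xi>) 0)))) \<partial>lborel) \<partial>torus_measure)"
    by (intro nn_integral_mono rep)
  also have "\<dots> = (\<integral>\<^sup>+t. (\<integral>\<^sup>+\<xi>. ennreal \<bar>K t\<bar> * (ennreal (1/2) * (ennreal (norm (tpoly a (rot t \<xi>) 0)) + ennreal (norm (tpoly a (rot (-t) \<xi>) 0)))) \<partial>torus_measure) \<partial>lborel)"
    using torus_Fubini[of "\<lambda>\<xi> t. ennreal \<bar>K t\<bar> * (ennreal (1/2) * (ennreal (norm (tpoly a (rot t \<xi>) 0)) + ennreal (norm (tpoly a (rot (-t) \<xi>) 0))))"]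
    by (simp add: case_prod_beta')
  also have "\<dots> = (\<integral>\<^sup>+t. ennreal \<bar>K t\<bar> * ?E \<partial>lborel)"
  proof (intro nn_integral_cong)
    fix t
    have "(\<integral>\<^sup>+\<xi>. ennreal \<bar>K t\<bar> * (ennreal (1/2) * (ennreal (norm (tpoly a (rot t \<xi>) 0)) + ennreal (norm (tpoly a (rot (-t) \<xi>) 0)))) \<partial>torus_measure)
      = ennreal \<bar>K t\<bar> * (ennreal (1/2) * (\<integral>\<^sup>+\<xi>. ennreal (norm (tpoly a (rot t \<xi>) 0)) + ennreal (norm (tpoly a (rot (-t) \<xi>) 0)) \<partial>torus_measure))"
      by (subst nn_integral_cmult, measurable, subst nn_integral_cmult, measurable)
    also have "\<dots> = ennreal \<bar>K t\<bar> * (ennreal (1/2) * (?E + ?E))"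
      by (subst nn_integral_add) (measurable, simp only: E)
    finally show "(\<integral>\<^sup>+\<xi>. ennreal \<bar>K t\<bar> * (ennreal (1/2) * (ennreal (norm (tpoly a (rot t \<xi>) 0)) + ennreal (norm (tpoly a (rot (-t) \<xi>) 0)))) \<partial>torus_measure) = ennreal \<bar>K t\<bar> * ?E"
      unfolding half .
  qed
  also have "\<dots> = (\<integral>\<^sup>+t. ennreal \<bar>K t\<bar> \<partial>lborel) * ?E"
    by (rule nn_integral_multc) measurable
  also have "\<dots> \<le> ennreal (4 * ln (real N + 1) + 4) * ?E"
    unfolding K_def by (intro mult_right_mono trap_kernel_log_L1 N) auto
  finally show ?thesis .
qed

lemma dpoly_norms_convergent:
  assumes p: "1 \<le> p" and ap: "Hp_approx p P f"
  shows "convergent (\<lambda>k. dpoly_norm p (P k))"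
proof -
  have P: "P k \<in> dirichlet_polys" for k using ap by (simp add: Hp_approx_def)
  have "Cauchy (\<lambda>k. dpoly_norm p (P k))"
  proof (rule metric_CauchyI)
    fix e :: real assume "e > 0"
    then obtain K where K: "\<And>j k. j \<ge> K \<Longrightarrow> k \<ge> K \<Longrightarrow> dpoly_norm p (\<lambda>n. P j n - P k n) < e"
      using ap unfolding Hp_approx_def by blast
    have "dist (dpoly_norm p (P j)) (dpoly_norm p (P k)) < e" if "j \<ge> K" "k \<ge> K" for j k
    proof -
      have "\<bar>pnorm p (\<lambda>\<xi>. tpoly (P j) \<xi> 0) - pnorm p (\<lambda>\<xi>. tpoly (P k) \<xi> 0)\<bar> \<le> pnorm p (\<lambda>\<xi>. tpoly (P j) \<xi> 0 - tpoly (P k) \<xi> 0)"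
        using p by (intro pnorm_diff_le tpoly_powr_integrable P) auto
      also have "\<dots> = dpoly_norm p (\<lambda>n. P j n - P k n)"
        using p by (simp add: dpoly_norm_eq dirichlet_polys_diff P tpoly_diff)
      also have "\<dots> < e" using K that by blast
      finally show ?thesis using p by (simp add: dist_real_def dpoly_norm_eq P)
    qed
    then show "\<exists>M. \<forall>m\<ge>M. \<forall>n\<ge>M. dist (dpoly_norm p (P m)) (dpoly_norm p (P n)) < e" by blast
  qed
  then show ?thesis by (rule Cauchy_convergent)
qed

context fast_approx
begin

lemma L1_bounded: "\<exists>B>0. \<forall>k. (\<integral>\<^sup>+\<xi>. ennreal (norm (tpoly (P k) \<xi> 0)) \<partial>torus_measure) \<le> ennreal B"
proof -
  obtain M where M: "M > 0" "\<And>k. norm (dpoly_norm p (P k)) \<le> M"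
    using convergent_imp_Bseq[OF dpoly_norms_convergent[OF p approx]] by (auto simp: Bseq_def)
  have "(\<integral>\<^sup>+\<xi>. ennreal (norm (tpoly (P k) \<xi> 0)) \<partial>torus_measure) \<le> ennreal (1 + M powr p)" for k
  proof -
    have "(\<integral>\<^sup>+\<xi>. ennreal (norm (tpoly (P k) \<xi> 0)) \<partial>torus_measure) \<le> (\<integral>\<^sup>+\<xi>. 1 + ennreal (norm (tpoly (P k) \<xi> 0) powr p) \<partial>torus_measure)"
    proof (intro nn_integral_mono)
      fix \<xi>
      have "ennreal (norm (tpoly (P k) \<xi> 0)) \<le> ennreal (1 + norm (tpoly (P k) \<xi> 0) powr p)"
        by (intro ennreal_leI le_one_plus_powr p) auto
      then show "ennreal (norm (tpoly (P k) \<xi> 0)) \<le> 1 + ennreal (norm (tpoly (P k) \<xi> 0) powr p)" by simp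
    qed
    also have "\<dots> = 1 + (\<integral>\<^sup>+\<xi>. ennreal (norm (tpoly (P k) \<xi> 0) powr p) \<partial>torus_measure)"
      by (subst nn_integral_add) (auto simp: TM.emeasure_space_1)
    also have "\<dots> \<le> 1 + ennreal (M powr p)"
      using M(2)[of k] p dpoly_norm_nonneg[OF P_poly]
      by (intro add_left_mono order_trans[OF tpoly_contract[OF P_poly p]] ennreal_leI powr_mono2) auto
    finally show ?thesis by simp
  qed
  then show ?thesis by (intro exI[of _ "1 + M powr p"]) (auto intro: add_pos_nonneg)
qed

lemma f_0: "f 0 = 0"
  using coeff_tendsto[of 0] dirichlet_polysD(1)[OF P_poly] by (simp add: LIMSEQ_const_iff)

definition psum :: "nat \<Rightarrow> (nat \<Rightarrow> complex) \<Rightarrow> complex" where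
  "psum N \<xi> = (\<Sum>n\<le>N. f n * cmult_ext \<xi> n)"

lemma psum_measurable [measurable]: "psum N \<in> borel_measurable torus_measure"
  unfolding psum_def by measurable

lemma psum_L1:
  assumes B: "\<And>k. (\<integral>\<^sup>+\<xi>. ennreal (norm (tpoly (P k) \<xi> 0)) \<partial>torus_measure) \<le> ennreal B" and N: "N \<ge> 1"
  shows "(\<integral>\<^sup>+\<xi>. ennreal (norm (psum N \<xi>)) \<partial>torus_measure) \<le> ennreal ((4 * ln (real N + 1) + 4) * B)"
proof -
  let ?c = "4 * ln (real N + 1) + 4"
  have c: "?c \<ge> 0" by simp
  have "(\<integral>\<^sup>+\<xi>. ennreal (norm (psum N \<xi>)) \<partial>torus_measure) =
    (\<integral>\<^sup>+\<xi>. liminf (\<lambda>k. ennreal (norm (\<Sum>n\<le>N. P k n * cmult_ext \<xi> n))) \<partial>torus_measure)"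
    unfolding psum_def
    by (intro nn_integral_cong lim_imp_Liminf[symmetric] tendsto_ennrealI tendsto_norm tendsto_sum tendsto_mult coeff_tendsto tendsto_const) auto
  also have "\<dots> \<le> liminf (\<lambda>k. \<integral>\<^sup>+\<xi>. ennreal (norm (\<Sum>n\<le>N. P k n * cmult_ext \<xi> n)) \<partial>torus_measure)"
    by (rule nn_integral_liminf) measurable
  also have "\<dots> \<le> liminf (\<lambda>k. ennreal (?c * B))"
  proof (intro Liminf_mono always_eventually allI)
    fix k
    have "(\<integral>\<^sup>+\<xi>. ennreal (norm (\<Sum>n\<le>N. P k n * cmult_ext \<xi> n)) \<partial>torus_measure) \<le> ennreal ?c * (\<integral>\<^sup>+\<xi>. ennreal (norm (tpoly (P k) \<xi> 0)) \<partial>torus_measure)"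
      by (rule partial_sum_L1[OF P_poly N])
    also have "\<dots> \<le> ennreal ?c * ennreal B" by (intro mult_left_mono B) auto
    also have "\<dots> = ennreal (?c * B)" using c by (simp only: ennreal_mult')
    finally show "(\<integral>\<^sup>+\<xi>. ennreal (norm (\<Sum>n\<le>N. P k n * cmult_ext \<xi> n)) \<partial>torus_measure) \<le> ennreal (?c * B)" .
  qed
  also have "\<dots> = ennreal (?c * B)" by (simp add: Liminf_const)
  finally show ?thesis .
qed

lemma coeff_bound:
  assumes B: "\<And>k. (\<integral>\<^sup>+\<xi>. ennreal (norm (tpoly (P k) \<xi> 0)) \<partial>torus_measure) \<le> ennreal B" "B > 0"
  shows "norm (P k n) \<le> B" "norm (f n) \<le> B"
proof -
  show P: "norm (P k n) \<le> B" for k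
  proof (cases "n = 0")
    case True
    then show ?thesis using dirichlet_polysD(1)[OF P_poly] B(2) by simp
  next
    case False
    then have "ennreal (norm (P k n)) \<le> ennreal B"
      by (intro order_trans[OF coefficient_bound[OF P_poly] B(1)]) auto
    then show ?thesis using B(2) by simp
  qed
  show "norm (f n) \<le> B"
    by (rule LIMSEQ_le_const2[OF tendsto_norm[OF coeff_tendsto]]) (use P in auto)
qed

text \<open>
  Along the squares \<open>N = j\<^sup>2\<close> the \<open>L\<^sup>1\<close> bound makes \<open>\<bar>psum (j\<^sup>2)\<bar> / j powr (1 + \<eta>)\<close> summable in expectation, hence
  almost surely bounded.  Between consecutive squares there are at most \<open>2 j\<close> further terms,
  each bounded by a constant.
\<close>

lemma AE_psum_growth:
  assumes \<eta>: "\<eta> > 0"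
  shows "AE \<xi> in torus_measure. \<exists>C. \<forall>N\<ge>1. norm (psum N \<xi>) \<le> C * real N powr ((1 + \<eta>) / 2)"
proof -
  obtain B where B: "B > 0" "\<And>k. (\<integral>\<^sup>+\<xi>. ennreal (norm (tpoly (P k) \<xi> 0)) \<partial>torus_measure) \<le> ennreal B"
    using L1_bounded by blast
  define T where "T j \<xi> = norm (psum ((Suc j)\<^sup>2) \<xi>) * real (Suc j) powr (- 1 - \<eta>)" for j \<xi>
  define c where "c = B * (4 * (2 powr (\<eta>/4) / (\<eta>/4)) + 4)"
  have ET: "(\<integral>\<^sup>+\<xi>. ennreal (T j \<xi>) \<partial>torus_measure) \<le> ennreal (c * real (Suc j) powr (- 1 - \<eta>/2))" for j
  proof -
    let ?x = "real (Suc j)"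
    have x1: "?x \<ge> 1" by simp
    have N: "real ((Suc j)\<^sup>2) = ?x\<^sup>2" by simp
    \<comment> \<open>The logarithm is absorbed by half of the exponent \<open>\<eta>\<close>.\<close>
    have ln: "ln (?x\<^sup>2 + 1) \<le> 2 powr (\<eta>/4) / (\<eta>/4) * ?x powr (\<eta>/2)"
    proof -
      have "1 \<le> ?x\<^sup>2" using x1 by (simp del: of_nat_Suc)
      have "ln (?x\<^sup>2 + 1) \<le> (?x\<^sup>2 + 1) powr (\<eta>/4) / (\<eta>/4)"
        by (rule ln_powr_bound) (use \<eta> in auto)
      also have "\<dots> \<le> (2 * ?x\<^sup>2) powr (\<eta>/4) / (\<eta>/4)"
        using \<eta> \<open>1 \<le> ?x\<^sup>2\<close> by (intro divide_right_mono powr_mono2) auto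
      also have "(2 * ?x\<^sup>2) powr (\<eta>/4) = 2 powr (\<eta>/4) * ?x powr (\<eta>/2)"
        by (subst powr_mult, subst square_powr) auto
      finally show ?thesis by (simp only: times_divide_eq_left)
    qed
    have one: "1 \<le> ?x powr (\<eta>/2)" using \<eta> x1 by (intro ge_one_powr_ge_zero) auto
    have "(\<integral>\<^sup>+\<xi>. ennreal (T j \<xi>) \<partial>torus_measure) = (\<integral>\<^sup>+\<xi>. ennreal (norm (psum ((Suc j)\<^sup>2) \<xi>)) * ennreal (?x powr (- 1 - \<eta>)) \<partial>torus_measure)"
      unfolding T_def by (intro nn_integral_cong ennreal_mult) auto
    also have "\<dots> = (\<integral>\<^sup>+\<xi>. ennreal (norm (psum ((Suc j)\<^sup>2) \<xi>)) \<partial>torus_measure) * ennreal (?x powr (- 1 - \<eta>))"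
      by (rule nn_integral_multc) measurable
    also have "\<dots> \<le> ennreal ((4 * ln (?x\<^sup>2 + 1) + 4) * B) * ennreal (?x powr (- 1 - \<eta>))"
      using psum_L1[OF B(2), of "(Suc j)\<^sup>2"] unfolding N by (intro mult_right_mono) auto
    also have "\<dots> = ennreal (((4 * ln (?x\<^sup>2 + 1) + 4) * B) * ?x powr (- 1 - \<eta>))"
      by (rule ennreal_mult''[symmetric]) simp
    also have "\<dots> \<le> ennreal (((4 * (2 powr (\<eta>/4) / (\<eta>/4) * ?x powr (\<eta>/2)) + 4 * ?x powr (\<eta>/2)) * B) * ?x powr (- 1 - \<eta>))"
      using ln one B(1) by (intro ennreal_leI mult_right_mono add_mono mult_left_mono) auto
    also have "((4 * (2 powr (\<eta>/4) / (\<eta>/4) * ?x powr (\<eta>/2)) + 4 * ?x powr (\<eta>/2)) * B) * ?x powr (- 1 - \<eta>) = c * (?x powr (\<eta>/2) * ?x powr (- 1 - \<eta>))"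
      unfolding c_def by (simp only: distrib_right distrib_left mult_ac)
    also have "?x powr (\<eta>/2) * ?x powr (- 1 - \<eta>) = ?x powr (- 1 - \<eta>/2)"
      unfolding powr_add[symmetric] by (intro arg_cong[where f = "\<lambda>e. ?x powr e"]) (simp add: field_simps)
    finally show ?thesis .
  qed
  have c0: "c \<ge> 0" using B \<eta> by (auto simp: c_def)
  have sm: "summable (\<lambda>j. c * real (Suc j) powr (- 1 - \<eta>/2))"
  proof (rule summable_mult)
    have "summable (\<lambda>j. real j powr (- 1 - \<eta>/2))" using \<eta> by (simp add: summable_real_powr_iff)
    then show "summable (\<lambda>j. real (Suc j) powr (- 1 - \<eta>/2))" by (subst summable_Suc_iff)
  qed
  have [measurable]: "T j \<in> borel_measurable torus_measure" for j unfolding T_def by measurable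
  have "(\<integral>\<^sup>+\<xi>. (\<Sum>j. ennreal (T j \<xi>)) \<partial>torus_measure) = (\<Sum>j. \<integral>\<^sup>+\<xi>. ennreal (T j \<xi>) \<partial>torus_measure)"
    by (rule nn_integral_suminf) measurable
  also have "\<dots> \<le> (\<Sum>j. ennreal (c * real (Suc j) powr (- 1 - \<eta>/2)))"
    by (intro suminf_le ET allI) auto
  also have "\<dots> = ennreal (\<Sum>j. c * real (Suc j) powr (- 1 - \<eta>/2))"
    using c0 by (intro suminf_ennreal2 sm) auto
  also have "\<dots> < \<infinity>" by simp
  finally have "AE \<xi> in torus_measure. (\<Sum>j. ennreal (T j \<xi>)) \<noteq> \<infinity>"
    by (intro nn_integral_PInf_AE) auto
  then show ?thesis using AE_space
  proof eventually_elim
    case (elim \<xi>)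
    then have fin: "(\<Sum>j. ennreal (T j \<xi>)) < \<infinity>" by (simp add: less_top)
    obtain C where C: "(\<Sum>j. ennreal (T j \<xi>)) = ennreal C" "C \<ge> 0"
      using elim by (cases "\<Sum>j. ennreal (T j \<xi>)") auto
    have TC: "T j \<xi> \<le> C" for j
    proof -
      have "ennreal (T j \<xi>) \<le> (\<Sum>j. ennreal (T j \<xi>))"
        using sum_le_suminf[of "\<lambda>j. ennreal (T j \<xi>)" "{j}"] by simp
      then show ?thesis using C by simp
    qed
    have sq: "norm (psum (j\<^sup>2) \<xi>) \<le> C * real j powr (1 + \<eta>)" if j: "j \<ge> 1" for j
    proof -
      obtain i where i: "j = Suc i" using j by (cases j) auto
      have "norm (psum (j\<^sup>2) \<xi>) = T i \<xi> * real j powr (1 + \<eta>)"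
      proof -
        have "real j powr (- 1 - \<eta>) * real j powr (1 + \<eta>) = 1" using that by (simp flip: powr_add)
        then show ?thesis by (simp add: T_def i mult.assoc del: of_nat_Suc)
      qed
      then show ?thesis using TC[of i] by (simp add: mult_right_mono)
    qed
    have "norm (psum N \<xi>) \<le> (C + 2 * B) * real N powr ((1 + \<eta>) / 2)" if N: "N \<ge> 1" for N
    proof -
      \<comment> \<open>The largest \<open>j\<close> with \<open>j\<^sup>2 \<le> N\<close>.\<close>
      define j where "j = nat \<lfloor>sqrt (real N)\<rfloor>"
      have j1: "j \<ge> 1" using N by (simp add: j_def le_nat_iff)
      have "real j = of_int \<lfloor>sqrt (real N)\<rfloor>" by (simp add: j_def)
      then have jN: "real j \<le> sqrt (real N)" "sqrt (real N) < real j + 1"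
        using floor_correct[of "sqrt (real N)"] by auto
      have "real j ^ 2 \<le> sqrt (real N) ^ 2" by (intro power_mono jN) auto
      then have jl: "j\<^sup>2 \<le> N" by (simp flip: of_nat_power)
      have "sqrt (real N) ^ 2 < (real j + 1) ^ 2" by (intro power_strict_mono jN) auto
      then have "real N < real ((j + 1)\<^sup>2)" by (simp add: add.commute)
      then have ju: "N < (j + 1)\<^sup>2" by (simp only: of_nat_less_iff)
      have "psum N \<xi> = psum (j\<^sup>2) \<xi> + (\<Sum>n\<in>{j\<^sup>2<..N}. f n * cmult_ext \<xi> n)"
      proof -
        have "{..N} = {..j\<^sup>2} \<union> {j\<^sup>2<..N}" using jl by auto
        then show ?thesis unfolding psum_def by (simp only:) (rule sum.union_disjoint, auto)
      qed
      also have "norm \<dots> \<le> norm (psum (j\<^sup>2) \<xi>) + (\<Sum>n\<in>{j\<^sup>2<..N}. B)"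
        by (intro norm_triangle_mono order_refl sum_norm_le)
           (use coeff_bound(2)[OF B(2) B(1)] norm_cmult_ext[OF elim(2)] in \<open>auto simp: norm_mult\<close>)
      also have "(\<Sum>n\<in>{j\<^sup>2<..N}. B) \<le> 2 * real j * B"
      proof -
        have "N - j\<^sup>2 \<le> 2 * j" using ju by (simp add: power2_eq_square)
        then have "real (N - j\<^sup>2) \<le> 2 * real j" by linarith
        then show ?thesis using B(1) by (simp add: mult_right_mono)
      qed
      also have "norm (psum (j\<^sup>2) \<xi>) + 2 * real j * B \<le> C * real j powr (1 + \<eta>) + 2 * B * real j powr (1 + \<eta>)"
      proof (intro add_mono sq j1)
        have "real j powr 1 \<le> real j powr (1 + \<eta>)" using j1 \<eta> by (intro powr_mono) auto
        then show "2 * real j * B \<le> 2 * B * real j powr (1 + \<eta>)" using B(1) j1 by (simp add: mult.commute)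
      qed
      also have "\<dots> = (C + 2 * B) * real j powr (1 + \<eta>)" by (simp add: distrib_right)
      also have "\<dots> \<le> (C + 2 * B) * sqrt (real N) powr (1 + \<eta>)"
        using jN C(2) B(1) \<eta> by (intro mult_left_mono powr_mono2) auto
      also have "sqrt (real N) powr (1 + \<eta>) = real N powr ((1 + \<eta>) / 2)"
        using N by (simp add: powr_half_sqrt[symmetric] powr_powr)
      finally show ?thesis by simp
    qed
    then show ?case by blast
  qed
qed

text \<open>
  For \<open>Re s > 1\<close> the bounded coefficients allow the limit \<open>k \<rightarrow> \<infinity>\<close> to be taken termwise.  For \<open>Re s > 1/2\<close> the
  growth of the partial sums provides a holomorphic sum of the series, which agrees with \<open>X \<xi>\<close> by
  the identity theorem.  The exponents \<open>\<eta> = 1 / (i + 1)\<close> suffice, so that only countably many null sets occur.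
\<close>

lemma AE_series: "AE \<xi> in torus_measure. is_twist_continuation f \<xi> (X \<xi>)"
proof -
  define et where "et i = 1 / real (Suc i)" for i
  have et: "et i > 0" "et i \<le> 1" for i by (auto simp: et_def)
  obtain B where B: "B > 0" "\<And>k. (\<integral>\<^sup>+\<xi>. ennreal (norm (tpoly (P k) \<xi> 0)) \<partial>torus_measure) \<le> ennreal B"
    using L1_bounded by blast
  have "AE \<xi> in torus_measure. \<forall>i. \<exists>C. \<forall>N\<ge>1. norm (psum N \<xi>) \<le> C * real N powr ((1 + et i) / 2)"
    unfolding AE_all_countable using AE_psum_growth[OF et(1)] by blast
  then show ?thesis using AE_converges AE_space
  proof eventually_elim
    case (elim \<xi>)
    let ?c = "\<lambda>n. f n * cmult_ext \<xi> n"
    have hol: "X \<xi> holomorphic_on {s. Re s > 0}" using elim(2) by (simp add: converges_at_def)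
    have far: "(\<lambda>n. ?c n * of_nat n powr (- s)) sums X \<xi> s" if s: "Re s > 1" for s
    proof -
      let ?a = "\<lambda>n k. P k n * cmult_ext \<xi> n * of_nat n powr (- s)"
      have T: "eventually (\<lambda>k. summable (\<lambda>n. norm (?a n k))) sequentially \<and> summable (\<lambda>n. norm (?c n * of_nat n powr (- s))) \<and>
         ((\<lambda>k. suminf (\<lambda>n. ?a n k)) \<longlonglongrightarrow> suminf (\<lambda>n. ?c n * of_nat n powr (- s)))"
      proof (rule tannerys_theorem[where M = "\<lambda>n. B * real n powr (- Re s)"])
        show "(\<lambda>k. ?a n k) \<longlonglongrightarrow> ?c n * of_nat n powr (- s)" for n
          by (intro tendsto_mult coeff_tendsto tendsto_const)
        have "norm (?a n k) \<le> B * real n powr (- Re s)" for n k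
        proof (cases "n = 0")
          case False
          then show ?thesis
            using coeff_bound(1)[OF B(2) B(1), of k n] norm_cmult_ext[OF elim(3)]
            by (simp add: norm_mult norm_of_nat_powr mult_right_mono)
        qed (use dirichlet_polysD(1)[OF P_poly] in simp)
        then show "eventually (\<lambda>(n, k). norm (?a n k) \<le> B * real n powr (- Re s)) (at_top \<times>\<^sub>F sequentially)"
          by (intro always_eventually) auto
        show "summable (\<lambda>n. B * real n powr (- Re s))"
          using s by (intro summable_mult) (simp add: summable_real_powr_iff)
      qed auto
      have "suminf (\<lambda>n. ?a n k) = tpoly (P k) \<xi> s" for k
        unfolding tpoly_def using dirichlet_polysD(2)[OF P_poly] by (intro suminf_finite) auto
      then have "(\<lambda>k. tpoly (P k) \<xi> s) \<longlonglongrightarrow> suminf (\<lambda>n. ?c n * of_nat n powr (- s))" using T by simp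
      moreover have "(\<lambda>k. tpoly (P k) \<xi> s) \<longlonglongrightarrow> X \<xi> s" using elim(2) s by (simp add: converges_at_def)
      ultimately have "X \<xi> s = suminf (\<lambda>n. ?c n * of_nat n powr (- s))" by (rule LIMSEQ_unique[rotated])
      then show ?thesis using T summable_norm_cancel summable_sums by fastforce
    qed
    have "(\<lambda>n. ?c n * of_nat n powr (- s)) sums X \<xi> s" if s: "Re s > 1/2" for s
    proof -
      obtain i where i: "et i < 2 * (Re s - 1/2)"
        using reals_Archimedean[of "2 * (Re s - 1/2)"] s unfolding et_def by (auto simp: inverse_eq_divide)
      define \<kappa> where "\<kappa> = (1 + et i) / 2"
      have \<kappa>: "\<kappa> > 0" "\<kappa> \<le> 1" "\<kappa> < Re s" using et[of i] i by (auto simp: \<kappa>_def)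
      obtain C where C: "\<And>N. N \<ge> 1 \<Longrightarrow> norm (psum N \<xi>) \<le> C * real N powr \<kappa>"
        using elim(1) unfolding \<kappa>_def by blast
      obtain g where g: "g holomorphic_on {s. Re s > \<kappa>}" "\<And>s. Re s > \<kappa> \<Longrightarrow> (\<lambda>n. ?c n * of_nat n powr (- s)) sums g s"
        using dirichlet_series_holomorphic_sum[of ?c \<kappa> C] C \<kappa>(1) f_0 by (auto simp: psum_def)
      have "X \<xi> s = g s"
      proof (rule analytic_continuation_open[where s = "{s. Re s > 1}" and s' = "{s. Re s > \<kappa>}" and f = "X \<xi>" and g = g and z = s])
        show "{s::complex. Re s > 1} \<noteq> {}" by (auto intro!: exI[of _ 2])
        show "X \<xi> holomorphic_on {s. Re s > \<kappa>}" by (rule holomorphic_on_subset[OF hol]) (use \<kappa> in auto)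
        show "X \<xi> z = g z" if "z \<in> {s. Re s > 1}" for z
          using far[of z] g(2)[of z] that \<kappa> by (auto intro: sums_unique2)
      qed (use \<kappa> g(1) in \<open>auto simp: open_halfspace_Re_gt convex_connected convex_halfspace_Re_gt\<close>)
      then show ?thesis using g(2)[OF \<kappa>(3)] by simp
    qed
    then show ?case using hol by (simp add: is_twist_continuation_def)
  qed
qed

section \<open>Time averages\<close>

text \<open>
  The inner integral of the theorem at time \<open>t = 0\<close>; at time \<open>t\<close> it is \<open>energy (rot t \<xi>)\<close>.
\<close>

definition energy :: "(nat \<Rightarrow> complex) \<Rightarrow> ennreal" where
  "energy \<xi> = (\<integral>\<^sup>+\<sigma>\<in>{0<..}. ennreal (norm (X \<xi> (of_real \<sigma>)) powr (p - 2) * norm (X' \<xi> (of_real \<sigma>)) ^ 2 * \<sigma>) \<partial>lborel)"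

lemma energy_integrand_measurable [measurable]:
  "(\<lambda>x. ennreal (norm (X (fst x) (of_real (snd x))) powr (p - 2) * norm (X' (fst x) (of_real (snd x))) ^ 2 * snd x) * indicator {0<..} (snd x))
    \<in> borel_measurable (torus_measure \<Otimes>\<^sub>M lborel)"
proof -
  have "(\<lambda>x. complex_of_real (snd x)) \<in> borel_measurable (torus_measure \<Otimes>\<^sub>M lborel)" by measurable
  note [measurable] = EF.X_meas_comp[OF measurable_fst this, simplified]
  show ?thesis by measurable
qed

lemma energy_measurable [measurable]: "energy \<in> borel_measurable torus_measure"
  unfolding energy_def
  by (rule lborel.borel_measurable_nn_integral) (simp add: case_prod_beta')

lemma energy_rot: "energy (rot t \<xi>) = (\<integral>\<^sup>+\<sigma>\<in>{0<..}. ennreal (norm (X \<xi> (Complex \<sigma> t)) powr (p - 2) * norm (X' \<xi> (Complex \<sigma> t)) ^ 2 * \<sigma>) \<partial>lborel)"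
  by (simp add: energy_def EF.X_rot EF.X'_rot EF.Complex_shift)

lemma mean_energy:
  "ennreal (p\<^sup>2) * (\<integral>\<^sup>+\<xi>. energy \<xi> \<partial>torus_measure) = (\<integral>\<^sup>+\<sigma>. indicator {0<..} \<sigma> * (ennreal \<sigma> * EF.mean_density \<sigma>) \<partial>lborel)"
proof -
  have e: "ennreal (p\<^sup>2) * (ennreal (norm (X \<xi> (of_real \<sigma>)) powr (p - 2) * norm (X' \<xi> (of_real \<sigma>)) ^ 2 * \<sigma>) * indicator {0<..} \<sigma>)
     = indicator {0<..} \<sigma> * (ennreal \<sigma> * ennreal (EF.lp_density \<xi> (of_real \<sigma>)))" for \<xi> \<sigma>
  proof (cases "\<sigma> > 0")
    case True
    then show ?thesis
      by (simp add: EF.lp_density_def ennreal_mult'[symmetric] mult_ac)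
  qed simp
  have "(\<lambda>\<xi>. EF.lp_density \<xi> s) \<in> borel_measurable torus_measure" for s
    by (rule EF.lp_density_meas_comp) auto
  note [measurable] = this
  have "ennreal (p\<^sup>2) * (\<integral>\<^sup>+\<xi>. energy \<xi> \<partial>torus_measure) =
     ennreal (p\<^sup>2) * (\<integral>\<^sup>+\<sigma>. (\<integral>\<^sup>+\<xi>. ennreal (norm (X \<xi> (of_real \<sigma>)) powr (p - 2) * norm (X' \<xi> (of_real \<sigma>)) ^ 2 * \<sigma>) * indicator {0<..} \<sigma> \<partial>torus_measure) \<partial>lborel)"
    unfolding energy_def
    using torus_Fubini[of "\<lambda>\<xi> \<sigma>. ennreal (norm (X \<xi> (of_real \<sigma>)) powr (p - 2) * norm (X' \<xi> (of_real \<sigma>)) ^ 2 * \<sigma>) * indicator {0<..} \<sigma>"]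
    by (simp add: case_prod_beta')
  also have "\<dots> = (\<integral>\<^sup>+\<sigma>. ennreal (p\<^sup>2) * (\<integral>\<^sup>+\<xi>. ennreal (norm (X \<xi> (of_real \<sigma>)) powr (p - 2) * norm (X' \<xi> (of_real \<sigma>)) ^ 2 * \<sigma>) * indicator {0<..} \<sigma> \<partial>torus_measure) \<partial>lborel)"
  proof (rule nn_integral_cmult[symmetric])
    have "(\<lambda>x. (snd x, fst x)) \<in> lborel \<Otimes>\<^sub>M torus_measure \<rightarrow>\<^sub>M torus_measure \<Otimes>\<^sub>M (lborel :: real measure)" by simp
    from measurable_compose[OF measurable_pair_swap' energy_integrand_measurable]
    show "(\<lambda>\<sigma>. \<integral>\<^sup>+\<xi>. ennreal (norm (X \<xi> (of_real \<sigma>)) powr (p - 2) * norm (X' \<xi> (of_real \<sigma>)) ^ 2 * \<sigma>) * indicator {0<..} \<sigma> \<partial>torus_measure) \<in> borel_measurable lborel"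
      by (intro TM.borel_measurable_nn_integral) (simp add: case_prod_beta')
  qed
  also have "\<dots> = (\<integral>\<^sup>+\<sigma>. indicator {0<..} \<sigma> * (ennreal \<sigma> * EF.mean_density \<sigma>) \<partial>lborel)"
  proof (intro nn_integral_cong)
    fix \<sigma>
    have m: "(\<lambda>\<xi>. ennreal (norm (X \<xi> (of_real \<sigma>)) powr (p - 2) * norm (X' \<xi> (of_real \<sigma>)) ^ 2 * \<sigma>) * indicator {0<..} \<sigma>) \<in> borel_measurable torus_measure"
      using EF.X_meas_comp[of "\<lambda>x. x" torus_measure "\<lambda>_. of_real \<sigma>", measurable] by measurable
    have "ennreal (p\<^sup>2) * (\<integral>\<^sup>+\<xi>. ennreal (norm (X \<xi> (of_real \<sigma>)) powr (p - 2) * norm (X' \<xi> (of_real \<sigma>)) ^ 2 * \<sigma>) * indicator {0<..} \<sigma> \<partial>torus_measure)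
       = (\<integral>\<^sup>+\<xi>. indicator {0<..} \<sigma> * (ennreal \<sigma> * ennreal (EF.lp_density \<xi> (of_real \<sigma>))) \<partial>torus_measure)"
      unfolding e[symmetric] by (rule nn_integral_cmult[symmetric, OF m])
    also have "\<dots> = indicator {0<..} \<sigma> * (ennreal \<sigma> * EF.mean_density \<sigma>)"
      unfolding EF.mean_density_def by (subst nn_integral_cmult, measurable, subst nn_integral_cmult, measurable)
    finally show "ennreal (p\<^sup>2) * (\<integral>\<^sup>+\<xi>. ennreal (norm (X \<xi> (of_real \<sigma>)) powr (p - 2) * norm (X' \<xi> (of_real \<sigma>)) ^ 2 * \<sigma>) * indicator {0<..} \<sigma> \<partial>torus_measure)
       = indicator {0<..} \<sigma> * (ennreal \<sigma> * EF.mean_density \<sigma>)" .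
  qed
  finally show ?thesis .
qed

text \<open>
  \<open>norm_formula\<close> bounds the expectation of \<open>energy\<close>, which is what the ergodic theorem requires.
\<close>

lemma littlewood_paley_AE:
  assumes N: "(\<lambda>k. dpoly_norm p (P k)) \<longlonglongrightarrow> N"
  shows "AE \<xi> in torus_measure. \<exists>F. is_twist_continuation f \<xi> F \<and>
           (\<exists>L::ennreal.
              ((\<lambda>T::real. ennreal (p\<^sup>2 / (2 * T)) * LP_integral p F T) \<longlongrightarrow> L) at_top \<and>
              ennreal (N powr p) = ennreal (norm (f 1) powr p) + L)"
proof -
  let ?E = "\<integral>\<^sup>+\<xi>. energy \<xi> \<partial>torus_measure"
  have eq: "ennreal (p\<^sup>2) * ?E + ennreal (norm (f 1) powr p) = ennreal (N powr p)"
    unfolding mean_energy by (rule norm_formula[OF N])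
  have "?E \<le> ennreal (p\<^sup>2) * ?E"
    using p mult_right_mono[of 1 "ennreal (p\<^sup>2)" ?E] by (simp add: one_le_power)
  also have "\<dots> \<le> ennreal (p\<^sup>2) * ?E + ennreal (norm (f 1) powr p)" by simp
  finally have fin: "?E < \<infinity>" unfolding eq by (simp add: le_less_trans)
  show ?thesis
    using torus_ergodic[OF energy_measurable fin] AE_converges AE_series
  proof eventually_elim
    case (elim \<xi>)
    have LP: "LP_integral p (X \<xi>) T = (\<integral>\<^sup>+t\<in>{-T..T}. energy (rot t \<xi>) \<partial>lborel)" for T
    proof -
      have "(\<integral>\<^sup>+\<sigma>\<in>{0<..}. ennreal (norm (X \<xi> (Complex \<sigma> t)) powr (p - 2) * norm (deriv (X \<xi>) (Complex \<sigma> t)) ^ 2 * \<sigma>) \<partial>lborel)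
         = energy (rot t \<xi>)" for t
        unfolding energy_rot
        by (intro nn_integral_cong) (use elim(2) in \<open>auto simp: converges_at_def indicator_def\<close>)
      then show ?thesis by (simp add: LP_integral_def)
    qed
    have "((\<lambda>T. ennreal (p\<^sup>2) * (ennreal (1 / (2 * T)) * (\<integral>\<^sup>+t\<in>{-T..T}. energy (rot t \<xi>) \<partial>lborel))) \<longlongrightarrow> ennreal (p\<^sup>2) * ?E) at_top"
      by (intro ennreal_tendsto_cmult elim(1)) simp
    also have "(\<lambda>T. ennreal (p\<^sup>2) * (ennreal (1 / (2 * T)) * (\<integral>\<^sup>+t\<in>{-T..T}. energy (rot t \<xi>) \<partial>lborel))) =
       (\<lambda>T. ennreal (p\<^sup>2 / (2 * T)) * LP_integral p (X \<xi>) T)"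
      unfolding LP by (rule ext) (simp add: mult.assoc[symmetric] ennreal_mult'[symmetric])
    finally show ?case
      using elim(3) eq[symmetric] by (intro exI[of _ "X \<xi>"] conjI exI[of _ "ennreal (p\<^sup>2) * ?E"]) (auto simp: add.commute)
  qed
qed

end

section \<open>The norm is well defined\<close>

lemma twist_continuation_unique:
  assumes "is_twist_continuation f \<xi> F" "is_twist_continuation f \<xi> G"
  shows "LP_integral p F T = LP_integral p G T"
proof -
  have FG: "F s = G s" if "Re s > 0" for s
  proof (rule analytic_continuation_open[where s = "{s. Re s > 1/2}" and s' = "{s. Re s > 0}" and f = F and g = G and z = s])
    show "{s::complex. Re s > 1/2} \<noteq> {}" by (auto intro!: exI[of _ 1])
    show "open {s::complex. Re s > 1/2}" by (rule open_halfspace_Re_gt)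
    show "F z = G z" if "z \<in> {s. Re s > 1/2}" for z
      using assms that unfolding is_twist_continuation_def by (auto intro: sums_unique2)
  qed (use assms that in \<open>auto simp: is_twist_continuation_def open_halfspace_Re_gt convex_connected convex_halfspace_Re_gt\<close>)
  have d: "deriv F s = deriv G s" if "Re s > 0" for s
  proof (rule deriv_cong_ev[OF _ refl])
    have "eventually (\<lambda>z. z \<in> {z. Re z > 0}) (nhds s)"
      using that by (intro eventually_nhds_in_open open_halfspace_Re_gt) auto
    then show "eventually (\<lambda>z. F z = G z) (nhds s)" by eventually_elim (simp add: FG)
  qed
  have "(\<integral>\<^sup>+\<sigma>\<in>{0<..}. ennreal (norm (F (Complex \<sigma> t)) powr (p - 2) * norm (deriv F (Complex \<sigma> t)) ^ 2 * \<sigma>) \<partial>lborel)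
     = (\<integral>\<^sup>+\<sigma>\<in>{0<..}. ennreal (norm (G (Complex \<sigma> t)) powr (p - 2) * norm (deriv G (Complex \<sigma> t)) ^ 2 * \<sigma>) \<partial>lborel)" for t
    by (intro nn_integral_cong) (use FG d in \<open>auto simp: indicator_def\<close>)
  then show ?thesis by (simp add: LP_integral_def)
qed

lemma fast_subsequence:
  assumes p: "1 \<le> p" and ap: "Hp_approx p Q f"
  obtains r :: "nat \<Rightarrow> nat" where "strict_mono r" "fast_approx p (\<lambda>k. Q (r k)) f"
proof -
  have "\<forall>k. \<exists>K. \<forall>i\<ge>K. \<forall>j\<ge>K. dpoly_norm p (\<lambda>n. Q i n - Q j n) < (1/4)^k"
    using ap by (simp add: Hp_approx_def)
  from choice[OF this] obtain K where K: "\<And>k i j. i \<ge> K k \<Longrightarrow> j \<ge> K k \<Longrightarrow> dpoly_norm p (\<lambda>n. Q i n - Q j n) < (1/4)^k"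
    by blast
  \<comment> \<open>The sum makes \<open>r k\<close> at least as large as \<open>K k\<close>, the summand \<open>k\<close> makes \<open>r\<close> strictly increasing.\<close>
  define r where "r k = k + (\<Sum>i\<le>k. K i)" for k
  have sm: "strict_mono r" by (rule strict_monoI_Suc) (simp add: r_def)
  have rK: "r k \<ge> K k" "r (Suc k) \<ge> K k" for k
  proof -
    have "K k \<le> (\<Sum>i\<le>k. K i)" by (rule member_le_sum) auto
    then show "r k \<ge> K k" "r (Suc k) \<ge> K k" by (auto simp: r_def)
  qed
  have "Hp_approx p (\<lambda>k. Q (r k)) f"
    unfolding Hp_approx_def
  proof (intro conjI allI impI)
    show "Q (r k) \<in> dirichlet_polys" for k using ap by (simp add: Hp_approx_def)
    show "(\<lambda>k. Q (r k) n) \<longlonglongrightarrow> f n" for n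
      using LIMSEQ_subseq_LIMSEQ[OF _ sm, of "\<lambda>k. Q k n"] ap by (simp add: Hp_approx_def o_def)
    fix e :: real assume "e > 0"
    then obtain M where M: "\<And>i j. i \<ge> M \<Longrightarrow> j \<ge> M \<Longrightarrow> dpoly_norm p (\<lambda>n. Q i n - Q j n) < e"
      using ap unfolding Hp_approx_def by blast
    show "\<exists>K. \<forall>j\<ge>K. \<forall>k\<ge>K. dpoly_norm p (\<lambda>n. Q (r j) n - Q (r k) n) < e"
      by (intro exI[of _ M] allI impI M) (use seq_suble[OF sm] order_trans in blast)+
  qed
  moreover have "dpoly_norm p (\<lambda>n. Q (r (Suc k)) n - Q (r k) n) \<le> (1/4)^k" for k
    using K[OF rK(2) rK(1), of k] by simp
  ultimately have "fast_approx p (\<lambda>k. Q (r k)) f" using p by unfold_locales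
  then show ?thesis using sm that by blast
qed

lemma littlewood_paley_approx:
  assumes p: "1 \<le> p" and ap: "Hp_approx p Q f" and N: "(\<lambda>k. dpoly_norm p (Q k)) \<longlonglongrightarrow> N"
  shows "AE \<xi> in torus_measure. \<exists>F. is_twist_continuation f \<xi> F \<and>
           (\<exists>L::ennreal.
              ((\<lambda>T::real. ennreal (p\<^sup>2 / (2 * T)) * LP_integral p F T) \<longlongrightarrow> L) at_top \<and>
              ennreal (N powr p) = ennreal (norm (f 1) powr p) + L)"
proof -
  obtain r where r: "strict_mono r" "fast_approx p (\<lambda>k. Q (r k)) f"
    using fast_subsequence[OF p ap] by blast
  interpret fast_approx p "\<lambda>k. Q (r k)" f by (rule r)
  show ?thesis
    by (rule littlewood_paley_AE) (use LIMSEQ_subseq_LIMSEQ[OF N r(1)] in \<open>simp add: o_def\<close>)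
qed

text \<open>
  Two approximating sequences of \<open>f\<close> yield, at almost every \<open>\<xi>\<close>, continuations of the same series and so
  the same limit \<open>L\<close>; comparing the two formulas at a single such \<open>\<xi>\<close> equates the norms.
\<close>

lemma Hp_norm_eq:
  assumes p: "1 \<le> p" and ap: "Hp_approx p Q f" and N: "(\<lambda>k. dpoly_norm p (Q k)) \<longlonglongrightarrow> N"
  shows "Hp_norm p f = N"
  unfolding Hp_norm_def
proof (rule the_equality)
  show "\<exists>P. Hp_approx p P f \<and> (\<lambda>k. dpoly_norm p (P k)) \<longlonglongrightarrow> N" using ap N by blast
  fix N' assume "\<exists>P. Hp_approx p P f \<and> (\<lambda>k. dpoly_norm p (P k)) \<longlonglongrightarrow> N'"
  then obtain Q' where ap': "Hp_approx p Q' f" and N': "(\<lambda>k. dpoly_norm p (Q' k)) \<longlonglongrightarrow> N'" by blast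
  have nonneg: "M \<ge> 0" if "Hp_approx p R f" "(\<lambda>k. dpoly_norm p (R k)) \<longlonglongrightarrow> M" for R M
    by (rule LIMSEQ_le_const[OF that(2)])
       (use that(1) p in \<open>auto simp: Hp_approx_def dpoly_norm_eq pnorm_nonneg\<close>)
  have "AE \<xi> in torus_measure. ennreal (N powr p) = ennreal (N' powr p)"
    using littlewood_paley_approx[OF p ap N] littlewood_paley_approx[OF p ap' N']
  proof eventually_elim
    case (elim \<xi>)
    then obtain F L G M where F: "is_twist_continuation f \<xi> F"
        "((\<lambda>T::real. ennreal (p\<^sup>2 / (2 * T)) * LP_integral p F T) \<longlongrightarrow> L) at_top"
        "ennreal (N powr p) = ennreal (norm (f 1) powr p) + L"
      and G: "is_twist_continuation f \<xi> G"
        "((\<lambda>T::real. ennreal (p\<^sup>2 / (2 * T)) * LP_integral p G T) \<longlongrightarrow> M) at_top"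
        "ennreal (N' powr p) = ennreal (norm (f 1) powr p) + M"
      by blast
    have "L = M"
      using F(2) G(2) unfolding twist_continuation_unique[OF F(1) G(1)] by (intro tendsto_unique[OF _ F(2)[unfolded twist_continuation_unique[OF F(1) G(1)]]]) auto
    then show ?case using F(3) G(3) by simp
  qed
  then have "ennreal (N powr p) = ennreal (N' powr p)" by simp
  then have "N powr p = N' powr p" by simp
  then have "(N powr p) powr (1 / p) = (N' powr p) powr (1 / p)" by simp
  then show "N' = N" using nonneg[OF ap N] nonneg[OF ap' N'] p by (simp add: powr_powr)
qed

theorem theorem1p1:
  fixes p :: real and f :: "nat \<Rightarrow> complex"
  assumes "1 \<le> p" and "f \<in> Hp p"
  shows "AE \<xi> in torus_measure. \<exists>F. is_twist_continuation f \<xi> F \<and>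
           (\<exists>L::ennreal.
              ((\<lambda>T::real. ennreal (p\<^sup>2 / (2 * T)) * LP_integral p F T) \<longlongrightarrow> L) at_top \<and>
              ennreal (Hp_norm p f powr p) = ennreal (norm (f 1) powr p) + L)"
proof -
  obtain Q where Q: "Hp_approx p Q f" using assms(2) by (auto simp: Hp_def)
  obtain N where N: "(\<lambda>k. dpoly_norm p (Q k)) \<longlonglongrightarrow> N"
    using dpoly_norms_convergent[OF assms(1) Q] by (auto simp: convergent_def)
  show ?thesis
    unfolding Hp_norm_eq[OF assms(1) Q N] by (rule littlewood_paley_approx[OF assms(1) Q N])
qed

end
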